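(* The functors $S_*,C_*^{ord}:\mathbf{MOp}_{\mathbf{Top}}\to\mathbf{MOp}_{\mathbf C_*(\mathbb Z)}$ are weakly equivalent (with respect to quasi-isomorphism). In particular, for a topological modular operad $P$, the dg modular operads $S_*(P)$ and $C_*^{ord}(P)$ are weakly equivalent.
   Context: Modular operads (Getzler–Kapranov). For a symmetric monoidal category $\mathcal C$, a modular operad $P$ in $\mathcal C$ consists of objects $P((g,I))$ of $\mathcal C$ for $g\ge0$ and finite sets $I$ with $2g-2+|I|>0$, functorial for bijections in $I$ (equivalently $P((g,l))$ with $\Sigma_l$-action), together with morphisms ${}_a\circ_b:P((g,I\sqcup\{a\}))\otimes P((h,J\sqcup\{b\}))\to P((g+h,I\sqcup J))$ and contractions $\xi_{ab}:P((g,I\sqcup\{a,b\}))\to P((g+1,I))$, natural for bijections, symmetric (${}_a\circ_b$ corresponds to ${}_b\circ_a$ under the symmetry of $\otimes$, $\xi_{ab}=\xi_{ba}$), and such that gluing two disjoint pairs of labels gives the same result in either order (associativity of the $\circ$'s, commutation of the $\xi$'s, commutation of $\xi$ with $\circ$, and $\xi_{cd}\,({}_a\circ_b)=\xi_{ab}\,({}_c\circ_d)$). $\mathbf{MOp}_{\mathcal C}$ is the category of modular operads in $\mathcal C$. A symmetric lax monoidal functor $F:\mathcal C\to\mathcal D$ applied componentwise induces a functor $\mathbf{MOp}_{\mathcal C}\to\mathbf{MOp}_{\mathcal D}$, also denoted $F$. $\mathbf{Top}$ has the cartesian product; $\mathbf C_*(\mathbb Z)$ is the symmetric monoidal category of bounded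 below chain complexes of abelian groups; a dg modular operad is a modular operad in it. A morphism of dg modular operads is a weak equivalence if it is a quasi-isomorphism in each component. Functors to $\mathbf{MOp}_{\mathbf C_*(\mathbb Z)}$ are weakly equivalent if connected by a finite zigzag of natural transformations all of whose components are weak equivalences; objects are weakly equivalent if connected by a finite zigzag of weak equivalences. $S_*(X)$: singular chains, with Künneth morphism the shuffle product $\sigma\otimes\tau\mapsto\sum_{(\mu,\nu)}\varepsilon(\mu,\nu)\,(s_{\nu_q}\cdots s_{\nu_1}\sigma,\ s_{\mu_p}\cdots s_{\mu_1}\tau)$ over $(p,q)$-shuffles. $C_*^{ord}(X)$: ordered cubical chains. $Q_p(X)$ is the free abelian group on continuous maps $I^p\to X$ with $d(c)=\sum_{i=1}^p\sum_{\epsilon\in\{0,1\}}(-1)^{i+\epsilon}c\circ\delta_i^\epsilon$ ($\delta_i^\epsilon$ inserts $\epsilon$ in the $i$-th place); $C_p(X)$ is its quotient by degenerate cubes (independent of some coordinate); $C_n^{ord}(X)$ is the quotient of $C_n(X)$ by the subgroup generated by all $c-\pi c$, $\pi\in\Sigma_n$, where $(\pi c)(t_1,\dots,t_n)=\varepsilon(\pi)\,c(t_{\pi(1)},\dots,t_{\pi(n)})$. Its Künneth morphism is induced by the cartesian product of cubes. *)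

theory Defs
  imports
    "HOL-Homology.Homology"
    "HOL-Combinatorics.Permutations"
    "HOL-Library.Infinite_Typeclass"
begin

section \<open>Chain complexes of abelian groups\<close>

text \<open>
  Chain complexes are graded by the integers; the group operation is written multiplicatively,
  as in HOL-Algebra.
\<close>

record 'a chain_cx =
  grp :: "int \<Rightarrow> 'a monoid"
  bd :: "int \<Rightarrow> 'a \<Rightarrow> 'a"

definition bounded_below_cx :: "'a chain_cx \<Rightarrow> bool" where
  "bounded_below_cx A \<longleftrightarrow>
     (\<forall>n. comm_group (grp A n)) \<and>
     (\<forall>n. bd A n \<in> hom (grp A n) (grp A (n - 1))) \<and>
     (\<forall>n. \<forall>x \<in> carrier (grp A n). bd A (n - 1) (bd A n x) = \<one>\<^bsub>grp A (n - 2)\<^esub>) \<and>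
     (\<exists>N. \<forall>n < N. carrier (grp A n) = {\<one>\<^bsub>grp A n\<^esub>})"

text \<open>
  All morphisms below are extensional functions, so that equality of morphisms is equality in HOL.
\<close>

definition cx_hom :: "'a chain_cx \<Rightarrow> 'b chain_cx \<Rightarrow> (int \<Rightarrow> 'a \<Rightarrow> 'b) set" where
  "cx_hom A B =
     {f. \<forall>n. f n \<in> hom (grp A n) (grp B n) \<and> f n \<in> extensional (carrier (grp A n)) \<and>
             (\<forall>x \<in> carrier (grp A n). bd B n (f n x) = f (n - 1) (bd A n x))}"

definition cx_id :: "'a chain_cx \<Rightarrow> int \<Rightarrow> 'a \<Rightarrow> 'a" where
  "cx_id A = (\<lambda>n. \<lambda>x \<in> carrier (grp A n). x)"

definition cx_comp ::
  "'a chain_cx \<Rightarrow> (int \<Rightarrow> 'b \<Rightarrow> 'c) \<Rightarrow> (int \<Rightarrow> 'a \<Rightarrow> 'b) \<Rightarrow> int \<Rightarrow> 'a \<Rightarrow> 'c" where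
  "cx_comp A g f = (\<lambda>n. compose (carrier (grp A n)) (g n) (f n))"

text \<open>
  If \<open>f\<close> is a homomorphism into \<open>H\<close> and \<open>c\<close> is a coset of a subgroup that \<open>f\<close> maps into \<open>K\<close>, then
  \<open>coset_map H K f c\<close> is the coset of \<open>K\<close> that contains the image of \<open>c\<close>.
\<close>

definition coset_map :: "'b monoid \<Rightarrow> 'b set \<Rightarrow> ('a \<Rightarrow> 'b) \<Rightarrow> 'a set \<Rightarrow> 'b set" where
  "coset_map H K f c = (\<Union>x\<in>c. K #>\<^bsub>H\<^esub> f x)"

definition boundaries :: "'a chain_cx \<Rightarrow> int \<Rightarrow> 'a set" where
  "boundaries A n = bd A (n + 1) ` carrier (grp A (n + 1))"

definition cx_homology :: "'a chain_cx \<Rightarrow> int \<Rightarrow> 'a set monoid" where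
  "cx_homology A n =
     (grp A n)\<lparr>carrier := kernel (grp A n) (grp A (n - 1)) (bd A n)\<rparr> Mod boundaries A n"

definition quasi_iso :: "'a chain_cx \<Rightarrow> 'b chain_cx \<Rightarrow> (int \<Rightarrow> 'a \<Rightarrow> 'b) \<Rightarrow> bool" where
  "quasi_iso A B f \<longleftrightarrow> f \<in> cx_hom A B \<and>
     (\<forall>n. coset_map (grp B n) (boundaries B n) (f n) \<in> iso (cx_homology A n) (cx_homology B n))"

text \<open>Quotient of a complex by a family of subgroups that is stable under the differential.\<close>

definition quot_cx :: "'a chain_cx \<Rightarrow> (int \<Rightarrow> 'a set) \<Rightarrow> 'a set chain_cx" where
  "quot_cx A N =
     \<lparr>grp = (\<lambda>n. grp A n Mod N n),
      bd = (\<lambda>n. coset_map (grp A (n - 1)) (N (n - 1)) (bd A n))\<rparr>"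

definition quot_mor ::
  "'a chain_cx \<Rightarrow> (int \<Rightarrow> 'a set) \<Rightarrow> 'b chain_cx \<Rightarrow> (int \<Rightarrow> 'b set) \<Rightarrow>
   (int \<Rightarrow> 'a \<Rightarrow> 'b) \<Rightarrow> int \<Rightarrow> 'a set \<Rightarrow> 'b set" where
  "quot_mor A N B M f =
     (\<lambda>n. restrict (coset_map (grp B n) (M n) (f n)) (carrier (grp (quot_cx A N) n)))"

subsection \<open>Tensor product\<close>

text \<open>
  The generator \<open>(i, a, j, b)\<close> stands for the tensor of \<open>a\<close> (degree \<open>i\<close>) and \<open>b\<close> (degree \<open>j\<close>).
  Dividing the free group on all generators with \<open>i + j = n\<close> by the biadditivity relations gives
  the direct sum of the groups \<open>A\<^sub>i \<otimes> B\<^sub>j\<close> in one step.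
\<close>

type_synonym ('a, 'b) tens = "((int \<times> 'a \<times> int \<times> 'b) \<Rightarrow>\<^sub>0 int) set"

definition tens_free ::
  "'a chain_cx \<Rightarrow> 'b chain_cx \<Rightarrow> int \<Rightarrow> ((int \<times> 'a \<times> int \<times> 'b) \<Rightarrow>\<^sub>0 int) monoid" where
  "tens_free A B n = free_Abelian_group
     {(i, a, j, b) | i a j b. i + j = n \<and> a \<in> carrier (grp A i) \<and> b \<in> carrier (grp B j)}"

definition tens_rel :: "'a chain_cx \<Rightarrow> 'b chain_cx \<Rightarrow> int \<Rightarrow> ((int \<times> 'a \<times> int \<times> 'b) \<Rightarrow>\<^sub>0 int) set" where
  "tens_rel A B n = generate (tens_free A B n)
     ({frag_of (i, a \<otimes>\<^bsub>grp A i\<^esub> a', j, b) - (frag_of (i, a, j, b) + frag_of (i, a', j, b))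
        | i a a' j b. i + j = n \<and> a \<in> carrier (grp A i) \<and> a' \<in> carrier (grp A i) \<and>
                      b \<in> carrier (grp B j)} \<union>
      {frag_of (i, a, j, b \<otimes>\<^bsub>grp B j\<^esub> b') - (frag_of (i, a, j, b) + frag_of (i, a, j, b'))
        | i a j b b'. i + j = n \<and> a \<in> carrier (grp A i) \<and>
                      b \<in> carrier (grp B j) \<and> b' \<in> carrier (grp B j)})"

definition koszul :: "int \<Rightarrow> int \<Rightarrow> int" where
  "koszul i j = (if odd i \<and> odd j then - 1 else 1)"

text \<open>Leibniz rule: \<open>d (a \<otimes> b) = d a \<otimes> b + (-1)\<^sup>i a \<otimes> d b\<close>.\<close>

definition tens_bd ::
  "'a chain_cx \<Rightarrow> 'b chain_cx \<Rightarrow> ((int \<times> 'a \<times> int \<times> 'b) \<Rightarrow>\<^sub>0 int) \<Rightarrow> ((int \<times> 'a \<times> int \<times> 'b) \<Rightarrow>\<^sub>0 int)" where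
  "tens_bd A B = frag_extend (\<lambda>(i, a, j, b).
     frag_of (i - 1, bd A i a, j, b) + frag_cmul (koszul i 1) (frag_of (i, a, j - 1, bd B j b)))"

definition tensor :: "'a chain_cx \<Rightarrow> 'b chain_cx \<Rightarrow> ('a, 'b) tens chain_cx" where
  "tensor A B =
     \<lparr>grp = (\<lambda>n. tens_free A B n Mod tens_rel A B n),
      bd = (\<lambda>n. coset_map (tens_free A B (n - 1)) (tens_rel A B (n - 1)) (tens_bd A B))\<rparr>"

definition pure_tensor ::
  "'a chain_cx \<Rightarrow> 'b chain_cx \<Rightarrow> int \<Rightarrow> 'a \<Rightarrow> int \<Rightarrow> 'b \<Rightarrow> ('a, 'b) tens" where
  "pure_tensor A B i a j b =
     tens_rel A B (i + j) #>\<^bsub>tens_free A B (i + j)\<^esub> frag_of (i, a, j, b)"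


section \<open>Modular operads\<close>

text \<open>
  The finite index sets are the finite subsets of a type \<open>'l\<close> of labels (infinite in the end
  result); \<open>A \<squnion> B\<close> is the union of disjoint subsets.  In both categories the fields have the
  following types, where \<open>I\<close> and \<open>J\<close> contain neither of the labels that are glued:
    \<open>mo_act P g I \<sigma> : P((g, I)) \<rightarrow> P((g, \<sigma> ` I))\<close> for \<open>\<sigma>\<close> injective on \<open>I\<close>,
    \<open>mo_circ P g I a h J b : P((g, I \<squnion> {a})) \<otimes> P((h, J \<squnion> {b})) \<rightarrow> P((g + h, I \<squnion> J))\<close>,
    \<open>mo_xi P g I a b : P((g, I \<squnion> {a, b})) \<rightarrow> P((g + 1, I))\<close>.
  Values of the fields at other arguments are irrelevant.
\<close>

record ('l, 'o, 'm, 't) modop =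
  mo_obj :: "nat \<Rightarrow> 'l set \<Rightarrow> 'o"
  mo_act :: "nat \<Rightarrow> 'l set \<Rightarrow> ('l \<Rightarrow> 'l) \<Rightarrow> 'm"
  mo_circ :: "nat \<Rightarrow> 'l set \<Rightarrow> 'l \<Rightarrow> nat \<Rightarrow> 'l set \<Rightarrow> 'l \<Rightarrow> 't"
  mo_xi :: "nat \<Rightarrow> 'l set \<Rightarrow> 'l \<Rightarrow> 'l \<Rightarrow> 'm"

text \<open>\<open>2g - 2 + |I| > 0\<close>, without truncated subtraction.\<close>

definition stable :: "nat \<Rightarrow> 'l set \<Rightarrow> bool" where
  "stable g I \<longleftrightarrow> finite I \<and> 2 < 2 * g + card I"

definition glueable :: "nat \<Rightarrow> 'l set \<Rightarrow> 'l \<Rightarrow> nat \<Rightarrow> 'l set \<Rightarrow> 'l \<Rightarrow> bool" where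
  "glueable g I a h J b \<longleftrightarrow> stable g (insert a I) \<and> stable h (insert b J) \<and>
     a \<notin> I \<and> b \<notin> J \<and> I \<inter> J = {}"

definition contractible :: "nat \<Rightarrow> 'l set \<Rightarrow> 'l \<Rightarrow> 'l \<Rightarrow> bool" where
  "contractible g I a b \<longleftrightarrow> stable g (insert a (insert b I)) \<and> a \<notin> I \<and> b \<notin> I \<and> a \<noteq> b"

definition join_on :: "'l set \<Rightarrow> ('l \<Rightarrow> 'l) \<Rightarrow> ('l \<Rightarrow> 'l) \<Rightarrow> 'l \<Rightarrow> 'l" where
  "join_on I \<sigma> \<tau> = (\<lambda>l. if l \<in> I then \<sigma> l else \<tau> l)"

subsection \<open>Topological modular operads\<close>

definition top_hom :: "'x topology \<Rightarrow> 'y topology \<Rightarrow> ('x \<Rightarrow> 'y) set" where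
  "top_hom X Y = {f. continuous_map X Y f \<and> f \<in> extensional (topspace X)}"

type_synonym ('l, 'x) top_modop = "('l, 'x topology, 'x \<Rightarrow> 'x, 'x \<times> 'x \<Rightarrow> 'x) modop"

definition is_top_modop :: "('l, 'x) top_modop \<Rightarrow> bool" where
  "is_top_modop P \<longleftrightarrow>
     \<comment> \<open>structure maps\<close>
     (\<forall>g I \<sigma>. stable g I \<and> inj_on \<sigma> I \<longrightarrow>
        mo_act P g I \<sigma> \<in> top_hom (mo_obj P g I) (mo_obj P g (\<sigma> ` I))) \<and>
     (\<forall>g I a h J b. glueable g I a h J b \<longrightarrow>
        mo_circ P g I a h J b \<in>
          top_hom (prod_topology (mo_obj P g (insert a I)) (mo_obj P h (insert b J)))
                  (mo_obj P (g + h) (I \<union> J))) \<and>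
     (\<forall>g I a b. contractible g I a b \<longrightarrow>
        mo_xi P g I a b \<in> top_hom (mo_obj P g (insert a (insert b I))) (mo_obj P (g + 1) I)) \<and>
     \<comment> \<open>functoriality for bijections\<close>
     (\<forall>g I \<sigma> \<tau>. stable g I \<and> inj_on \<sigma> I \<and> (\<forall>l \<in> I. \<sigma> l = \<tau> l) \<longrightarrow>
        mo_act P g I \<sigma> = mo_act P g I \<tau>) \<and>
     (\<forall>g I. stable g I \<longrightarrow> (\<forall>x \<in> topspace (mo_obj P g I). mo_act P g I id x = x)) \<and>
     (\<forall>g I \<sigma> \<tau>. stable g I \<and> inj_on \<sigma> I \<and> inj_on \<tau> (\<sigma> ` I) \<longrightarrow>
        (\<forall>x \<in> topspace (mo_obj P g I).
           mo_act P g I (\<tau> \<circ> \<sigma>) x = mo_act P g (\<sigma> ` I) \<tau> (mo_act P g I \<sigma> x))) \<and>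
     \<comment> \<open>naturality\<close>
     (\<forall>g I a h J b \<sigma> \<tau>.
        glueable g I a h J b \<and> inj_on \<sigma> (insert a I) \<and> inj_on \<tau> (insert b J) \<and>
        \<sigma> ` I \<inter> \<tau> ` J = {} \<longrightarrow>
        (\<forall>x \<in> topspace (mo_obj P g (insert a I)). \<forall>y \<in> topspace (mo_obj P h (insert b J)).
           mo_circ P g (\<sigma> ` I) (\<sigma> a) h (\<tau> ` J) (\<tau> b)
             (mo_act P g (insert a I) \<sigma> x, mo_act P h (insert b J) \<tau> y) =
           mo_act P (g + h) (I \<union> J) (join_on I \<sigma> \<tau>) (mo_circ P g I a h J b (x, y)))) \<and>
     (\<forall>g I a b \<sigma>. contractible g I a b \<and> inj_on \<sigma> (insert a (insert b I)) \<longrightarrow>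
        (\<forall>x \<in> topspace (mo_obj P g (insert a (insert b I))).
           mo_xi P g (\<sigma> ` I) (\<sigma> a) (\<sigma> b) (mo_act P g (insert a (insert b I)) \<sigma> x) =
           mo_act P (g + 1) I \<sigma> (mo_xi P g I a b x))) \<and>
     \<comment> \<open>symmetry\<close>
     (\<forall>g I a h J b. glueable g I a h J b \<longrightarrow>
        (\<forall>x \<in> topspace (mo_obj P g (insert a I)). \<forall>y \<in> topspace (mo_obj P h (insert b J)).
           mo_circ P g I a h J b (x, y) = mo_circ P h J b g I a (y, x))) \<and>
     (\<forall>g I a b. contractible g I a b \<longrightarrow> mo_xi P g I a b = mo_xi P g I b a) \<and>
     \<comment> \<open>two gluings in either order; the other shapes follow by symmetry\<close>
     (\<forall>g I a h J b c k K d.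
        glueable g I a h (insert c J) b \<and> glueable (g + h) (I \<union> J) c k K d \<and>
        glueable h (insert b J) c k K d \<and> glueable g I a (h + k) (J \<union> K) b \<longrightarrow>
        (\<forall>x \<in> topspace (mo_obj P g (insert a I)).
         \<forall>y \<in> topspace (mo_obj P h (insert b (insert c J))).
         \<forall>z \<in> topspace (mo_obj P k (insert d K)).
           mo_circ P (g + h) (I \<union> J) c k K d (mo_circ P g I a h (insert c J) b (x, y), z) =
           mo_circ P g I a (h + k) (J \<union> K) b (x, mo_circ P h (insert b J) c k K d (y, z)))) \<and>
     (\<forall>g I a b c d.
        contractible g (insert c (insert d I)) a b \<and> contractible g (insert a (insert b I)) c d \<longrightarrow>
        (\<forall>x \<in> topspace (mo_obj P g (insert a (insert b (insert c (insert d I))))).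
           mo_xi P (g + 1) I a b (mo_xi P g (insert a (insert b I)) c d x) =
           mo_xi P (g + 1) I c d (mo_xi P g (insert c (insert d I)) a b x))) \<and>
     (\<forall>g I a h J b c d.
        glueable g (insert c (insert d I)) a h J b \<and> contractible (g + h) (I \<union> J) c d \<longrightarrow>
        (\<forall>x \<in> topspace (mo_obj P g (insert a (insert c (insert d I)))).
         \<forall>y \<in> topspace (mo_obj P h (insert b J)).
           mo_circ P (g + 1) I a h J b (mo_xi P g (insert a I) c d x, y) =
           mo_xi P (g + h) (I \<union> J) c d (mo_circ P g (insert c (insert d I)) a h J b (x, y)))) \<and>
     (\<forall>g I a c h J b d.
        glueable g (insert c I) a h (insert d J) b \<and> glueable g (insert a I) c h (insert b J) d \<and>
        contractible (g + h) (I \<union> J) c d \<and> contractible (g + h) (I \<union> J) a b \<longrightarrow>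
        (\<forall>x \<in> topspace (mo_obj P g (insert a (insert c I))).
         \<forall>y \<in> topspace (mo_obj P h (insert b (insert d J))).
           mo_xi P (g + h) (I \<union> J) c d (mo_circ P g (insert c I) a h (insert d J) b (x, y)) =
           mo_xi P (g + h) (I \<union> J) a b (mo_circ P g (insert a I) c h (insert b J) d (x, y))))"

type_synonym ('l, 'm) modop_mor = "nat \<Rightarrow> 'l set \<Rightarrow> 'm"

definition top_modop_hom ::
  "('l, 'x) top_modop \<Rightarrow> ('l, 'x) top_modop \<Rightarrow> ('l, 'x \<Rightarrow> 'x) modop_mor set" where
  "top_modop_hom P Q = {f.
     (\<forall>g I. if stable g I then f g I \<in> top_hom (mo_obj P g I) (mo_obj Q g I)
            else f g I = undefined) \<and>
     (\<forall>g I \<sigma>. stable g I \<and> inj_on \<sigma> I \<longrightarrow>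
        (\<forall>x \<in> topspace (mo_obj P g I).
           f g (\<sigma> ` I) (mo_act P g I \<sigma> x) = mo_act Q g I \<sigma> (f g I x))) \<and>
     (\<forall>g I a h J b. glueable g I a h J b \<longrightarrow>
        (\<forall>x \<in> topspace (mo_obj P g (insert a I)). \<forall>y \<in> topspace (mo_obj P h (insert b J)).
           f (g + h) (I \<union> J) (mo_circ P g I a h J b (x, y)) =
           mo_circ Q g I a h J b (f g (insert a I) x, f h (insert b J) y))) \<and>
     (\<forall>g I a b. contractible g I a b \<longrightarrow>
        (\<forall>x \<in> topspace (mo_obj P g (insert a (insert b I))).
           f (g + 1) I (mo_xi P g I a b x) = mo_xi Q g I a b (f g (insert a (insert b I)) x)))}"

definition top_modop_id :: "('l, 'x) top_modop \<Rightarrow> ('l, 'x \<Rightarrow> 'x) modop_mor" where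
  "top_modop_id P =
     (\<lambda>g I. if stable g I then (\<lambda>x \<in> topspace (mo_obj P g I). x) else undefined)"

definition top_modop_comp ::
  "('l, 'x) top_modop \<Rightarrow> ('l, 'x \<Rightarrow> 'x) modop_mor \<Rightarrow> ('l, 'x \<Rightarrow> 'x) modop_mor \<Rightarrow>
   ('l, 'x \<Rightarrow> 'x) modop_mor" where
  "top_modop_comp P f' f =
     (\<lambda>g I. if stable g I then compose (topspace (mo_obj P g I)) (f' g I) (f g I) else undefined)"

subsection \<open>Dg modular operads\<close>

type_synonym ('l, 'a) dg_modop =
  "('l, 'a chain_cx, int \<Rightarrow> 'a \<Rightarrow> 'a, int \<Rightarrow> ('a, 'a) tens \<Rightarrow> 'a) modop"

abbreviation dg_el :: "('l, 'a) dg_modop \<Rightarrow> nat \<Rightarrow> 'l set \<Rightarrow> int \<Rightarrow> 'a set" where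
  "dg_el P g I i \<equiv> carrier (grp (mo_obj P g I) i)"

text \<open>The composition \<open>a\<circ>b\<close> evaluated on the pure tensor of \<open>x\<close> (degree \<open>i\<close>) and \<open>y\<close> (degree \<open>j\<close>).\<close>

definition dg_circ ::
  "('l, 'a) dg_modop \<Rightarrow> nat \<Rightarrow> 'l set \<Rightarrow> 'l \<Rightarrow> nat \<Rightarrow> 'l set \<Rightarrow> 'l \<Rightarrow> int \<Rightarrow> 'a \<Rightarrow> int \<Rightarrow> 'a \<Rightarrow> 'a" where
  "dg_circ P g I a h J b i x j y =
     mo_circ P g I a h J b (i + j)
       (pure_tensor (mo_obj P g (insert a I)) (mo_obj P h (insert b J)) i x j y)"

text \<open>
  Equality of maps out of (iterated) tensor products is expressed on pure tensors of homogeneous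
  elements.
\<close>

definition is_dg_modop :: "('l, 'a) dg_modop \<Rightarrow> bool" where
  "is_dg_modop P \<longleftrightarrow>
     \<comment> \<open>structure maps\<close>
     (\<forall>g I. stable g I \<longrightarrow> bounded_below_cx (mo_obj P g I)) \<and>
     (\<forall>g I \<sigma>. stable g I \<and> inj_on \<sigma> I \<longrightarrow>
        mo_act P g I \<sigma> \<in> cx_hom (mo_obj P g I) (mo_obj P g (\<sigma> ` I))) \<and>
     (\<forall>g I a h J b. glueable g I a h J b \<longrightarrow>
        mo_circ P g I a h J b \<in>
          cx_hom (tensor (mo_obj P g (insert a I)) (mo_obj P h (insert b J)))
                 (mo_obj P (g + h) (I \<union> J))) \<and>
     (\<forall>g I a b. contractible g I a b \<longrightarrow>
        mo_xi P g I a b \<in> cx_hom (mo_obj P g (insert a (insert b I))) (mo_obj P (g + 1) I)) \<and>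
     \<comment> \<open>functoriality for bijections\<close>
     (\<forall>g I \<sigma> \<tau>. stable g I \<and> inj_on \<sigma> I \<and> (\<forall>l \<in> I. \<sigma> l = \<tau> l) \<longrightarrow>
        mo_act P g I \<sigma> = mo_act P g I \<tau>) \<and>
     (\<forall>g I. stable g I \<longrightarrow> (\<forall>i. \<forall>x \<in> dg_el P g I i. mo_act P g I id i x = x)) \<and>
     (\<forall>g I \<sigma> \<tau>. stable g I \<and> inj_on \<sigma> I \<and> inj_on \<tau> (\<sigma> ` I) \<longrightarrow>
        (\<forall>i. \<forall>x \<in> dg_el P g I i.
           mo_act P g I (\<tau> \<circ> \<sigma>) i x = mo_act P g (\<sigma> ` I) \<tau> i (mo_act P g I \<sigma> i x))) \<and>
     \<comment> \<open>naturality\<close>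
     (\<forall>g I a h J b \<sigma> \<tau>.
        glueable g I a h J b \<and> inj_on \<sigma> (insert a I) \<and> inj_on \<tau> (insert b J) \<and>
        \<sigma> ` I \<inter> \<tau> ` J = {} \<longrightarrow>
        (\<forall>i j. \<forall>x \<in> dg_el P g (insert a I) i. \<forall>y \<in> dg_el P h (insert b J) j.
           dg_circ P g (\<sigma> ` I) (\<sigma> a) h (\<tau> ` J) (\<tau> b)
             i (mo_act P g (insert a I) \<sigma> i x) j (mo_act P h (insert b J) \<tau> j y) =
           mo_act P (g + h) (I \<union> J) (join_on I \<sigma> \<tau>) (i + j) (dg_circ P g I a h J b i x j y))) \<and>
     (\<forall>g I a b \<sigma>. contractible g I a b \<and> inj_on \<sigma> (insert a (insert b I)) \<longrightarrow>
        (\<forall>i. \<forall>x \<in> dg_el P g (insert a (insert b I)) i.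
           mo_xi P g (\<sigma> ` I) (\<sigma> a) (\<sigma> b) i (mo_act P g (insert a (insert b I)) \<sigma> i x) =
           mo_act P (g + 1) I \<sigma> i (mo_xi P g I a b i x))) \<and>
     \<comment> \<open>symmetry\<close>
     (\<forall>g I a h J b. glueable g I a h J b \<longrightarrow>
        (\<forall>i j. \<forall>x \<in> dg_el P g (insert a I) i. \<forall>y \<in> dg_el P h (insert b J) j.
           dg_circ P g I a h J b i x j y =
           dg_circ P h J b g I a j y i x [^]\<^bsub>grp (mo_obj P (g + h) (I \<union> J)) (i + j)\<^esub> koszul i j)) \<and>
     (\<forall>g I a b. contractible g I a b \<longrightarrow> mo_xi P g I a b = mo_xi P g I b a) \<and>
     \<comment> \<open>two gluings in either order; the other shapes follow by symmetry\<close>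
     (\<forall>g I a h J b c k K d.
        glueable g I a h (insert c J) b \<and> glueable (g + h) (I \<union> J) c k K d \<and>
        glueable h (insert b J) c k K d \<and> glueable g I a (h + k) (J \<union> K) b \<longrightarrow>
        (\<forall>i j m. \<forall>x \<in> dg_el P g (insert a I) i. \<forall>y \<in> dg_el P h (insert b (insert c J)) j.
         \<forall>z \<in> dg_el P k (insert d K) m.
           dg_circ P (g + h) (I \<union> J) c k K d (i + j) (dg_circ P g I a h (insert c J) b i x j y) m z =
           dg_circ P g I a (h + k) (J \<union> K) b i x (j + m) (dg_circ P h (insert b J) c k K d j y m z))) \<and>
     (\<forall>g I a b c d.
        contractible g (insert c (insert d I)) a b \<and> contractible g (insert a (insert b I)) c d \<longrightarrow>
        (\<forall>i. \<forall>x \<in> dg_el P g (insert a (insert b (insert c (insert d I)))) i.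
           mo_xi P (g + 1) I a b i (mo_xi P g (insert a (insert b I)) c d i x) =
           mo_xi P (g + 1) I c d i (mo_xi P g (insert c (insert d I)) a b i x))) \<and>
     (\<forall>g I a h J b c d.
        glueable g (insert c (insert d I)) a h J b \<and> contractible (g + h) (I \<union> J) c d \<longrightarrow>
        (\<forall>i j. \<forall>x \<in> dg_el P g (insert a (insert c (insert d I))) i.
         \<forall>y \<in> dg_el P h (insert b J) j.
           dg_circ P (g + 1) I a h J b i (mo_xi P g (insert a I) c d i x) j y =
           mo_xi P (g + h) (I \<union> J) c d (i + j)
             (dg_circ P g (insert c (insert d I)) a h J b i x j y))) \<and>
     (\<forall>g I a c h J b d.
        glueable g (insert c I) a h (insert d J) b \<and> glueable g (insert a I) c h (insert b J) d \<and>
        contractible (g + h) (I \<union> J) c d \<and> contractible (g + h) (I \<union> J) a b \<longrightarrow>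
        (\<forall>i j. \<forall>x \<in> dg_el P g (insert a (insert c I)) i.
         \<forall>y \<in> dg_el P h (insert b (insert d J)) j.
           mo_xi P (g + h) (I \<union> J) c d (i + j)
             (dg_circ P g (insert c I) a h (insert d J) b i x j y) =
           mo_xi P (g + h) (I \<union> J) a b (i + j)
             (dg_circ P g (insert a I) c h (insert b J) d i x j y)))"

definition dg_modop_hom ::
  "('l, 'a) dg_modop \<Rightarrow> ('l, 'b) dg_modop \<Rightarrow> ('l, int \<Rightarrow> 'a \<Rightarrow> 'b) modop_mor set" where
  "dg_modop_hom P Q = {f.
     (\<forall>g I. if stable g I then f g I \<in> cx_hom (mo_obj P g I) (mo_obj Q g I)
            else f g I = undefined) \<and>
     (\<forall>g I \<sigma>. stable g I \<and> inj_on \<sigma> I \<longrightarrow>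
        (\<forall>i. \<forall>x \<in> dg_el P g I i.
           f g (\<sigma> ` I) i (mo_act P g I \<sigma> i x) = mo_act Q g I \<sigma> i (f g I i x))) \<and>
     (\<forall>g I a h J b. glueable g I a h J b \<longrightarrow>
        (\<forall>i j. \<forall>x \<in> dg_el P g (insert a I) i. \<forall>y \<in> dg_el P h (insert b J) j.
           f (g + h) (I \<union> J) (i + j) (dg_circ P g I a h J b i x j y) =
           dg_circ Q g I a h J b i (f g (insert a I) i x) j (f h (insert b J) j y))) \<and>
     (\<forall>g I a b. contractible g I a b \<longrightarrow>
        (\<forall>i. \<forall>x \<in> dg_el P g (insert a (insert b I)) i.
           f (g + 1) I i (mo_xi P g I a b i x) =
           mo_xi Q g I a b i (f g (insert a (insert b I)) i x)))}"

definition dg_modop_id :: "('l, 'a) dg_modop \<Rightarrow> ('l, int \<Rightarrow> 'a \<Rightarrow> 'a) modop_mor" where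
  "dg_modop_id P = (\<lambda>g I. if stable g I then cx_id (mo_obj P g I) else undefined)"

definition dg_modop_comp ::
  "('l, 'a) dg_modop \<Rightarrow> ('l, int \<Rightarrow> 'b \<Rightarrow> 'c) modop_mor \<Rightarrow> ('l, int \<Rightarrow> 'a \<Rightarrow> 'b) modop_mor \<Rightarrow>
   ('l, int \<Rightarrow> 'a \<Rightarrow> 'c) modop_mor" where
  "dg_modop_comp P f' f =
     (\<lambda>g I. if stable g I then cx_comp (mo_obj P g I) (f' g I) (f g I) else undefined)"

definition dg_weak_equiv ::
  "('l, 'a) dg_modop \<Rightarrow> ('l, 'b) dg_modop \<Rightarrow> ('l, int \<Rightarrow> 'a \<Rightarrow> 'b) modop_mor \<Rightarrow> bool" where
  "dg_weak_equiv P Q f \<longleftrightarrow> f \<in> dg_modop_hom P Q \<and>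
     (\<forall>g I. stable g I \<longrightarrow> quasi_iso (mo_obj P g I) (mo_obj Q g I) (f g I))"


section \<open>Functors from topological to dg modular operads\<close>

record ('l, 'x, 'a) modop_functor =
  fun_ob :: "('l, 'x) top_modop \<Rightarrow> ('l, 'a) dg_modop"
  fun_mor :: "('l, 'x) top_modop \<Rightarrow> ('l, 'x) top_modop \<Rightarrow> ('l, 'x \<Rightarrow> 'x) modop_mor \<Rightarrow>
              ('l, int \<Rightarrow> 'a \<Rightarrow> 'a) modop_mor"

definition is_modop_functor :: "('l, 'x, 'a) modop_functor \<Rightarrow> bool" where
  "is_modop_functor F \<longleftrightarrow>
     (\<forall>P. is_top_modop P \<longrightarrow> is_dg_modop (fun_ob F P)) \<and>
     (\<forall>P Q f. is_top_modop P \<and> is_top_modop Q \<and> f \<in> top_modop_hom P Q \<longrightarrow>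
        fun_mor F P Q f \<in> dg_modop_hom (fun_ob F P) (fun_ob F Q)) \<and>
     (\<forall>P. is_top_modop P \<longrightarrow>
        fun_mor F P P (top_modop_id P) = dg_modop_id (fun_ob F P)) \<and>
     (\<forall>P Q R f f'. is_top_modop P \<and> is_top_modop Q \<and> is_top_modop R \<and>
        f \<in> top_modop_hom P Q \<and> f' \<in> top_modop_hom Q R \<longrightarrow>
        fun_mor F P R (top_modop_comp P f' f) =
        dg_modop_comp (fun_ob F P) (fun_mor F Q R f') (fun_mor F P Q f))"

text \<open>There is a natural transformation all of whose components are weak equivalences.\<close>

definition nat_weak_equiv :: "('l, 'x, 'a) modop_functor \<Rightarrow> ('l, 'x, 'b) modop_functor \<Rightarrow> bool" where
  "nat_weak_equiv F G \<longleftrightarrow> is_modop_functor F \<and> is_modop_functor G \<and>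
     (\<exists>\<eta>. (\<forall>P. is_top_modop P \<longrightarrow> dg_weak_equiv (fun_ob F P) (fun_ob G P) (\<eta> P)) \<and>
          (\<forall>P Q f. is_top_modop P \<and> is_top_modop Q \<and> f \<in> top_modop_hom P Q \<longrightarrow>
             dg_modop_comp (fun_ob F P) (\<eta> Q) (fun_mor F P Q f) =
             dg_modop_comp (fun_ob F P) (fun_mor G P Q f) (\<eta> P)))"

definition dg_weak_equiv_ex :: "('l, 'a) dg_modop \<Rightarrow> ('l, 'b) dg_modop \<Rightarrow> bool" where
  "dg_weak_equiv_ex P Q \<longleftrightarrow> is_dg_modop P \<and> is_dg_modop Q \<and> (\<exists>f. dg_weak_equiv P Q f)"

text \<open>
  A zigzag has to live in one HOL type, whereas its two ends may have different element types.
  Therefore the interior of a zigzag consists of complexes with elements in a type \<open>'w\<close>,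
  made explicit as a parameter (the smaller, the stronger the claim); the first and the last step
  may change the type.
\<close>

definition weakly_equiv_functors ::
  "'w itself \<Rightarrow> ('l, 'x, 'a) modop_functor \<Rightarrow> ('l, 'x, 'b) modop_functor \<Rightarrow> bool" where
  "weakly_equiv_functors TYPE('w) F G \<longleftrightarrow>
     (\<exists>H K :: ('l, 'x, 'w) modop_functor.
        (nat_weak_equiv F H \<or> nat_weak_equiv H F) \<and>
        equivclp nat_weak_equiv H K \<and>
        (nat_weak_equiv K G \<or> nat_weak_equiv G K))"

definition weakly_equiv_dg ::
  "'w itself \<Rightarrow> ('l, 'a) dg_modop \<Rightarrow> ('l, 'b) dg_modop \<Rightarrow> bool" where
  "weakly_equiv_dg TYPE('w) P Q \<longleftrightarrow>
     (\<exists>H K :: ('l, 'w) dg_modop.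
        (dg_weak_equiv_ex P H \<or> dg_weak_equiv_ex H P) \<and>
        equivclp dg_weak_equiv_ex H K \<and>
        (dg_weak_equiv_ex K Q \<or> dg_weak_equiv_ex Q K))"

text \<open>
  The componentwise extension of a lax monoidal functor with value \<open>F X\<close> on a space \<open>X\<close> and
  Kuenneth morphism \<open>\<kappa> X Y : F X \<otimes> F Y \<rightarrow> F (X \<times> Y)\<close>.  The action on morphisms is passed twice,
  as \<open>Fm\<close> for maps of spaces with points in \<open>'x\<close> and as \<open>Fm2\<close> for maps out of a product.
\<close>

definition induced_functor ::
  "('x topology \<Rightarrow> 'a chain_cx) \<Rightarrow>
   ('x topology \<Rightarrow> 'x topology \<Rightarrow> ('x \<Rightarrow> 'x) \<Rightarrow> int \<Rightarrow> 'a \<Rightarrow> 'a) \<Rightarrow>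
   (('x \<times> 'x) topology \<Rightarrow> 'x topology \<Rightarrow> ('x \<times> 'x \<Rightarrow> 'x) \<Rightarrow> int \<Rightarrow> 'b \<Rightarrow> 'a) \<Rightarrow>
   ('x topology \<Rightarrow> 'x topology \<Rightarrow> int \<Rightarrow> ('a, 'a) tens \<Rightarrow> 'b) \<Rightarrow> ('l, 'x, 'a) modop_functor" where
  "induced_functor F Fm Fm2 \<kappa> =
     \<lparr>fun_ob = (\<lambda>P.
        \<lparr>mo_obj = (\<lambda>g I. F (mo_obj P g I)),
         mo_act = (\<lambda>g I \<sigma>. Fm (mo_obj P g I) (mo_obj P g (\<sigma> ` I)) (mo_act P g I \<sigma>)),
         mo_circ = (\<lambda>g I a h J b.
           let X = mo_obj P g (insert a I); Y = mo_obj P h (insert b J) in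
           cx_comp (tensor (F X) (F Y))
             (Fm2 (prod_topology X Y) (mo_obj P (g + h) (I \<union> J)) (mo_circ P g I a h J b))
             (\<kappa> X Y)),
         mo_xi = (\<lambda>g I a b.
           Fm (mo_obj P g (insert a (insert b I))) (mo_obj P (g + 1) I) (mo_xi P g I a b))\<rparr>),
      fun_mor = (\<lambda>P Q f g I.
        if stable g I then Fm (mo_obj P g I) (mo_obj Q g I) (f g I) else undefined)\<rparr>"


section \<open>Singular chains\<close>

definition sing_cx :: "'x topology \<Rightarrow> 'x chain chain_cx" where
  "sing_cx X =
     \<lparr>grp = (\<lambda>n. if n < 0 then singleton_group 0 else chain_group (nat n) X),
      bd = (\<lambda>n. chain_boundary (nat n))\<rparr>"

definition sing_mor ::
  "'x topology \<Rightarrow> 'y topology \<Rightarrow> ('x \<Rightarrow> 'y) \<Rightarrow> int \<Rightarrow> 'x chain \<Rightarrow> 'y chain" where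
  "sing_mor X Y f = (\<lambda>n. restrict (chain_map (nat n) f) (carrier (grp (sing_cx X) n)))"

text \<open>The degeneracy \<open>s\<^sub>i\<close>: precomposition with the map that collapses the vertices \<open>i\<close> and \<open>i + 1\<close>.\<close>

definition simplical_degen :: "nat \<Rightarrow> (nat \<Rightarrow> real) \<Rightarrow> nat \<Rightarrow> real" where
  "simplical_degen i x = (\<lambda>j. if j < i then x j else if j = i then x i + x (Suc i) else x (Suc j))"

definition singular_degen :: "nat \<Rightarrow> nat \<Rightarrow> ((nat \<Rightarrow> real) \<Rightarrow> 'x) \<Rightarrow> (nat \<Rightarrow> real) \<Rightarrow> 'x" where
  "singular_degen p i \<sigma> = restrict (\<sigma> \<circ> simplical_degen i) (standard_simplex (Suc p))"

text \<open>\<open>degens p [i\<^sub>1, \<dots>, i\<^sub>k] \<sigma>\<close> is \<open>s\<^bsub>i\<^sub>k\<^esub> \<dots> s\<^bsub>i\<^sub>1\<^esub> \<sigma>\<close> for a \<open>p\<close>-simplex \<open>\<sigma>\<close>.\<close>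

primrec degens :: "nat \<Rightarrow> nat list \<Rightarrow> ((nat \<Rightarrow> real) \<Rightarrow> 'x) \<Rightarrow> (nat \<Rightarrow> real) \<Rightarrow> 'x" where
  "degens p [] \<sigma> = \<sigma>"
| "degens p (i # is) \<sigma> = degens (Suc p) is (singular_degen p i \<sigma>)"

text \<open>
  The permutation \<open>\<pi>\<close> of \<open>{0, \<dots>, p + q - 1}\<close> encodes the shuffle with
  \<open>(\<mu>\<^sub>1, \<dots>, \<mu>\<^sub>p, \<nu>\<^sub>1, \<dots>, \<nu>\<^sub>q) = (\<pi> 0, \<dots>, \<pi> (p + q - 1))\<close>.
\<close>

definition pq_shuffles :: "nat \<Rightarrow> nat \<Rightarrow> (nat \<Rightarrow> nat) set" where
  "pq_shuffles p q =
     {\<pi>. \<pi> permutes {..<p + q} \<and> strict_mono_on {..<p} \<pi> \<and> strict_mono_on {p..<p + q} \<pi>}"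

definition shuffle_simplex ::
  "nat \<Rightarrow> nat \<Rightarrow> ((nat \<Rightarrow> real) \<Rightarrow> 'x) \<Rightarrow> ((nat \<Rightarrow> real) \<Rightarrow> 'y) \<Rightarrow> ('x \<times> 'y) chain" where
  "shuffle_simplex p q \<sigma> \<tau> =
     (\<Sum>\<pi> \<in> pq_shuffles p q. frag_cmul (sign \<pi>) (frag_of
        (\<lambda>t \<in> standard_simplex (p + q).
           (degens p (map \<pi> [p..<p + q]) \<sigma> t, degens q (map \<pi> [0..<p]) \<tau> t))))"

definition shuffle_prod :: "nat \<Rightarrow> nat \<Rightarrow> 'x chain \<Rightarrow> 'y chain \<Rightarrow> ('x \<times> 'y) chain" where
  "shuffle_prod p q x y = frag_extend (\<lambda>\<sigma>. frag_extend (\<lambda>\<tau>. shuffle_simplex p q \<sigma> \<tau>) y) x"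

definition sing_kunneth ::
  "'x topology \<Rightarrow> 'y topology \<Rightarrow> int \<Rightarrow> ('x chain, 'y chain) tens \<Rightarrow> ('x \<times> 'y) chain" where
  "sing_kunneth X Y = (\<lambda>n. \<lambda>c \<in> carrier (grp (tensor (sing_cx X) (sing_cx Y)) n).
     the_elem (frag_extend (\<lambda>(i, x, j, y). shuffle_prod (nat i) (nat j) x y) ` c))"

definition sing_functor :: "('l, 'x, 'x chain) modop_functor" where
  "sing_functor = induced_functor sing_cx sing_mor sing_mor sing_kunneth"


section \<open>Ordered cubical chains\<close>

definition unit_cube :: "nat \<Rightarrow> (nat \<Rightarrow> real) set" where
  "unit_cube p = {t. (\<forall>i<p. 0 \<le> t i \<and> t i \<le> 1) \<and> (\<forall>i\<ge>p. t i = 0)}"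

definition singular_cube :: "nat \<Rightarrow> 'x topology \<Rightarrow> ((nat \<Rightarrow> real) \<Rightarrow> 'x) \<Rightarrow> bool" where
  "singular_cube p X c \<longleftrightarrow>
     continuous_map (subtopology (powertop_real UNIV) (unit_cube p)) X c \<and>
     c \<in> extensional (unit_cube p)"

text \<open>The place \<open>i\<close> is counted from 1, so the \<open>i\<close>-th coordinate of \<open>t\<close> is \<open>t (i - 1)\<close>.\<close>

definition cube_insert :: "nat \<Rightarrow> real \<Rightarrow> (nat \<Rightarrow> real) \<Rightarrow> nat \<Rightarrow> real" where
  "cube_insert i e t = (\<lambda>j. if j < i - 1 then t j else if j = i - 1 then e else t (j - 1))"

definition cube_bd :: "nat \<Rightarrow> 'x chain \<Rightarrow> 'x chain" where
  "cube_bd p = frag_extend (\<lambda>c. \<Sum>i\<in>{1..p}. \<Sum>e\<in>{0, 1}. frag_cmul ((- 1) ^ (i + e))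
     (frag_of (restrict (c \<circ> cube_insert i (real e)) (unit_cube (p - 1)))))"

definition cubeQ :: "'x topology \<Rightarrow> 'x chain chain_cx" where
  "cubeQ X =
     \<lparr>grp = (\<lambda>n. if n < 0 then singleton_group 0
                 else free_Abelian_group (Collect (singular_cube (nat n) X))),
      bd = (\<lambda>n. cube_bd (nat n))\<rparr>"

definition degenerate_cube :: "nat \<Rightarrow> ((nat \<Rightarrow> real) \<Rightarrow> 'x) \<Rightarrow> bool" where
  "degenerate_cube p c \<longleftrightarrow>
     (\<exists>i<p. \<forall>s \<in> unit_cube p. \<forall>t \<in> unit_cube p. (\<forall>j. j \<noteq> i \<longrightarrow> s j = t j) \<longrightarrow> c s = c t)"

definition cube_degen :: "'x topology \<Rightarrow> int \<Rightarrow> 'x chain set" where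
  "cube_degen X n = generate (grp (cubeQ X) n)
     {frag_of c | c. 0 \<le> n \<and> singular_cube (nat n) X c \<and> degenerate_cube (nat n) c}"

definition cubeC :: "'x topology \<Rightarrow> 'x chain set chain_cx" where
  "cubeC X = quot_cx (cubeQ X) (cube_degen X)"

definition cube_perm :: "nat \<Rightarrow> (nat \<Rightarrow> nat) \<Rightarrow> ((nat \<Rightarrow> real) \<Rightarrow> 'x) \<Rightarrow> 'x chain" where
  "cube_perm p \<pi> c =
     frag_cmul (sign \<pi>) (frag_of (restrict (\<lambda>t. c (t \<circ> \<pi>)) (unit_cube p)))"

definition cube_sym :: "'x topology \<Rightarrow> int \<Rightarrow> 'x chain set set" where
  "cube_sym X n = generate (grp (cubeC X) n)
     {cube_degen X n #>\<^bsub>grp (cubeQ X) n\<^esub> (frag_of c - cube_perm (nat n) \<pi> c)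
       | c \<pi>. 0 \<le> n \<and> singular_cube (nat n) X c \<and> \<pi> permutes {..<nat n}}"

definition cord_cx :: "'x topology \<Rightarrow> 'x chain set set chain_cx" where
  "cord_cx X = quot_cx (cubeC X) (cube_sym X)"

definition cubeQ_mor ::
  "'x topology \<Rightarrow> 'y topology \<Rightarrow> ('x \<Rightarrow> 'y) \<Rightarrow> int \<Rightarrow> 'x chain \<Rightarrow> 'y chain" where
  "cubeQ_mor X Y f = (\<lambda>n. restrict
     (frag_extend (\<lambda>c. frag_of (restrict (f \<circ> c) (unit_cube (nat n))))) (carrier (grp (cubeQ X) n)))"

definition cord_mor ::
  "'x topology \<Rightarrow> 'y topology \<Rightarrow> ('x \<Rightarrow> 'y) \<Rightarrow> int \<Rightarrow> 'x chain set set \<Rightarrow> 'y chain set set" where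
  "cord_mor X Y f =
     quot_mor (cubeC X) (cube_sym X) (cubeC Y) (cube_sym Y)
       (quot_mor (cubeQ X) (cube_degen X) (cubeQ Y) (cube_degen Y) (cubeQ_mor X Y f))"

definition cube_cross ::
  "nat \<Rightarrow> nat \<Rightarrow> ((nat \<Rightarrow> real) \<Rightarrow> 'x) \<Rightarrow> ((nat \<Rightarrow> real) \<Rightarrow> 'y) \<Rightarrow> (nat \<Rightarrow> real) \<Rightarrow> 'x \<times> 'y" where
  "cube_cross p q c c' =
     (\<lambda>t \<in> unit_cube (p + q). (c (\<lambda>i. if i < p then t i else 0), c' (\<lambda>i. t (p + i))))"

definition cross_prod :: "nat \<Rightarrow> nat \<Rightarrow> 'x chain \<Rightarrow> 'y chain \<Rightarrow> ('x \<times> 'y) chain" where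
  "cross_prod p q x y = frag_extend (\<lambda>c. frag_extend (\<lambda>c'. frag_of (cube_cross p q c c')) y) x"

definition cord_class :: "'x topology \<Rightarrow> int \<Rightarrow> 'x chain \<Rightarrow> 'x chain set set" where
  "cord_class X n x =
     cube_sym X n #>\<^bsub>grp (cubeC X) n\<^esub> (cube_degen X n #>\<^bsub>grp (cubeQ X) n\<^esub> x)"

text \<open>An arbitrary cubical chain representing an element of the double quotient.\<close>

definition cord_rep :: "'x chain set set \<Rightarrow> 'x chain" where
  "cord_rep u = (SOME x. x \<in> \<Union> u)"

definition cord_kunneth ::
  "'x topology \<Rightarrow> 'y topology \<Rightarrow> int \<Rightarrow> ('x chain set set, 'y chain set set) tens \<Rightarrow>
   ('x \<times> 'y) chain set set" where
  "cord_kunneth X Y = (\<lambda>n. \<lambda>c \<in> carrier (grp (tensor (cord_cx X) (cord_cx Y)) n).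
     the_elem ((\<lambda>z. cord_class (prod_topology X Y) n
        (frag_extend (\<lambda>(i, u, j, v). cross_prod (nat i) (nat j) (cord_rep u) (cord_rep v)) z)) ` c))"

definition cord_functor :: "('l, 'x, 'x chain set set) modop_functor" where
  "cord_functor = induced_functor cord_cx cord_mor cord_mor cord_kunneth"

end

theory Submission
  imports Defs
begin

text \<open>
  Both functors are compared with normalized singular chains \<open>N\<close>.  The quotient map from \<open>S\<^sub>*\<close> to
  \<open>N\<close> is multiplicative.  The map from \<open>C\<^sub>*\<^sup>o\<^sup>r\<^sup>d\<close> to \<open>N\<close> sends a cube \<open>c\<close> to the push-forward along
  \<open>c\<close> of the fundamental chain of \<open>I\<^sup>n\<close>, the \<open>n\<close>-fold shuffle power of the edge \<open>I\<close>.  It is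
  multiplicative since the shuffle product is associative; it kills cubes that are independent of a
  coordinate, because a factor becomes degenerate, and it is alternating because the shuffle product
  is graded commutative.

  All three functors are given by free chains on models modulo relations that are affine and preserve
  base points.  The cones from the base points respect these relations, so the method of acyclic
  models applies to the quotients: any two such theories are related by natural chain maps that are
  unique up to natural homotopy, and every natural chain map that is the identity in degree 0 is a
  quasi-isomorphism.
\<close>

section \<open>Free chains and natural operators\<close>

text \<open>A cube that a transposition of coordinates leaves invariant satisfies 2c = 0 in C^ord.
  So these groups have torsion, and the classical form of acyclic models, which needs free values,
  does not apply. What survives is representability: a natural additive operator on free chains is
  one chain on each model, and it descends to the quotients once it respects the relations on the
  models. Hence relations are stored as chains on models, and identities are checked on identity
  cells.

  Normalized chains stand in the middle because the triangulation of a degenerate cube consists of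
  degenerate simplices, which need not cancel in S. Only the two maps into N have to be
  multiplicative; their homotopy inverses are built from cones, without control over products, and
  serve only to detect isomorphisms in homology.

  The cubical cone has a surplus constant face, which vanishes only modulo degenerate cubes. So the
  contraction identity, too, is demanded only modulo relations.

  Chains are computed with in additive type classes; \<open>presents\<close> carries the results
  over to the quotient groups of the definitions.\<close>

type_synonym vec = "nat \<Rightarrow> real"

section \<open>Additive maps and subgroups\<close>

definition zlin :: "('a::ab_group_add \<Rightarrow> 'b::ab_group_add) \<Rightarrow> bool" where
  "zlin f \<longleftrightarrow> (\<forall>x y. f (x - y) = f x - f y)"

definition subgrp :: "'a::ab_group_add set \<Rightarrow> bool" where
  "subgrp A \<longleftrightarrow> 0 \<in> A \<and> (\<forall>x\<in>A. \<forall>y\<in>A. x - y \<in> A)"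

lemma zlin_diff: "zlin f \<Longrightarrow> f (x - y) = f x - f y"
  by (simp add: zlin_def)

lemma zlin_0: "zlin f \<Longrightarrow> f 0 = 0"
  using zlin_diff[of f 0 0] by simp

lemma zlin_minus: "zlin f \<Longrightarrow> f (- x) = - f x"
  using zlin_diff[of f 0 x] zlin_0[of f] by simp

lemma zlin_add: "zlin f \<Longrightarrow> f (x + y) = f x + f y"
  using zlin_diff[of f x "- y"] zlin_minus[of f y] by simp

lemma zlin_sum: "zlin f \<Longrightarrow> f (sum g I) = (\<Sum>i\<in>I. f (g i))"
  by (induction I rule: infinite_finite_induct) (auto simp: zlin_0 zlin_add)

lemma zlinI: "(\<And>x y. f (x + y) = f x + f y) \<Longrightarrow> zlin f"
  unfolding zlin_def by (metis add_diff_cancel diff_add_cancel)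

lemma zlin_comp: "zlin f \<Longrightarrow> zlin g \<Longrightarrow> zlin (\<lambda>x. f (g x))"
  by (simp add: zlin_def)

lemma zlin_plus: "zlin f \<Longrightarrow> zlin g \<Longrightarrow> zlin (\<lambda>x. f x + g x)"
  by (simp add: zlin_def)

lemma zlin_minus_fun: "zlin f \<Longrightarrow> zlin g \<Longrightarrow> zlin (\<lambda>x. f x - g x)"
  by (simp add: zlin_def)

lemma zlin_frag_extend: "zlin (frag_extend f)"
  by (simp add: zlin_def frag_extend_diff)

lemma zlin_frag_cmul_id: "zlin (frag_cmul k)"
  by (rule zlinI) (rule frag_cmul_distrib2)

lemma zlin_id: "zlin (\<lambda>x. x)"
  by (simp add: zlin_def)

lemma frag_cmul_sum': "frag_cmul k (sum g I) = (\<Sum>i\<in>I. frag_cmul k (g i))"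
  by (rule zlin_sum[OF zlin_frag_cmul_id])

lemma frag_cmul_diff2: "frag_cmul k (x - y) = frag_cmul k x - frag_cmul k y"
  by (rule zlin_diff[OF zlin_frag_cmul_id])

lemma zlin_cmul:
  fixes f :: "('a \<Rightarrow>\<^sub>0 int) \<Rightarrow> ('b \<Rightarrow>\<^sub>0 int)"
  assumes "zlin f" shows "f (frag_cmul k x) = frag_cmul k (f x)"
proof (induction k rule: int_induct[where k=0])
  case (step1 i) then show ?case by (simp add: frag_cmul_distrib zlin_add[OF assms])
next
  case (step2 i) then show ?case by (simp add: frag_cmul_diff_distrib zlin_diff[OF assms])
qed (simp_all add: zlin_0[OF assms])

lemma subgrp_0: "subgrp A \<Longrightarrow> 0 \<in> A"
  by (simp add: subgrp_def)

lemma subgrp_diff: "subgrp A \<Longrightarrow> x \<in> A \<Longrightarrow> y \<in> A \<Longrightarrow> x - y \<in> A"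
  by (simp add: subgrp_def)

lemma subgrp_minus: "subgrp A \<Longrightarrow> x \<in> A \<Longrightarrow> - x \<in> A"
  using subgrp_diff[of A 0 x] by (simp add: subgrp_0)

lemma subgrp_add: "subgrp A \<Longrightarrow> x \<in> A \<Longrightarrow> y \<in> A \<Longrightarrow> x + y \<in> A"
  using subgrp_diff[of A x "- y"] by (simp add: subgrp_minus)

lemma subgrp_sum: "subgrp A \<Longrightarrow> (\<And>i. i \<in> I \<Longrightarrow> g i \<in> A) \<Longrightarrow> sum g I \<in> A"
  by (induction I rule: infinite_finite_induct) (auto simp: subgrp_0 subgrp_add)

lemma subgrp_cmul:
  fixes x :: "'a \<Rightarrow>\<^sub>0 int"
  assumes "subgrp A" "x \<in> A" shows "frag_cmul k x \<in> A"
proof (induction k rule: int_induct[where k=0])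
  case (step1 i) then show ?case by (simp add: frag_cmul_distrib subgrp_add assms)
next
  case (step2 i) then show ?case by (simp add: frag_cmul_diff_distrib subgrp_diff assms)
qed (simp_all add: subgrp_0 assms)

lemma subgrp_vimage: "zlin f \<Longrightarrow> subgrp A \<Longrightarrow> subgrp {x. f x \<in> A}"
  by (simp add: subgrp_def zlin_0 zlin_diff)

text \<open>With \<open>zlin_eq\<close>, the device by which nearly every assertion about chains is
  reduced to single cells: one side is additive, so only generators need a look.\<close>

lemma zlin_mem:
  assumes "zlin f" "subgrp A" "Poly_Mapping.keys x \<subseteq> S" "\<And>c. c \<in> S \<Longrightarrow> f (frag_of c) \<in> A"
  shows "f x \<in> A"
  using assms(3)
  by (induction x rule: frag_induction) (use assms in \<open>auto simp: zlin_0 zlin_diff subgrp_def\<close>)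

lemma zlin_eq:
  assumes "zlin f" "zlin g" "Poly_Mapping.keys x \<subseteq> S"
    and "\<And>c. c \<in> S \<Longrightarrow> f (frag_of c) = g (frag_of c)"
  shows "f x = g x"
  using assms(3)
  by (induction x rule: frag_induction) (use assms in \<open>auto simp: zlin_0 zlin_diff\<close>)

lemma zlin_frag_extend_comp:
  assumes "zlin f" shows "f (frag_extend g x) = frag_extend (\<lambda>c. f (g c)) x"
  by (rule zlin_eq[OF zlin_comp[OF assms zlin_frag_extend] zlin_frag_extend subset_UNIV]) simp

lemma frag_extend_plus_fun:
  "frag_extend (\<lambda>c. f c + g c) x = frag_extend f x + frag_extend g x"
  by (rule zlin_eq[OF zlin_frag_extend zlin_plus[OF zlin_frag_extend zlin_frag_extend] subset_UNIV]) simp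

lemma frag_extend_diff_fun:
  "frag_extend (\<lambda>c. f c - g c) x = frag_extend f x - frag_extend g x"
  by (rule zlin_eq[OF zlin_frag_extend zlin_minus_fun[OF zlin_frag_extend zlin_frag_extend] subset_UNIV]) simp

lemma frag_extend_cmul_fun:
  "frag_extend (\<lambda>c. frag_cmul k (f c)) x = frag_cmul k (frag_extend f x)"
  by (simp add: zlin_frag_extend_comp[OF zlin_frag_cmul_id])

text \<open>Additivity in the function argument. It makes \<open>act\<close> and \<open>mul\<close>
  additive in each variable separately, so that identities between them can be tested on generators
  one variable at a time.\<close>

lemma zlin_frag_extend_fun:
  assumes "\<And>c. zlin (\<lambda>y. f y c)" shows "zlin (\<lambda>y. frag_extend (f y) x)"
proof -
  have "f (y - z) = (\<lambda>c. f y c - f z c)" for y z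
    using zlin_diff[OF assms] by (simp add: fun_eq_iff)
  then show ?thesis by (simp add: zlin_def frag_extend_diff_fun)
qed

lemma frag_extend_0_fun: "frag_extend (\<lambda>c. 0) x = 0"
  by (simp add: frag_extend_eq_0)

inductive_set zspan :: "('a::ab_group_add) set \<Rightarrow> 'a set" for G where
  zspan_0: "0 \<in> zspan G"
| zspan_gen: "g \<in> G \<Longrightarrow> g \<in> zspan G"
| zspan_diff: "x \<in> zspan G \<Longrightarrow> y \<in> zspan G \<Longrightarrow> x - y \<in> zspan G"

lemma subgrp_zspan: "subgrp (zspan G)"
  by (simp add: subgrp_def zspan_0 zspan_diff)

lemma zspan_least: "subgrp A \<Longrightarrow> G \<subseteq> A \<Longrightarrow> zspan G \<subseteq> A"
proof
  fix x assume "subgrp A" "G \<subseteq> A" "x \<in> zspan G"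
  from this(3) show "x \<in> A"
    by induction (use \<open>subgrp A\<close> \<open>G \<subseteq> A\<close> in \<open>auto simp: subgrp_def\<close>)
qed

lemma zlin_zspan:
  assumes "zlin f" "subgrp A" "\<And>g. g \<in> G \<Longrightarrow> f g \<in> A" "x \<in> zspan G"
  shows "f x \<in> A"
  using zspan_least[OF subgrp_vimage[OF assms(1,2)], of G] assms(3,4) by blast

lemma zspan_empty: "zspan {} = {0}"
  using zspan_least[of "{0}" "{}"] by (auto simp: subgrp_def zspan_0)

section \<open>Cells, push-forward and operators given by chains on models\<close>

definition cells :: "vec set \<Rightarrow> 'x topology \<Rightarrow> (vec \<Rightarrow> 'x) set" where
  "cells S X = {c. continuous_map (subtopology (powertop_real UNIV) S) X c \<and> c \<in> extensional S}"

abbreviation mtop :: "vec set \<Rightarrow> vec topology" where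
  "mtop S \<equiv> subtopology (powertop_real UNIV) S"

definition chains :: "vec set \<Rightarrow> 'x topology \<Rightarrow> 'x chain set" where
  "chains S X = {x. Poly_Mapping.keys x \<subseteq> cells S X}"

definition push :: "vec set \<Rightarrow> ('x \<Rightarrow> 'y) \<Rightarrow> 'x chain \<Rightarrow> 'y chain" where
  "push S f = frag_extend (\<lambda>c. frag_of (restrict (f \<circ> c) S))"

text \<open>A combination \<open>E\<close> of maps from \<open>S\<close> to the domain of the cells acts on chains by precomposition.\<close>

definition act :: "vec set \<Rightarrow> vec chain \<Rightarrow> 'x chain \<Rightarrow> 'x chain" where
  "act S E = frag_extend (\<lambda>c. push S c E)"

text \<open>\<open>M\<close> is a universal product: a chain in the product of two models, which a
  pair of cells carries along to the product of two spaces. Both the shuffle product and the cross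
  product have this form.\<close>

definition mul :: "vec set \<Rightarrow> (vec \<times> vec) chain \<Rightarrow> 'x chain \<Rightarrow> 'y chain \<Rightarrow> ('x \<times> 'y) chain" where
  "mul S M x y = frag_extend (\<lambda>c. frag_extend (\<lambda>c'. push S (map_prod c c') M) y) x"

definition idc :: "vec set \<Rightarrow> vec chain" where
  "idc S = frag_of (restrict (\<lambda>t. t) S)"

lemma cells_value: "c \<in> cells S X \<Longrightarrow> t \<in> S \<Longrightarrow> c t \<in> topspace X"
  unfolding cells_def using continuous_map_image_subset_topspace by fastforce

lemma cells_ext: "c \<in> cells S X \<Longrightarrow> t \<notin> S \<Longrightarrow> c t = undefined"
  by (auto simp: cells_def extensional_def)

lemma cells_comp:
  assumes "c \<in> cells S X" "continuous_map X Y f"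
  shows "restrict (f \<circ> c) S \<in> cells S Y"
proof -
  have "continuous_map (mtop S) Y (f \<circ> c)"
    using assms continuous_map_compose by (auto simp: cells_def)
  then have "continuous_map (mtop S) Y (restrict (f \<circ> c) S)"
    by (rule continuous_map_eq) simp
  then show ?thesis by (simp add: cells_def)
qed

lemma cells_continuous: "c \<in> cells S X \<Longrightarrow> continuous_map (mtop S) X c"
  by (simp add: cells_def)

lemma id_cell: "restrict (\<lambda>t. t) S \<in> cells S (mtop S)"
  using continuous_map_eq[OF continuous_map_id, of "mtop S" "restrict (\<lambda>t. t) S"]
  by (auto simp: cells_def)

lemma idc_chain: "idc S \<in> chains S (mtop S)"
  using id_cell by (auto simp: idc_def chains_def)

lemma subgrp_chains: "subgrp (chains S X)"
  unfolding subgrp_def chains_def using keys_diff by fastforce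

lemma frag_of_chains: "frag_of c \<in> chains S X \<longleftrightarrow> c \<in> cells S X"
  by (simp add: chains_def)

lemma chains_lin_mem:
  assumes "x \<in> chains S X" "zlin f" "subgrp A" "\<And>c. c \<in> cells S X \<Longrightarrow> f (frag_of c) \<in> A"
  shows "f x \<in> A"
  using zlin_mem[OF assms(2,3) _ assms(4), of x "cells S X"] assms(1) by (simp add: chains_def)

lemma chains_lin_eq:
  assumes "x \<in> chains S X" "zlin f" "zlin g"
    "\<And>c. c \<in> cells S X \<Longrightarrow> f (frag_of c) = g (frag_of c)"
  shows "f x = g x"
  using zlin_eq[OF assms(2,3) _ assms(4), of x "cells S X"] assms(1) by (simp add: chains_def)

lemma zlin_push: "zlin (push S f)"
  by (simp add: push_def zlin_frag_extend)

lemma push_of: "push S f (frag_of c) = frag_of (restrict (f \<circ> c) S)"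
  by (simp add: push_def)

lemma push_chain:
  assumes "x \<in> chains S X" "continuous_map X Y f" shows "push S f x \<in> chains S Y"
  by (rule chains_lin_mem[OF assms(1) zlin_push subgrp_chains])
     (simp add: push_of frag_of_chains cells_comp[OF _ assms(2)])

lemma push_push: "push S f (push S g x) = push S (f \<circ> g) x"
proof (rule zlin_eq[OF zlin_comp[OF zlin_push zlin_push] zlin_push subset_UNIV])
  fix c
  have "restrict (f \<circ> restrict (g \<circ> c) S) S = restrict (f \<circ> g \<circ> c) S" by auto
  then show "push S f (push S g (frag_of c)) = push S (f \<circ> g) (frag_of c)" by (simp add: push_of)
qed

lemma push_cong:
  assumes "x \<in> chains S X" "\<And>y. y \<in> topspace X \<Longrightarrow> f y = g y"
  shows "push S f x = push S g x"
proof (rule chains_lin_eq[OF assms(1) zlin_push zlin_push])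
  fix c assume "c \<in> cells S X"
  then have "restrict (f \<circ> c) S = restrict (g \<circ> c) S"
    using assms(2) by (auto simp: cells_value)
  then show "push S f (frag_of c) = push S g (frag_of c)" by (simp add: push_of)
qed

lemma push_id:
  assumes "x \<in> chains S X" "\<And>y. y \<in> topspace X \<Longrightarrow> f y = y"
  shows "push S f x = x"
proof (rule chains_lin_eq[OF assms(1) zlin_push zlin_id])
  fix c assume "c \<in> cells S X"
  then have "restrict (f \<circ> c) S = c"
    using assms(2) by (auto simp: cells_value cells_ext fun_eq_iff restrict_def)
  then show "push S f (frag_of c) = frag_of c" by (simp add: push_of)
qed

lemma zlin_act: "zlin (act S E)"
  by (simp add: act_def zlin_frag_extend)

lemma act_of: "act S E (frag_of c) = push S c E"
  by (simp add: act_def)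

lemma zlin_act1: "zlin (\<lambda>E. act S E x)"
  unfolding act_def by (intro zlin_frag_extend_fun zlin_push)

lemma act_0: "act S 0 x = 0"
  by (rule zlin_0[OF zlin_act1])

lemma act_chain:
  assumes "E \<in> chains S (mtop S')" "x \<in> chains S' X"
  shows "act S E x \<in> chains S X"
  by (rule chains_lin_mem[OF assms(2) zlin_act subgrp_chains])
     (simp add: act_of push_chain[OF assms(1)] cells_continuous)

text \<open>Naturality of the operator of \<open>E\<close>. The push-forward along \<open>f\<close>
  cuts composites off outside \<open>S'\<close>, and the cells of \<open>E\<close> do not notice
  this because their values lie in \<open>S'\<close>.\<close>

lemma act_push:
  assumes "E \<in> chains S (mtop S')"
  shows "act S E (push S' f x) = push S f (act S E x)"
proof (rule zlin_eq[OF zlin_comp[OF zlin_act zlin_push] zlin_comp[OF zlin_push zlin_act] subset_UNIV])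
  fix c
  have "push S (restrict (f \<circ> c) S') E = push S (f \<circ> c) E"
    by (rule push_cong[OF assms]) auto
  then show "act S E (push S' f (frag_of c)) = push S f (act S E (frag_of c))"
    by (simp add: act_of push_of push_push)
qed

text \<open>Operators compose as their universal chains do. Together with the unit laws
  \<open>act_idc\<close> and \<open>act_idc2\<close> this is the Yoneda lemma for operators on
  chains.\<close>

lemma act_act:
  assumes "E \<in> chains S (mtop S')"
  shows "act S E (act S' E' x) = act S (act S E E') x"
  by (rule zlin_eq[OF zlin_comp[OF zlin_act zlin_act] zlin_act subset_UNIV])
     (simp add: act_of act_push[OF assms])

lemma act_idc:
  assumes "x \<in> chains S X" shows "act S (idc S) x = x"
proof (rule chains_lin_eq[OF assms zlin_act zlin_id])
  fix c assume "c \<in> cells S X"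
  then have "restrict (c \<circ> restrict (\<lambda>t. t) S) S = c"
    by (auto simp: cells_ext fun_eq_iff restrict_def)
  then show "act S (idc S) (frag_of c) = frag_of c" by (simp add: act_of idc_def push_of)
qed

lemma act_idc2:
  assumes "E \<in> chains S (mtop S')" shows "act S E (idc S') = E"
  by (simp add: idc_def act_of, rule push_id[OF assms]) simp

lemma zlin_mul1: "zlin (\<lambda>x. mul S M x y)"
  unfolding mul_def by (rule zlin_frag_extend)

lemma zlin_mul2: "zlin (\<lambda>y. mul S M x y)"
  unfolding mul_def by (rule zlin_frag_extend_fun) (rule zlin_frag_extend)

lemma zlin_mul0: "zlin (\<lambda>M. mul S M x y)"
  unfolding mul_def by (intro zlin_frag_extend_fun zlin_push)

lemma mul_of: "mul S M (frag_of c) (frag_of c') = push S (map_prod c c') M"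
  by (simp add: mul_def)

lemma mul_mem:
  assumes "x \<in> chains S1 X" "y \<in> chains S2 Y" "subgrp A" "zlin F"
    and "\<And>c c'. c \<in> cells S1 X \<Longrightarrow> c' \<in> cells S2 Y \<Longrightarrow> F (push S (map_prod c c') M) \<in> A"
  shows "F (mul S M x y) \<in> A"
proof (rule chains_lin_mem[OF assms(1) zlin_comp[OF assms(4) zlin_mul1] assms(3)])
  fix c assume c: "c \<in> cells S1 X"
  show "F (mul S M (frag_of c) y) \<in> A"
    by (rule chains_lin_mem[OF assms(2) zlin_comp[OF assms(4) zlin_mul2] assms(3)])
       (simp add: mul_of assms(5) c)
qed

lemma continuous_map_prod_cells:
  assumes "continuous_map X X' f" "continuous_map Y Y' g"
  shows "continuous_map (prod_topology X Y) (prod_topology X' Y') (map_prod f g)"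
proof -
  have "continuous_map (prod_topology X Y) X' (f \<circ> fst)" "continuous_map (prod_topology X Y) Y' (g \<circ> snd)"
    using assms by (blast intro: continuous_map_compose continuous_map_fst continuous_map_snd)+
  then show ?thesis
    unfolding continuous_map_pairwise by (simp add: o_def)
qed

lemma mul_chain:
  assumes "M \<in> chains S (prod_topology (mtop S1) (mtop S2))" "x \<in> chains S1 X" "y \<in> chains S2 Y"
  shows "mul S M x y \<in> chains S (prod_topology X Y)"
  by (rule mul_mem[OF assms(2,3) subgrp_chains zlin_id])
     (intro push_chain[OF assms(1)] continuous_map_prod_cells cells_continuous)

lemma mul_push:
  assumes "M \<in> chains S (prod_topology (mtop S1) (mtop S2))"
  shows "mul S M (push S1 f x) (push S2 g y) = push S (map_prod f g) (mul S M x y)"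
proof (rule zlin_eq[OF zlin_comp[OF zlin_mul1 zlin_push] zlin_comp[OF zlin_push zlin_mul1] subset_UNIV])
  fix c
  show "mul S M (push S1 f (frag_of c)) (push S2 g y) = push S (map_prod f g) (mul S M (frag_of c) y)"
  proof (rule zlin_eq[OF zlin_comp[OF zlin_mul2 zlin_push] zlin_comp[OF zlin_push zlin_mul2] subset_UNIV])
    fix c'
    have "push S (map_prod (restrict (f \<circ> c) S1) (restrict (g \<circ> c') S2)) M
        = push S (map_prod f g \<circ> map_prod c c') M"
      by (rule push_cong[OF assms]) auto
    then show "mul S M (push S1 f (frag_of c)) (push S2 g (frag_of c'))
        = push S (map_prod f g) (mul S M (frag_of c) (frag_of c'))"
      by (simp add: mul_of push_of push_push)
  qed
qed

lemma act_mul: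
  assumes "E \<in> chains S (mtop S')"
  shows "act S E (mul S' M x y) = mul S (act S E M) x y"
proof (rule zlin_eq[OF zlin_comp[OF zlin_act zlin_mul1] zlin_mul1 subset_UNIV])
  fix c
  show "act S E (mul S' M (frag_of c) y) = mul S (act S E M) (frag_of c) y"
    by (rule zlin_eq[OF zlin_comp[OF zlin_act zlin_mul2] zlin_mul2 subset_UNIV])
       (simp add: mul_of act_push[OF assms])
qed

lemma mul_act:
  assumes "M \<in> chains S (prod_topology (mtop S1) (mtop S2))"
  shows "mul S M (act S1 E x) (act S2 E' y) = mul S (mul S M E E') x y"
proof (rule zlin_eq[OF zlin_comp[OF zlin_mul1 zlin_act] zlin_mul1 subset_UNIV])
  fix c
  show "mul S M (act S1 E (frag_of c)) (act S2 E' y) = mul S (mul S M E E') (frag_of c) y"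
    by (rule zlin_eq[OF zlin_comp[OF zlin_mul2 zlin_act] zlin_mul2 subset_UNIV])
       (simp add: mul_of act_of mul_push[OF assms])
qed

lemma mul_idc:
  assumes "M \<in> chains S (prod_topology (mtop S1) (mtop S2))"
  shows "mul S M (idc S1) (idc S2) = M"
  unfolding idc_def mul_of by (rule push_id[OF assms]) auto

text \<open>The relations in a space are images of universal ones, so they are natural in the space
  by construction, and an operator has to be tested only on the pairs in \<open>rel\<close>.\<close>

definition relspan :: "(nat \<Rightarrow> vec set) \<Rightarrow> (nat \<Rightarrow> (nat \<times> vec chain) set) \<Rightarrow> nat \<Rightarrow> 'x topology \<Rightarrow> 'x chain set" where
  "relspan K rel p X = zspan {push (K p) c r | m r c. (m, r) \<in> rel p \<and> c \<in> cells (K m) X}"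

lemma subgrp_relspan: "subgrp (relspan K rel p X)"
  by (simp add: relspan_def subgrp_zspan)

lemma relspan_gen: "(m, r) \<in> rel p \<Longrightarrow> c \<in> cells (K m) X \<Longrightarrow> push (K p) c r \<in> relspan K rel p X"
  unfolding relspan_def by (rule zspan_gen) blast

lemma zlin_relspan:
  assumes "zlin f" "subgrp A" "x \<in> relspan K rel p X"
    "\<And>m r c. (m, r) \<in> rel p \<Longrightarrow> c \<in> cells (K m) X \<Longrightarrow> f (push (K p) c r) \<in> A"
  shows "f x \<in> A"
  by (rule zlin_zspan[OF assms(1,2) _ assms(3)[unfolded relspan_def]]) (use assms(4) in blast)

lemma push_relspan:
  assumes rc: "\<And>m r. (m, r) \<in> rel p \<Longrightarrow> r \<in> chains (K p) (mtop (K m))"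
    and "x \<in> relspan K rel p X" "continuous_map X Y f"
  shows "push (K p) f x \<in> relspan K rel p Y"
proof (rule zlin_relspan[OF zlin_push subgrp_relspan assms(2)])
  fix m r c assume *: "(m, r) \<in> rel p" "c \<in> cells (K m) X"
  have "push (K p) f (push (K p) c r) = push (K p) (restrict (f \<circ> c) (K m)) r"
    unfolding push_push by (rule push_cong[OF rc[OF *(1)]]) auto
  then show "push (K p) f (push (K p) c r) \<in> relspan K rel p Y"
    using relspan_gen[of m r rel p "restrict (f \<circ> c) (K m)"] cells_comp[OF *(2) assms(3)] * by auto
qed

lemma relspan_chains:
  assumes rc: "\<And>m r. (m, r) \<in> rel p \<Longrightarrow> r \<in> chains (K p) (mtop (K m))"
    and "x \<in> relspan K rel p X"
  shows "x \<in> chains (K p) X"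
  by (rule zlin_relspan[OF zlin_id subgrp_chains assms(2)])
     (use push_chain[OF rc] cells_continuous in blast)

section \<open>Acyclic models modulo relations\<close>

text \<open>
  \<open>mdl p\<close> is the domain of the \<open>p\<close>-cells, \<open>bdy p\<close> the boundary of its identity.  A relation
  \<open>(m, r) \<in> rels p\<close> is a \<open>p\<close>-chain \<open>r\<close> of \<open>mdl m\<close>, whose push-forwards are divided out in every space.
\<close>

record cell_data =
  mdl :: "nat \<Rightarrow> vec set"
  bdy :: "nat \<Rightarrow> vec chain"
  rels :: "nat \<Rightarrow> (nat \<times> vec chain) set"
  base :: "nat \<Rightarrow> vec"
  cone :: "vec \<Rightarrow> nat \<Rightarrow> (vec \<Rightarrow> vec) \<Rightarrow> vec \<Rightarrow> vec"
  mlt :: "nat \<Rightarrow> nat \<Rightarrow> (vec \<times> vec) chain"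

abbreviation mdt :: "cell_data \<Rightarrow> nat \<Rightarrow> vec topology" where
  "mdt T p \<equiv> mtop (mdl T p)"

abbreviation rspan :: "cell_data \<Rightarrow> nat \<Rightarrow> 'x topology \<Rightarrow> 'x chain set" where
  "rspan T p X \<equiv> relspan (mdl T) (rels T) p X"

abbreviation bd1 :: "cell_data \<Rightarrow> nat \<Rightarrow> 'x chain \<Rightarrow> 'x chain" where
  "bd1 T p \<equiv> act (mdl T p) (bdy T (Suc p))"

text \<open>The uniform bound on coordinates is there for the simplicial cone: near the apex the
  rescaled point of the opposite face has no limit, and only boundedness of its image makes the cone
  continuous.\<close>

definition star_at :: "vec \<Rightarrow> vec set \<Rightarrow> bool" where
  "star_at v V \<longleftrightarrow> v \<in> V \<and> (\<forall>x\<in>V. \<forall>t\<in>{0..1}. (\<lambda>i. (1 - t) * v i + t * x i) \<in> V) \<and>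
     (\<exists>B. \<forall>x\<in>V. \<forall>i. \<bar>x i\<bar> \<le> B)"

text \<open>Affine along the segments that start at the base point. This is what is needed for
  composition with \<open>f\<close> to commute with cones over these base points.\<close>

definition bpaff :: "vec \<Rightarrow> vec set \<Rightarrow> vec \<Rightarrow> (vec \<Rightarrow> vec) \<Rightarrow> bool" where
  "bpaff v V v' f \<longleftrightarrow> (\<forall>x\<in>V. \<forall>t\<in>{0..1}.
     f (\<lambda>i. (1 - t) * v i + t * x i) = (\<lambda>i. (1 - t) * v' i + t * f x i))"

definition conec :: "cell_data \<Rightarrow> vec \<Rightarrow> nat \<Rightarrow> vec chain \<Rightarrow> vec chain" where
  "conec T v p = frag_extend (\<lambda>c. frag_of (cone T v p c))"

text \<open>\<open>bd1 T p\<close> goes from degree \<open>p + 1\<close> to degree \<open>p\<close>.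
  The default \<open>bdy T 0 = 0\<close> later makes the boundary of the graded complex vanish in
  all degrees up to 0.\<close>

locale cell_theory =
  fixes T :: cell_data
  assumes D_chain: "bdy T (Suc p) \<in> chains (mdl T p) (mdt T (Suc p))"
    and D_0: "bdy T 0 = 0"
    and DD: "bd1 T p (bdy T (Suc (Suc p))) = 0"
    and rel_chain: "(m, r) \<in> rels T p \<Longrightarrow> r \<in> chains (mdl T p) (mdt T m)"
    and rel_0: "rels T 0 = {}"
    and rel_D: "(m, r) \<in> rels T (Suc p) \<Longrightarrow> bd1 T p r \<in> rspan T p (mdt T m)"
begin

lemma rspan_chains: "x \<in> rspan T p X \<Longrightarrow> x \<in> chains (mdl T p) X"
  by (rule relspan_chains[OF rel_chain])

lemma rspan_push: "x \<in> rspan T p X \<Longrightarrow> continuous_map X Y f \<Longrightarrow> push (mdl T p) f x \<in> rspan T p Y"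
  by (rule push_relspan[OF rel_chain])

lemma bd1_chain: "x \<in> chains (mdl T (Suc p)) X \<Longrightarrow> bd1 T p x \<in> chains (mdl T p) X"
  by (rule act_chain[OF D_chain])

lemma bd1_push: "bd1 T p (push (mdl T (Suc p)) f x) = push (mdl T p) f (bd1 T p x)"
  by (rule act_push[OF D_chain])

lemma bd1_bd1: "bd1 T p (bd1 T (Suc p) x) = 0"
  by (simp add: act_act[OF D_chain] DD act_0)

lemma act_rspan:
  assumes "U \<in> rspan T n (mtop S)" "x \<in> chains S X"
  shows "act (mdl T n) U x \<in> rspan T n X"
  by (rule chains_lin_mem[OF assms(2) zlin_act subgrp_relspan])
     (simp add: act_of rspan_push[OF assms(1)] cells_continuous)

lemma bd1_rspan:
  assumes "x \<in> rspan T (Suc p) X" shows "bd1 T p x \<in> rspan T p X"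
  by (rule zlin_relspan[OF zlin_act subgrp_relspan assms])
     (simp add: bd1_push rspan_push[OF rel_D] cells_continuous)

end

text \<open>\<open>cone_bd\<close> is stated modulo relations because the cubical cone has a
  constant face at the apex, a degenerate cube in positive dimension. In degree 0 constants are not
  degenerate; they survive in \<open>cone_bd0\<close>, where they act as the augmentation.\<close>

locale acyclic_theory = cell_theory +
  assumes model_star: "star_at (base T m) (mdl T m)"
    and rel_aff: "(m, r) \<in> rels T p \<Longrightarrow> c \<in> Poly_Mapping.keys r \<Longrightarrow>
      bpaff (base T p) (mdl T p) (base T m) c"
    and model_0: "mdl T 0 = {base T 0}"
    and aug: "push (mdl T 0) (\<lambda>_. base T 0) (bdy T (Suc 0)) = 0"
    and cone_cell: "star_at v V \<Longrightarrow> c \<in> cells (mdl T p) (mtop V) \<Longrightarrow>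
      cone T v p c \<in> cells (mdl T (Suc p)) (mtop V)"
    and cone_nat: "star_at v V \<Longrightarrow> bpaff v V v' f \<Longrightarrow> c \<in> cells (mdl T p) (mtop V) \<Longrightarrow>
      cone T v' p (restrict (f \<circ> c) (mdl T p)) = restrict (f \<circ> cone T v p c) (mdl T (Suc p))"
    and cone_rel: "star_at v V \<Longrightarrow> (m, r) \<in> rels T p \<Longrightarrow> c \<in> cells (mdl T m) (mtop V) \<Longrightarrow>
      conec T v p (push (mdl T p) c r) \<in> rspan T (Suc p) (mtop V)"
    and cone_bd: "star_at v V \<Longrightarrow> c \<in> cells (mdl T (Suc p)) (mtop V) \<Longrightarrow>
      push (mdl T (Suc p)) (cone T v (Suc p) c) (bdy T (Suc (Suc p)))
        - (frag_of c - conec T v p (push (mdl T p) c (bdy T (Suc p))))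
      \<in> rspan T (Suc p) (mtop V)"
    and cone_bd0: "star_at v V \<Longrightarrow> c \<in> cells (mdl T 0) (mtop V) \<Longrightarrow>
      push (mdl T 0) (cone T v 0 c) (bdy T (Suc 0)) = frag_of c - frag_of (restrict (\<lambda>_. v) (mdl T 0))"
begin

lemma zlin_conec: "zlin (conec T v p)"
  by (simp add: conec_def zlin_frag_extend)

lemma conec_chain:
  assumes "star_at v V" "x \<in> chains (mdl T p) (mtop V)"
  shows "conec T v p x \<in> chains (mdl T (Suc p)) (mtop V)"
  by (rule chains_lin_mem[OF assms(2) zlin_conec subgrp_chains])
     (simp add: conec_def frag_of_chains cone_cell[OF assms(1)])

lemma conec_nat:
  assumes "star_at v V" "bpaff v V v' f" "x \<in> chains (mdl T p) (mtop V)"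
  shows "conec T v' p (push (mdl T p) f x) = push (mdl T (Suc p)) f (conec T v p x)"
  by (rule chains_lin_eq[OF assms(3) zlin_comp[OF zlin_conec zlin_push] zlin_comp[OF zlin_push zlin_conec]])
     (simp add: push_of conec_def cone_nat[OF assms(1,2)])

lemma conec_rspan:
  assumes "star_at v V" "x \<in> rspan T p (mtop V)"
  shows "conec T v p x \<in> rspan T (Suc p) (mtop V)"
  by (rule zlin_relspan[OF zlin_conec subgrp_relspan assms(2)]) (rule cone_rel[OF assms(1)])

lemma conec_bd:
  assumes "star_at v V" "x \<in> chains (mdl T (Suc p)) (mtop V)"
  shows "bd1 T (Suc p) (conec T v (Suc p) x) - (x - conec T v p (bd1 T p x)) \<in> rspan T (Suc p) (mtop V)"
proof (rule chains_lin_mem[OF assms(2) _ subgrp_relspan])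
  show "zlin (\<lambda>x. bd1 T (Suc p) (conec T v (Suc p) x) - (x - conec T v p (bd1 T p x)))"
    by (intro zlin_minus_fun zlin_comp[OF zlin_act zlin_conec] zlin_id zlin_comp[OF zlin_conec zlin_act])
qed (use cone_bd[OF assms(1)] in \<open>simp add: conec_def act_of\<close>)

lemma conec_bd0:
  assumes "star_at v V" "x \<in> chains (mdl T 0) (mtop V)"
  shows "bd1 T 0 (conec T v 0 x) = x - push (mdl T 0) (\<lambda>_. v) x"
proof (rule chains_lin_eq[OF assms(2)])
  show "zlin (\<lambda>x. bd1 T 0 (conec T v 0 x))" by (rule zlin_comp[OF zlin_act zlin_conec])
  show "zlin (\<lambda>x. x - push (mdl T 0) (\<lambda>_. v) x)" by (rule zlin_minus_fun[OF zlin_id zlin_push])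
qed (simp add: conec_def act_of push_of cone_bd0[OF assms(1)] o_def)

lemma aug_const: "push (mdl T 0) (\<lambda>_. w) (bdy T (Suc 0)) = 0"
proof -
  have "push (mdl T 0) (\<lambda>_. w) (bdy T (Suc 0)) =
      push (mdl T 0) (\<lambda>_. w) (push (mdl T 0) (\<lambda>_. base T 0) (bdy T (Suc 0)))"
    by (simp add: push_push o_def)
  then show ?thesis by (simp add: aug zlin_0[OF zlin_push])
qed

end

text \<open>The universal elements of a natural transformation that is a chain map modulo relations.\<close>

definition chain_datum :: "cell_data \<Rightarrow> cell_data \<Rightarrow> (nat \<Rightarrow> vec chain) \<Rightarrow> bool" where
  "chain_datum A B e \<longleftrightarrow>
     (\<forall>n. e n \<in> chains (mdl B n) (mdt A n)) \<and>
     (\<forall>n m r. (m, r) \<in> rels A n \<longrightarrow> act (mdl B n) (e n) r \<in> rspan B n (mdt A m)) \<and>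
     (\<forall>n. bd1 B n (e (Suc n)) - act (mdl B n) (e n) (bdy A (Suc n)) \<in> rspan B n (mdt A (Suc n))) \<and>
     e 0 = frag_of (restrict (\<lambda>_. base A 0) (mdl B 0))"

text \<open>Operators commute with push-forward and every relation in \<open>X\<close> is spanned by
  push-forwards of universal ones, so the test on models suffices.\<close>

lemma act_gen_rspan:
  assumes "cell_theory A" "cell_theory B" "E \<in> chains (mdl B k) (mdt A n)"
    "\<And>m r. (m, r) \<in> rels A n \<Longrightarrow> act (mdl B k) E r \<in> rspan B k (mdt A m)"
    "x \<in> rspan A n X"
  shows "act (mdl B k) E x \<in> rspan B k X"
proof -
  interpret B: cell_theory B by fact
  show ?thesis
    by (rule zlin_relspan[OF zlin_act subgrp_relspan assms(5)])
       (simp add: act_push[OF assms(3)] B.rspan_push[OF assms(4)] cells_continuous)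
qed

locale theory_map = A: cell_theory A + B: cell_theory B for A B +
  fixes e :: "nat \<Rightarrow> vec chain"
  assumes datum: "chain_datum A B e"
begin

lemma e_chain: "e n \<in> chains (mdl B n) (mdt A n)"
  using datum by (simp add: chain_datum_def)

lemma e_0: "e 0 = frag_of (restrict (\<lambda>_. base A 0) (mdl B 0))"
  using datum by (simp add: chain_datum_def)

lemma map_chain: "x \<in> chains (mdl A n) X \<Longrightarrow> act (mdl B n) (e n) x \<in> chains (mdl B n) X"
  by (rule act_chain[OF e_chain])

lemma map_rspan: "x \<in> rspan A n X \<Longrightarrow> act (mdl B n) (e n) x \<in> rspan B n X"
  by (rule act_gen_rspan[OF A.cell_theory_axioms B.cell_theory_axioms e_chain])
     (use datum in \<open>auto simp: chain_datum_def\<close>)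

lemma map_bd:
  assumes "x \<in> chains (mdl A (Suc n)) X"
  shows "bd1 B n (act (mdl B (Suc n)) (e (Suc n)) x) - act (mdl B n) (e n) (bd1 A n x) \<in> rspan B n X"
proof -
  have "act (mdl B n) (bd1 B n (e (Suc n)) - act (mdl B n) (e n) (bdy A (Suc n))) x \<in> rspan B n X"
    using datum by (intro B.act_rspan[OF _ assms]) (simp add: chain_datum_def)
  then show ?thesis
    by (simp add: zlin_diff[OF zlin_act1] act_act[OF B.D_chain] act_act[OF e_chain])
qed

end

lemma datum_id:
  assumes "acyclic_theory A" shows "chain_datum A A (\<lambda>n. idc (mdl A n))"
proof -
  interpret acyclic_theory A by fact
  show ?thesis
    unfolding chain_datum_def
  proof (intro conjI allI impI)
    fix n m r assume r: "(m, r) \<in> rels A n"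
    have "push (mdl A n) (restrict (\<lambda>t. t) (mdl A m)) r = r"
      by (rule push_id[OF rel_chain[OF r]]) simp
    then show "act (mdl A n) (idc (mdl A n)) r \<in> rspan A n (mdt A m)"
      using relspan_gen[where K="mdl A" and rel="rels A", OF r id_cell] by (simp add: act_idc[OF rel_chain[OF r]])
  next
    fix n
    show "bd1 A n (idc (mdl A (Suc n))) - act (mdl A n) (idc (mdl A n)) (bdy A (Suc n)) \<in> rspan A n (mdt A (Suc n))"
      by (simp add: act_idc[OF D_chain] act_idc2[OF D_chain] subgrp_0[OF subgrp_relspan])
  next
    have "restrict (\<lambda>t. t) (mdl A 0) = restrict (\<lambda>_. base A 0) (mdl A 0)"
      by (simp add: model_0 fun_eq_iff)
    then show "idc (mdl A 0) = frag_of (restrict (\<lambda>_. base A 0) (mdl A 0))" by (simp add: idc_def)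
  qed (simp add: idc_chain)
qed

lemma datum_comp:
  assumes "cell_theory A" "acyclic_theory B" "cell_theory C" "chain_datum A B e" "chain_datum B C f"
  shows "chain_datum A C (\<lambda>n. act (mdl C n) (f n) (e n))"
proof -
  interpret A: cell_theory A by fact
  interpret B: acyclic_theory B by fact
  interpret C: cell_theory C by fact
  interpret e: theory_map A B e by standard fact
  interpret f: theory_map B C f by standard fact
  show ?thesis
    unfolding chain_datum_def
  proof (intro conjI allI impI)
    fix n m r assume r: "(m, r) \<in> rels A n"
    have "act (mdl B n) (e n) r \<in> rspan B n (mdt A m)"
      using e.datum r by (simp add: chain_datum_def)
    then show "act (mdl C n) (act (mdl C n) (f n) (e n)) r \<in> rspan C n (mdt A m)"
      by (simp add: f.map_rspan flip: act_act[OF f.e_chain])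
  next
    fix n
    have 1: "bd1 C n (act (mdl C (Suc n)) (f (Suc n)) (e (Suc n))) - act (mdl C n) (f n) (bd1 B n (e (Suc n)))
        \<in> rspan C n (mdt A (Suc n))"
      by (rule f.map_bd[OF e.e_chain])
    have 2: "act (mdl C n) (f n) (bd1 B n (e (Suc n)) - act (mdl B n) (e n) (bdy A (Suc n))) \<in> rspan C n (mdt A (Suc n))"
      using e.datum by (intro f.map_rspan) (simp add: chain_datum_def)
    show "bd1 C n (act (mdl C (Suc n)) (f (Suc n)) (e (Suc n)))
        - act (mdl C n) (act (mdl C n) (f n) (e n)) (bdy A (Suc n)) \<in> rspan C n (mdt A (Suc n))"
      using subgrp_add[OF subgrp_relspan 1 2]
      by (simp add: zlin_diff[OF zlin_act] flip: act_act[OF f.e_chain])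
  next
    have "restrict (restrict (\<lambda>_. base A 0) (mdl B 0) \<circ> restrict (\<lambda>_. base B 0) (mdl C 0)) (mdl C 0)
        = restrict (\<lambda>_. base A 0) (mdl C 0)"
      by (auto simp: B.model_0)
    then show "act (mdl C 0) (f 0) (e 0) = frag_of (restrict (\<lambda>_. base A 0) (mdl C 0))"
      by (simp add: e.e_0 f.e_0 act_of push_of)
  qed (rule f.map_chain[OF e.e_chain])
qed

text \<open>The construction of acyclic models: on each model, the value already found on its
  boundary is filled by the cone from the base point.\<close>

primrec lift_map :: "cell_data \<Rightarrow> cell_data \<Rightarrow> nat \<Rightarrow> vec chain" where
  "lift_map A B 0 = frag_of (restrict (\<lambda>_. base A 0) (mdl B 0))"
| "lift_map A B (Suc n) = conec B (base A (Suc n)) n (act (mdl B n) (lift_map A B n) (bdy A (Suc n)))"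

text \<open>
  The maps between models that define the relations are affine and preserve base points, hence
  commute with cones; so a map defined by cones preserves relations.
\<close>

lemma act_conec_rel:
  assumes "acyclic_theory A" "acyclic_theory B" "(m, r) \<in> rels A (Suc n)"
    and z: "z \<in> chains (mdl B k) (mdt A (Suc n))"
    and zr: "act (mdl B k) z r \<in> rspan B k (mdt A m)"
  shows "act (mdl B (Suc k)) (conec B (base A (Suc n)) k z) r \<in> rspan B (Suc k) (mdt A m)"
proof -
  interpret A: acyclic_theory A by fact
  interpret B: acyclic_theory B by fact
  have "act (mdl B (Suc k)) (conec B (base A (Suc n)) k z) r = conec B (base A m) k (act (mdl B k) z r)"
    unfolding act_def zlin_frag_extend_comp[OF B.zlin_conec]
    by (rule frag_extend_eq) (simp add: B.conec_nat[OF A.model_star A.rel_aff[OF assms(3)] z])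
  then show ?thesis using B.conec_rspan[OF A.model_star zr] by simp
qed

lemma lift_map_datum:
  assumes "acyclic_theory A" "acyclic_theory B"
  shows "chain_datum A B (lift_map A B)"
proof -
  interpret A: acyclic_theory A by fact
  interpret B: acyclic_theory B by fact
  let ?e = "lift_map A B"
  have const: "restrict (\<lambda>_. base A 0) (mdl B 0) \<in> cells (mdl B 0) (mdt A 0)"
    using continuous_map_eq[of "mtop (mdl B 0)" "mdt A 0" "\<lambda>_. base A 0" "restrict (\<lambda>_. base A 0) (mdl B 0)"]
    by (auto simp: cells_def A.model_0)
  have chain: "?e n \<in> chains (mdl B n) (mdt A n)" for n
  proof (induction n)
    case (Suc n)
    show ?case by (simp, intro B.conec_chain[OF A.model_star] act_chain[OF Suc] A.D_chain)
  qed (simp add: frag_of_chains const)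
  have rel: "\<forall>m r. (m, r) \<in> rels A n \<longrightarrow> act (mdl B n) (?e n) r \<in> rspan B n (mdt A m)" for n
  proof (induction n)
    case (Suc n)
    show ?case
    proof (intro allI impI)
      fix m r assume r: "(m, r) \<in> rels A (Suc n)"
      \<comment> \<open>\<open>act_conec_rel\<close> moves the cone past \<open>r\<close>. What is
        left under the cone is \<open>?e n\<close> applied to the boundary of \<open>r\<close>, a
        combination of relations one degree lower.\<close>
      have "act (mdl B n) (?e n) (bd1 A n r) \<in> rspan B n (mdt A m)"
        by (rule act_gen_rspan[OF A.cell_theory_axioms B.cell_theory_axioms chain _ A.rel_D[OF r]])
           (use Suc in blast)
      then show "act (mdl B (Suc n)) (?e (Suc n)) r \<in> rspan B (Suc n) (mdt A m)"
        by (simp, intro act_conec_rel[OF assms r] act_chain[OF chain] A.D_chain)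
           (simp add: act_act[OF chain])
    qed
  qed (simp add: A.rel_0)
  have bd: "bd1 B n (?e (Suc n)) - act (mdl B n) (?e n) (bdy A (Suc n)) \<in> rspan B n (mdt A (Suc n))" for n
  proof (induction n)
    case 0
    let ?z = "act (mdl B 0) (?e 0) (bdy A (Suc 0))"
    have z: "?z \<in> chains (mdl B 0) (mdt A (Suc 0))"
      by (rule act_chain[OF chain A.D_chain])
    \<comment> \<open>The boundary of the cone over a 0-chain differs from the chain by its
      augmentation times a point. The augmentation of \<open>?z\<close> is zero since that of the
      boundary of the 1-dimensional model is.\<close>
    have "push (mdl B 0) (\<lambda>_. w) ?z = 0" for w
      by (simp only: act_push[OF chain, symmetric] A.aug_const zlin_0[OF zlin_act])
    then have "bd1 B 0 (?e (Suc 0)) - ?z = 0"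
      by (simp only: lift_map.simps(2) B.conec_bd0[OF A.model_star z]) simp
    then show ?case
      by (simp only: subgrp_0[OF subgrp_relspan])
  next
    case (Suc n)
    let ?z = "act (mdl B (Suc n)) (?e (Suc n)) (bdy A (Suc (Suc n)))"
    have z: "?z \<in> chains (mdl B (Suc n)) (mdt A (Suc (Suc n)))"
      by (rule act_chain[OF chain A.D_chain])
    \<comment> \<open>Applying the induction hypothesis to a boundary: the second term disappears by
      \<open>A.DD\<close>, and \<open>?z\<close> turns out to be a cycle modulo relations. The cone
      over its boundary is then a relation as well.\<close>
    have "act (mdl B n) (bd1 B n (?e (Suc n)) - act (mdl B n) (?e n) (bdy A (Suc n))) (bdy A (Suc (Suc n)))
        \<in> rspan B n (mdt A (Suc (Suc n)))"
      by (rule B.act_rspan[OF Suc A.D_chain])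
    then have dz: "bd1 B n ?z \<in> rspan B n (mdt A (Suc (Suc n)))"
      by (simp only: zlin_diff[OF zlin_act1] A.DD zlin_0[OF zlin_act] diff_zero
            flip: act_act[OF B.D_chain] act_act[OF chain])
    have "bd1 B (Suc n) (conec B (base A (Suc (Suc n))) (Suc n) ?z) - ?z
        = (bd1 B (Suc n) (conec B (base A (Suc (Suc n))) (Suc n) ?z)
            - (?z - conec B (base A (Suc (Suc n))) n (bd1 B n ?z))) - conec B (base A (Suc (Suc n))) n (bd1 B n ?z)"
      by simp
    then show ?case
      using subgrp_diff[OF subgrp_relspan B.conec_bd[OF A.model_star z] B.conec_rspan[OF A.model_star dz]]
      by (simp only: lift_map.simps)
  qed
  show ?thesis
    unfolding chain_datum_def using chain rel bd by auto
qed

text \<open>Chain data are normalized to coincide in degree 0, so the homotopy starts with 0. In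
  each further degree the defect of the homotopy identity is filled by a cone.\<close>

primrec lift_htpy :: "cell_data \<Rightarrow> cell_data \<Rightarrow> (nat \<Rightarrow> vec chain) \<Rightarrow> (nat \<Rightarrow> vec chain) \<Rightarrow> nat \<Rightarrow> vec chain" where
  "lift_htpy A B e f 0 = 0"
| "lift_htpy A B e f (Suc n) = conec B (base A (Suc n)) (Suc n)
     (e (Suc n) - f (Suc n) - act (mdl B (Suc n)) (lift_htpy A B e f n) (bdy A (Suc n)))"

lemma lift_htpy:
  assumes "acyclic_theory A" "acyclic_theory B" "chain_datum A B e" "chain_datum A B f"
  defines "h \<equiv> lift_htpy A B e f"
  shows lift_htpy_chain: "h n \<in> chains (mdl B (Suc n)) (mdt A n)"
    and lift_htpy_rel: "(m, r) \<in> rels A n \<Longrightarrow> act (mdl B (Suc n)) (h n) r \<in> rspan B (Suc n) (mdt A m)"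
    and lift_htpy_bd: "bd1 B (Suc n) (h (Suc n)) + act (mdl B (Suc n)) (h n) (bdy A (Suc n))
       - (e (Suc n) - f (Suc n)) \<in> rspan B (Suc n) (mdt A (Suc n))"
proof -
  interpret A: acyclic_theory A by fact
  interpret B: acyclic_theory B by fact
  interpret e: theory_map A B e by standard fact
  interpret f: theory_map A B f by standard fact
  define z where "z n = e (Suc n) - f (Suc n) - act (mdl B (Suc n)) (h n) (bdy A (Suc n))" for n
  have hS: "h (Suc n) = conec B (base A (Suc n)) (Suc n) (z n)" for n
    by (simp add: h_def z_def)
  have h0: "h 0 = 0" by (simp add: h_def)
  have z_chain: "z n \<in> chains (mdl B (Suc n)) (mdt A (Suc n))"
    if "h n \<in> chains (mdl B (Suc n)) (mdt A n)" for n
    unfolding z_def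
    by (intro subgrp_diff[OF subgrp_chains] e.e_chain f.e_chain act_chain[OF that] A.D_chain)
  have chain: "h n \<in> chains (mdl B (Suc n)) (mdt A n)" for n
  proof (induction n)
    case (Suc n) then show ?case
      unfolding hS by (intro B.conec_chain[OF A.model_star] z_chain)
  qed (simp add: h0 subgrp_0[OF subgrp_chains])
  have rel: "\<forall>m r. (m, r) \<in> rels A n \<longrightarrow> act (mdl B (Suc n)) (h n) r \<in> rspan B (Suc n) (mdt A m)" for n
  proof (induction n)
    case (Suc n)
    show ?case
    proof (intro allI impI)
      fix m r assume r: "(m, r) \<in> rels A (Suc n)"
      have "act (mdl B (Suc n)) (h n) (bd1 A n r) \<in> rspan B (Suc n) (mdt A m)"
        by (rule act_gen_rspan[OF A.cell_theory_axioms B.cell_theory_axioms chain _ A.rel_D[OF r]])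
           (use Suc in blast)
      then have "act (mdl B (Suc n)) (z n) r \<in> rspan B (Suc n) (mdt A m)"
        unfolding z_def zlin_diff[OF zlin_act1] act_act[OF chain, symmetric]
        by (intro subgrp_diff[OF subgrp_relspan])
           (use r e.datum f.datum in \<open>auto simp: chain_datum_def\<close>)
      then show "act (mdl B (Suc (Suc n))) (h (Suc n)) r \<in> rspan B (Suc (Suc n)) (mdt A m)"
        unfolding hS by (intro act_conec_rel[OF assms(1,2) r] z_chain chain)
    qed
  qed (simp add: A.rel_0)
  \<comment> \<open>The difference of two chain maps modulo relations is again one.\<close>
  have ef: "bd1 B n (e (Suc n)) - bd1 B n (f (Suc n)) - act (mdl B n) (e n - f n) (bdy A (Suc n))
      \<in> rspan B n (mdt A (Suc n))" for n
    using subgrp_diff[OF subgrp_relspan, of "bd1 B n (e (Suc n)) - act (mdl B n) (e n) (bdy A (Suc n))"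
      "mdl B" "rels B" n "mdt A (Suc n)" "bd1 B n (f (Suc n)) - act (mdl B n) (f n) (bdy A (Suc n))"]
      e.datum f.datum
    by (simp add: chain_datum_def zlin_diff[OF zlin_act1] algebra_simps)
  have dz_bd: "bd1 B (Suc n) (h (Suc n)) + act (mdl B (Suc n)) (h n) (bdy A (Suc n))
       - (e (Suc n) - f (Suc n)) \<in> rspan B (Suc n) (mdt A (Suc n))"
    if dz: "bd1 B n (z n) \<in> rspan B n (mdt A (Suc n))" for n
  proof -
    have "bd1 B (Suc n) (h (Suc n)) + act (mdl B (Suc n)) (h n) (bdy A (Suc n)) - (e (Suc n) - f (Suc n))
        = (bd1 B (Suc n) (h (Suc n)) - (z n - conec B (base A (Suc n)) n (bd1 B n (z n))))
          - conec B (base A (Suc n)) n (bd1 B n (z n))"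
      by (simp add: z_def)
    then show ?thesis
      using subgrp_diff[OF subgrp_relspan B.conec_bd[OF A.model_star z_chain[OF chain]]
          B.conec_rspan[OF A.model_star dz]]
      by (simp only: hS)
  qed
  \<comment> \<open>The defect has to be a cycle modulo relations before it can be filled. This
    needs the homotopy identity one degree lower, which \<open>dz_bd\<close> derives from the
    previous case of the induction.\<close>
  have dz: "bd1 B n (z n) \<in> rspan B n (mdt A (Suc n))" for n
  proof (induction n)
    case 0
    have "e 0 - f 0 = 0" by (simp add: e.e_0 f.e_0)
    then show ?case
      using ef[of 0] by (simp add: z_def h0 act_0 zlin_diff[OF zlin_act])
  next
    case (Suc n)
    let ?D = "bdy A (Suc (Suc n))"
    have "act (mdl B (Suc n)) (bd1 B (Suc n) (h (Suc n)) + act (mdl B (Suc n)) (h n) (bdy A (Suc n))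
       - (e (Suc n) - f (Suc n))) ?D \<in> rspan B (Suc n) (mdt A (Suc (Suc n)))"
      by (rule B.act_rspan[OF dz_bd[OF Suc] A.D_chain])
    then have "bd1 B (Suc n) (act (mdl B (Suc (Suc n))) (h (Suc n)) ?D)
         - act (mdl B (Suc n)) (e (Suc n) - f (Suc n)) ?D \<in> rspan B (Suc n) (mdt A (Suc (Suc n)))"
      by (simp only: zlin_diff[OF zlin_act1, of _ _ _ ?D] zlin_add[OF zlin_act1] A.DD zlin_0[OF zlin_act]
            add_0_right flip: act_act[OF B.D_chain] act_act[OF chain])
    from subgrp_diff[OF subgrp_relspan ef[of "Suc n"] this]
    show ?case by (simp add: z_def zlin_diff[OF zlin_act])
  qed
  note bd = dz_bd[OF dz]
  show "h n \<in> chains (mdl B (Suc n)) (mdt A n)" by (rule chain)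
  show "(m, r) \<in> rels A n \<Longrightarrow> act (mdl B (Suc n)) (h n) r \<in> rspan B (Suc n) (mdt A m)"
    using rel by blast
  show "bd1 B (Suc n) (h (Suc n)) + act (mdl B (Suc n)) (h n) (bdy A (Suc n))
       - (e (Suc n) - f (Suc n)) \<in> rspan B (Suc n) (mdt A (Suc n))"
    by (rule bd)
qed

section \<open>Complexes presented by free chains and relations\<close>

lemma (in comm_group) r_coset_eq_iff:
  assumes "subgroup N G" "x \<in> carrier G" "y \<in> carrier G"
  shows "N #> x = N #> y \<longleftrightarrow> x \<otimes> inv y \<in> N"
proof -
  have "N #> x = N #> y \<longleftrightarrow> x \<in> N #> y"
    using assms repr_independence[of x N y] rcos_self[of x N] by auto
  also have "\<dots> \<longleftrightarrow> x \<otimes> inv y \<in> N"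
    by (rule subgroup.rcos_module[OF assms(1) is_group assms(3,2)])
  finally show ?thesis .
qed

lemma (in comm_group) r_coset_mult:
  assumes "subgroup N G" "x \<in> carrier G" "y \<in> carrier G"
  shows "(N #> x) <#> (N #> y) = N #> (x \<otimes> y)"
  using normal.rcos_sum[OF subgroup_imp_normal[OF assms(1)]] assms by blast

text \<open>\<open>coset_map\<close> unites the cosets of the images of all members of a coset;
  since \<open>f\<close> maps \<open>N\<close> into \<open>K\<close>, these cosets are all the
  same.\<close>

lemma coset_map_coset:
  assumes "comm_group G" "comm_group H" "subgroup N G" "subgroup K H" "f \<in> hom G H" "f ` N \<subseteq> K"
    and a: "a \<in> carrier G"
  shows "coset_map H K f (N #>\<^bsub>G\<^esub> a) = K #>\<^bsub>H\<^esub> f a"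
proof -
  interpret G: comm_group G by fact
  interpret H: comm_group H by fact
  have fa: "f a \<in> carrier H" using assms(5) a by (auto simp: hom_def)
  have "K #>\<^bsub>H\<^esub> f (h \<otimes>\<^bsub>G\<^esub> a) = K #>\<^bsub>H\<^esub> f a" if h: "h \<in> N" for h
  proof -
    have hG: "h \<in> carrier G" using subgroup.mem_carrier[OF assms(3) h] .
    have "f h \<in> K" "f h \<in> carrier H" using assms h hG by (auto simp: hom_def)
    then show ?thesis
      using hom_mult[OF assms(5) hG a] H.coset_mult_assoc[OF subgroup.subset[OF assms(4)], of "f h" "f a"]
        H.coset_join2[OF _ assms(4)] fa by simp
  qed
  moreover have "a \<in> N #>\<^bsub>G\<^esub> a" by (rule G.rcos_self[OF a assms(3)])
  ultimately show ?thesis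
    unfolding coset_map_def r_coset_def by auto
qed

lemma coset_map_iso:
  assumes "comm_group G" "comm_group H" "subgroup N G" "subgroup K H" "f \<in> hom G H" "f ` N \<subseteq> K"
    and inj: "\<And>x. x \<in> carrier G \<Longrightarrow> f x \<in> K \<Longrightarrow> x \<in> N"
    and surj: "\<And>y. y \<in> carrier H \<Longrightarrow> \<exists>x\<in>carrier G. y \<otimes>\<^bsub>H\<^esub> inv\<^bsub>H\<^esub> f x \<in> K"
  shows "coset_map H K f \<in> iso (G Mod N) (H Mod K)"
proof -
  interpret G: comm_group G by fact
  interpret H: comm_group H by fact
  interpret f: group_hom G H f
    by (simp add: group_hom_def group_hom_axioms_def G.is_group H.is_group assms(5))
  note cm = coset_map_coset[OF assms(1-6)]
  have "coset_map H K f \<in> hom (G Mod N) (H Mod K)"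
  proof (rule homI)
    fix c assume "c \<in> carrier (G Mod N)"
    then obtain a where "a \<in> carrier G" "c = N #>\<^bsub>G\<^esub> a" by (auto simp: FactGroup_def RCOSETS_def)
    then show "coset_map H K f c \<in> carrier (H Mod K)"
      by (auto simp: cm FactGroup_def RCOSETS_def)
  next
    fix c d assume "c \<in> carrier (G Mod N)" "d \<in> carrier (G Mod N)"
    then obtain a b where "a \<in> carrier G" "c = N #>\<^bsub>G\<^esub> a" "b \<in> carrier G" "d = N #>\<^bsub>G\<^esub> b"
      by (auto simp: FactGroup_def RCOSETS_def)
    then show "coset_map H K f (c \<otimes>\<^bsub>G Mod N\<^esub> d) = coset_map H K f c \<otimes>\<^bsub>H Mod K\<^esub> coset_map H K f d"
      by (simp add: FactGroup_def G.r_coset_mult assms(3) cm H.r_coset_mult[OF assms(4)])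
  qed
  moreover have "inj_on (coset_map H K f) (carrier (G Mod N))"
  proof (rule inj_onI)
    fix c d assume "c \<in> carrier (G Mod N)" "d \<in> carrier (G Mod N)"
      and eq: "coset_map H K f c = coset_map H K f d"
    then obtain a b where ab: "a \<in> carrier G" "c = N #>\<^bsub>G\<^esub> a" "b \<in> carrier G" "d = N #>\<^bsub>G\<^esub> b"
      by (auto simp: FactGroup_def RCOSETS_def)
    then have "f a \<otimes>\<^bsub>H\<^esub> inv\<^bsub>H\<^esub> f b \<in> K"
      using eq by (simp add: cm H.r_coset_eq_iff[OF assms(4)])
    then have "f (a \<otimes>\<^bsub>G\<^esub> inv\<^bsub>G\<^esub> b) \<in> K" using ab by simp
    then have "a \<otimes>\<^bsub>G\<^esub> inv\<^bsub>G\<^esub> b \<in> N" using ab by (intro inj) auto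
    then show "c = d" using ab by (simp add: G.r_coset_eq_iff[OF assms(3)])
  qed
  moreover have "carrier (H Mod K) \<subseteq> coset_map H K f ` carrier (G Mod N)"
  proof
    fix d assume "d \<in> carrier (H Mod K)"
    then obtain y where y: "y \<in> carrier H" "d = K #>\<^bsub>H\<^esub> y" by (auto simp: FactGroup_def RCOSETS_def)
    then obtain x where x: "x \<in> carrier G" "y \<otimes>\<^bsub>H\<^esub> inv\<^bsub>H\<^esub> f x \<in> K" using surj by blast
    then have "d = coset_map H K f (N #>\<^bsub>G\<^esub> x)"
      using y by (simp add: cm H.r_coset_eq_iff[OF assms(4)])
    then show "d \<in> coset_map H K f ` carrier (G Mod N)"
      using x(1) by (auto simp: FactGroup_def RCOSETS_def)
  qed
  ultimately show ?thesis
    by (auto simp: iso_def bij_betw_def hom_def Pi_def)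
qed

lemma quasi_isoI:
  assumes A: "bounded_below_cx A" and B: "bounded_below_cx B" and f: "f \<in> cx_hom A B"
    and inj: "\<And>n x. x \<in> carrier (grp A n) \<Longrightarrow> bd A n x = \<one>\<^bsub>grp A (n - 1)\<^esub> \<Longrightarrow>
      f n x \<in> boundaries B n \<Longrightarrow> x \<in> boundaries A n"
    and surj: "\<And>n y. y \<in> carrier (grp B n) \<Longrightarrow> bd B n y = \<one>\<^bsub>grp B (n - 1)\<^esub> \<Longrightarrow>
      \<exists>x\<in>carrier (grp A n). bd A n x = \<one>\<^bsub>grp A (n - 1)\<^esub> \<and>
        y \<otimes>\<^bsub>grp B n\<^esub> inv\<^bsub>grp B n\<^esub> f n x \<in> boundaries B n"
  shows "quasi_iso A B f"
proof -
  have cycles: "subgroup (kernel (grp C n) (grp C (n - 1)) (bd C n)) (grp C n)"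
    "subgroup (boundaries C n) ((grp C n)\<lparr>carrier := kernel (grp C n) (grp C (n - 1)) (bd C n)\<rparr>)"
    "comm_group (grp C n)" "comm_group ((grp C n)\<lparr>carrier := kernel (grp C n) (grp C (n - 1)) (bd C n)\<rparr>)"
    if C: "bounded_below_cx C" for C :: "'c chain_cx" and n
  proof -
    have G: "comm_group (grp C m)" for m using C by (simp add: bounded_below_cx_def)
    have gh: "group_hom (grp C m) (grp C (m - 1)) (bd C m)" for m
      using C G by (simp add: bounded_below_cx_def group_hom_def group_hom_axioms_def comm_group.axioms)
    show ker: "subgroup (kernel (grp C n) (grp C (n - 1)) (bd C n)) (grp C n)"
      by (rule group_hom.subgroup_kernel[OF gh])
    have im: "subgroup (boundaries C n) (grp C n)"
      unfolding boundaries_def using group_hom.img_is_subgroup[OF gh[of "n + 1"]] by simp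
    have "boundaries C n \<subseteq> kernel (grp C n) (grp C (n - 1)) (bd C n)"
    proof -
      have "bd C n (bd C (n + 1) x) = \<one>\<^bsub>grp C (n - 1)\<^esub>" if "x \<in> carrier (grp C (n + 1))" for x
      proof -
        have "\<forall>m. \<forall>x\<in>carrier (grp C m). bd C (m - 1) (bd C m x) = \<one>\<^bsub>grp C (m - 2)\<^esub>"
          using C by (simp add: bounded_below_cx_def)
        from this[rule_format, of x "n + 1"] that show ?thesis by simp
      qed
      then show ?thesis
        using subgroup.subset[OF im] by (auto simp: kernel_def boundaries_def)
    qed
    then show "subgroup (boundaries C n) ((grp C n)\<lparr>carrier := kernel (grp C n) (grp C (n - 1)) (bd C n)\<rparr>)"
      by (rule group.subgroup_incl[OF comm_group.axioms(2)[OF G] im ker])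
    show "comm_group ((grp C n)\<lparr>carrier := kernel (grp C n) (grp C (n - 1)) (bd C n)\<rparr>)"
    proof (rule group.group_comm_groupI[OF subgroup.subgroup_is_group[OF ker comm_group.axioms(2)[OF G]]])
      fix x y
      assume "x \<in> carrier ((grp C n)\<lparr>carrier := kernel (grp C n) (grp C (n - 1)) (bd C n)\<rparr>)"
        "y \<in> carrier ((grp C n)\<lparr>carrier := kernel (grp C n) (grp C (n - 1)) (bd C n)\<rparr>)"
      then have "x \<in> carrier (grp C n)" "y \<in> carrier (grp C n)" by (simp_all add: kernel_def)
      from comm_monoid.m_comm[OF comm_group.axioms(1)[OF G] this]
      show "x \<otimes>\<^bsub>(grp C n)\<lparr>carrier := kernel (grp C n) (grp C (n - 1)) (bd C n)\<rparr>\<^esub> y =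
        y \<otimes>\<^bsub>(grp C n)\<lparr>carrier := kernel (grp C n) (grp C (n - 1)) (bd C n)\<rparr>\<^esub> x" by simp
    qed
  qed (use C in \<open>simp add: bounded_below_cx_def\<close>)
  have "coset_map (grp B n) (boundaries B n) (f n) \<in> iso (cx_homology A n) (cx_homology B n)" for n
  proof -
    let ?ZA = "(grp A n)\<lparr>carrier := kernel (grp A n) (grp A (n - 1)) (bd A n)\<rparr>"
    let ?ZB = "(grp B n)\<lparr>carrier := kernel (grp B n) (grp B (n - 1)) (bd B n)\<rparr>"
    have fh: "f m \<in> hom (grp A m) (grp B m)" and fb: "x \<in> carrier (grp A m) \<Longrightarrow> bd B m (f m x) = f (m - 1) (bd A m x)" for m x
      using f by (auto simp: cx_hom_def)
    have f1: "f m \<one>\<^bsub>grp A m\<^esub> = \<one>\<^bsub>grp B m\<^esub>" for m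
      by (rule hom_one[OF fh comm_group.axioms(2)[OF cycles(3)[OF A]] comm_group.axioms(2)[OF cycles(3)[OF B]]])
    have fZ: "f n \<in> hom ?ZA ?ZB"
      using fh[of n] f1[of "n - 1"] fb[of _ n] by (auto simp: hom_def kernel_def)
    have fB: "f n ` boundaries A n \<subseteq> boundaries B n"
    proof -
      have "f n (bd A (n + 1) x) = bd B (n + 1) (f (n + 1) x)" if "x \<in> carrier (grp A (n + 1))" for x
        using fb[OF that] by simp
      then show ?thesis using fh[of "n + 1"] by (auto simp: boundaries_def hom_def)
    qed
    have inv: "inv\<^bsub>?ZB\<^esub> y = inv\<^bsub>grp B n\<^esub> y" if "y \<in> kernel (grp B n) (grp B (n - 1)) (bd B n)" for y
      using group.m_inv_consistent[OF comm_group.axioms(2)[OF cycles(3)[OF B]] cycles(1)[OF B] that] .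
    have "coset_map ?ZB (boundaries B n) (f n) \<in> iso (?ZA Mod boundaries A n) (?ZB Mod boundaries B n)"
    proof (rule coset_map_iso[OF cycles(4)[OF A] cycles(4)[OF B] cycles(2)[OF A] cycles(2)[OF B] fZ fB])
      show "x \<in> boundaries A n" if "x \<in> carrier ?ZA" "f n x \<in> boundaries B n" for x
        using inj that by (auto simp: kernel_def)
    next
      fix y assume y: "y \<in> carrier ?ZB"
      have "y \<in> carrier (grp B n)" "bd B n y = \<one>\<^bsub>grp B (n - 1)\<^esub>" using y by (simp_all add: kernel_def)
      from surj[OF this] obtain x where x: "x \<in> carrier (grp A n)" "bd A n x = \<one>\<^bsub>grp A (n - 1)\<^esub>"
        "y \<otimes>\<^bsub>grp B n\<^esub> inv\<^bsub>grp B n\<^esub> f n x \<in> boundaries B n"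
        by blast
      have xZ: "x \<in> carrier ?ZA" using x by (simp add: kernel_def)
      have "f n x \<in> kernel (grp B n) (grp B (n - 1)) (bd B n)"
        using hom_in_carrier[OF fZ xZ] by simp
      then have "y \<otimes>\<^bsub>?ZB\<^esub> inv\<^bsub>?ZB\<^esub> f n x \<in> boundaries B n"
        using x(3) by (simp add: inv)
      with xZ show "\<exists>x\<in>carrier ?ZA. y \<otimes>\<^bsub>?ZB\<^esub> inv\<^bsub>?ZB\<^esub> f n x \<in> boundaries B n"
        by blast
    qed
    \<comment> \<open>Passing to the subgroup of cycles changes the carrier but not the
      multiplication, so cosets formed in either group agree.\<close>
    moreover have "coset_map ?ZB (boundaries B n) (f n) = coset_map (grp B n) (boundaries B n) (f n)"
      by (simp add: coset_map_def r_coset_def fun_eq_iff)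
    ultimately show ?thesis by (simp add: cx_homology_def)
  qed
  with f show ?thesis by (simp add: quasi_iso_def)
qed

text \<open>
  \<open>C\<close> is the complex of the groups \<open>Ch n\<close> modulo \<open>Rl n\<close>, where \<open>cls n x\<close> is the class of \<open>x\<close>
  and \<open>b\<close> induces the differential.
\<close>

definition presents ::
  "(int \<Rightarrow> 'c::ab_group_add set) \<Rightarrow> (int \<Rightarrow> 'c set) \<Rightarrow> (int \<Rightarrow> 'c \<Rightarrow> 'c) \<Rightarrow>
   'a chain_cx \<Rightarrow> (int \<Rightarrow> 'c \<Rightarrow> 'a) \<Rightarrow> bool" where
  "presents Ch Rl b C cls \<longleftrightarrow> (\<forall>n.
     subgrp (Ch n) \<and> subgrp (Rl n) \<and> Rl n \<subseteq> Ch n \<and> zlin (b n) \<and>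
     carrier (grp C n) = cls n ` Ch n \<and> \<one>\<^bsub>grp C n\<^esub> = cls n 0 \<and>
     (\<forall>x\<in>Ch n. \<forall>y\<in>Ch n. cls n (x + y) = cls n x \<otimes>\<^bsub>grp C n\<^esub> cls n y) \<and>
     (\<forall>x\<in>Ch n. \<forall>y\<in>Ch n. cls n x = cls n y \<longleftrightarrow> x - y \<in> Rl n) \<and>
     (\<forall>x\<in>Ch n. b n x \<in> Ch (n - 1) \<and> bd C n (cls n x) = cls (n - 1) (b n x)) \<and>
     (\<forall>x\<in>Rl n. b n x \<in> Rl (n - 1)))"

locale presented =
  fixes Ch Rl b C cls assumes pres: "presents Ch Rl b C cls"
begin

lemma subgrp_Ch: "subgrp (Ch n)" and subgrp_Rl: "subgrp (Rl n)" and Rl_Ch: "x \<in> Rl n \<Longrightarrow> x \<in> Ch n"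
  and zlin_b: "zlin (b n)" and carrier_eq: "carrier (grp C n) = cls n ` Ch n"
  and one_eq: "\<one>\<^bsub>grp C n\<^esub> = cls n 0"
  and cls_add: "x \<in> Ch n \<Longrightarrow> y \<in> Ch n \<Longrightarrow> cls n (x + y) = cls n x \<otimes>\<^bsub>grp C n\<^esub> cls n y"
  and cls_eq: "x \<in> Ch n \<Longrightarrow> y \<in> Ch n \<Longrightarrow> cls n x = cls n y \<longleftrightarrow> x - y \<in> Rl n"
  and b_Ch: "x \<in> Ch n \<Longrightarrow> b n x \<in> Ch (n - 1)"
  and bd_cls: "x \<in> Ch n \<Longrightarrow> bd C n (cls n x) = cls (n - 1) (b n x)"
  and b_Rl: "x \<in> Rl n \<Longrightarrow> b n x \<in> Rl (n - 1)"
  using pres by (auto simp: presents_def)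

lemma cls_carrier: "x \<in> Ch n \<Longrightarrow> cls n x \<in> carrier (grp C n)"
  by (simp add: carrier_eq)

lemma cls_obtain:
  assumes "u \<in> carrier (grp C n)" obtains x where "x \<in> Ch n" "u = cls n x"
  using assms by (auto simp: carrier_eq)

lemma comm_group: "comm_group (grp C n)"
proof (rule comm_groupI)
  fix u assume u: "u \<in> carrier (grp C n)"
  then obtain x where x: "x \<in> Ch n" "u = cls n x" by (rule cls_obtain)
  have "cls n (- x) \<otimes>\<^bsub>grp C n\<^esub> u = \<one>\<^bsub>grp C n\<^esub>"
    using cls_add[of "- x" n x] x subgrp_minus[OF subgrp_Ch] by (simp add: one_eq)
  then show "\<exists>v\<in>carrier (grp C n). v \<otimes>\<^bsub>grp C n\<^esub> u = \<one>\<^bsub>grp C n\<^esub>"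
    using x cls_carrier subgrp_minus[OF subgrp_Ch] by blast
  show "\<one>\<^bsub>grp C n\<^esub> \<otimes>\<^bsub>grp C n\<^esub> u = u"
    using cls_add[of 0 n x] x subgrp_0[OF subgrp_Ch] by (simp add: one_eq)
next
  fix u v assume "u \<in> carrier (grp C n)" "v \<in> carrier (grp C n)"
  then obtain x y where *: "x \<in> Ch n" "u = cls n x" "y \<in> Ch n" "v = cls n y" by (metis cls_obtain)
  then show "u \<otimes>\<^bsub>grp C n\<^esub> v \<in> carrier (grp C n)"
    using cls_carrier[OF subgrp_add[OF subgrp_Ch]] by (simp flip: cls_add)
  show "u \<otimes>\<^bsub>grp C n\<^esub> v = v \<otimes>\<^bsub>grp C n\<^esub> u"
    using * by (simp add: add.commute flip: cls_add)
  fix w assume "w \<in> carrier (grp C n)"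
  then obtain z where "z \<in> Ch n" "w = cls n z" by (rule cls_obtain)
  with * show "u \<otimes>\<^bsub>grp C n\<^esub> v \<otimes>\<^bsub>grp C n\<^esub> w = u \<otimes>\<^bsub>grp C n\<^esub> (v \<otimes>\<^bsub>grp C n\<^esub> w)"
    by (simp add: add.assoc subgrp_add[OF subgrp_Ch] flip: cls_add)
qed (simp add: one_eq cls_carrier subgrp_0[OF subgrp_Ch])

lemma cls_minus: "x \<in> Ch n \<Longrightarrow> cls n (- x) = inv\<^bsub>grp C n\<^esub> cls n x"
  using comm_group.axioms(2)[OF comm_group]
  by (intro group.inv_equality[symmetric])
     (auto simp: cls_carrier subgrp_minus[OF subgrp_Ch] one_eq simp flip: cls_add)

lemma cls_diff: "x \<in> Ch n \<Longrightarrow> y \<in> Ch n \<Longrightarrow> cls n (x - y) = cls n x \<otimes>\<^bsub>grp C n\<^esub> inv\<^bsub>grp C n\<^esub> cls n y"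
  using cls_add[of x n "- y"] by (simp add: cls_minus subgrp_minus[OF subgrp_Ch])

lemma cls_one: "x \<in> Ch n \<Longrightarrow> cls n x = \<one>\<^bsub>grp C n\<^esub> \<longleftrightarrow> x \<in> Rl n"
  using cls_eq[of x n 0] by (simp add: one_eq subgrp_0[OF subgrp_Ch])

lemma bd_hom: "bd C n \<in> hom (grp C n) (grp C (n - 1))"
proof (rule homI)
  fix u v assume "u \<in> carrier (grp C n)" "v \<in> carrier (grp C n)"
  then obtain x y where *: "x \<in> Ch n" "u = cls n x" "y \<in> Ch n" "v = cls n y" by (metis cls_obtain)
  then show "bd C n (u \<otimes>\<^bsub>grp C n\<^esub> v) = bd C n u \<otimes>\<^bsub>grp C (n - 1)\<^esub> bd C n v"
    by (simp add: bd_cls b_Ch zlin_add[OF zlin_b] subgrp_add[OF subgrp_Ch] flip: cls_add)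
qed (auto simp: bd_cls b_Ch cls_carrier elim!: cls_obtain)

lemma bounded_below:
  assumes "\<And>n x. x \<in> Ch n \<Longrightarrow> b (n - 1) (b n x) \<in> Rl (n - 2)" "\<And>n. n < 0 \<Longrightarrow> Ch n = {0}"
  shows "bounded_below_cx C"
  unfolding bounded_below_cx_def
proof (intro conjI allI ballI)
  fix n u assume "u \<in> carrier (grp C n)"
  then obtain x where x: "x \<in> Ch n" "u = cls n x" by (rule cls_obtain)
  have "b (n - 1) (b n x) \<in> Ch (n - 2)" using assms(1)[OF x(1)] Rl_Ch by blast
  then show "bd C (n - 1) (bd C n u) = \<one>\<^bsub>grp C (n - 2)\<^esub>"
    using x assms(1)[OF x(1)] b_Ch[OF b_Ch[OF x(1)]] by (simp add: bd_cls b_Ch cls_one)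
next
  show "\<exists>N. \<forall>n<N. carrier (grp C n) = {\<one>\<^bsub>grp C n\<^esub>}"
    using assms(2) by (intro exI[of _ 0]) (simp add: carrier_eq one_eq)
qed (use comm_group bd_hom in auto)

end

text \<open>The map of representatives \<open>g\<close> commutes with the differentials only modulo
  relations; the induced map \<open>f\<close> of the quotients is then an honest chain map.\<close>

locale presented_map = A: presented Ch Rl b A cls + B: presented Ch' Rl' b' B cls'
  for Ch Rl b A cls Ch' Rl' b' B cls' +
  fixes g f
  assumes zlin_g: "zlin (g n)" and g_Ch: "x \<in> Ch n \<Longrightarrow> g n x \<in> Ch' n"
    and g_bd: "x \<in> Ch n \<Longrightarrow> b' n (g n x) - g (n - 1) (b n x) \<in> Rl' (n - 1)"
    and f_cls: "x \<in> Ch n \<Longrightarrow> f n (cls n x) = cls' n (g n x)"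
    and f_ext: "f n \<in> extensional (carrier (grp A n))"
begin

lemma cx_hom: "f \<in> cx_hom A B"
  unfolding cx_hom_def
proof (intro CollectI allI conjI ballI homI)
  fix n u assume "u \<in> carrier (grp A n)"
  then obtain x where x: "x \<in> Ch n" "u = cls n x" by (rule A.cls_obtain)
  then show "f n u \<in> carrier (grp B n)" by (simp add: f_cls g_Ch B.cls_carrier)
  show "bd B n (f n u) = f (n - 1) (bd A n u)"
    using g_bd[OF x(1)] x by (simp add: f_cls B.bd_cls A.bd_cls g_Ch A.b_Ch B.b_Ch B.cls_eq)
  fix v assume "v \<in> carrier (grp A n)"
  then obtain y where y: "y \<in> Ch n" "v = cls n y" by (rule A.cls_obtain)
  with x show "f n (u \<otimes>\<^bsub>grp A n\<^esub> v) = f n u \<otimes>\<^bsub>grp B n\<^esub> f n v"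
    by (simp add: f_cls zlin_add[OF zlin_g] g_Ch subgrp_add[OF A.subgrp_Ch] flip: A.cls_add B.cls_add)
qed (rule f_ext)

lemma quasi_iso:
  assumes "bounded_below_cx A" "bounded_below_cx B"
    and g': "\<And>n. zlin (g' n)" "\<And>n x. x \<in> Ch' n \<Longrightarrow> g' n x \<in> Ch n" "\<And>n x. x \<in> Rl' n \<Longrightarrow> g' n x \<in> Rl n"
      "\<And>n x. x \<in> Ch' n \<Longrightarrow> b n (g' n x) - g' (n - 1) (b' n x) \<in> Rl (n - 1)"
    and h: "\<And>n x. x \<in> Ch n \<Longrightarrow> h n x \<in> Ch (n + 1)" "\<And>n x. x \<in> Rl n \<Longrightarrow> h n x \<in> Rl (n + 1)"
      "\<And>n x. x \<in> Ch n \<Longrightarrow> b (n + 1) (h n x) + h (n - 1) (b n x) - (g' n (g n x) - x) \<in> Rl n"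
    and h': "\<And>n x. x \<in> Ch' n \<Longrightarrow> h' n x \<in> Ch' (n + 1)" "\<And>n x. x \<in> Rl' n \<Longrightarrow> h' n x \<in> Rl' (n + 1)"
      "\<And>n x. x \<in> Ch' n \<Longrightarrow> b' (n + 1) (h' n x) + h' (n - 1) (b' n x) - (g n (g' n x) - x) \<in> Rl' n"
  shows "quasi_iso A B f"
proof (rule quasi_isoI[OF assms(1,2) cx_hom])
  fix n u assume u: "u \<in> carrier (grp A n)" "bd A n u = \<one>\<^bsub>grp A (n - 1)\<^esub>" "f n u \<in> boundaries B n"
  obtain x where x: "x \<in> Ch n" "u = cls n x" using u(1) by (rule A.cls_obtain)
  then have bx: "b n x \<in> Rl (n - 1)" using u by (simp add: A.bd_cls A.cls_one A.b_Ch)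
  obtain y where y: "y \<in> Ch' (n + 1)" "cls' n (g n x) = cls' n (b' (n + 1) y)"
    using u(3) x B.bd_cls[of _ "n + 1"] by (auto simp: boundaries_def f_cls B.carrier_eq)
  have bdy: "b' (n + 1) y \<in> Ch' n" using B.b_Ch[OF y(1)] by simp
  \<comment> \<open>Modulo relations \<open>g n x\<close> is the boundary of \<open>y\<close>, so
    \<open>g' (n + 1) y\<close> bounds \<open>g' n (g n x)\<close>; the homotopy
    \<open>h n x\<close> corrects this to \<open>x\<close> itself.\<close>
  let ?w = "g' (n + 1) y - h n x"
  have w: "?w \<in> Ch (n + 1)" using y x g' h subgrp_diff[OF A.subgrp_Ch] by blast
  have bw: "b (n + 1) ?w \<in> Ch n" using A.b_Ch[OF w] by simp
  have "g n x - b' (n + 1) y \<in> Rl' n" using y by (simp add: B.cls_eq g_Ch x bdy)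
  then have 1: "g' n (g n x - b' (n + 1) y) \<in> Rl n" by (rule g'(3))
  have 2: "h (n - 1) (b n x) \<in> Rl n" using h(2)[OF bx] by simp
  have 3: "b (n + 1) (g' (n + 1) y) - g' n (b' (n + 1) y) \<in> Rl n" using g'(4)[OF y(1)] by simp
  have "x - b (n + 1) ?w = (b (n + 1) (h n x) + h (n - 1) (b n x) - (g' n (g n x) - x)) - h (n - 1) (b n x)
      + g' n (g n x - b' (n + 1) y) - (b (n + 1) (g' (n + 1) y) - g' n (b' (n + 1) y))"
    by (simp add: zlin_diff[OF A.zlin_b] zlin_diff[OF g'(1)])
  also have "\<dots> \<in> Rl n"
    by (intro subgrp_diff[OF A.subgrp_Rl] subgrp_add[OF A.subgrp_Rl] 1 2 3 h(3)[OF x(1)])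
  finally have "cls n x = cls n (b (n + 1) ?w)" by (simp add: A.cls_eq x bw)
  then have "u = bd A (n + 1) (cls (n + 1) ?w)"
    using A.bd_cls[OF w] x by simp
  then show "u \<in> boundaries A n"
    using A.cls_carrier[OF w] by (simp add: boundaries_def)
next
  fix n v assume v: "v \<in> carrier (grp B n)" "bd B n v = \<one>\<^bsub>grp B (n - 1)\<^esub>"
  obtain y where y: "y \<in> Ch' n" "v = cls' n y" using v(1) by (rule B.cls_obtain)
  then have bdy: "b' n y \<in> Rl' (n - 1)" using v by (simp add: B.bd_cls B.cls_one B.b_Ch)
  let ?x = "g' n y"
  have x: "?x \<in> Ch n" using y g' by blast
  have "b n ?x = (b n ?x - g' (n - 1) (b' n y)) + g' (n - 1) (b' n y)" by simp
  also have "\<dots> \<in> Rl (n - 1)" by (rule subgrp_add[OF A.subgrp_Rl g'(4)[OF y(1)] g'(3)[OF bdy]])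
  finally have bx: "bd A n (cls n ?x) = \<one>\<^bsub>grp A (n - 1)\<^esub>" using x by (simp add: A.bd_cls A.cls_one A.b_Ch)
  \<comment> \<open>The second homotopy, evaluated on a cycle modulo relations, exhibits
    \<open>y - g n (g' n y)\<close> as the boundary of this element.\<close>
  let ?w = "- h' n y"
  have w: "?w \<in> Ch' (n + 1)" by (intro subgrp_minus[OF B.subgrp_Ch] h'(1) y)
  have bw: "b' (n + 1) ?w \<in> Ch' n" using B.b_Ch[OF w] by simp
  have yg: "y - g n ?x \<in> Ch' n" by (intro subgrp_diff[OF B.subgrp_Ch] y g_Ch x)
  have hb: "h' (n - 1) (b' n y) \<in> Rl' n" using h'(2)[OF bdy] by simp
  have "y - g n ?x - b' (n + 1) ?w =
      (b' (n + 1) (h' n y) + h' (n - 1) (b' n y) - (g n (g' n y) - y)) - h' (n - 1) (b' n y)"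
    by (simp add: zlin_minus[OF B.zlin_b])
  also have "\<dots> \<in> Rl' n" by (intro subgrp_diff[OF B.subgrp_Rl] h'(3) y hb)
  finally have "cls' n (y - g n ?x) = cls' n (b' (n + 1) ?w)" by (simp add: B.cls_eq yg bw)
  then have "v \<otimes>\<^bsub>grp B n\<^esub> inv\<^bsub>grp B n\<^esub> f n (cls n ?x) = bd B (n + 1) (cls' (n + 1) ?w)"
    using B.bd_cls[OF w] y x by (simp add: f_cls B.cls_diff g_Ch)
  then show "\<exists>x\<in>carrier (grp A n). bd A n x = \<one>\<^bsub>grp A (n - 1)\<^esub> \<and>
      v \<otimes>\<^bsub>grp B n\<^esub> inv\<^bsub>grp B n\<^esub> f n x \<in> boundaries B n"
    using bx x A.cls_carrier[OF x] B.cls_carrier[OF w] by (auto simp: boundaries_def)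
qed

end

lemma r_coset_free: "N #>\<^bsub>free_Abelian_group S\<^esub> x = (\<lambda>h. h + x) ` N"
  by (auto simp: r_coset_def)

lemma generate_free:
  assumes "G \<subseteq> carrier (free_Abelian_group S)"
  shows "generate (free_Abelian_group S) G = zspan G"
proof
  show "generate (free_Abelian_group S) G \<subseteq> zspan G"
  proof
    fix x assume "x \<in> generate (free_Abelian_group S) G"
    then show "x \<in> zspan G"
    proof (induction rule: generate.induct)
      case (inv h)
      then show ?case
        using assms subgrp_minus[OF subgrp_zspan zspan_gen, of h G] by auto
    qed (auto intro: zspan_0 zspan_gen subgrp_add[OF subgrp_zspan])
  qed
  have sg: "subgroup (generate (free_Abelian_group S) G) (free_Abelian_group S)"
    by (rule group.generate_is_subgroup[OF group_free_Abelian_group assms])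
  have "subgrp (generate (free_Abelian_group S) G)"
    unfolding subgrp_def
  proof (intro conjI ballI)
    show "0 \<in> generate (free_Abelian_group S) G" using subgroup.one_closed[OF sg] by simp
    fix x y assume xy: "x \<in> generate (free_Abelian_group S) G" "y \<in> generate (free_Abelian_group S) G"
    then have "Poly_Mapping.keys y \<subseteq> S" using subgroup.mem_carrier[OF sg] by simp
    then have "- y \<in> generate (free_Abelian_group S) G"
      using subgroup.m_inv_closed[OF sg xy(2)] by simp
    then show "x - y \<in> generate (free_Abelian_group S) G"
      using subgroup.m_closed[OF sg xy(1), of "- y"] by simp
  qed
  then show "zspan G \<subseteq> generate (free_Abelian_group S) G"
    by (rule zspan_least) (auto intro: generate.incl)
qed

text \<open>A quotient of a presented complex is presented by the same chains with more relations.
  Applied twice, this unfolds the two-step definition of C^ord into a single quotient of cubical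
  chains.\<close>

lemma presents_quot:
  assumes "presents Ch Rl b A cls"
    and N: "\<And>n. N n = cls n ` Rl' n" "\<And>n. subgrp (Rl' n)" "\<And>n. Rl n \<subseteq> Rl' n" "\<And>n. Rl' n \<subseteq> Ch n"
      "\<And>n x. x \<in> Rl' n \<Longrightarrow> b n x \<in> Rl' (n - 1)"
  shows "presents Ch Rl' b (quot_cx A N) (\<lambda>n x. N n #>\<^bsub>grp A n\<^esub> cls n x)"
proof -
  interpret presented Ch Rl b A cls by standard fact
  have subD: "x \<in> Ch n" if "x \<in> Rl' n" for n x using N(4) that by blast
  have memN: "cls n x \<in> N n \<longleftrightarrow> x \<in> Rl' n" if x: "x \<in> Ch n" for n x
  proof
    assume "cls n x \<in> N n"
    then obtain y where y: "y \<in> Rl' n" "cls n x = cls n y" unfolding N(1) by blast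
    then have "x - y \<in> Rl' n" using subD[OF y(1)] x N(3) by (simp add: cls_eq) blast
    from subgrp_add[OF N(2) this y(1)] show "x \<in> Rl' n" by simp
  qed (simp add: N(1))
  have Nsub: "N n \<subseteq> carrier (grp A n)" for n
    unfolding N(1) carrier_eq using N(4) by blast
  have sg: "subgroup (N n) (grp A n)" for n
  proof (rule group.subgroupI[OF comm_group.axioms(2)[OF comm_group] Nsub])
    show "N n \<noteq> {}" unfolding N(1) using subgrp_0[OF N(2)] by blast
    fix u assume "u \<in> N n"
    then obtain x where x: "x \<in> Rl' n" "u = cls n x" unfolding N(1) by blast
    show "inv\<^bsub>grp A n\<^esub> u \<in> N n"
      using memN[OF subgrp_minus[OF subgrp_Ch subD[OF x(1)]]] subgrp_minus[OF N(2) x(1)] cls_minus[OF subD[OF x(1)]] x(2)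
      by simp
    fix v assume "v \<in> N n"
    then obtain y where y: "y \<in> Rl' n" "v = cls n y" unfolding N(1) by blast
    show "u \<otimes>\<^bsub>grp A n\<^esub> v \<in> N n"
      using memN[OF subgrp_add[OF subgrp_Ch subD[OF x(1)] subD[OF y(1)]]] subgrp_add[OF N(2) x(1) y(1)]
        cls_add[OF subD[OF x(1)] subD[OF y(1)]] x(2) y(2)
      by simp
  qed
  have bdN: "bd A n ` N n \<subseteq> N (n - 1)" for n
  proof
    fix u assume "u \<in> bd A n ` N n"
    then obtain y where y: "y \<in> Rl' n" "u = bd A n (cls n y)" unfolding N(1) by blast
    then have "u = cls (n - 1) (b n y)" using bd_cls[OF subD] by simp
    then show "u \<in> N (n - 1)" unfolding N(1)[of "n - 1"] using N(5)[OF y(1)] by blast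
  qed
  have bdQ: "bd (quot_cx A N) n (N n #>\<^bsub>grp A n\<^esub> cls n x) = N (n - 1) #>\<^bsub>grp A (n - 1)\<^esub> cls (n - 1) (b n x)"
    if x: "x \<in> Ch n" for n x
    using coset_map_coset[OF comm_group comm_group sg sg bd_hom bdN cls_carrier[OF x]]
    by (simp add: quot_cx_def bd_cls[OF x])
  have eqQ: "N n #>\<^bsub>grp A n\<^esub> cls n x = N n #>\<^bsub>grp A n\<^esub> cls n y \<longleftrightarrow> x - y \<in> Rl' n"
    if xy: "x \<in> Ch n" "y \<in> Ch n" for n x y
    unfolding comm_group.r_coset_eq_iff[OF comm_group sg cls_carrier[OF xy(1)] cls_carrier[OF xy(2)]]
    using memN[OF subgrp_diff[OF subgrp_Ch xy]] cls_diff[OF xy] by simp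
  have addQ: "N n #>\<^bsub>grp A n\<^esub> cls n (x + y) =
        (N n #>\<^bsub>grp A n\<^esub> cls n x) \<otimes>\<^bsub>grp (quot_cx A N) n\<^esub> (N n #>\<^bsub>grp A n\<^esub> cls n y)"
    if xy: "x \<in> Ch n" "y \<in> Ch n" for n x y
    using comm_group.r_coset_mult[OF comm_group sg cls_carrier[OF xy(1)] cls_carrier[OF xy(2)]]
    by (simp add: quot_cx_def FactGroup_def cls_add[OF xy])
  have carrQ: "carrier (grp (quot_cx A N) n) = (\<lambda>x. N n #>\<^bsub>grp A n\<^esub> cls n x) ` Ch n" for n
    unfolding quot_cx_def FactGroup_def RCOSETS_def using carrier_eq[of n] by auto
  have oneQ: "\<one>\<^bsub>grp (quot_cx A N) n\<^esub> = N n #>\<^bsub>grp A n\<^esub> cls n 0" for n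
    using group.coset_mult_one[OF comm_group.axioms(2)[OF comm_group] Nsub, of n]
    by (simp add: quot_cx_def FactGroup_def one_eq)
  show ?thesis
    unfolding presents_def
    by (intro allI conjI ballI) (rule subgrp_Ch N(2,4) zlin_b carrQ oneQ addQ eqQ b_Ch bdQ N(5); assumption)+
qed

lemma presents_free:
  assumes "\<And>n. carrier (grp C n) = Ch n" "\<And>n. \<one>\<^bsub>grp C n\<^esub> = 0"
    "\<And>n x y. x \<in> Ch n \<Longrightarrow> y \<in> Ch n \<Longrightarrow> x \<otimes>\<^bsub>grp C n\<^esub> y = x + y" "\<And>n. subgrp (Ch n)"
    "\<And>n. zlin (b n)" "\<And>n x. x \<in> Ch n \<Longrightarrow> b n x \<in> Ch (n - 1)" "\<And>n x. x \<in> Ch n \<Longrightarrow> bd C n x = b n x"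
  shows "presents Ch (\<lambda>_. {0}) b C (\<lambda>n x. x)"
  unfolding presents_def using assms by (auto simp: subgrp_0 zlin_0) (simp_all add: subgrp_def)

section \<open>The tensor product as a presented complex\<close>

definition tens_gens :: "'a chain_cx \<Rightarrow> 'b chain_cx \<Rightarrow> int \<Rightarrow> (int \<times> 'a \<times> int \<times> 'b) set" where
  "tens_gens A B n = {(i, a, j, b) | i a j b. i + j = n \<and> a \<in> carrier (grp A i) \<and> b \<in> carrier (grp B j)}"

definition tens_rels :: "'a chain_cx \<Rightarrow> 'b chain_cx \<Rightarrow> int \<Rightarrow> ((int \<times> 'a \<times> int \<times> 'b) \<Rightarrow>\<^sub>0 int) set" where
  "tens_rels A B n =
     {frag_of (i, a \<otimes>\<^bsub>grp A i\<^esub> a', j, b) - (frag_of (i, a, j, b) + frag_of (i, a', j, b))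
        | i a a' j b. i + j = n \<and> a \<in> carrier (grp A i) \<and> a' \<in> carrier (grp A i) \<and>
                      b \<in> carrier (grp B j)} \<union>
     {frag_of (i, a, j, b \<otimes>\<^bsub>grp B j\<^esub> b') - (frag_of (i, a, j, b) + frag_of (i, a, j, b'))
        | i a j b b'. i + j = n \<and> a \<in> carrier (grp A i) \<and>
                      b \<in> carrier (grp B j) \<and> b' \<in> carrier (grp B j)}"

lemma tens_rels_cases:
  assumes "g \<in> tens_rels A B n"
  obtains (1) i a a' j b where "i + j = n" "a \<in> carrier (grp A i)" "a' \<in> carrier (grp A i)" "b \<in> carrier (grp B j)"
      "g = frag_of (i, a \<otimes>\<^bsub>grp A i\<^esub> a', j, b) - (frag_of (i, a, j, b) + frag_of (i, a', j, b))"
  | (2) i a j b b' where "i + j = n" "a \<in> carrier (grp A i)" "b \<in> carrier (grp B j)" "b' \<in> carrier (grp B j)"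
      "g = frag_of (i, a, j, b \<otimes>\<^bsub>grp B j\<^esub> b') - (frag_of (i, a, j, b) + frag_of (i, a, j, b'))"
  using assms unfolding tens_rels_def by blast

definition is_cx :: "'a chain_cx \<Rightarrow> bool" where
  "is_cx A \<longleftrightarrow> (\<forall>n. comm_group (grp A n) \<and> bd A n \<in> hom (grp A n) (grp A (n - 1)))"

lemma is_cxD:
  assumes "is_cx A" "a \<in> carrier (grp A i)" "a' \<in> carrier (grp A i)"
  shows "a \<otimes>\<^bsub>grp A i\<^esub> a' \<in> carrier (grp A i)" "bd A i a \<in> carrier (grp A (i - 1))"
    "bd A i (a \<otimes>\<^bsub>grp A i\<^esub> a') = bd A i a \<otimes>\<^bsub>grp A (i - 1)\<^esub> bd A i a'"
  using assms unfolding is_cx_def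
  by (auto intro: monoid.m_closed comm_monoid.axioms(1) comm_group.axioms(1) simp: hom_def)

lemma subgrp_keys: "subgrp {x. Poly_Mapping.keys x \<subseteq> S}"
  unfolding subgrp_def using keys_diff by fastforce

lemma tens_rels_I:
  "i + j = n \<Longrightarrow> a \<in> carrier (grp A i) \<Longrightarrow> a' \<in> carrier (grp A i) \<Longrightarrow> b \<in> carrier (grp B j) \<Longrightarrow>
    frag_of (i, a \<otimes>\<^bsub>grp A i\<^esub> a', j, b) - (frag_of (i, a, j, b) + frag_of (i, a', j, b)) \<in> tens_rels A B n"
  "i + j = n \<Longrightarrow> a \<in> carrier (grp A i) \<Longrightarrow> b \<in> carrier (grp B j) \<Longrightarrow> b' \<in> carrier (grp B j) \<Longrightarrow>
    frag_of (i, a, j, b \<otimes>\<^bsub>grp B j\<^esub> b') - (frag_of (i, a, j, b) + frag_of (i, a, j, b')) \<in> tens_rels A B n"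
  unfolding tens_rels_def by blast+

lemma tens_rels_keys:
  assumes "is_cx A" "is_cx B" "g \<in> tens_rels A B n"
  shows "Poly_Mapping.keys g \<subseteq> tens_gens A B n"
proof -
  have 3: "Poly_Mapping.keys (frag_of u - (frag_of v + frag_of w)) \<subseteq> S" if "u \<in> S" "v \<in> S" "w \<in> S" for u v w S
    using subgrp_diff[OF subgrp_keys, of "frag_of u" S "frag_of v + frag_of w"]
      subgrp_add[OF subgrp_keys, of "frag_of v" S "frag_of w"] that by simp
  from assms(3) show ?thesis
  proof (cases rule: tens_rels_cases)
    case (1 i a a' j b)
    show ?thesis
      unfolding 1(5) by (rule 3) (use 1 is_cxD(1)[OF assms(1)] in \<open>auto simp: tens_gens_def\<close>)
  next
    case (2 i a j b b')
    show ?thesis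
      unfolding 2(5) by (rule 3) (use 2 is_cxD(1)[OF assms(2)] in \<open>auto simp: tens_gens_def\<close>)
  qed
qed

lemma tens_rel_eq:
  assumes "is_cx A" "is_cx B" shows "tens_rel A B n = zspan (tens_rels A B n)"
proof -
  have "tens_rels A B n \<subseteq> carrier (tens_free A B n)"
    using tens_rels_keys[OF assms, of _ n] by (auto simp: tens_free_def tens_gens_def)
  then show ?thesis
    unfolding tens_rel_def tens_rels_def[symmetric] tens_free_def by (rule generate_free)
qed

lemma zlin_tens_bd: "zlin (tens_bd A B)"
  by (simp add: tens_bd_def zlin_frag_extend)

lemma tens_bd_of: "tens_bd A B (frag_of (i, a, j, b)) =
    frag_of (i - 1, bd A i a, j, b) + frag_cmul (koszul i 1) (frag_of (i, a, j - 1, bd B j b))"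
  by (simp add: tens_bd_def)

text \<open>The Leibniz formula turns a biadditivity relation into two of the same kind, one for
  each factor that is differentiated.\<close>

lemma tens_bd_rel:
  assumes "is_cx A" "is_cx B" "x \<in> tens_rel A B n"
  shows "tens_bd A B x \<in> tens_rel A B (n - 1)"
  unfolding tens_rel_eq[OF assms(1,2)]
proof (rule zlin_zspan[OF zlin_tens_bd subgrp_zspan _ assms(3)[unfolded tens_rel_eq[OF assms(1,2)]]])
  fix g assume "g \<in> tens_rels A B n"
  then show "tens_bd A B g \<in> zspan (tens_rels A B (n - 1))"
  proof (cases rule: tens_rels_cases)
    case (1 i a a' j b)
    let ?k = "frag_cmul (koszul i 1)"
    have "tens_bd A B g =
      (frag_of (i - 1, bd A i a \<otimes>\<^bsub>grp A (i - 1)\<^esub> bd A i a', j, b)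
         - (frag_of (i - 1, bd A i a, j, b) + frag_of (i - 1, bd A i a', j, b)))
      + ?k (frag_of (i, a \<otimes>\<^bsub>grp A i\<^esub> a', j - 1, bd B j b)
         - (frag_of (i, a, j - 1, bd B j b) + frag_of (i, a', j - 1, bd B j b)))"
      using 1 by (simp add: zlin_diff[OF zlin_tens_bd] zlin_add[OF zlin_tens_bd] tens_bd_of
          is_cxD[OF assms(1)] frag_cmul_diff2 frag_cmul_distrib2)
    also have "\<dots> \<in> zspan (tens_rels A B (n - 1))"
      by (intro subgrp_add[OF subgrp_zspan] subgrp_cmul[OF subgrp_zspan] zspan_gen)
         (rule tens_rels_I; use 1 is_cxD(2)[OF assms(1)] is_cxD(2)[OF assms(2)] is_cxD(1)[OF assms(1)] in force)+
    finally show ?thesis .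
  next
    case (2 i a j b b')
    let ?k = "frag_cmul (koszul i 1)"
    have "tens_bd A B g =
      (frag_of (i - 1, bd A i a, j, b \<otimes>\<^bsub>grp B j\<^esub> b')
         - (frag_of (i - 1, bd A i a, j, b) + frag_of (i - 1, bd A i a, j, b')))
      + ?k (frag_of (i, a, j - 1, bd B j b \<otimes>\<^bsub>grp B (j - 1)\<^esub> bd B j b')
         - (frag_of (i, a, j - 1, bd B j b) + frag_of (i, a, j - 1, bd B j b')))"
      using 2 by (simp add: zlin_diff[OF zlin_tens_bd] zlin_add[OF zlin_tens_bd] tens_bd_of
          is_cxD[OF assms(2)] frag_cmul_diff2 frag_cmul_distrib2)
    also have "\<dots> \<in> zspan (tens_rels A B (n - 1))"
      by (intro subgrp_add[OF subgrp_zspan] subgrp_cmul[OF subgrp_zspan] zspan_gen)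
         (rule tens_rels_I; use 2 is_cxD(2)[OF assms(1)] is_cxD(2)[OF assms(2)] is_cxD(1)[OF assms(2)] in force)+
    finally show ?thesis .
  qed
qed

text \<open>Puts tensor products under the same locale as chains of spaces: representatives are
  formal sums of generators, and a map out of the tensor product is given on these.\<close>

lemma tensor_presents:
  assumes "is_cx A" "is_cx B"
  shows "presents (\<lambda>n. carrier (tens_free A B n)) (tens_rel A B) (\<lambda>n. tens_bd A B) (tensor A B)
    (\<lambda>n z. tens_rel A B n #>\<^bsub>tens_free A B n\<^esub> z)"
proof -
  have carr: "carrier (tens_free A B n) = {x. Poly_Mapping.keys x \<subseteq> tens_gens A B n}" for n
    by (auto simp: tens_free_def tens_gens_def)
  let ?F = "\<lparr>grp = tens_free A B, bd = \<lambda>n. tens_bd A B\<rparr>"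
  have rel: "tens_rel A B n \<subseteq> carrier (tens_free A B n)" for n
    unfolding tens_rel_eq[OF assms] carr
    by (rule zspan_least[OF subgrp_keys]) (use tens_rels_keys[OF assms] in blast)
  have bd: "tens_bd A B x \<in> carrier (tens_free A B (n - 1))" if "x \<in> carrier (tens_free A B n)" for n x
    unfolding carr
  proof (rule zlin_mem[OF zlin_tens_bd subgrp_keys that[unfolded carr mem_Collect_eq]])
    fix c assume "c \<in> tens_gens A B n"
    then obtain i a j b where c: "c = (i, a, j, b)" "i + j = n" "a \<in> carrier (grp A i)" "b \<in> carrier (grp B j)"
      by (auto simp: tens_gens_def)
    show "tens_bd A B (frag_of c) \<in> {x. Poly_Mapping.keys x \<subseteq> tens_gens A B (n - 1)}"
      unfolding c(1) tens_bd_of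
      by (intro subgrp_add[OF subgrp_keys] subgrp_cmul[OF subgrp_keys])
         (use c is_cxD(2)[OF assms(1)] is_cxD(2)[OF assms(2)] in \<open>auto simp: tens_gens_def\<close>)
  qed
  have "presents (\<lambda>n. carrier (tens_free A B n)) (\<lambda>_. {0}) (\<lambda>n. tens_bd A B) ?F (\<lambda>n x. x)"
    by (rule presents_free) (use subgrp_keys bd in \<open>auto simp: zlin_tens_bd carr\<close>, auto simp: tens_free_def)
  from presents_quot[OF this, of "tens_rel A B" "tens_rel A B"] rel tens_bd_rel[OF assms]
  have "presents (\<lambda>n. carrier (tens_free A B n)) (tens_rel A B) (\<lambda>n. tens_bd A B) (quot_cx ?F (tens_rel A B))
    (\<lambda>n z. tens_rel A B n #>\<^bsub>tens_free A B n\<^esub> z)"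
    by (simp add: tens_rel_eq[OF assms] subgrp_zspan zspan_0)
  then show ?thesis by (simp add: quot_cx_def tensor_def)
qed

section \<open>The functor on modular operads of a multiplicative cell theory\<close>

definition gch :: "cell_data \<Rightarrow> 'x topology \<Rightarrow> int \<Rightarrow> 'x chain set" where
  "gch T X n = (if n < 0 then {0} else chains (mdl T (nat n)) X)"

definition grl :: "cell_data \<Rightarrow> 'x topology \<Rightarrow> int \<Rightarrow> 'x chain set" where
  "grl T X n = (if n < 0 then {0} else rspan T (nat n) X)"

text \<open>The truncations are harmless: for \<open>n \<le> 0\<close> the chain used is
  \<open>bdy T 0\<close>, which is zero in every cell theory.\<close>

definition gbd :: "cell_data \<Rightarrow> int \<Rightarrow> 'x chain \<Rightarrow> 'x chain" where
  "gbd T n x = act (mdl T (nat n - 1)) (bdy T (nat n)) x"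

definition gpush :: "cell_data \<Rightarrow> int \<Rightarrow> ('x \<Rightarrow> 'y) \<Rightarrow> 'x chain \<Rightarrow> 'y chain" where
  "gpush T n = push (mdl T (nat n))"

text \<open>The dimension \<open>nat i + nat j\<close> can differ from \<open>nat (i + j)\<close>
  only if an index is negative; then one of the two factors is the zero chain.\<close>

definition gmul :: "cell_data \<Rightarrow> int \<Rightarrow> int \<Rightarrow> 'x chain \<Rightarrow> 'y chain \<Rightarrow> ('x \<times> 'y) chain" where
  "gmul T i j = mul (mdl T (nat i + nat j)) (mlt T (nat i) (nat j))"

lemma zlin_gbd: "zlin (gbd T n)"
  unfolding gbd_def by (rule zlin_act)

lemma zlin_gpush: "zlin (gpush T n f)"
  unfolding gpush_def by (rule zlin_push)

lemma zlin_gmul1: "zlin (\<lambda>x. gmul T i j x y)"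
  unfolding gmul_def by (rule zlin_mul1)

lemma zlin_gmul2: "zlin (gmul T i j x)"
  using zlin_mul2 unfolding gmul_def by blast

lemma subgrp_gch: "subgrp (gch T X n)"
  by (simp add: gch_def subgrp_chains) (simp add: subgrp_def)

lemma subgrp_grl: "subgrp (grl T X n)"
  by (simp add: grl_def subgrp_relspan) (simp add: subgrp_def)

lemma gpush_gpush: "gpush T n f (gpush T n g x) = gpush T n (f \<circ> g) x"
  by (simp add: gpush_def push_push)

lemma gpush_cong: "x \<in> gch T X n \<Longrightarrow> (\<And>y. y \<in> topspace X \<Longrightarrow> f y = g y) \<Longrightarrow> gpush T n f x = gpush T n g x"
  unfolding gpush_def gch_def by (auto split: if_splits simp: zlin_0[OF zlin_push] intro: push_cong)

lemma gpush_id: "x \<in> gch T X n \<Longrightarrow> (\<And>y. y \<in> topspace X \<Longrightarrow> f y = y) \<Longrightarrow> gpush T n f x = x"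
  unfolding gpush_def gch_def by (auto split: if_splits simp: zlin_0[OF zlin_push] intro: push_id)

lemma gpush_gch: "x \<in> gch T X n \<Longrightarrow> continuous_map X Y f \<Longrightarrow> gpush T n f x \<in> gch T Y n"
  unfolding gpush_def gch_def by (auto split: if_splits simp: zlin_0[OF zlin_push] intro: push_chain)

context cell_theory
begin

lemma gbd_gch: "x \<in> gch T X n \<Longrightarrow> gbd T n x \<in> gch T X (n - 1)"
  and gbd_grl: "x \<in> grl T X n \<Longrightarrow> gbd T n x \<in> grl T X (n - 1)"
  and gbd_gpush: "gbd T n (gpush T n f x) = gpush T (n - 1) f (gbd T n x)"
  and gbd_gbd: "gbd T (n - 1) (gbd T n x) = 0"
proof -
  consider "n \<le> 0" | "n = 1" | k where "n = int k + 2"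
  proof -
    have "n \<le> 0 \<or> n = 1 \<or> n = int (nat (n - 2)) + 2" by linarith
    then show thesis using that by blast
  qed
  note cases = this
  have n1: "nat (int k + 2) - 1 = Suc k" "nat (int k + 1) - 1 = k" "nat (int k + 2) = Suc (Suc k)"
    "nat (int k + 1) = Suc k" "(int k + 2 - 1) = int k + 1" for k by auto
  show "x \<in> gch T X n \<Longrightarrow> gbd T n x \<in> gch T X (n - 1)"
    by (cases rule: cases) (auto simp: gbd_def gch_def D_0 act_0 subgrp_0[OF subgrp_chains] n1 intro: bd1_chain)
  show "x \<in> grl T X n \<Longrightarrow> gbd T n x \<in> grl T X (n - 1)"
    by (cases rule: cases) (auto simp: gbd_def grl_def D_0 act_0 subgrp_0[OF subgrp_relspan] n1 intro: bd1_rspan)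
  show "gbd T n (gpush T n f x) = gpush T (n - 1) f (gbd T n x)"
    by (cases rule: cases) (auto simp: gbd_def gpush_def D_0 act_0 zlin_0[OF zlin_push] n1 bd1_push)
  show "gbd T (n - 1) (gbd T n x) = 0"
    by (cases rule: cases) (auto simp: gbd_def D_0 act_0 zlin_0[OF zlin_act] n1 bd1_bd1)
qed

lemma grl_gch: "grl T X n \<subseteq> gch T X n"
  by (auto simp: grl_def gch_def rspan_chains)

lemma gpush_grl: "x \<in> grl T X n \<Longrightarrow> continuous_map X Y f \<Longrightarrow> gpush T n f x \<in> grl T Y n"
  unfolding gpush_def grl_def by (auto split: if_splits simp: zlin_0[OF zlin_push] intro: rspan_push)

end

text \<open>All clauses concern universal chains. In \<open>mlt_bd\<close> the index
  \<open>p - 1\<close> is truncated at \<open>p = 0\<close>, where the factor \<open>bdy T p\<close>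
  is zero. Commutativity is required only modulo relations, since exchanging two cubes permutes the
  coordinates of their product.\<close>

locale monoidal_theory = cell_theory +
  assumes mlt_chain: "mlt T p q \<in> chains (mdl T (p + q)) (prod_topology (mdt T p) (mdt T q))"
    and mlt_bd: "act (mdl T (p + q - 1)) (bdy T (p + q)) (mlt T p q) =
      mul (mdl T (p + q - 1)) (mlt T (p - 1) q) (bdy T p) (idc (mdl T q)) +
      frag_cmul ((- 1) ^ p) (mul (mdl T (p + q - 1)) (mlt T p (q - 1)) (idc (mdl T p)) (bdy T q))"
    and mlt_assoc: "push (mdl T (p + q + r)) (\<lambda>((x, y), z). (x, (y, z)))
        (mul (mdl T (p + q + r)) (mlt T (p + q) r) (mlt T p q) (idc (mdl T r))) =
      mul (mdl T (p + q + r)) (mlt T p (q + r)) (idc (mdl T p)) (mlt T q r)"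
    and mlt_sym: "push (mdl T (p + q)) prod.swap (mlt T p q) - frag_cmul ((- 1) ^ (p * q)) (mlt T q p)
      \<in> rspan T (p + q) (prod_topology (mdt T q) (mdt T p))"
    and mlt_rel1: "(m, u) \<in> rels T p \<Longrightarrow> mul (mdl T (p + q)) (mlt T p q) u (idc (mdl T q))
      \<in> rspan T (p + q) (prod_topology (mdt T m) (mdt T q))"
    and mlt_rel2: "(m, u) \<in> rels T q \<Longrightarrow> mul (mdl T (p + q)) (mlt T p q) (idc (mdl T p)) u
      \<in> rspan T (p + q) (prod_topology (mdt T p) (mdt T m))"
begin

abbreviation mm :: "nat \<Rightarrow> nat \<Rightarrow> 'x chain \<Rightarrow> 'y chain \<Rightarrow> ('x \<times> 'y) chain" where
  "mm p q \<equiv> mul (mdl T (p + q)) (mlt T p q)"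

lemma mm_chain: "x \<in> chains (mdl T p) X \<Longrightarrow> y \<in> chains (mdl T q) Y \<Longrightarrow>
    mm p q x y \<in> chains (mdl T (p + q)) (prod_topology X Y)"
  by (rule mul_chain[OF mlt_chain])

lemma mm_push: "mm p q (push (mdl T p) f x) (push (mdl T q) g y) = push (mdl T (p + q)) (map_prod f g) (mm p q x y)"
  by (rule mul_push[OF mlt_chain])

text \<open>By naturality in both factors the product of a push-forward with a cell is a
  push-forward of the product on models, where \<open>mlt_rel1\<close> applies.\<close>

lemma mm_rel1:
  assumes "x \<in> rspan T p X" "y \<in> chains (mdl T q) Y"
  shows "mm p q x y \<in> rspan T (p + q) (prod_topology X Y)"
proof (rule zlin_relspan[OF zlin_mul1 subgrp_relspan assms(1)])
  fix m r c assume mr: "(m, r) \<in> rels T p" "c \<in> cells (mdl T m) X"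
  show "mm p q (push (mdl T p) c r) y \<in> rspan T (p + q) (prod_topology X Y)"
  proof (rule chains_lin_mem[OF assms(2) zlin_mul2 subgrp_relspan])
    fix c' assume c': "c' \<in> cells (mdl T q) Y"
    have "mm p q (push (mdl T p) c r) (push (mdl T q) c' (idc (mdl T q))) \<in> rspan T (p + q) (prod_topology X Y)"
      unfolding mm_push
      by (rule rspan_push[OF mlt_rel1[OF mr(1)]]) (intro continuous_map_prod_cells cells_continuous mr c')
    then show "mm p q (push (mdl T p) c r) (frag_of c') \<in> rspan T (p + q) (prod_topology X Y)"
      using act_idc[of "frag_of c'" "mdl T q" Y] c' by (simp add: act_of frag_of_chains)
  qed
qed

lemma mm_rel2:
  assumes "x \<in> chains (mdl T p) X" "y \<in> rspan T q Y"
  shows "mm p q x y \<in> rspan T (p + q) (prod_topology X Y)"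
proof (rule zlin_relspan[OF zlin_mul2 subgrp_relspan assms(2)])
  fix m r c assume mr: "(m, r) \<in> rels T q" "c \<in> cells (mdl T m) Y"
  show "mm p q x (push (mdl T q) c r) \<in> rspan T (p + q) (prod_topology X Y)"
  proof (rule chains_lin_mem[OF assms(1) zlin_mul1 subgrp_relspan])
    fix c' assume c': "c' \<in> cells (mdl T p) X"
    have "mm p q (push (mdl T p) c' (idc (mdl T p))) (push (mdl T q) c r) \<in> rspan T (p + q) (prod_topology X Y)"
      unfolding mm_push
      by (rule rspan_push[OF mlt_rel2[OF mr(1)]]) (intro continuous_map_prod_cells cells_continuous mr c')
    then show "mm p q (frag_of c') (push (mdl T q) c r) \<in> rspan T (p + q) (prod_topology X Y)"
      using act_idc[of "frag_of c'" "mdl T p" X] c' by (simp add: act_of frag_of_chains)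
  qed
qed

lemma act_push_idc: "c \<in> cells S X \<Longrightarrow> frag_of c = push S c (idc S)"
  using act_idc[of "frag_of c" S X] by (simp add: act_of frag_of_chains)

lemma mm_bd:
  assumes x: "x \<in> chains (mdl T p) X" and y: "y \<in> chains (mdl T q) Y"
  shows "act (mdl T (p + q - 1)) (bdy T (p + q)) (mm p q x y) =
      mul (mdl T (p + q - 1)) (mlt T (p - 1) q) (act (mdl T (p - 1)) (bdy T p) x) y +
      frag_cmul ((- 1) ^ p) (mul (mdl T (p + q - 1)) (mlt T p (q - 1)) x (act (mdl T (q - 1)) (bdy T q) y))"
proof -
  have D: "bdy T (p + q) \<in> chains (mdl T (p + q - 1)) (mdt T (p + q))"
    by (cases "p + q") (simp_all add: D_0 subgrp_0[OF subgrp_chains] D_chain)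
  have 1: "mul (mdl T (p + q - 1)) (mlt T (p - 1) q) (act (mdl T (p - 1)) (bdy T p) x) y =
    mul (mdl T (p + q - 1)) (mul (mdl T (p + q - 1)) (mlt T (p - 1) q) (bdy T p) (idc (mdl T q))) x y"
  proof (cases p)
    case 0 then show ?thesis by (simp add: D_0 act_0 zlin_0[OF zlin_mul1] zlin_0[OF zlin_mul0])
  next
    case (Suc p')
    then show ?thesis
      using mul_act[OF mlt_chain, of p' q "bdy T p" x "idc (mdl T q)" y] by (simp add: act_idc[OF y])
  qed
  have 2: "mul (mdl T (p + q - 1)) (mlt T p (q - 1)) x (act (mdl T (q - 1)) (bdy T q) y) =
    mul (mdl T (p + q - 1)) (mul (mdl T (p + q - 1)) (mlt T p (q - 1)) (idc (mdl T p)) (bdy T q)) x y"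
  proof (cases q)
    case 0 then show ?thesis by (simp add: D_0 act_0 zlin_0[OF zlin_mul2] zlin_0[OF zlin_mul0])
  next
    case (Suc q')
    then show ?thesis
      using mul_act[OF mlt_chain, of p q' "idc (mdl T p)" x "bdy T q" y] by (simp add: act_idc[OF x])
  qed
  show ?thesis
    unfolding act_mul[OF D] mlt_bd zlin_add[OF zlin_mul0] zlin_cmul[OF zlin_mul0] 1 2 ..
qed

text \<open>Both sides are additive in three variables, and on cells both are push-forwards of the
  two sides of \<open>mlt_assoc\<close> along the product of the three cells.\<close>

lemma mm_assoc:
  assumes "x \<in> chains (mdl T p) X" "y \<in> chains (mdl T q) Y" "z \<in> chains (mdl T r) Z"
  shows "push (mdl T (p + q + r)) (\<lambda>((x, y), z). (x, (y, z))) (mm (p + q) r (mm p q x y) z) =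
    mul (mdl T (p + q + r)) (mlt T p (q + r)) x (mm q r y z)"
proof -
  let ?S = "mdl T (p + q + r)" and ?a = "\<lambda>((x, y), z). (x, (y, z))"
  have M: "mlt T p (q + r) \<in> chains ?S (prod_topology (mdt T p) (mdt T (q + r)))"
    using mlt_chain[of p "q + r"] by (simp add: add.assoc)
  have gen: "push ?S ?a (mm (p + q) r (mm p q (frag_of c) (frag_of c')) (frag_of c'')) =
     mul ?S (mlt T p (q + r)) (frag_of c) (mm q r (frag_of c') (frag_of c''))"
    if c: "c \<in> cells (mdl T p) X" "c' \<in> cells (mdl T q) Y" "c'' \<in> cells (mdl T r) Z" for c c' c''
  proof -
    note i = act_push_idc[OF c(1)] act_push_idc[OF c(2)] act_push_idc[OF c(3)]
    have "?a \<circ> map_prod (map_prod c c') c'' = map_prod c (map_prod c' c'') \<circ> ?a" by auto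
    then have "push ?S ?a (mm (p + q) r (mm p q (frag_of c) (frag_of c')) (frag_of c'')) =
      push ?S (map_prod c (map_prod c' c'')) (push ?S ?a (mm (p + q) r (mlt T p q) (idc (mdl T r))))"
      by (simp add: i mm_push push_push mul_idc[OF mlt_chain])
    also have "\<dots> = mul ?S (mlt T p (q + r)) (frag_of c) (mm q r (frag_of c') (frag_of c''))"
      unfolding mlt_assoc by (simp add: i mm_push mul_push[OF M] mul_idc[OF mlt_chain])
    finally show ?thesis .
  qed
  note zl = zlin_comp[OF zlin_push zlin_mul1] zlin_comp[OF zlin_push zlin_mul2]
  show ?thesis
  proof (rule chains_lin_eq[OF assms(1)
        zlin_comp[OF zlin_push zlin_comp[OF zlin_mul1 zlin_mul1]] zlin_mul1])
    fix c assume c: "c \<in> cells (mdl T p) X"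
    show "push ?S ?a (mm (p + q) r (mm p q (frag_of c) y) z) = mul ?S (mlt T p (q + r)) (frag_of c) (mm q r y z)"
    proof (rule chains_lin_eq[OF assms(2)
          zlin_comp[OF zlin_push zlin_comp[OF zlin_mul1 zlin_mul2]] zlin_comp[OF zlin_mul2 zlin_mul1]])
      fix c' assume c': "c' \<in> cells (mdl T q) Y"
      show "push ?S ?a (mm (p + q) r (mm p q (frag_of c) (frag_of c')) z) =
        mul ?S (mlt T p (q + r)) (frag_of c) (mm q r (frag_of c') z)"
        by (rule chains_lin_eq[OF assms(3) zlin_comp[OF zlin_push zlin_mul2] zlin_comp[OF zlin_mul2 zlin_mul2]])
           (rule gen[OF c c'])
    qed
  qed
qed

lemma mm_sym:
  assumes x: "x \<in> chains (mdl T p) X" and y: "y \<in> chains (mdl T q) Y"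
  shows "push (mdl T (p + q)) prod.swap (mm p q x y)
      - frag_cmul ((- 1) ^ (p * q)) (mul (mdl T (p + q)) (mlt T q p) y x) \<in> rspan T (p + q) (prod_topology Y X)"
proof -
  let ?S = "mdl T (p + q)"
  let ?F = "\<lambda>x y. push ?S prod.swap (mm p q x y) - frag_cmul ((- 1) ^ (p * q)) (mul ?S (mlt T q p) y x)"
  have M: "mlt T q p \<in> chains ?S (prod_topology (mdt T q) (mdt T p))"
    using mlt_chain[of q p] by (simp add: add.commute)
  have "?F x y \<in> rspan T (p + q) (prod_topology Y X)"
  proof (rule chains_lin_mem[OF x _ subgrp_relspan])
    show "zlin (\<lambda>x. ?F x y)"
      by (intro zlin_minus_fun zlin_comp[OF zlin_push zlin_mul1] zlin_comp[OF zlin_frag_cmul_id zlin_mul2])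
    fix c assume c: "c \<in> cells (mdl T p) X"
    show "?F (frag_of c) y \<in> rspan T (p + q) (prod_topology Y X)"
    proof (rule chains_lin_mem[OF y _ subgrp_relspan])
      show "zlin (\<lambda>y. ?F (frag_of c) y)"
        by (intro zlin_minus_fun zlin_comp[OF zlin_push zlin_mul2] zlin_comp[OF zlin_frag_cmul_id zlin_mul1])
      fix c' assume c': "c' \<in> cells (mdl T q) Y"
      have "push ?S (map_prod c' c) (push ?S prod.swap (mlt T p q) - frag_cmul ((- 1) ^ (p * q)) (mlt T q p))
         \<in> rspan T (p + q) (prod_topology Y X)"
        by (rule rspan_push[OF mlt_sym]) (intro continuous_map_prod_cells cells_continuous c c')
      moreover have "map_prod c' c \<circ> prod.swap = prod.swap \<circ> map_prod c c'" by auto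
      ultimately show "?F (frag_of c) (frag_of c') \<in> rspan T (p + q) (prod_topology Y X)"
        unfolding act_push_idc[OF c] act_push_idc[OF c'] mm_push mul_push[OF M]
        by (simp add: mul_idc[OF mlt_chain] mul_idc[OF M] zlin_diff[OF zlin_push] zlin_cmul[OF zlin_push] push_push)
    qed
  qed
  then show ?thesis .
qed

lemma gmul_gch: "x \<in> gch T X i \<Longrightarrow> y \<in> gch T Y j \<Longrightarrow> gmul T i j x y \<in> gch T (prod_topology X Y) (i + j)"
  unfolding gch_def gmul_def
  by (auto split: if_splits simp: zlin_0[OF zlin_mul1] zlin_0[OF zlin_mul2] subgrp_0[OF subgrp_chains]
      nat_add_distrib intro: mm_chain)

lemma gmul_grl1: "x \<in> grl T X i \<Longrightarrow> y \<in> gch T Y j \<Longrightarrow> gmul T i j x y \<in> grl T (prod_topology X Y) (i + j)"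
  unfolding gch_def gmul_def grl_def
  by (auto split: if_splits simp: zlin_0[OF zlin_mul1] zlin_0[OF zlin_mul2] subgrp_0[OF subgrp_relspan]
      nat_add_distrib intro: mm_rel1)

lemma gmul_grl2: "x \<in> gch T X i \<Longrightarrow> y \<in> grl T Y j \<Longrightarrow> gmul T i j x y \<in> grl T (prod_topology X Y) (i + j)"
  unfolding gch_def gmul_def grl_def
  by (auto split: if_splits simp: zlin_0[OF zlin_mul1] zlin_0[OF zlin_mul2] subgrp_0[OF subgrp_relspan]
      nat_add_distrib intro: mm_rel2)

lemma gmul_gpush:
  "gmul T i j (gpush T i f x) (gpush T j g y) = push (mdl T (nat i + nat j)) (map_prod f g) (gmul T i j x y)"
  unfolding gmul_def gpush_def by (rule mm_push)

lemma gch_cases: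
  assumes "x \<in> gch T X i"
  obtains "x = 0" | p where "i = int p" "x \<in> chains (mdl T p) X"
  using assms unfolding gch_def by (metis nonneg_int_cases linorder_not_less nat_int singletonD)

lemma gmul_bd:
  assumes "x \<in> gch T X i" "y \<in> gch T Y j"
  shows "gbd T (i + j) (gmul T i j x y) =
    gmul T (i - 1) j (gbd T i x) y + frag_cmul (koszul i 1) (gmul T i (j - 1) x (gbd T j y))"
  using assms(1)
proof (cases rule: gch_cases)
  case 1 then show ?thesis by (simp add: zlin_0[OF zlin_gmul1] zlin_0[OF zlin_gbd])
next
  case x: (2 p)
  from assms(2) show ?thesis
  proof (cases rule: gch_cases)
    case 1 then show ?thesis by (simp add: zlin_0[OF zlin_gmul2] zlin_0[OF zlin_gbd])
  next
    case y: (2 q)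
    have k: "koszul i 1 = (- 1) ^ p" by (simp add: koszul_def x)
    have 1: "nat (int p - 1) = p - 1" "nat (int q - 1) = q - 1" "nat (int p + int q) = p + q" by auto
    have 2: "mul (mdl T (p + q - 1)) (mlt T (p - 1) q) (act (mdl T (p - 1)) (bdy T p) x) y =
        mul (mdl T (p - 1 + q)) (mlt T (p - 1) q) (act (mdl T (p - 1)) (bdy T p) x) y"
      by (cases p) (simp_all add: D_0 act_0 zlin_0[OF zlin_mul1])
    have 3: "mul (mdl T (p + q - 1)) (mlt T p (q - 1)) x (act (mdl T (q - 1)) (bdy T q) y) =
        mul (mdl T (p + (q - 1))) (mlt T p (q - 1)) x (act (mdl T (q - 1)) (bdy T q) y)"
      by (cases q) (simp_all add: D_0 act_0 zlin_0[OF zlin_mul2])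
    show ?thesis
      using mm_bd[OF x(2) y(2)] by (simp only: k[unfolded x(1)] gbd_def gmul_def x(1) y(1) nat_int 1 2 3)
  qed
qed

lemma gmul_assoc:
  assumes "x \<in> gch T X i" "y \<in> gch T Y j" "z \<in> gch T Z m"
  shows "gpush T (i + j + m) (\<lambda>((x, y), z). (x, (y, z))) (gmul T (i + j) m (gmul T i j x y) z) =
    gmul T i (j + m) x (gmul T j m y z)"
  using assms(1)
proof (cases rule: gch_cases)
  case 1 then show ?thesis by (simp add: zlin_0[OF zlin_gmul1] zlin_0[OF zlin_gpush])
next
  case x: (2 p)
  from assms(2) show ?thesis
  proof (cases rule: gch_cases)
    case 1 then show ?thesis
      by (simp add: zlin_0[OF zlin_gmul1] zlin_0[OF zlin_gmul2] zlin_0[OF zlin_gpush])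
  next
    case y: (2 q)
    from assms(3) show ?thesis
    proof (cases rule: gch_cases)
      case 1 then show ?thesis by (simp add: zlin_0[OF zlin_gmul2] zlin_0[OF zlin_gpush])
    next
      case z: (2 r)
      have "nat (int p + int q) = p + q" "nat (int q + int r) = q + r" "nat (int p + int q + int r) = p + q + r"
        by auto
      then show ?thesis
        using mm_assoc[OF x(2) y(2) z(2)]
        by (simp only: gpush_def gmul_def x(1) y(1) z(1) nat_int add.assoc)
    qed
  qed
qed

lemma gmul_sym:
  assumes "x \<in> gch T X i" "y \<in> gch T Y j"
  shows "gpush T (i + j) prod.swap (gmul T i j x y) - frag_cmul (koszul i j) (gmul T j i y x)
    \<in> grl T (prod_topology Y X) (i + j)"
  using assms(1)
proof (cases rule: gch_cases)
  case 1 then show ?thesis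
    by (simp add: zlin_0[OF zlin_gmul1] zlin_0[OF zlin_gmul2] zlin_0[OF zlin_gpush] subgrp_0[OF subgrp_grl])
next
  case x: (2 p)
  from assms(2) show ?thesis
  proof (cases rule: gch_cases)
    case 1 then show ?thesis
      by (simp add: zlin_0[OF zlin_gmul1] zlin_0[OF zlin_gmul2] zlin_0[OF zlin_gpush] subgrp_0[OF subgrp_grl])
  next
    case y: (2 q)
    have k: "koszul i j = (- 1) ^ (p * q)" by (simp add: koszul_def x y)
    have "nat (int p + int q) = p + q" "\<not> int p + int q < 0" by auto
    then show ?thesis
      using mm_sym[OF x(2) y(2)]
      by (simp only: gpush_def gmul_def grl_def x(1) y(1) k[unfolded x y] nat_int if_False add.commute[of q p])
  qed
qed

end

text \<open>
  \<open>F\<close> presents the chains of a space modulo relations, \<open>F2\<close> those of a product; \<open>rep\<close> chooses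
  representatives.
\<close>

locale lax_functor = monoidal_theory T for T +
  fixes F :: "'x topology \<Rightarrow> 'a chain_cx" and cls :: "'x topology \<Rightarrow> int \<Rightarrow> 'x chain \<Rightarrow> 'a"
    and Fm :: "'x topology \<Rightarrow> 'x topology \<Rightarrow> ('x \<Rightarrow> 'x) \<Rightarrow> int \<Rightarrow> 'a \<Rightarrow> 'a"
    and F2 :: "('x \<times> 'x) topology \<Rightarrow> 'b chain_cx" and cls2 :: "('x \<times> 'x) topology \<Rightarrow> int \<Rightarrow> ('x \<times> 'x) chain \<Rightarrow> 'b"
    and Fm2 :: "('x \<times> 'x) topology \<Rightarrow> 'x topology \<Rightarrow> ('x \<times> 'x \<Rightarrow> 'x) \<Rightarrow> int \<Rightarrow> 'b \<Rightarrow> 'a"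
    and \<kappa> :: "'x topology \<Rightarrow> 'x topology \<Rightarrow> int \<Rightarrow> ('a, 'a) tens \<Rightarrow> 'b"
    and rep :: "'a \<Rightarrow> 'x chain"
  assumes pres: "presents (gch T X) (grl T X) (gbd T) (F X) (cls X)"
    and pres2: "presents (gch T X2) (grl T X2) (gbd T) (F2 X2) (cls2 X2)"
    and Fm_cls: "f \<in> top_hom X Y \<Longrightarrow> x \<in> gch T X n \<Longrightarrow> Fm X Y f n (cls X n x) = cls Y n (gpush T n f x)"
    and Fm_ext: "f \<in> top_hom X Y \<Longrightarrow> Fm X Y f n \<in> extensional (carrier (grp (F X) n))"
    and Fm2_cls: "f2 \<in> top_hom X2 Y \<Longrightarrow> x2 \<in> gch T X2 n \<Longrightarrow> Fm2 X2 Y f2 n (cls2 X2 n x2) = cls Y n (gpush T n f2 x2)"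
    and Fm2_ext: "f2 \<in> top_hom X2 Y \<Longrightarrow> Fm2 X2 Y f2 n \<in> extensional (carrier (grp (F2 X2) n))"
    and rep: "u \<in> carrier (grp (F X) n) \<Longrightarrow> rep u \<in> gch T X n \<and> cls X n (rep u) = u"
    and \<kappa>_eq: "\<kappa> X Y = (\<lambda>n. \<lambda>c \<in> carrier (grp (tensor (F X) (F Y)) n).
      the_elem ((\<lambda>z. cls2 (prod_topology X Y) n
        (frag_extend (\<lambda>(i, u, j, v). gmul T i j (rep u) (rep v)) z)) ` c))"
begin

sublocale PF: presented "gch T X" "grl T X" "gbd T" "F X" "cls X" for X
  by standard (rule pres)

sublocale PF2: presented "gch T X2" "grl T X2" "gbd T" "F2 X2" "cls2 X2" for X2
  by standard (rule pres2)

lemma bounded_below: "bounded_below_cx (F X)"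
  by (rule PF.bounded_below) (simp_all add: gbd_gbd subgrp_0[OF subgrp_grl], simp add: gch_def)

lemma is_cx: "is_cx (F X)"
  using bounded_below[of X] by (simp add: is_cx_def bounded_below_cx_def)

lemma Fm_hom: assumes "f \<in> top_hom X Y" shows "Fm X Y f \<in> cx_hom (F X) (F Y)"
proof -
  have f: "continuous_map X Y f" using assms by (simp add: top_hom_def)
  interpret presented_map "gch T X" "grl T X" "gbd T" "F X" "cls X" "gch T Y" "grl T Y" "gbd T" "F Y" "cls Y"
    "\<lambda>n. gpush T n f" "Fm X Y f"
    by standard (auto simp: zlin_gpush gpush_gch[OF _ f] gbd_gpush subgrp_0[OF subgrp_grl] Fm_cls[OF assms] Fm_ext[OF assms])
  show ?thesis by (rule cx_hom)
qed

lemma Fm2_hom: assumes "f \<in> top_hom X Y" shows "Fm2 X Y f \<in> cx_hom (F2 X) (F Y)"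
proof -
  have f: "continuous_map X Y f" using assms by (simp add: top_hom_def)
  interpret presented_map "gch T X" "grl T X" "gbd T" "F2 X" "cls2 X" "gch T Y" "grl T Y" "gbd T" "F Y" "cls Y"
    "\<lambda>n. gpush T n f" "Fm2 X Y f"
    by standard (auto simp: zlin_gpush gpush_gch[OF _ f] gbd_gpush subgrp_0[OF subgrp_grl] Fm2_cls[OF assms] Fm2_ext[OF assms])
  show ?thesis by (rule cx_hom)
qed

text \<open>The Kuenneth map on formal sums. A choice of representatives need not be additive, so
  biadditivity relations are sent to relations of the theory and not necessarily to zero.\<close>

definition ktens :: "((int \<times> 'a \<times> int \<times> 'a) \<Rightarrow>\<^sub>0 int) \<Rightarrow> ('x \<times> 'x) chain" where
  "ktens = frag_extend (\<lambda>(i, u, j, v). gmul T i j (rep u) (rep v))"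

lemma zlin_ktens: "zlin ktens"
  by (simp add: ktens_def zlin_frag_extend)

lemma rep_cls:
  assumes "x \<in> gch T X n" shows "rep (cls X n x) \<in> gch T X n" "rep (cls X n x) - x \<in> grl T X n"
  using rep[OF PF.cls_carrier[OF assms]] PF.cls_eq[OF conjunct1[OF rep[OF PF.cls_carrier[OF assms]]] assms] by auto

lemma gmul_cong:
  assumes "x \<in> gch T X i" "x' \<in> gch T X i" "y \<in> gch T Y j" "y' \<in> gch T Y j"
    "x - x' \<in> grl T X i" "y - y' \<in> grl T Y j"
  shows "gmul T i j x y - gmul T i j x' y' \<in> grl T (prod_topology X Y) (i + j)"
proof -
  have "gmul T i j x y - gmul T i j x' y' = gmul T i j (x - x') y + gmul T i j x' (y - y')"
    by (simp add: zlin_diff[OF zlin_gmul1] zlin_diff[OF zlin_gmul2])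
  then show ?thesis
    using subgrp_add[OF subgrp_grl gmul_grl1[OF assms(5,3)] gmul_grl2[OF assms(2,6)]] by simp
qed

lemma ktens_gch:
  assumes "z \<in> carrier (tens_free (F X) (F Y) n)" shows "ktens z \<in> gch T (prod_topology X Y) n"
proof (rule zlin_mem[OF zlin_ktens subgrp_gch])
  show "Poly_Mapping.keys z \<subseteq> tens_gens (F X) (F Y) n"
    using assms by (auto simp: tens_free_def tens_gens_def)
qed (auto simp: tens_gens_def ktens_def rep intro!: gmul_gch)

lemma ktens_grl:
  assumes "z \<in> tens_rel (F X) (F Y) n" shows "ktens z \<in> grl T (prod_topology X Y) n"
proof (rule zlin_zspan[OF zlin_ktens subgrp_grl _ assms[unfolded tens_rel_eq[OF is_cx is_cx]]])
  fix g assume "g \<in> tens_rels (F X) (F Y) n"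
  then show "ktens g \<in> grl T (prod_topology X Y) n"
  proof (cases rule: tens_rels_cases)
    case (1 i u u' j v)
    note r = rep[OF 1(2), THEN conjunct1] rep[OF 1(3), THEN conjunct1] rep[OF 1(4), THEN conjunct1]
    have uu: "u \<otimes>\<^bsub>grp (F X) i\<^esub> u' = cls X i (rep u + rep u')"
      using PF.cls_add[OF r(1,2)] rep 1 by simp
    have rr: "rep u + rep u' \<in> gch T X i" by (rule subgrp_add[OF subgrp_gch r(1,2)])
    have "ktens g = gmul T i j (rep (cls X i (rep u + rep u'))) (rep v) - gmul T i j (rep u + rep u') (rep v)"
      unfolding 1(5) uu by (simp add: zlin_diff[OF zlin_ktens] zlin_add[OF zlin_ktens] zlin_add[OF zlin_gmul1])
        (simp add: ktens_def)
    also have "\<dots> \<in> grl T (prod_topology X Y) (i + j)"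
      by (rule gmul_cong) (use r rep_cls[OF rr] rr subgrp_0[OF subgrp_grl] in auto)
    finally show ?thesis using 1(1) by simp
  next
    case (2 i u j v v')
    note r = rep[OF 2(2), THEN conjunct1] rep[OF 2(3), THEN conjunct1] rep[OF 2(4), THEN conjunct1]
    have vv: "v \<otimes>\<^bsub>grp (F Y) j\<^esub> v' = cls Y j (rep v + rep v')"
      using PF.cls_add[OF r(2,3)] rep 2 by simp
    have rr: "rep v + rep v' \<in> gch T Y j" by (rule subgrp_add[OF subgrp_gch r(2,3)])
    have "ktens g = gmul T i j (rep u) (rep (cls Y j (rep v + rep v'))) - gmul T i j (rep u) (rep v + rep v')"
      unfolding 2(5) vv by (simp add: zlin_diff[OF zlin_ktens] zlin_add[OF zlin_ktens] zlin_add[OF zlin_gmul2])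
        (simp add: ktens_def)
    also have "\<dots> \<in> grl T (prod_topology X Y) (i + j)"
      by (rule gmul_cong) (use r rep_cls[OF rr] rr subgrp_0[OF subgrp_grl] in auto)
    finally show ?thesis using 2(1) by simp
  qed
qed

lemma ktens_bd:
  assumes "z \<in> carrier (tens_free (F X) (F Y) n)"
  shows "gbd T n (ktens z) - ktens (tens_bd (F X) (F Y) z) \<in> grl T (prod_topology X Y) (n - 1)"
proof -
  let ?F = "\<lambda>z. gbd T n (ktens z) - ktens (tens_bd (F X) (F Y) z)"
  have "?F z \<in> grl T (prod_topology X Y) (n - 1)"
  proof (rule zlin_mem[of ?F, OF _ subgrp_grl])
    show "zlin ?F"
      by (intro zlin_minus_fun zlin_comp[OF zlin_gbd zlin_ktens] zlin_comp[OF zlin_ktens zlin_tens_bd])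
    show "Poly_Mapping.keys z \<subseteq> tens_gens (F X) (F Y) n"
      using assms by (auto simp: tens_free_def tens_gens_def)
    fix c assume "c \<in> tens_gens (F X) (F Y) n"
    then obtain i u j v where c: "c = (i, u, j, v)" "i + j = n" "u \<in> carrier (grp (F X) i)" "v \<in> carrier (grp (F Y) j)"
      by (auto simp: tens_gens_def)
    note ru = rep[OF c(3)] and rv = rep[OF c(4)]
    have ru1: "rep u \<in> gch T X i" and rv1: "rep v \<in> gch T Y j" using ru rv by auto
    have bu: "bd (F X) i u = cls X (i - 1) (gbd T i (rep u))" using ru PF.bd_cls[OF ru1] by simp
    have bv: "bd (F Y) j v = cls Y (j - 1) (gbd T j (rep v))" using rv PF.bd_cls[OF rv1] by simp
    have 1: "gmul T (i - 1) j (gbd T i (rep u)) (rep v) - gmul T (i - 1) j (rep (bd (F X) i u)) (rep v)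
        \<in> grl T (prod_topology X Y) (n - 1)"
      using gmul_cong[OF gbd_gch[OF ru1] rep_cls(1)[OF gbd_gch[OF ru1]] rv1 rv1]
        subgrp_minus[OF subgrp_grl rep_cls(2)[OF gbd_gch[OF ru1]]] subgrp_0[OF subgrp_grl, of T Y j] c(2)
      by (simp add: bu algebra_simps)
    have 2: "gmul T i (j - 1) (rep u) (gbd T j (rep v)) - gmul T i (j - 1) (rep u) (rep (bd (F Y) j v))
        \<in> grl T (prod_topology X Y) (n - 1)"
      using gmul_cong[OF ru1 ru1 gbd_gch[OF rv1] rep_cls(1)[OF gbd_gch[OF rv1]]]
        subgrp_minus[OF subgrp_grl rep_cls(2)[OF gbd_gch[OF rv1]]] subgrp_0[OF subgrp_grl, of T X i] c(2)
      by (simp add: bv algebra_simps)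
    have "ktens (frag_of (i, u, j, v)) = gmul T i j (rep u) (rep v)" for i u j v
      by (simp add: ktens_def)
    then have "?F (frag_of c) =
       (gmul T (i - 1) j (gbd T i (rep u)) (rep v) - gmul T (i - 1) j (rep (bd (F X) i u)) (rep v))
     + frag_cmul (koszul i 1)
         (gmul T i (j - 1) (rep u) (gbd T j (rep v)) - gmul T i (j - 1) (rep u) (rep (bd (F Y) j v)))"
      using gmul_bd[OF ru1 rv1] c(2)
      by (simp add: c(1) tens_bd_of zlin_add[OF zlin_ktens] zlin_cmul[OF zlin_ktens] frag_cmul_diff2)
    then show "?F (frag_of c) \<in> grl T (prod_topology X Y) (n - 1)"
      using subgrp_add[OF subgrp_grl 1 subgrp_cmul[OF subgrp_grl 2]] by simp
  qed
  then show ?thesis .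
qed

text \<open>Justifies \<open>the_elem\<close> in the description of \<open>\<kappa>\<close>: modulo
  relations \<open>ktens\<close> is constant on a coset, so the image of the coset has one
  element.\<close>

lemma \<kappa>_coset:
  assumes z: "z \<in> carrier (tens_free (F X) (F Y) n)"
  shows "\<kappa> X Y n (tens_rel (F X) (F Y) n #>\<^bsub>tens_free (F X) (F Y) n\<^esub> z) = cls2 (prod_topology X Y) n (ktens z)"
proof -
  interpret t: presented "\<lambda>n. carrier (tens_free (F X) (F Y) n)" "tens_rel (F X) (F Y)"
    "\<lambda>n. tens_bd (F X) (F Y)" "tensor (F X) (F Y)" "\<lambda>n z. tens_rel (F X) (F Y) n #>\<^bsub>tens_free (F X) (F Y) n\<^esub> z"
    by standard (rule tensor_presents[OF is_cx is_cx])
  have coset: "tens_rel (F X) (F Y) n #>\<^bsub>tens_free (F X) (F Y) n\<^esub> z = (\<lambda>h. h + z) ` tens_rel (F X) (F Y) n"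
    unfolding tens_free_def by (rule r_coset_free)
  have "cls2 (prod_topology X Y) n (ktens (h + z)) = cls2 (prod_topology X Y) n (ktens z)"
    if "h \<in> tens_rel (F X) (F Y) n" for h
    using ktens_grl[OF that] ktens_gch[OF z] ktens_gch[OF t.Rl_Ch[OF that]]
    by (simp add: PF2.cls_eq zlin_add[OF zlin_ktens] subgrp_add[OF subgrp_gch])
  then have im: "(\<lambda>z. cls2 (prod_topology X Y) n (ktens z)) ` ((\<lambda>h. h + z) ` tens_rel (F X) (F Y) n) =
      {cls2 (prod_topology X Y) n (ktens z)}"
    using subgrp_0[OF t.subgrp_Rl[of n]] by (auto simp: image_image image_iff)
  show ?thesis
    using t.cls_carrier[OF z] im by (simp add: \<kappa>_eq coset flip: ktens_def)
qed

lemma \<kappa>_hom: "\<kappa> X Y \<in> cx_hom (tensor (F X) (F Y)) (F2 (prod_topology X Y))"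
proof -
  interpret t: presented "\<lambda>n. carrier (tens_free (F X) (F Y) n)" "tens_rel (F X) (F Y)"
    "\<lambda>n. tens_bd (F X) (F Y)" "tensor (F X) (F Y)" "\<lambda>n z. tens_rel (F X) (F Y) n #>\<^bsub>tens_free (F X) (F Y) n\<^esub> z"
    by standard (rule tensor_presents[OF is_cx is_cx])
  interpret presented_map "\<lambda>n. carrier (tens_free (F X) (F Y) n)" "tens_rel (F X) (F Y)"
    "\<lambda>n. tens_bd (F X) (F Y)" "tensor (F X) (F Y)" "\<lambda>n z. tens_rel (F X) (F Y) n #>\<^bsub>tens_free (F X) (F Y) n\<^esub> z"
    "gch T (prod_topology X Y)" "grl T (prod_topology X Y)" "gbd T" "F2 (prod_topology X Y)" "cls2 (prod_topology X Y)"
    "\<lambda>n. ktens" "\<kappa> X Y"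
    by standard (use zlin_ktens ktens_gch ktens_bd \<kappa>_coset in \<open>auto simp: \<kappa>_eq\<close>)
  show ?thesis by (rule cx_hom)
qed

lemma pure_carrier:
  assumes "u \<in> carrier (grp (F X) i)" "v \<in> carrier (grp (F Y) j)"
  shows "pure_tensor (F X) (F Y) i u j v \<in> carrier (grp (tensor (F X) (F Y)) (i + j))"
    "frag_of (i, u, j, v) \<in> carrier (tens_free (F X) (F Y) (i + j))"
proof -
  interpret t: presented "\<lambda>n. carrier (tens_free (F X) (F Y) n)" "tens_rel (F X) (F Y)"
    "\<lambda>n. tens_bd (F X) (F Y)" "tensor (F X) (F Y)" "\<lambda>n z. tens_rel (F X) (F Y) n #>\<^bsub>tens_free (F X) (F Y) n\<^esub> z"
    by standard (rule tensor_presents[OF is_cx is_cx])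
  show 1: "frag_of (i, u, j, v) \<in> carrier (tens_free (F X) (F Y) (i + j))"
    using assms by (simp add: tens_free_def)
  show "pure_tensor (F X) (F Y) i u j v \<in> carrier (grp (tensor (F X) (F Y)) (i + j))"
    using t.cls_carrier[OF 1] by (simp add: pure_tensor_def)
qed

text \<open>The chosen representatives may be exchanged for any others. From here on the operadic
  identities can be computed with whatever representatives are convenient.\<close>

lemma \<kappa>_pure:
  assumes "x \<in> gch T X i" "y \<in> gch T Y j"
  shows "\<kappa> X Y (i + j) (pure_tensor (F X) (F Y) i (cls X i x) j (cls Y j y)) =
    cls2 (prod_topology X Y) (i + j) (gmul T i j x y)"
proof -
  have "\<kappa> X Y (i + j) (pure_tensor (F X) (F Y) i (cls X i x) j (cls Y j y)) =
     cls2 (prod_topology X Y) (i + j) (gmul T i j (rep (cls X i x)) (rep (cls Y j y)))"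
    unfolding pure_tensor_def
    by (subst \<kappa>_coset[OF pure_carrier(2)]) (simp_all add: PF.cls_carrier assms ktens_def)
  also have "\<dots> = cls2 (prod_topology X Y) (i + j) (gmul T i j x y)"
    using gmul_cong[OF rep_cls(1)[OF assms(1)] assms(1) rep_cls(1)[OF assms(2)] assms(2)
        rep_cls(2)[OF assms(1)] rep_cls(2)[OF assms(2)]]
    by (simp add: PF2.cls_eq gmul_gch rep_cls assms)
  finally show ?thesis .
qed

definition G :: "('l, 'x, 'a) modop_functor" where
  "G = induced_functor F Fm Fm2 \<kappa>"

lemma G_simps:
  "mo_obj (fun_ob G P) g I = F (mo_obj P g I)"
  "mo_act (fun_ob G P) g I \<sigma> = Fm (mo_obj P g I) (mo_obj P g (\<sigma> ` I)) (mo_act P g I \<sigma>)"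
  "mo_xi (fun_ob G P) g I a b = Fm (mo_obj P g (insert a (insert b I))) (mo_obj P (g + 1) I) (mo_xi P g I a b)"
  by (simp_all add: G_def induced_functor_def)

lemma G_circ:
  "mo_circ (fun_ob G P) g I a h J b =
     cx_comp (tensor (F (mo_obj P g (insert a I))) (F (mo_obj P h (insert b J))))
       (Fm2 (prod_topology (mo_obj P g (insert a I)) (mo_obj P h (insert b J))) (mo_obj P (g + h) (I \<union> J)) (mo_circ P g I a h J b))
       (\<kappa> (mo_obj P g (insert a I)) (mo_obj P h (insert b J)))"
  by (simp add: G_def induced_functor_def Let_def)

lemma G_circ_cls:
  assumes "mo_circ P g I a h J b \<in> top_hom (prod_topology X Y) Z"
    and "X = mo_obj P g (insert a I)" "Y = mo_obj P h (insert b J)" "Z = mo_obj P (g + h) (I \<union> J)"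
    and "x \<in> gch T X i" "y \<in> gch T Y j"
  shows "dg_circ (fun_ob G P) g I a h J b i (cls X i x) j (cls Y j y) =
    cls Z (i + j) (gpush T (i + j) (mo_circ P g I a h J b) (gmul T i j x y))"
  using assms(5,6) pure_carrier(1)[OF PF.cls_carrier[OF assms(5)] PF.cls_carrier[OF assms(6)]]
    Fm2_cls[OF assms(1) gmul_gch[OF assms(5,6)]]
  by (simp add: dg_circ_def G_circ G_simps cx_comp_def compose_def \<kappa>_pure flip: assms(2-4))

lemma cls_cmul_koszul:
  assumes "x \<in> gch T X n"
  shows "cls X n (frag_cmul (koszul i j) x) = cls X n x [^]\<^bsub>grp (F X) n\<^esub> koszul i j"
proof -
  have g: "group (grp (F X) n)" using PF.comm_group comm_group.axioms(2) by blast
  have "cls X n x [^]\<^bsub>grp (F X) n\<^esub> (- 1 :: int) = inv\<^bsub>grp (F X) n\<^esub> cls X n x"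
    using group.int_pow_neg[OF g PF.cls_carrier[OF assms], of 1] group.int_pow_1[OF g PF.cls_carrier[OF assms]] by simp
  then show ?thesis
    using PF.cls_minus[OF assms] group.int_pow_1[OF g PF.cls_carrier[OF assms]] by (simp add: koszul_def)
qed

end

lemma cx_hom_comp:
  assumes f: "f \<in> cx_hom A B" and g: "g \<in> cx_hom B C"
    and A: "\<And>n x. x \<in> carrier (grp A n) \<Longrightarrow> bd A n x \<in> carrier (grp A (n - 1))"
      "\<And>n x y. x \<in> carrier (grp A n) \<Longrightarrow> y \<in> carrier (grp A n) \<Longrightarrow> x \<otimes>\<^bsub>grp A n\<^esub> y \<in> carrier (grp A n)"
  shows "cx_comp A g f \<in> cx_hom A C"
proof -
  have f': "f n \<in> hom (grp A n) (grp B n)" "x \<in> carrier (grp A n) \<Longrightarrow> bd B n (f n x) = f (n - 1) (bd A n x)" for n x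
    using f by (auto simp: cx_hom_def)
  have g': "g n \<in> hom (grp B n) (grp C n)" "x \<in> carrier (grp B n) \<Longrightarrow> bd C n (g n x) = g (n - 1) (bd B n x)" for n x
    using g by (auto simp: cx_hom_def)
  note m = hom_in_carrier[OF f'(1)]
  show ?thesis
    unfolding cx_hom_def cx_comp_def
    by (auto intro!: homI simp: compose_def m hom_in_carrier[OF g'(1)] hom_mult[OF f'(1)] hom_mult[OF g'(1)] A f'(2) g'(2))
qed

section \<open>Stability and relabelling of index sets\<close>

lemma stable_image: "stable g I \<Longrightarrow> inj_on \<sigma> I \<Longrightarrow> stable g (\<sigma> ` I)"
  by (simp add: stable_def card_image)

lemma glueable_stable:
  assumes "glueable g I a h J b" shows "stable (g + h) (I \<union> J)"
  using assms unfolding glueable_def stable_def by (auto simp: card_Un_disjoint)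

lemma contractible_stable:
  assumes "contractible g I a b" shows "stable (g + 1) I"
  using assms unfolding contractible_def stable_def by auto

lemma glueable_image:
  assumes "glueable g I a h J b" "inj_on \<sigma> (insert a I)" "inj_on \<tau> (insert b J)" "\<sigma> ` I \<inter> \<tau> ` J = {}"
  shows "glueable g (\<sigma> ` I) (\<sigma> a) h (\<tau> ` J) (\<tau> b)"
proof -
  have "stable g (insert (\<sigma> a) (\<sigma> ` I))" "stable h (insert (\<tau> b) (\<tau> ` J))"
    using assms stable_image[of g "insert a I" \<sigma>] stable_image[of h "insert b J" \<tau>]
    by (simp_all add: glueable_def)
  moreover have "\<sigma> a \<notin> \<sigma> ` I" "\<tau> b \<notin> \<tau> ` J"
    using assms by (auto simp: glueable_def inj_on_def)
  ultimately show ?thesis using assms(4) by (simp add: glueable_def)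
qed

lemma contractible_image:
  assumes "contractible g I a b" "inj_on \<sigma> (insert a (insert b I))"
  shows "contractible g (\<sigma> ` I) (\<sigma> a) (\<sigma> b)"
proof -
  have "stable g (insert (\<sigma> a) (insert (\<sigma> b) (\<sigma> ` I)))"
    using assms stable_image[of g "insert a (insert b I)" \<sigma>] by (simp add: contractible_def)
  moreover have "\<sigma> a \<notin> \<sigma> ` I" "\<sigma> b \<notin> \<sigma> ` I" "\<sigma> a \<noteq> \<sigma> b"
    using assms by (auto simp: contractible_def inj_on_def)
  ultimately show ?thesis by (simp add: contractible_def)
qed

lemma glueable_sym: "glueable g I a h J b \<Longrightarrow> glueable h J b g I a"
  by (auto simp: glueable_def)

lemma join_on_image: "I \<inter> J = {} \<Longrightarrow> join_on I \<sigma> \<tau> ` (I \<union> J) = \<sigma> ` I \<union> \<tau> ` J"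
proof -
  assume "I \<inter> J = {}"
  then have "join_on I \<sigma> \<tau> ` I = \<sigma> ` I" "join_on I \<sigma> \<tau> ` J = \<tau> ` J"
    by (auto simp: join_on_def intro!: image_cong)
  then show ?thesis by (simp add: image_Un)
qed

lemma join_on_inj:
  "inj_on \<sigma> I \<Longrightarrow> inj_on \<tau> J \<Longrightarrow> I \<inter> J = {} \<Longrightarrow> \<sigma> ` I \<inter> \<tau> ` J = {} \<Longrightarrow> inj_on (join_on I \<sigma> \<tau>) (I \<union> J)"
proof -
  assume *: "inj_on \<sigma> I" "inj_on \<tau> J" "I \<inter> J = {}" "\<sigma> ` I \<inter> \<tau> ` J = {}"
  have "inj_on (join_on I \<sigma> \<tau>) I \<longleftrightarrow> inj_on \<sigma> I" "inj_on (join_on I \<sigma> \<tau>) J \<longleftrightarrow> inj_on \<tau> J"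
    by (rule inj_on_cong; use *(3) in \<open>auto simp: join_on_def\<close>)+
  moreover have "join_on I \<sigma> \<tau> ` I = \<sigma> ` I" "join_on I \<sigma> \<tau> ` J = \<tau> ` J"
    using *(3) by (auto simp: join_on_def intro!: image_cong)
  moreover have "I - J = I" "J - I = J" using *(3) by auto
  ultimately show ?thesis using * by (simp add: inj_on_Un)
qed

lemma top_hom_cont: "f \<in> top_hom X Y \<Longrightarrow> continuous_map X Y f"
  by (simp add: top_hom_def)

lemma gpush_gch': "f \<in> top_hom X Y \<Longrightarrow> x \<in> gch T X n \<Longrightarrow> gpush T n f x \<in> gch T Y n"
  by (rule gpush_gch) (auto simp: top_hom_def)

section \<open>The dg modular operad of chains of a topological modular operad\<close>

context lax_functor
begin

lemma gpush_gmul: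
  assumes "x \<in> gch T X i" "y \<in> gch T Y j"
  shows "gmul T i j (gpush T i f x) (gpush T j g y) = gpush T (i + j) (map_prod f g) (gmul T i j x y)"
proof (cases "i < 0 \<or> j < 0")
  case True
  then have "x = 0 \<or> y = 0" using assms by (auto simp: gch_def)
  then show ?thesis by (auto simp: zlin_0[OF zlin_gpush] zlin_0[OF zlin_gmul1] zlin_0[OF zlin_gmul2])
next
  case False
  then show ?thesis using gmul_gpush[of i j f x g y] by (simp add: gpush_def nat_add_distrib)
qed


lemma Fm2_\<kappa>_hom:
  assumes "f \<in> top_hom (prod_topology X Y) Z"
  shows "cx_comp (tensor (F X) (F Y)) (Fm2 (prod_topology X Y) Z f) (\<kappa> X Y) \<in> cx_hom (tensor (F X) (F Y)) (F Z)"
proof -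
  interpret t: presented "\<lambda>n. carrier (tens_free (F X) (F Y) n)" "tens_rel (F X) (F Y)"
    "\<lambda>n. tens_bd (F X) (F Y)" "tensor (F X) (F Y)" "\<lambda>n z. tens_rel (F X) (F Y) n #>\<^bsub>tens_free (F X) (F Y) n\<^esub> z"
    by standard (rule tensor_presents[OF is_cx is_cx])
  show ?thesis
    by (rule cx_hom_comp[OF \<kappa>_hom Fm2_hom[OF assms] hom_in_carrier[OF t.bd_hom]
          monoid.m_closed[OF comm_monoid.axioms(1)[OF comm_group.axioms(1)[OF t.comm_group]]]])
qed

context
  fixes P :: "('l, 'x) top_modop"
  assumes P: "is_top_modop P"
begin

text \<open>Names for the clauses of \<open>is_top_modop\<close>, in the order of that
  definition.\<close>

lemmas top_P = P[unfolded is_top_modop_def]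
lemmas t_act = top_P[THEN conjunct1]
lemmas top_P1 = top_P[THEN conjunct2]
lemmas t_circ = top_P1[THEN conjunct1]
lemmas top_P2 = top_P1[THEN conjunct2]
lemmas t_xi = top_P2[THEN conjunct1]
lemmas top_P3 = top_P2[THEN conjunct2]
lemmas t_act_cong = top_P3[THEN conjunct1]
lemmas top_P4 = top_P3[THEN conjunct2]
lemmas t_act_id = top_P4[THEN conjunct1]
lemmas top_P5 = top_P4[THEN conjunct2]
lemmas t_act_comp = top_P5[THEN conjunct1]
lemmas top_P6 = top_P5[THEN conjunct2]
lemmas t_circ_nat = top_P6[THEN conjunct1]
lemmas top_P7 = top_P6[THEN conjunct2]
lemmas t_xi_nat = top_P7[THEN conjunct1]
lemmas top_P8 = top_P7[THEN conjunct2]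
lemmas t_circ_sym = top_P8[THEN conjunct1]
lemmas top_P9 = top_P8[THEN conjunct2]
lemmas t_xi_sym = top_P9[THEN conjunct1]
lemmas top_P10 = top_P9[THEN conjunct2]
lemmas t_assoc = top_P10[THEN conjunct1]
lemmas top_P11 = top_P10[THEN conjunct2]
lemmas t_xixi = top_P11[THEN conjunct1]
lemmas top_P12 = top_P11[THEN conjunct2]
lemmas t_xicirc = top_P12[THEN conjunct1]
lemmas t_circcirc = top_P12[THEN conjunct2]

lemma act_hom: "stable g I \<Longrightarrow> inj_on \<sigma> I \<Longrightarrow> mo_act P g I \<sigma> \<in> top_hom (mo_obj P g I) (mo_obj P g (\<sigma> ` I))"
  using t_act by blast

lemma circ_hom: "glueable g I a h J b \<Longrightarrow> mo_circ P g I a h J b \<in>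
    top_hom (prod_topology (mo_obj P g (insert a I)) (mo_obj P h (insert b J))) (mo_obj P (g + h) (I \<union> J))"
  using t_circ by blast

lemma xi_hom: "contractible g I a b \<Longrightarrow>
    mo_xi P g I a b \<in> top_hom (mo_obj P g (insert a (insert b I))) (mo_obj P (g + 1) I)"
  using t_xi by blast

lemma G_act_cls:
  assumes "stable g I" "inj_on \<sigma> I" "x \<in> gch T (mo_obj P g I) n"
  shows "mo_act (fun_ob G P) g I \<sigma> n (cls (mo_obj P g I) n x) =
    cls (mo_obj P g (\<sigma> ` I)) n (gpush T n (mo_act P g I \<sigma>) x)"
  by (simp add: G_simps Fm_cls[OF act_hom[OF assms(1,2)] assms(3)])

lemma G_xi_cls:
  assumes "contractible g I a b" "X = mo_obj P g (insert a (insert b I))" "x \<in> gch T X n"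
  shows "mo_xi (fun_ob G P) g I a b n (cls X n x) = cls (mo_obj P (g + 1) I) n (gpush T n (mo_xi P g I a b) x)"
  using Fm_cls[OF xi_hom[OF assms(1)], of x n] assms(2,3) by (simp add: G_simps)

lemma G_circ_cls':
  assumes "glueable g I a h J b"
    and "X = mo_obj P g (insert a I)" "Y = mo_obj P h (insert b J)"
    and "x \<in> gch T X i" "y \<in> gch T Y j"
  shows "dg_circ (fun_ob G P) g I a h J b i (cls X i x) j (cls Y j y) =
    cls (mo_obj P (g + h) (I \<union> J)) (i + j) (gpush T (i + j) (mo_circ P g I a h J b) (gmul T i j x y))"
  by (rule G_circ_cls) (use circ_hom[OF assms(1)] assms in auto)

text \<open>On classes of chains each axiom becomes an equation between push-forwards along
  continuous maps, and \<open>gpush_cong\<close> reduces it to the axiom for points. The product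
  enters through naturality, through \<open>gmul_assoc\<close> for the change of brackets, and
  through \<open>gmul_sym\<close>, the source of the Koszul sign.\<close>

lemma G_dg_modop: "is_dg_modop (fun_ob G P)"
  unfolding is_dg_modop_def
proof (intro conjI allI impI ballI, goal_cases)
  case (1 g I)
  show ?case by (simp add: G_simps bounded_below)
next
  case (2 g I \<sigma>)
  show ?case
    unfolding G_simps by (rule Fm_hom[OF act_hom[OF conjunct1[OF 2] conjunct2[OF 2]]])
next
  case (3 g I a h J b)
  show ?case
    unfolding G_circ G_simps by (rule Fm2_\<kappa>_hom[OF circ_hom[OF 3]])
next
  case (4 g I a b)
  then show ?case unfolding G_simps by (intro Fm_hom xi_hom)
next
  case (5 g I \<sigma> \<tau>)
  then have "mo_act P g I \<sigma> = mo_act P g I \<tau>" "\<sigma> ` I = \<tau> ` I" using t_act_cong by (blast, auto)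
  then show ?case unfolding G_simps by simp
next
  case (6 g I i u)
  then obtain x where x: "x \<in> gch T (mo_obj P g I) i" "u = cls (mo_obj P g I) i x"
    unfolding G_simps by (elim PF.cls_obtain)
  have "gpush T i (mo_act P g I id) x = x"
    by (rule gpush_id[OF x(1)]) (use t_act_id 6 in blast)
  then show ?case using G_act_cls[OF 6(1) inj_on_id x(1)] x by simp
next
  case (7 g I \<sigma> \<tau> i u)
  then obtain x where x: "x \<in> gch T (mo_obj P g I) i" "u = cls (mo_obj P g I) i x"
    unfolding G_simps by (elim PF.cls_obtain)
  have s: "stable g I" "inj_on \<sigma> I" "inj_on \<tau> (\<sigma> ` I)" using 7 by auto
  have "gpush T i (mo_act P g I (\<tau> \<circ> \<sigma>)) x = gpush T i (mo_act P g (\<sigma> ` I) \<tau>) (gpush T i (mo_act P g I \<sigma>) x)"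
    unfolding gpush_gpush by (rule gpush_cong[OF x(1)]) (use t_act_comp s in \<open>auto simp: o_def\<close>)
  then show ?case
    using G_act_cls[OF s(1) comp_inj_on[OF s(2,3)] x(1)] G_act_cls[OF s(1,2) x(1)]
      G_act_cls[OF stable_image[OF s(1,2)] s(3) gpush_gch'[OF act_hom[OF s(1,2)] x(1)]]
    by (simp add: x(2) image_comp)
next
  case (8 g I a h J b \<sigma> \<tau> i j u v)
  let ?X = "mo_obj P g (insert a I)" and ?Y = "mo_obj P h (insert b J)"
  have s: "glueable g I a h J b" "inj_on \<sigma> (insert a I)" "inj_on \<tau> (insert b J)" "\<sigma> ` I \<inter> \<tau> ` J = {}"
    using 8 by auto
  have st: "stable g (insert a I)" "stable h (insert b J)" "I \<inter> J = {}" using s(1) by (auto simp: glueable_def)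
  have inj: "inj_on (join_on I \<sigma> \<tau>) (I \<union> J)"
    by (rule join_on_inj) (use s st in \<open>auto intro: inj_on_subset\<close>)
  obtain x where x: "x \<in> gch T ?X i" "u = cls ?X i x" using 8(2) unfolding G_simps by (elim PF.cls_obtain)
  obtain y where y: "y \<in> gch T ?Y j" "v = cls ?Y j y" using 8(3) unfolding G_simps by (elim PF.cls_obtain)
  note gx = gpush_gch'[OF act_hom[OF st(1) s(2)] x(1)] and gy = gpush_gch'[OF act_hom[OF st(2) s(3)] y(1)]
  note C = G_circ_cls'[OF s(1) refl refl x(1) y(1)]
  note C' = G_circ_cls'[OF glueable_image[OF s] _ _ gx gy]
  have eq: "gpush T (i + j) (mo_circ P g (\<sigma> ` I) (\<sigma> a) h (\<tau> ` J) (\<tau> b))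
      (gmul T i j (gpush T i (mo_act P g (insert a I) \<sigma>) x) (gpush T j (mo_act P h (insert b J) \<tau>) y)) =
    gpush T (i + j) (mo_act P (g + h) (I \<union> J) (join_on I \<sigma> \<tau>)) (gpush T (i + j) (mo_circ P g I a h J b) (gmul T i j x y))"
    unfolding gpush_gmul[OF x(1) y(1)] gpush_gpush
    by (rule gpush_cong[OF gmul_gch[OF x(1) y(1)]]) (use t_circ_nat s in auto)
  show ?case
    unfolding x(2) y(2) G_act_cls[OF st(1) s(2) x(1)] G_act_cls[OF st(2) s(3) y(1)] C
    using C' G_act_cls[OF glueable_stable[OF s(1)] inj gpush_gch'[OF circ_hom[OF s(1)] gmul_gch[OF x(1) y(1)]]]
    by (simp add: eq join_on_image[OF st(3)])
next
  case (9 g I a b \<sigma> i u)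
  let ?X = "mo_obj P g (insert a (insert b I))"
  have s: "contractible g I a b" "inj_on \<sigma> (insert a (insert b I))" using 9 by auto
  have st: "stable g (insert a (insert b I))" "inj_on \<sigma> I" using s by (auto simp: contractible_def intro: inj_on_subset)
  obtain x where x: "x \<in> gch T ?X i" "u = cls ?X i x" using 9(2) unfolding G_simps by (elim PF.cls_obtain)
  have eq: "gpush T i (mo_xi P g (\<sigma> ` I) (\<sigma> a) (\<sigma> b)) (gpush T i (mo_act P g (insert a (insert b I)) \<sigma>) x) =
      gpush T i (mo_act P (g + 1) I \<sigma>) (gpush T i (mo_xi P g I a b) x)"
    unfolding gpush_gpush by (rule gpush_cong[OF x(1)]) (use t_xi_nat s in auto)
  show ?case
    unfolding x(2) G_act_cls[OF st(1) s(2) x(1)] G_xi_cls[OF s(1) refl x(1)]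
    using G_xi_cls[OF contractible_image[OF s] _ gpush_gch'[OF act_hom[OF st(1) s(2)] x(1)]]
      G_act_cls[OF contractible_stable[OF s(1)] st(2) gpush_gch'[OF xi_hom[OF s(1)] x(1)]]
    by (simp add: eq)
next
  case (10 g I a h J b i j u v)
  let ?X = "mo_obj P g (insert a I)" and ?Y = "mo_obj P h (insert b J)" and ?Z = "mo_obj P (g + h) (I \<union> J)"
  note s = 10(1)
  obtain x where x: "x \<in> gch T ?X i" "u = cls ?X i x" using 10(2) unfolding G_simps by (elim PF.cls_obtain)
  obtain y where y: "y \<in> gch T ?Y j" "v = cls ?Y j y" using 10(3) unfolding G_simps by (elim PF.cls_obtain)
  let ?c = "mo_circ P g I a h J b" and ?c' = "mo_circ P h J b g I a"
  have obj: "mo_obj P (h + g) (J \<union> I) = ?Z" by (simp add: add.commute Un_commute)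
  have c': "?c' \<in> top_hom (prod_topology ?Y ?X) ?Z"
    using circ_hom[OF glueable_sym[OF s]] by (simp add: obj)
  have yx: "gmul T j i y x \<in> gch T (prod_topology ?Y ?X) (i + j)"
    using gmul_gch[OF y(1) x(1)] by (simp add: add.commute)
  \<comment> \<open>On points, symmetry says that one gluing is the other one after a swap. On
    chains the swap is evaluated by \<open>gmul_sym\<close>, at the price of a sign and of a
    relation.\<close>
  have "gpush T (i + j) ?c (gmul T i j x y) = gpush T (i + j) ?c' (gpush T (i + j) prod.swap (gmul T i j x y))"
    unfolding gpush_gpush
  proof (rule gpush_cong[OF gmul_gch[OF x(1) y(1)]])
    fix q assume "q \<in> topspace (prod_topology ?X ?Y)"
    then obtain a b where "q = (a, b)" "a \<in> topspace ?X" "b \<in> topspace ?Y" by auto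
    then show "?c q = (?c' \<circ> prod.swap) q" using t_circ_sym s by (simp only: o_apply swap_simp) blast
  qed
  then have "gpush T (i + j) ?c (gmul T i j x y) - frag_cmul (koszul i j) (gpush T (i + j) ?c' (gmul T j i y x)) =
      gpush T (i + j) ?c' (gpush T (i + j) prod.swap (gmul T i j x y) - frag_cmul (koszul i j) (gmul T j i y x))"
    by (simp add: zlin_diff[OF zlin_gpush] zlin_cmul[OF zlin_gpush])
  also have "\<dots> \<in> grl T ?Z (i + j)"
    by (rule gpush_grl[OF gmul_sym[OF x(1) y(1)] top_hom_cont[OF c']])
  finally have "cls ?Z (i + j) (gpush T (i + j) ?c (gmul T i j x y)) =
      cls ?Z (i + j) (frag_cmul (koszul i j) (gpush T (i + j) ?c' (gmul T j i y x)))"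
    using gpush_gch'[OF circ_hom[OF s] gmul_gch[OF x(1) y(1)]] subgrp_cmul[OF subgrp_gch gpush_gch'[OF c' yx]]
    by (simp add: PF.cls_eq)
  then show ?case
    unfolding x(2) y(2) G_circ_cls'[OF s refl refl x(1) y(1)] cls_cmul_koszul[OF gpush_gch'[OF c' yx]]
    using G_circ_cls'[OF glueable_sym[OF s] refl refl y(1) x(1)] by (simp add: G_simps add.commute Un_commute)
next
  case (11 g I a b)
  then have "mo_xi P g I a b = mo_xi P g I b a" using t_xi_sym by blast
  then show ?case unfolding G_simps by (simp add: insert_commute)
next
  case (12 g I a h J b c k K d i j m u v w)
  let ?X = "mo_obj P g (insert a I)" and ?Y = "mo_obj P h (insert b (insert c J))" and ?Z = "mo_obj P k (insert d K)"
  have s: "glueable g I a h (insert c J) b" "glueable (g + h) (I \<union> J) c k K d"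
    "glueable h (insert b J) c k K d" "glueable g I a (h + k) (J \<union> K) b" using 12 by auto
  obtain x where x: "x \<in> gch T ?X i" "u = cls ?X i x" using 12(2) unfolding G_simps by (elim PF.cls_obtain)
  obtain y where y: "y \<in> gch T ?Y j" "v = cls ?Y j y" using 12(3) unfolding G_simps by (elim PF.cls_obtain)
  obtain z where z: "z \<in> gch T ?Z m" "w = cls ?Z m z" using 12(4) unfolding G_simps by (elim PF.cls_obtain)
  let ?c1 = "mo_circ P g I a h (insert c J) b" and ?c2 = "mo_circ P (g + h) (I \<union> J) c k K d"
  let ?c3 = "mo_circ P h (insert b J) c k K d" and ?c4 = "mo_circ P g I a (h + k) (J \<union> K) b"
  have e1: "I \<union> insert c J = insert c (I \<union> J)" "insert b J \<union> K = insert b (J \<union> K)" "insert c (insert b J) = insert b (insert c J)"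
    by auto
  have c1: "?c1 \<in> top_hom (prod_topology ?X ?Y) (mo_obj P (g + h) (insert c (I \<union> J)))"
    using circ_hom[OF s(1)] by (simp add: e1)
  have c3: "?c3 \<in> top_hom (prod_topology ?Y ?Z) (mo_obj P (h + k) (insert b (J \<union> K)))"
    using circ_hom[OF s(3)] by (simp add: e1)
  note g1 = gpush_gch'[OF c1 gmul_gch[OF x(1) y(1)]]
  note g3 = gpush_gch'[OF c3 gmul_gch[OF y(1) z(1)]]
  have C1: "dg_circ (fun_ob G P) g I a h (insert c J) b i u j v =
      cls (mo_obj P (g + h) (insert c (I \<union> J))) (i + j) (gpush T (i + j) ?c1 (gmul T i j x y))"
    using G_circ_cls'[OF s(1) refl refl x(1) y(1)] by (simp add: x y e1)
  have C3: "dg_circ (fun_ob G P) h (insert b J) c k K d j v m w =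
      cls (mo_obj P (h + k) (insert b (J \<union> K))) (j + m) (gpush T (j + m) ?c3 (gmul T j m y z))"
    using G_circ_cls'[OF s(3) _ refl y(1) z(1)] by (simp add: y z e1)
  \<comment> \<open>Both gluings are first moved outside the threefold product; there the axiom for
    points applies to the composite maps, and rebracketing the product accounts for the
    rest.\<close>
  have "gpush T (i + j + m) ?c2 (gmul T (i + j) m (gpush T (i + j) ?c1 (gmul T i j x y)) z) =
      gpush T (i + j + m) ?c2 (gpush T (i + j + m) (map_prod ?c1 id) (gmul T (i + j) m (gmul T i j x y) z))"
    using gpush_gmul[OF gmul_gch[OF x(1) y(1)] z(1), of ?c1 id] gpush_id[OF z(1), of id] by simp
  also have "\<dots> = gpush T (i + j + m) ?c4 (gpush T (i + j + m) (map_prod id ?c3)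
      (gpush T (i + j + m) (\<lambda>((x, y), z). (x, (y, z))) (gmul T (i + j) m (gmul T i j x y) z)))"
    unfolding gpush_gpush
    by (rule gpush_cong[OF gmul_gch[OF gmul_gch[OF x(1) y(1)] z(1)]]) (use t_assoc s in \<open>auto simp: e1\<close>)
  also have "\<dots> = gpush T (i + j + m) ?c4 (gmul T i (j + m) x (gpush T (j + m) ?c3 (gmul T j m y z)))"
    using gpush_gmul[OF x(1) gmul_gch[OF y(1) z(1)], of id ?c3] gpush_id[OF x(1), of id]
    unfolding gmul_assoc[OF x(1) y(1) z(1)] by (simp add: add.assoc)
  finally show ?case
    unfolding C1 C3 using G_circ_cls'[OF s(2) refl refl g1 z(1)] G_circ_cls'[OF s(4) refl refl x(1) g3]
    by (simp add: x z add.assoc Un_assoc)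
next
  case (13 g I a b c d i u)
  let ?X = "mo_obj P g (insert a (insert b (insert c (insert d I))))"
  have s: "contractible g (insert c (insert d I)) a b" "contractible g (insert a (insert b I)) c d" using 13 by auto
  have s': "contractible (g + 1) I a b" "contractible (g + 1) I c d"
    using s contractible_stable[OF s(1)] contractible_stable[OF s(2)] by (auto simp: contractible_def)
  have X: "?X = mo_obj P g (insert c (insert d (insert a (insert b I))))" by (simp add: insert_commute)
  obtain x where x: "x \<in> gch T ?X i" "u = cls ?X i x" using 13(2) unfolding G_simps by (elim PF.cls_obtain)
  have g2: "gpush T i (mo_xi P g (insert a (insert b I)) c d) x \<in> gch T (mo_obj P (g + 1) (insert a (insert b I))) i"
    by (rule gpush_gch'[OF xi_hom[OF s(2)] x(1)[unfolded X]])
  note g1 = gpush_gch'[OF xi_hom[OF s(1)] x(1)]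
  have "gpush T i (mo_xi P (g + 1) I a b) (gpush T i (mo_xi P g (insert a (insert b I)) c d) x) =
      gpush T i (mo_xi P (g + 1) I c d) (gpush T i (mo_xi P g (insert c (insert d I)) a b) x)"
    unfolding gpush_gpush by (rule gpush_cong[OF x(1)]) (use t_xixi s in \<open>simp only: o_apply; blast\<close>)
  then show ?case
    using G_xi_cls[OF s(2) X x(1)] G_xi_cls[OF s(1) refl x(1)] G_xi_cls[OF s'(1) refl g2] G_xi_cls[OF s'(2) refl g1]
    by (simp add: x(2))
next
  case (14 g I a h J b c d i j u v)
  let ?X = "mo_obj P g (insert a (insert c (insert d I)))" and ?Y = "mo_obj P h (insert b J)"
  have s: "glueable g (insert c (insert d I)) a h J b" "contractible (g + h) (I \<union> J) c d" using 14 by auto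
  have s': "contractible g (insert a I) c d"
    using s by (auto simp: contractible_def glueable_def insert_commute)
  have s'': "glueable (g + 1) I a h J b"
    using s contractible_stable[OF s'] by (auto simp: glueable_def)
  have X: "?X = mo_obj P g (insert c (insert d (insert a I)))" by (simp add: insert_commute)
  have e: "insert c (insert d I) \<union> J = insert c (insert d (I \<union> J))" by auto
  obtain x where x: "x \<in> gch T ?X i" "u = cls ?X i x" using 14(2) unfolding G_simps by (elim PF.cls_obtain)
  obtain y where y: "y \<in> gch T ?Y j" "v = cls ?Y j y" using 14(3) unfolding G_simps by (elim PF.cls_obtain)
  let ?c = "mo_circ P g (insert c (insert d I)) a h J b"
  have c: "?c \<in> top_hom (prod_topology ?X ?Y) (mo_obj P (g + h) (insert c (insert d (I \<union> J))))"
    using circ_hom[OF s(1)] by (simp add: e)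
  have g1: "gpush T i (mo_xi P g (insert a I) c d) x \<in> gch T (mo_obj P (g + 1) (insert a I)) i"
    by (rule gpush_gch'[OF xi_hom[OF s'] x(1)[unfolded X]])
  note g2 = gpush_gch'[OF c gmul_gch[OF x(1) y(1)]]
  have "gpush T (i + j) (mo_circ P (g + 1) I a h J b) (gmul T i j (gpush T i (mo_xi P g (insert a I) c d) x) y) =
      gpush T (i + j) (mo_circ P (g + 1) I a h J b) (gpush T (i + j) (map_prod (mo_xi P g (insert a I) c d) id) (gmul T i j x y))"
    using gpush_gmul[OF x(1) y(1), of "mo_xi P g (insert a I) c d" id] gpush_id[OF y(1), of id] by simp
  also have "\<dots> = gpush T (i + j) (mo_xi P (g + h) (I \<union> J) c d) (gpush T (i + j) ?c (gmul T i j x y))"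
    unfolding gpush_gpush by (rule gpush_cong[OF gmul_gch[OF x(1) y(1)]]) (use t_xicirc s in auto)
  finally show ?case
    using G_circ_cls'[OF s(1) refl refl x(1) y(1)] G_xi_cls[OF s' X x(1)]
      G_circ_cls'[OF s'' refl refl g1 y(1)] G_xi_cls[OF s(2) refl g2]
    by (simp add: x(2) y(2) e)
next
  case (15 g I a c h J b d i j u v)
  let ?X = "mo_obj P g (insert a (insert c I))" and ?Y = "mo_obj P h (insert b (insert d J))"
  have s: "glueable g (insert c I) a h (insert d J) b" "glueable g (insert a I) c h (insert b J) d"
    "contractible (g + h) (I \<union> J) c d" "contractible (g + h) (I \<union> J) a b" using 15 by auto
  have X: "?X = mo_obj P g (insert c (insert a I))" "?Y = mo_obj P h (insert d (insert b J))" by (simp_all add: insert_commute)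
  have e: "insert c I \<union> insert d J = insert c (insert d (I \<union> J))" "insert a I \<union> insert b J = insert a (insert b (I \<union> J))" by auto
  obtain x where x: "x \<in> gch T ?X i" "u = cls ?X i x" using 15(2) unfolding G_simps by (elim PF.cls_obtain)
  obtain y where y: "y \<in> gch T ?Y j" "v = cls ?Y j y" using 15(3) unfolding G_simps by (elim PF.cls_obtain)
  let ?c1 = "mo_circ P g (insert c I) a h (insert d J) b" and ?c2 = "mo_circ P g (insert a I) c h (insert b J) d"
  have c1: "?c1 \<in> top_hom (prod_topology ?X ?Y) (mo_obj P (g + h) (insert c (insert d (I \<union> J))))"
    using circ_hom[OF s(1)] by (simp only: e)
  have c2: "?c2 \<in> top_hom (prod_topology ?X ?Y) (mo_obj P (g + h) (insert a (insert b (I \<union> J))))"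
    using circ_hom[OF s(2)] by (simp only: e X)
  note g1 = gpush_gch'[OF c1 gmul_gch[OF x(1) y(1)]] and g2 = gpush_gch'[OF c2 gmul_gch[OF x(1) y(1)]]
  have "gpush T (i + j) (mo_xi P (g + h) (I \<union> J) c d) (gpush T (i + j) ?c1 (gmul T i j x y)) =
      gpush T (i + j) (mo_xi P (g + h) (I \<union> J) a b) (gpush T (i + j) ?c2 (gmul T i j x y))"
    unfolding gpush_gpush
  proof (rule gpush_cong[OF gmul_gch[OF x(1) y(1)]])
    fix q assume "q \<in> topspace (prod_topology ?X ?Y)"
    then obtain p r where "q = (p, r)" "p \<in> topspace ?X" "r \<in> topspace ?Y" by auto
    then show "(mo_xi P (g + h) (I \<union> J) c d \<circ> ?c1) q = (mo_xi P (g + h) (I \<union> J) a b \<circ> ?c2) q"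
      using t_circcirc s by (simp only: o_apply)
  qed
  then show ?case
    using G_circ_cls'[OF s(1) refl refl x(1) y(1)] G_circ_cls'[OF s(2) X x(1) y(1)]
      G_xi_cls[OF s(3) refl g1] G_xi_cls[OF s(4) refl g2]
    by (simp only: x(2) y(2) e)
qed

end

end

section \<open>Morphisms of modular operads and functoriality\<close>

context lax_functor
begin

lemma cls_ext_eq:
  assumes "f \<in> extensional (carrier (grp (F X) n))" "g \<in> extensional (carrier (grp (F X) n))"
    "\<And>x. x \<in> gch T X n \<Longrightarrow> f (cls X n x) = g (cls X n x)"
  shows "f = g"
  by (rule extensionalityI[OF assms(1,2)]) (use assms(3) in \<open>auto elim!: PF.cls_obtain\<close>)

lemma G_mor: "fun_mor G P Q f g I =
    (if stable g I then Fm (mo_obj P g I) (mo_obj Q g I) (f g I) else undefined)"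
  by (simp add: G_def induced_functor_def)

lemma G_mor_hom:
  assumes P: "is_top_modop P" and Q: "is_top_modop Q" and f: "f \<in> top_modop_hom P Q"
  shows "fun_mor G P Q f \<in> dg_modop_hom (fun_ob G P) (fun_ob G Q)"
proof -
  note f1 = f[unfolded top_modop_hom_def mem_Collect_eq, THEN conjunct1]
  note f2 = f[unfolded top_modop_hom_def mem_Collect_eq, THEN conjunct2, THEN conjunct1]
  note f3 = f[unfolded top_modop_hom_def mem_Collect_eq, THEN conjunct2, THEN conjunct2, THEN conjunct1]
  note f4 = f[unfolded top_modop_hom_def mem_Collect_eq, THEN conjunct2, THEN conjunct2, THEN conjunct2]
  have fh: "f g I \<in> top_hom (mo_obj P g I) (mo_obj Q g I)" if "stable g I" for g I
    using f1 that by metis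
  have mor: "fun_mor G P Q f g I n (cls (mo_obj P g I) n x) = cls (mo_obj Q g I) n (gpush T n (f g I) x)"
    if "stable g I" "x \<in> gch T (mo_obj P g I) n" for g I n x
    using Fm_cls[OF fh[OF that(1)] that(2)] that(1) by (simp only: G_mor if_True)
  show ?thesis
    unfolding dg_modop_hom_def mem_Collect_eq
  proof (intro conjI allI impI ballI, goal_cases)
    case (1 g I)
    then show ?case using Fm_hom[OF fh] by (simp add: G_mor G_simps)
  next
    case (2 g I \<sigma> i u)
    have s: "stable g I" "inj_on \<sigma> I" using 2 by auto
    obtain x where x: "x \<in> gch T (mo_obj P g I) i" "u = cls (mo_obj P g I) i x"
      using 2(2) unfolding G_simps by (elim PF.cls_obtain)
    note a = act_hom[OF P s] and a' = act_hom[OF Q s]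
    have "gpush T i (f g (\<sigma> ` I)) (gpush T i (mo_act P g I \<sigma>) x) = gpush T i (mo_act Q g I \<sigma>) (gpush T i (f g I) x)"
      unfolding gpush_gpush by (rule gpush_cong[OF x(1)]) (use f2 s in \<open>simp only: o_apply\<close>)
    then show ?case
      unfolding x(2) G_act_cls[OF P s x(1)] mor[OF s(1) x(1)] mor[OF stable_image[OF s] gpush_gch'[OF a x(1)]]
        G_act_cls[OF Q s gpush_gch'[OF fh[OF s(1)] x(1)]] by simp
  next
    case (3 g I a h J b i j u v)
    let ?X = "mo_obj P g (insert a I)" and ?Y = "mo_obj P h (insert b J)"
    have s: "stable g (insert a I)" "stable h (insert b J)" using 3(1) by (auto simp: glueable_def)
    obtain x where x: "x \<in> gch T ?X i" "u = cls ?X i x" using 3(2) unfolding G_simps by (elim PF.cls_obtain)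
    obtain y where y: "y \<in> gch T ?Y j" "v = cls ?Y j y" using 3(3) unfolding G_simps by (elim PF.cls_obtain)
    note c = circ_hom[OF P 3(1)] and c' = circ_hom[OF Q 3(1)]
    have "gpush T (i + j) (f (g + h) (I \<union> J)) (gpush T (i + j) (mo_circ P g I a h J b) (gmul T i j x y)) =
        gpush T (i + j) (mo_circ Q g I a h J b) (gmul T i j (gpush T i (f g (insert a I)) x) (gpush T j (f h (insert b J)) y))"
      unfolding gpush_gmul[OF x(1) y(1)] gpush_gpush
    proof (rule gpush_cong[OF gmul_gch[OF x(1) y(1)]])
      fix q assume "q \<in> topspace (prod_topology ?X ?Y)"
      then obtain p r where "q = (p, r)" "p \<in> topspace ?X" "r \<in> topspace ?Y" by auto
      then show "(f (g + h) (I \<union> J) \<circ> mo_circ P g I a h J b) q =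
          (mo_circ Q g I a h J b \<circ> map_prod (f g (insert a I)) (f h (insert b J))) q"
        using f3 3(1) by (simp only: o_apply map_prod_simp)
    qed
    then show ?case
      unfolding x(2) y(2) G_circ_cls'[OF P 3(1) refl refl x(1) y(1)] mor[OF s(1) x(1)] mor[OF s(2) y(1)]
        mor[OF glueable_stable[OF 3(1)] gpush_gch'[OF c gmul_gch[OF x(1) y(1)]]]
        G_circ_cls'[OF Q 3(1) refl refl gpush_gch'[OF fh[OF s(1)] x(1)] gpush_gch'[OF fh[OF s(2)] y(1)]]
      by simp
  next
    case (4 g I a b i u)
    let ?X = "mo_obj P g (insert a (insert b I))"
    have s: "stable g (insert a (insert b I))" using 4(1) by (simp add: contractible_def)
    obtain x where x: "x \<in> gch T ?X i" "u = cls ?X i x" using 4(2) unfolding G_simps by (elim PF.cls_obtain)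
    note a = xi_hom[OF P 4(1)]
    have "gpush T i (f (g + 1) I) (gpush T i (mo_xi P g I a b) x) =
        gpush T i (mo_xi Q g I a b) (gpush T i (f g (insert a (insert b I))) x)"
      unfolding gpush_gpush by (rule gpush_cong[OF x(1)]) (use f4 4(1) in \<open>simp only: o_apply\<close>)
    then show ?case
      unfolding x(2) G_xi_cls[OF P 4(1) refl x(1)] mor[OF s x(1)]
        mor[OF contractible_stable[OF 4(1)] gpush_gch'[OF a x(1)]]
        G_xi_cls[OF Q 4(1) refl gpush_gch'[OF fh[OF s] x(1)]] by simp
  qed
qed

lemma id_top_hom: "restrict (\<lambda>x. x) (topspace X) \<in> top_hom X X"
  using continuous_map_eq[OF continuous_map_id, of X "restrict (\<lambda>x. x) (topspace X)"] by (simp add: top_hom_def)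

lemma compose_top_hom:
  assumes "f \<in> top_hom X Y" "f' \<in> top_hom Y Z" shows "compose (topspace X) f' f \<in> top_hom X Z"
  using continuous_map_eq[OF continuous_map_compose[OF top_hom_cont[OF assms(1)] top_hom_cont[OF assms(2)]],
      of "compose (topspace X) f' f"]
  by (simp add: top_hom_def compose_def)

lemma G_is_functor: "is_modop_functor (G :: ('l, 'x, 'a) modop_functor)"
  unfolding is_modop_functor_def
proof (intro conjI allI impI)
  fix P :: "('l, 'x) top_modop" assume P: "is_top_modop P"
  show "is_dg_modop (fun_ob G P)" by (rule G_dg_modop[OF P])
  have "Fm X X (restrict (\<lambda>x. x) (topspace X)) n = cx_id (F X) n" for X n
  proof (rule cls_ext_eq[OF Fm_ext[OF id_top_hom]])
    fix x assume "x \<in> gch T X n"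
    then show "Fm X X (restrict (\<lambda>x. x) (topspace X)) n (cls X n x) = cx_id (F X) n (cls X n x)"
      by (simp add: Fm_cls[OF id_top_hom] gpush_id cx_id_def PF.cls_carrier)
  qed (simp add: cx_id_def)
  then show "fun_mor G P P (top_modop_id P) = dg_modop_id (fun_ob G P)"
    by (simp add: fun_eq_iff G_mor top_modop_id_def dg_modop_id_def G_simps)
next
  fix P Q :: "('l, 'x) top_modop" and f assume "is_top_modop P \<and> is_top_modop Q \<and> f \<in> top_modop_hom P Q"
  then show "fun_mor G P Q f \<in> dg_modop_hom (fun_ob G P) (fun_ob G Q)" using G_mor_hom by blast
next
  fix P Q R :: "('l, 'x) top_modop" and f f'
  assume *: "is_top_modop P \<and> is_top_modop Q \<and> is_top_modop R \<and> f \<in> top_modop_hom P Q \<and> f' \<in> top_modop_hom Q R"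
  have fh: "f g I \<in> top_hom (mo_obj P g I) (mo_obj Q g I)" "f' g I \<in> top_hom (mo_obj Q g I) (mo_obj R g I)"
    if "stable g I" for g I
    using * that unfolding top_modop_hom_def mem_Collect_eq by metis+
  have "Fm X Z (compose (topspace X) k' k) n = cx_comp (F X) (Fm Y Z k') (Fm X Y k) n"
    if k: "k \<in> top_hom X Y" "k' \<in> top_hom Y Z" for X Y Z k k' n
  proof (rule cls_ext_eq[OF Fm_ext[OF compose_top_hom[OF k]]])
    fix x assume x: "x \<in> gch T X n"
    have eq: "gpush T n (compose (topspace X) k' k) x = gpush T n k' (gpush T n k x)"
      unfolding gpush_gpush by (rule gpush_cong[OF x]) (simp add: compose_def)
    show "Fm X Z (compose (topspace X) k' k) n (cls X n x) = cx_comp (F X) (Fm Y Z k') (Fm X Y k) n (cls X n x)"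
      unfolding Fm_cls[OF compose_top_hom[OF k] x] eq cx_comp_def compose_eq[OF PF.cls_carrier[OF x]]
        Fm_cls[OF k(1) x] Fm_cls[OF k(2) gpush_gch'[OF k(1) x]] ..
  qed (simp add: cx_comp_def)
  then have "fun_mor G P R (top_modop_comp P f' f) g I = dg_modop_comp (fun_ob G P) (fun_mor G Q R f') (fun_mor G P Q f) g I" for g I
    using fh[of g I] by (cases "stable g I") (simp_all add: G_mor top_modop_comp_def dg_modop_comp_def G_simps fun_eq_iff)
  then show "fun_mor G P R (top_modop_comp P f' f) = dg_modop_comp (fun_ob G P) (fun_mor G Q R f') (fun_mor G P Q f)"
    by (rule ext[OF ext])
qed

end

section \<open>Comparison of two multiplicative theories\<close>

definition gact :: "cell_data \<Rightarrow> (nat \<Rightarrow> vec chain) \<Rightarrow> int \<Rightarrow> 'x chain \<Rightarrow> 'x chain" where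
  "gact B e n = act (mdl B (nat n)) (e (nat n))"

definition hact :: "cell_data \<Rightarrow> (nat \<Rightarrow> vec chain) \<Rightarrow> int \<Rightarrow> 'x chain \<Rightarrow> 'x chain" where
  "hact B h n = act (mdl B (Suc (nat n))) (h (nat n))"

lemma zlin_gact: "zlin (gact B e n)"
  by (simp add: gact_def zlin_act)

lemma grl_int: "grl T X (int k) = rspan T k X"
  by (simp add: grl_def)

lemma int_cases_neg:
  obtains (neg) "n < 0" | (zero) "n = 0" | (Suc) k where "n = int k + 1"
proof -
  have "n < 0 \<or> n = 0 \<or> n = int (nat (n - 1)) + 1" by linarith
  then show thesis using that by blast
qed

context theory_map
begin

lemma gact_gch: "x \<in> gch A X n \<Longrightarrow> gact B e n x \<in> gch B X n"
  by (auto simp: gch_def gact_def zlin_0[OF zlin_act] map_chain split: if_splits)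

lemma gact_grl: "x \<in> grl A X n \<Longrightarrow> gact B e n x \<in> grl B X n"
  by (auto simp: grl_def gact_def zlin_0[OF zlin_act] map_rspan split: if_splits)

lemma gact_bd:
  assumes "x \<in> gch A X n" shows "gbd B n (gact B e n x) - gact B e (n - 1) (gbd A n x) \<in> grl B X (n - 1)"
proof (cases n rule: int_cases_neg)
  case neg then show ?thesis using assms
    by (simp add: gch_def zlin_0[OF zlin_gact] zlin_0[OF zlin_gbd] subgrp_0[OF subgrp_grl])
next
  case zero then show ?thesis
    by (simp add: gbd_def A.D_0 B.D_0 act_0 zlin_0[OF zlin_gact] subgrp_0[OF subgrp_grl])
next
  case (Suc k)
  have n: "nat (int k + 1) = Suc k" "int k + 1 - 1 = int k" by auto
  from map_bd[of x k X] assms show ?thesis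
    by (simp add: Suc n gbd_def gact_def grl_int gch_def)
qed

lemma gact_gpush: "gact B e n (gpush A n f x) = gpush B n f (gact B e n x)"
  by (simp add: gact_def gpush_def act_push[OF e_chain])

lemma gact_gmul:
  assumes "monoidal_theory A" "monoidal_theory B"
    and mlt: "\<And>p q. act (mdl B (p + q)) (e (p + q)) (mlt A p q) = mul (mdl B (p + q)) (mlt B p q) (e p) (e q)"
    and x: "x \<in> gch A X i" and y: "y \<in> gch A Y j"
  shows "gact B e (i + j) (gmul A i j x y) = gmul B i j (gact B e i x) (gact B e j y)"
proof (cases "i < 0 \<or> j < 0")
  case True
  then have "x = 0 \<or> y = 0" using x y by (auto simp: gch_def)
  then show ?thesis by (auto simp: zlin_0[OF zlin_gact] zlin_0[OF zlin_gmul1] zlin_0[OF zlin_gmul2])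
next
  case False
  then have n: "nat (i + j) = nat i + nat j" by (simp add: nat_add_distrib)
  show ?thesis
    unfolding gact_def gmul_def n act_mul[OF e_chain] mul_act[OF monoidal_theory.mlt_chain[OF assms(2)]] mlt ..
qed

end

lemma hact_props:
  assumes "acyclic_theory A" "acyclic_theory B" "chain_datum A B e" "chain_datum A B f"
  defines "h \<equiv> lift_htpy A B e f"
  shows "x \<in> gch A X n \<Longrightarrow> hact B h n x \<in> gch B X (n + 1)"
    and "x \<in> grl A X n \<Longrightarrow> hact B h n x \<in> grl B X (n + 1)"
    and "x \<in> gch A X n \<Longrightarrow> gbd B (n + 1) (hact B h n x) + hact B h (n - 1) (gbd A n x)
      - (gact B e n x - gact B f n x) \<in> grl B X n"
proof -
  interpret A: acyclic_theory A by fact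
  interpret B: acyclic_theory B by fact
  interpret e: theory_map A B e by standard fact
  interpret f: theory_map A B f by standard fact
  note hc = lift_htpy_chain[OF assms(1-4), folded h_def] and hr = lift_htpy_rel[OF assms(1-4), folded h_def]
    and hb = lift_htpy_bd[OF assms(1-4), folded h_def]
  have n0: "nat (n + 1) = Suc (nat n)" if "\<not> n < 0" for n using that by auto
  show "x \<in> gch A X n \<Longrightarrow> hact B h n x \<in> gch B X (n + 1)"
    by (auto simp: gch_def hact_def n0 zlin_0[OF zlin_act] subgrp_0[OF subgrp_chains] act_chain[OF hc] split: if_splits)
  show "x \<in> grl A X n \<Longrightarrow> hact B h n x \<in> grl B X (n + 1)"
    using act_gen_rspan[OF A.cell_theory_axioms B.cell_theory_axioms hc hr]
    by (auto simp: grl_def hact_def n0 zlin_0[OF zlin_act] subgrp_0[OF subgrp_relspan] split: if_splits)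
  assume x: "x \<in> gch A X n"
  show "gbd B (n + 1) (hact B h n x) + hact B h (n - 1) (gbd A n x)
      - (gact B e n x - gact B f n x) \<in> grl B X n"
  proof (cases n rule: int_cases_neg)
    case neg then show ?thesis using x
      by (simp add: gch_def hact_def zlin_0[OF zlin_gact] zlin_0[OF zlin_act] zlin_0[OF zlin_gbd] subgrp_0[OF subgrp_grl])
  next
    case zero
    have "h 0 = 0" by (simp add: h_def)
    then show ?thesis
      by (simp add: zero gbd_def hact_def gact_def act_0 zlin_0[OF zlin_act] e.e_0 f.e_0 A.D_0 subgrp_0[OF subgrp_grl])
  next
    case (Suc k)
    have n: "nat (int k + 1) = Suc k" "int k + 1 - 1 = int k" "nat (int k + 1 + 1) = Suc (Suc k)"
      "\<not> int k + 1 < 0" "nat (2 + int k) = Suc (Suc k)" by auto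
    have xk: "x \<in> chains (mdl A (Suc k)) X" using x by (simp add: Suc gch_def n)
    have "act (mdl B (Suc k)) (bd1 B (Suc k) (h (Suc k)) + act (mdl B (Suc k)) (h k) (bdy A (Suc k))
       - (e (Suc k) - f (Suc k))) x \<in> rspan B (Suc k) X"
      by (rule B.act_rspan[OF hb xk])
    then show ?thesis
      by (simp add: Suc n gbd_def hact_def gact_def grl_def zlin_diff[OF zlin_act1] zlin_add[OF zlin_act1]
          act_act[OF B.D_chain] act_act[OF hc])
  qed
qed

text \<open>\<open>e_mlt\<close> is the compatibility with Kuenneth morphisms in universal form: it
  makes the induced map one of operads. Acyclicity of both theories serves to invert it up to
  homotopy.\<close>

locale lax_map = A: lax_functor A FA clsA FmA FA2 clsA2 FmA2 \<kappa>A repA + B: lax_functor B FB clsB FmB FB2 clsB2 FmB2 \<kappa>B repB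
    + theory_map A B e
  for A and FA :: "'c topology \<Rightarrow> 'b chain_cx" and clsA FmA FA2 clsA2 FmA2 \<kappa>A repA
    and B and FB :: "'c topology \<Rightarrow> 'e chain_cx" and clsB FmB FB2 clsB2 FmB2 \<kappa>B repB e +
  assumes acycA: "acyclic_theory A" and acycB: "acyclic_theory B"
    and e_mlt: "act (mdl B (p + q)) (e (p + q)) (mlt A p q) = mul (mdl B (p + q)) (mlt B p q) (e p) (e q)"
begin

definition \<eta> :: "'c topology \<Rightarrow> int \<Rightarrow> 'b \<Rightarrow> 'e" where
  "\<eta> X n = (\<lambda>u \<in> carrier (grp (FA X) n). clsB X n (gact B e n (repA u)))"

lemma \<eta>_cls:
  assumes "x \<in> gch A X n" shows "\<eta> X n (clsA X n x) = clsB X n (gact B e n x)"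
proof -
  have "gact B e n (repA (clsA X n x)) - gact B e n x \<in> grl B X n"
    using gact_grl[OF A.rep_cls(2)[OF assms]] by (simp add: zlin_diff[OF zlin_gact])
  then show ?thesis
    using assms by (simp add: \<eta>_def A.PF.cls_carrier B.PF.cls_eq gact_gch A.rep_cls(1))
qed

sublocale pm: presented_map "gch A X" "grl A X" "gbd A" "FA X" "clsA X" "gch B X" "grl B X" "gbd B" "FB X" "clsB X"
    "gact B e" "\<eta> X" for X
  by standard (use zlin_gact gact_gch gact_bd \<eta>_cls in \<open>auto simp: \<eta>_def\<close>)

text \<open>The inverse \<open>e'\<close> is built from cones and need not respect products, which
  is no loss since being a quasi-isomorphism concerns complexes alone. Both composites and both
  identities are chain data, and any two chain data between the same acyclic theories are
  homotopic.\<close>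

lemma \<eta>_quasi_iso: "quasi_iso (FA X) (FB X) (\<eta> X)"
proof -
  define e' where "e' = lift_map B A"
  have d': "chain_datum B A e'" unfolding e'_def by (rule lift_map_datum[OF acycB acycA])
  interpret e': theory_map B A e' by standard (rule d')
  have dA: "chain_datum A A (\<lambda>n. act (mdl A n) (e' n) (e n))" "chain_datum A A (\<lambda>n. idc (mdl A n))"
    by (rule datum_comp[OF A.cell_theory_axioms acycB A.cell_theory_axioms datum d'] datum_id[OF acycA])+
  have dB: "chain_datum B B (\<lambda>n. act (mdl B n) (e n) (e' n))" "chain_datum B B (\<lambda>n. idc (mdl B n))"
    by (rule datum_comp[OF B.cell_theory_axioms acycA B.cell_theory_axioms d' datum] datum_id[OF acycB])+
  have cA: "gact A (\<lambda>n. act (mdl A n) (e' n) (e n)) n x = gact A e' n (gact B e n x)" for n and x :: "'c chain"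
    by (simp add: gact_def act_act[OF e'.e_chain])
  have cB: "gact B (\<lambda>n. act (mdl B n) (e n) (e' n)) n x = gact B e n (gact A e' n x)" for n and x :: "'c chain"
    by (simp add: gact_def act_act[OF e_chain])
  have iA: "gact A (\<lambda>n. idc (mdl A n)) n x = x" if "x \<in> gch A X n" for n and x :: "'c chain"
    using that by (auto simp: gact_def gch_def act_idc zlin_0[OF zlin_act] split: if_splits)
  have iB: "gact B (\<lambda>n. idc (mdl B n)) n x = x" if "x \<in> gch B X n" for n and x :: "'c chain"
    using that by (auto simp: gact_def gch_def act_idc zlin_0[OF zlin_act] split: if_splits)
  show ?thesis
  proof (rule pm.quasi_iso[OF A.bounded_below B.bounded_below zlin_gact e'.gact_gch e'.gact_grl e'.gact_bd
        hact_props(1,2)[OF acycA acycA dA] _ hact_props(1,2)[OF acycB acycB dB]])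
    fix n and x :: "'c chain" assume x: "x \<in> gch A X n"
    show "gbd A (n + 1) (hact A (lift_htpy A A (\<lambda>n. act (mdl A n) (e' n) (e n)) (\<lambda>n. idc (mdl A n))) n x)
      + hact A (lift_htpy A A (\<lambda>n. act (mdl A n) (e' n) (e n)) (\<lambda>n. idc (mdl A n))) (n - 1) (gbd A n x)
      - (gact A e' n (gact B e n x) - x) \<in> grl A X n"
      using hact_props(3)[OF acycA acycA dA x] by (simp add: cA iA[OF x])
  next
    fix n and x :: "'c chain" assume x: "x \<in> gch B X n"
    show "gbd B (n + 1) (hact B (lift_htpy B B (\<lambda>n. act (mdl B n) (e n) (e' n)) (\<lambda>n. idc (mdl B n))) n x)
      + hact B (lift_htpy B B (\<lambda>n. act (mdl B n) (e n) (e' n)) (\<lambda>n. idc (mdl B n))) (n - 1) (gbd B n x)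
      - (gact B e n (gact A e' n x) - x) \<in> grl B X n"
      using hact_props(3)[OF acycB acycB dB x] by (simp add: cB iB[OF x])
  qed
qed

definition nt :: "('l, 'c) top_modop \<Rightarrow> ('l, int \<Rightarrow> 'b \<Rightarrow> 'e) modop_mor" where
  "nt P = (\<lambda>g I. if stable g I then \<eta> (mo_obj P g I) else undefined)"

lemma nt_cls: "stable g I \<Longrightarrow> x \<in> gch A (mo_obj P g I) n \<Longrightarrow>
    nt P g I n (clsA (mo_obj P g I) n x) = clsB (mo_obj P g I) n (gact B e n x)"
  by (simp add: nt_def \<eta>_cls)

lemma nt_weak_equiv:
  assumes P: "is_top_modop P" shows "dg_weak_equiv (fun_ob A.G P) (fun_ob B.G P) (nt P)"
proof -
  have "nt P \<in> dg_modop_hom (fun_ob A.G P) (fun_ob B.G P)"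
    unfolding dg_modop_hom_def mem_Collect_eq
  proof (intro conjI allI impI ballI, goal_cases)
    case (1 g I)
    show ?case using pm.cx_hom by (simp add: nt_def A.G_simps B.G_simps)
  next
    case (2 g I \<sigma> i u)
    have s: "stable g I" "inj_on \<sigma> I" using 2 by auto
    obtain x where x: "x \<in> gch A (mo_obj P g I) i" "u = clsA (mo_obj P g I) i x"
      using 2(2) unfolding A.G_simps by (elim A.PF.cls_obtain)
    note a = A.act_hom[OF P s]
    show ?case
      unfolding x(2) A.G_act_cls[OF P s x(1)] nt_cls[OF s(1) x(1)] nt_cls[OF stable_image[OF s] gpush_gch'[OF a x(1)]]
        B.G_act_cls[OF P s gact_gch[OF x(1)]] gact_gpush ..
  next
    case (3 g I a h J b i j u v)
    let ?X = "mo_obj P g (insert a I)" and ?Y = "mo_obj P h (insert b J)"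
    have s: "stable g (insert a I)" "stable h (insert b J)" using 3(1) by (auto simp: glueable_def)
    obtain x where x: "x \<in> gch A ?X i" "u = clsA ?X i x" using 3(2) unfolding A.G_simps by (elim A.PF.cls_obtain)
    obtain y where y: "y \<in> gch A ?Y j" "v = clsA ?Y j y" using 3(3) unfolding A.G_simps by (elim A.PF.cls_obtain)
    note c = A.circ_hom[OF P 3(1)]
    show ?case
      unfolding x(2) y(2) A.G_circ_cls'[OF P 3(1) refl refl x(1) y(1)] nt_cls[OF s(1) x(1)] nt_cls[OF s(2) y(1)]
        nt_cls[OF glueable_stable[OF 3(1)] gpush_gch'[OF c A.gmul_gch[OF x(1) y(1)]]]
        B.G_circ_cls'[OF P 3(1) refl refl gact_gch[OF x(1)] gact_gch[OF y(1)]] gact_gpush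
        gact_gmul[OF A.monoidal_theory_axioms B.monoidal_theory_axioms e_mlt x(1) y(1)] ..
  next
    case (4 g I a b i u)
    let ?X = "mo_obj P g (insert a (insert b I))"
    have s: "stable g (insert a (insert b I))" using 4(1) by (simp add: contractible_def)
    obtain x where x: "x \<in> gch A ?X i" "u = clsA ?X i x" using 4(2) unfolding A.G_simps by (elim A.PF.cls_obtain)
    note a = A.xi_hom[OF P 4(1)]
    show ?case
      unfolding x(2) A.G_xi_cls[OF P 4(1) refl x(1)] nt_cls[OF s x(1)]
        nt_cls[OF contractible_stable[OF 4(1)] gpush_gch'[OF a x(1)]]
        B.G_xi_cls[OF P 4(1) refl gact_gch[OF x(1)]] gact_gpush ..
  qed
  then show ?thesis
    using \<eta>_quasi_iso by (simp add: dg_weak_equiv_def nt_def A.G_simps B.G_simps)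
qed

theorem nat_weak_equiv: "nat_weak_equiv (A.G :: ('l, 'c, 'b) modop_functor) (B.G :: ('l, 'c, 'e) modop_functor)"
proof -
  have pt: "dg_modop_comp (fun_ob A.G P) (nt Q) (fun_mor A.G P Q f) g I =
      dg_modop_comp (fun_ob A.G P) (fun_mor B.G P Q f) (nt P) g I"
    if *: "is_top_modop P" "is_top_modop Q" "f \<in> top_modop_hom P Q" for P Q :: "('l, 'c) top_modop" and f g I
  proof (cases "stable g I")
    case False then show ?thesis by (simp add: dg_modop_comp_def)
  next
    case True
    let ?X = "mo_obj P g I" and ?Y = "mo_obj Q g I"
    have fh: "f g I \<in> top_hom ?X ?Y"
      using *(3) True unfolding top_modop_hom_def mem_Collect_eq by metis
    have "cx_comp (FA ?X) (\<eta> ?Y) (FmA ?X ?Y (f g I)) n = cx_comp (FA ?X) (FmB ?X ?Y (f g I)) (\<eta> ?X) n" for n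
    proof (rule A.cls_ext_eq)
      fix x assume x: "x \<in> gch A ?X n"
      show "cx_comp (FA ?X) (\<eta> ?Y) (FmA ?X ?Y (f g I)) n (clsA ?X n x) =
          cx_comp (FA ?X) (FmB ?X ?Y (f g I)) (\<eta> ?X) n (clsA ?X n x)"
        using x by (simp add: cx_comp_def compose_def A.PF.cls_carrier A.Fm_cls[OF fh] \<eta>_cls gpush_gch'[OF fh]
            B.Fm_cls[OF fh gact_gch] gact_gpush)
    qed (simp_all add: cx_comp_def)
    then show ?thesis
      using True by (simp add: dg_modop_comp_def A.G_mor B.G_mor nt_def A.G_simps fun_eq_iff)
  qed
  have comm: "dg_modop_comp (fun_ob A.G P) (nt Q) (fun_mor A.G P Q f) =
      dg_modop_comp (fun_ob A.G P) (fun_mor B.G P Q f) (nt P)"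
    if "is_top_modop P" "is_top_modop Q" "f \<in> top_modop_hom P Q" for P Q :: "('l, 'c) top_modop" and f
    by (rule ext, rule ext, rule pt[OF that])
  show ?thesis
    unfolding nat_weak_equiv_def
    by (intro conjI A.G_is_functor B.G_is_functor exI[of _ nt] allI impI nt_weak_equiv comm)
       simp_all
qed

end

section \<open>Shuffles as lattice paths\<close>

lemma neg_one_power: "(- 1 :: int) ^ n = (if even n then 1 else - 1)"
  by simp

definition consf :: "'a \<Rightarrow> ('a list \<Rightarrow>\<^sub>0 int) \<Rightarrow> ('a list \<Rightarrow>\<^sub>0 int)" where
  "consf v = frag_extend (\<lambda>l. frag_of (v # l))"

definition mapf :: "('a \<Rightarrow> 'b) \<Rightarrow> ('a list \<Rightarrow>\<^sub>0 int) \<Rightarrow> ('b list \<Rightarrow>\<^sub>0 int)" where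
  "mapf h = frag_extend (\<lambda>l. frag_of (map h l))"

text \<open>The alternating sum of the lists with one entry deleted.\<close>

primrec dl :: "'a list \<Rightarrow> ('a list \<Rightarrow>\<^sub>0 int)" where
  "dl [] = 0"
| "dl (v # l) = frag_of l - consf v (dl l)"

text \<open>
  The signed sum of all lattice paths through the grid with rows \<open>xs\<close> and columns \<open>ys\<close>.
\<close>

fun sh :: "'a list \<Rightarrow> 'b list \<Rightarrow> (('a \<times> 'b) list \<Rightarrow>\<^sub>0 int)" where
  "sh [] ys = 0"
| "sh (x # xs) [] = 0"
| "sh (x # xs) (y # ys) = (if xs = [] \<and> ys = [] then frag_of [(x, y)] else
     consf (x, y) (sh xs (y # ys) + frag_cmul ((- 1) ^ length xs) (sh (x # xs) ys)))"

definition shx :: "('a list \<Rightarrow>\<^sub>0 int) \<Rightarrow> ('b list \<Rightarrow>\<^sub>0 int) \<Rightarrow> (('a \<times> 'b) list \<Rightarrow>\<^sub>0 int)" where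
  "shx x y = frag_extend (\<lambda>xs. frag_extend (sh xs) y) x"

abbreviation "Dl \<equiv> frag_extend dl"

lemma zlin_consf: "zlin (consf v)"
  by (simp add: consf_def zlin_frag_extend)

lemma zlin_mapf: "zlin (mapf v)"
  by (simp add: mapf_def zlin_frag_extend)

lemma consf_of [simp]: "consf v (frag_of l) = frag_of (v # l)"
  by (simp add: consf_def)

lemma mapf_of [simp]: "mapf h (frag_of l) = frag_of (map h l)"
  by (simp add: mapf_def)

lemmas consf_lin = zlin_0[OF zlin_consf] zlin_add[OF zlin_consf] zlin_diff[OF zlin_consf] zlin_minus[OF zlin_consf]
  zlin_cmul[OF zlin_consf]

lemmas mapf_lin = zlin_0[OF zlin_mapf] zlin_add[OF zlin_mapf] zlin_diff[OF zlin_mapf] zlin_minus[OF zlin_mapf]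
  zlin_cmul[OF zlin_mapf]

lemma sh_Nil2 [simp]: "sh xs [] = 0"
  by (cases xs) auto

lemma zlin_shx1: "zlin (\<lambda>x. shx x y)"
  unfolding shx_def by (rule zlin_frag_extend)

lemma zlin_shx2: "zlin (shx x)"
  unfolding shx_def by (rule zlin_frag_extend_fun) (rule zlin_frag_extend)

lemma shx_of: "shx (frag_of xs) (frag_of ys) = sh xs ys"
  by (simp add: shx_def)

lemma keys_consf: "l \<in> Poly_Mapping.keys (consf v z) \<Longrightarrow> \<exists>l'\<in>Poly_Mapping.keys z. l = v # l'"
  using keys_frag_extend[of "\<lambda>l. frag_of (v # l)" z] by (auto simp: consf_def)

lemma keys_dl: "l' \<in> Poly_Mapping.keys (dl l) \<Longrightarrow> Suc (length l') = length l"
proof (induction l arbitrary: l')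
  case (Cons v l)
  then have "l' = l \<or> l' \<in> Poly_Mapping.keys (consf v (dl l))"
    using keys_diff[of "frag_of l" "consf v (dl l)"] by auto
  then show ?case using Cons.IH by (auto dest: keys_consf)
qed simp

lemma keys_sh: "l \<in> Poly_Mapping.keys (sh xs ys) \<Longrightarrow> Suc (length l) = length xs + length ys"
proof (induction xs ys arbitrary: l rule: sh.induct)
  case (3 x xs y ys)
  show ?case
  proof (cases "xs = [] \<and> ys = []")
    case True then show ?thesis using 3 by simp
  next
    case False
    let ?k = "frag_cmul ((- 1) ^ length xs) (sh (x # xs) ys)"
    obtain l' where l': "l = (x, y) # l'" "l' \<in> Poly_Mapping.keys (sh xs (y # ys) + ?k)"
      using 3(3) False by (auto dest: keys_consf)
    then have "l' \<in> Poly_Mapping.keys (sh xs (y # ys)) \<or> l' \<in> Poly_Mapping.keys (sh (x # xs) ys)"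
      using keys_add[of "sh xs (y # ys)" ?k] keys_cmul[of _ "sh (x # xs) ys"] by blast
    then show ?thesis using 3(1,2)[OF False] l'(1) by auto
  qed
qed auto

lemma mapf_consf: "mapf h (consf v z) = consf (h v) (mapf h z)"
  by (rule zlin_eq[OF zlin_comp[OF zlin_mapf zlin_consf] zlin_comp[OF zlin_consf zlin_mapf] subset_UNIV]) simp

lemma sh_map: "sh (map f xs) (map g ys) = mapf (map_prod f g) (sh xs ys)"
  by (induction xs ys rule: sh.induct) (auto simp: mapf_lin mapf_consf)

lemma Dl_consf: "Dl (consf v z) = z - consf v (Dl z)"
  by (rule zlin_eq[OF zlin_comp[OF zlin_frag_extend zlin_consf]
        zlin_minus_fun[OF zlin_id zlin_comp[OF zlin_consf zlin_frag_extend]] subset_UNIV]) simp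

lemma frag_extend_consf: "frag_extend f (consf v z) = frag_extend (\<lambda>l. f (v # l)) z"
  by (rule zlin_eq[OF zlin_comp[OF zlin_frag_extend zlin_consf] zlin_frag_extend subset_UNIV]) simp

lemma consf_frag_extend: "consf v (frag_extend f z) = frag_extend (\<lambda>l. consf v (f l)) z"
  by (rule zlin_frag_extend_comp[OF zlin_consf])

lemma sh_consx:
  assumes "\<And>l. l \<in> Poly_Mapping.keys z \<Longrightarrow> length l = n \<and> (l \<noteq> [] \<or> ys \<noteq> [])"
  shows "frag_extend (\<lambda>l. sh (x # l) (y # ys)) z =
    consf (x, y) (frag_extend (\<lambda>l. sh l (y # ys)) z + frag_cmul ((- 1) ^ n) (frag_extend (\<lambda>l. sh (x # l) ys) z))"
proof -
  have "frag_extend (\<lambda>l. sh (x # l) (y # ys)) z =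
    frag_extend (\<lambda>l. consf (x, y) (sh l (y # ys) + frag_cmul ((- 1) ^ n) (sh (x # l) ys))) z"
    using assms by (intro frag_extend_eq) auto
  then show ?thesis
    by (simp only: consf_frag_extend[symmetric] frag_extend_plus_fun frag_extend_cmul_fun)
qed

lemma sh_consy:
  assumes "\<And>l. l \<in> Poly_Mapping.keys z \<Longrightarrow> xs \<noteq> [] \<or> l \<noteq> []"
  shows "frag_extend (\<lambda>l. sh (x # xs) (y # l)) z =
    consf (x, y) (frag_extend (\<lambda>l. sh xs (y # l)) z + frag_cmul ((- 1) ^ length xs) (frag_extend (\<lambda>l. sh (x # xs) l) z))"
proof -
  have "frag_extend (\<lambda>l. sh (x # xs) (y # l)) z =
    frag_extend (\<lambda>l. consf (x, y) (sh xs (y # l) + frag_cmul ((- 1) ^ length xs) (sh (x # xs) l))) z"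
    using assms by (intro frag_extend_eq) auto
  then show ?thesis
    by (simp only: consf_frag_extend[symmetric] frag_extend_plus_fun frag_extend_cmul_fun)
qed

text \<open>The Leibniz rule for lists. A list of length \<open>p + 1\<close> stands for a simplex
  of dimension \<open>p\<close>, hence the minus sign in front of the second term. Two one-element
  lists are excluded: deleting an only entry leaves the empty list and not zero, so the formula
  would fail.\<close>

lemma Dl_sh:
  assumes "length xs + length ys \<ge> 3"
  shows "Dl (sh xs ys) = frag_extend (\<lambda>l. sh l ys) (dl xs) - frag_cmul ((- 1) ^ length xs) (frag_extend (sh xs) (dl ys))"
  using assms
proof (induction xs ys rule: sh.induct)
  case (1 ys) then show ?case by (simp add: frag_extend_0_fun)
next
  case (2 x xs) then show ?case by (simp add: frag_extend_0_fun)
next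
  case (3 x xs y ys)
  have ne: "\<not> (xs = [] \<and> ys = [])" using 3(3) by auto
  show ?case
  proof (cases "length xs + length ys \<ge> 2")
    case False
    then consider x' where "xs = [x']" "ys = []" | y' where "xs = []" "ys = [y']"
      using ne by (cases xs; cases ys) (auto simp: Suc_le_eq)
    then show ?thesis
      by cases (simp_all add: frag_extend_diff frag_extend_minus frag_extend_cmul frag_extend_add consf_lin)
  next
    case True
    define \<epsilon> where "\<epsilon> = (- 1 :: int) ^ length xs"
    have \<epsilon>: "\<epsilon> = 1 \<or> \<epsilon> = - 1" by (simp add: \<epsilon>_def neg_one_power)
    define A where "A = frag_extend (\<lambda>l. sh l (y # ys)) (dl xs)"
    define B where "B = frag_extend (\<lambda>l. sh (x # l) ys) (dl xs)"
    define C where "C = frag_extend (\<lambda>l. sh xs (y # l)) (dl ys)"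
    define E where "E = frag_extend (sh (x # xs)) (dl ys)"
    let ?S = "sh xs ys"
    have 1: "Dl (sh xs (y # ys)) = A - frag_cmul \<epsilon> (?S - C)"
      using 3(1)[OF ne] True
      by (simp add: A_def C_def \<epsilon>_def frag_extend_diff frag_extend_consf)
    have 2: "Dl (sh (x # xs) ys) = (?S - B) + frag_cmul \<epsilon> E"
      using 3(2)[OF ne] True
      by (simp add: B_def E_def \<epsilon>_def frag_extend_diff frag_extend_consf)
    \<comment> \<open>The two occurrences of \<open>?S\<close> cancel. They come from paths that go
      around the first square in its two ways, with the intermediate corner deleted.\<close>
    have L: "Dl (sh (x # xs) (y # ys)) = sh xs (y # ys) + frag_cmul \<epsilon> (sh (x # xs) ys)
        - consf (x, y) (A + frag_cmul \<epsilon> C - frag_cmul \<epsilon> B + E)"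
      using ne \<epsilon> by (auto simp: Dl_consf frag_extend_add frag_extend_cmul 1 2 frag_cmul_diff2 frag_cmul_distrib2
          frag_extend_diff consf_lin \<epsilon>_def[symmetric])
    \<comment> \<open>The lists in \<open>dl xs\<close> are shorter by one than \<open>xs\<close>,
      so the recursion for \<open>sh\<close> now carries the sign
      \<open>- \<epsilon>\<close>.\<close>
    have B': "frag_extend (\<lambda>l. sh (x # l) (y # ys)) (dl xs) = consf (x, y) (A - frag_cmul \<epsilon> B)"
    proof (cases xs)
      case Nil then show ?thesis by (simp add: A_def B_def consf_lin)
    next
      case (Cons x' xs')
      have "frag_extend (\<lambda>l. sh (x # l) (y # ys)) (dl xs) =
        consf (x, y) (A + frag_cmul ((- 1) ^ length xs') B)"
        unfolding A_def B_def
      proof (rule sh_consx)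
        fix l assume "l \<in> Poly_Mapping.keys (dl xs)"
        from keys_dl[OF this] show "length l = length xs' \<and> (l \<noteq> [] \<or> ys \<noteq> [])" using True Cons by auto
      qed
      moreover have "A - frag_cmul \<epsilon> B = A + frag_cmul ((- 1) ^ length xs') B"
        by (simp add: \<epsilon>_def Cons diff_conv_add_uminus del: add_uminus_conv_diff)
      ultimately show ?thesis by (simp only:)
    qed
    have E': "frag_extend (\<lambda>l. sh (x # xs) (y # l)) (dl ys) = consf (x, y) (C + frag_cmul \<epsilon> E)"
      unfolding C_def E_def \<epsilon>_def
    proof (rule sh_consy)
      fix l assume "l \<in> Poly_Mapping.keys (dl ys)"
      from keys_dl[OF this] show "xs \<noteq> [] \<or> l \<noteq> []" using True by auto
    qed
    have R: "frag_extend (\<lambda>l. sh l (y # ys)) (dl (x # xs)) - frag_cmul ((- 1) ^ length (x # xs)) (frag_extend (sh (x # xs)) (dl (y # ys)))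
      = sh xs (y # ys) - consf (x, y) (A - frag_cmul \<epsilon> B) + frag_cmul \<epsilon> (sh (x # xs) ys - consf (x, y) (C + frag_cmul \<epsilon> E))"
    proof -
      have "frag_extend (\<lambda>l. sh l (y # ys)) (dl (x # xs)) = sh xs (y # ys) - consf (x, y) (A - frag_cmul \<epsilon> B)"
        by (simp add: frag_extend_diff frag_extend_consf B' del: sh.simps(3))
      moreover have "frag_extend (sh (x # xs)) (dl (y # ys)) = sh (x # xs) ys - consf (x, y) (C + frag_cmul \<epsilon> E)"
        by (simp add: frag_extend_diff frag_extend_consf E' del: sh.simps(3))
      moreover have "(- 1 :: int) ^ length (x # xs) = - \<epsilon>" by (simp add: \<epsilon>_def)
      ultimately show ?thesis
        by (simp only: diff_conv_add_uminus minus_frag_cmul minus_minus)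
    qed
    show ?thesis
      unfolding L R using \<epsilon> by (auto simp: consf_lin algebra_simps)
  qed
qed

text \<open>The sign of a path counts the pairs in which a step in \<open>ys\<close> precedes a step
  in \<open>xs\<close>. Reflecting the grid exchanges these pairs with the remaining ones, and there
  are \<open>(length xs - 1) * (length ys - 1)\<close> pairs in all.\<close>

lemma sh_swap: "mapf prod.swap (sh xs ys) = frag_cmul ((- 1) ^ ((length xs - 1) * (length ys - 1))) (sh ys xs)"
proof (induction xs ys rule: sh.induct)
  case (3 x xs y ys)
  show ?case
  proof (cases "xs = [] \<and> ys = []")
    case False
    have "(- 1 :: int) ^ (length xs * length ys) = (- 1) ^ ((length xs - 1) * length ys) * (- 1) ^ length ys" if "xs \<noteq> []"
      using that by (cases xs) (auto simp: neg_one_power)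
    moreover have "(- 1 :: int) ^ (length xs * length ys) = (- 1) ^ length xs * (- 1) ^ (length xs * (length ys - 1))" if "ys \<noteq> []"
      using that by (cases ys) (auto simp: neg_one_power)
    moreover have "(- 1 :: int) ^ length ys * (- 1) ^ length ys = 1" by (simp add: neg_one_power)
    ultimately show ?thesis
      using 3[OF False] False
      by (cases "xs = []"; cases "ys = []")
         (auto simp: mapf_lin mapf_consf consf_lin frag_cmul_distrib2 add.commute mult.assoc conj_commute)
  qed simp
qed (simp_all add: mapf_lin)

definition assoc3 :: "('a \<times> 'b) \<times> 'c \<Rightarrow> 'a \<times> 'b \<times> 'c" where
  "assoc3 = (\<lambda>((x, y), z). (x, (y, z)))"

text \<open>What follows the common first vertex. Admitting the empty list for the grid with one
  point makes \<open>sh_Cons\<close> hold without a case distinction.\<close>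

definition sh_tail :: "'a \<Rightarrow> 'a list \<Rightarrow> 'b \<Rightarrow> 'b list \<Rightarrow> (('a \<times> 'b) list \<Rightarrow>\<^sub>0 int)" where
  "sh_tail x xs y ys = (if xs = [] \<and> ys = [] then frag_of [] else
     sh xs (y # ys) + frag_cmul ((- 1) ^ length xs) (sh (x # xs) ys))"

lemma sh_Cons: "sh (x # xs) (y # ys) = consf (x, y) (sh_tail x xs y ys)"
  by (simp add: sh_tail_def)

lemma keys_sh_tail: "l \<in> Poly_Mapping.keys (sh_tail x xs y ys) \<Longrightarrow> length l = length xs + length ys"
  using keys_add[of "sh xs (y # ys)" "frag_cmul ((- 1) ^ length xs) (sh (x # xs) ys)"]
    keys_cmul[of _ "sh (x # xs) ys"] keys_sh[of l xs "y # ys"] keys_sh[of l "x # xs" ys]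
  by (auto simp: sh_tail_def split: if_splits)

lemma sh_Nil1: "sh [] = (\<lambda>_. 0)"
  by (simp add: fun_eq_iff)

lemma frag_extend_sh_tail:
  "frag_extend (\<lambda>u. sh u l) (sh_tail x xs y ys) = frag_extend (\<lambda>u. sh u l) (sh xs (y # ys))
     + frag_cmul ((- 1) ^ length xs) (frag_extend (\<lambda>u. sh u l) (sh (x # xs) ys))"
  "frag_extend (sh k) (sh_tail x xs y ys) = frag_extend (sh k) (sh xs (y # ys))
     + frag_cmul ((- 1) ^ length xs) (frag_extend (sh k) (sh (x # xs) ys))"
  by (auto simp: sh_tail_def frag_extend_add frag_extend_cmul)

text \<open>
  After the common first vertex, a path in the threefold grid advances in one of the three
  directions; both ways of bracketing lead to the same signs.
\<close>

lemma sh_assoc: "mapf assoc3 (frag_extend (\<lambda>u. sh u zs) (sh xs ys)) = frag_extend (sh xs) (sh ys zs)"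
proof (induction "length xs + length ys + length zs" arbitrary: xs ys zs rule: less_induct)
  case less
  show ?case
  proof (cases "xs = [] \<or> ys = [] \<or> zs = []")
    case True
    then show ?thesis by (auto simp: mapf_lin frag_extend_0_fun sh_Nil1)
  next
    case False
    then obtain x xs' y ys' z zs' where s: "xs = x # xs'" "ys = y # ys'" "zs = z # zs'"
      by (metis neq_Nil_conv)
    show ?thesis
    proof (cases "xs' = [] \<and> ys' = [] \<and> zs' = []")
      case True then show ?thesis by (simp add: s assoc3_def)
    next
      case ne: False
      define p q where "p = length xs'" and "q = length ys'"
      let ?W = "sh_tail x xs' y ys'" and ?W' = "sh_tail y ys' z zs'"
      have xy: "sh xs ys = consf (x, y) ?W" and yz: "sh ys zs = consf (y, z) ?W'"
        by (simp_all only: s sh_Cons)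
      have "frag_extend (\<lambda>u. sh u zs) (sh xs ys) = frag_extend (\<lambda>l. sh ((x, y) # l) (z # zs')) ?W"
        by (simp only: xy frag_extend_consf s(3))
      also have "\<dots> = consf ((x, y), z) (frag_extend (\<lambda>l. sh l (z # zs')) ?W
          + frag_cmul ((- 1) ^ (p + q)) (frag_extend (\<lambda>l. sh ((x, y) # l) zs') ?W))"
        by (rule sh_consx) (use keys_sh_tail ne in \<open>fastforce simp: p_def q_def\<close>)
      also have "frag_extend (\<lambda>l. sh ((x, y) # l) zs') ?W = frag_extend (\<lambda>u. sh u zs') (sh xs ys)"
        by (simp only: xy frag_extend_consf)
      also have "frag_extend (\<lambda>l. sh l (z # zs')) ?W = frag_extend (\<lambda>u. sh u zs) (sh xs' ys)
          + frag_cmul ((- 1) ^ p) (frag_extend (\<lambda>u. sh u zs) (sh xs ys'))"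
        by (simp only: frag_extend_sh_tail s p_def)
      finally have L: "mapf assoc3 (frag_extend (\<lambda>u. sh u zs) (sh xs ys)) = consf (x, (y, z))
          (frag_extend (sh xs') (sh ys zs) + frag_cmul ((- 1) ^ p) (frag_extend (sh xs) (sh ys' zs))
           + frag_cmul ((- 1) ^ (p + q)) (frag_extend (sh xs) (sh ys zs')))"
        using less[of xs' ys zs] less[of xs ys' zs] less[of xs ys zs']
        by (simp add: s mapf_consf mapf_lin del: sh.simps) (simp add: assoc3_def)
      have "frag_extend (sh xs) (sh ys zs) = frag_extend (\<lambda>w. sh (x # xs') ((y, z) # w)) ?W'"
        by (simp only: yz frag_extend_consf s(1))
      also have "\<dots> = consf (x, (y, z)) (frag_extend (\<lambda>w. sh xs' ((y, z) # w)) ?W'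
          + frag_cmul ((- 1) ^ p) (frag_extend (sh (x # xs')) ?W'))"
        unfolding p_def by (rule sh_consy) (use keys_sh_tail ne in fastforce)
      also have "frag_extend (\<lambda>w. sh xs' ((y, z) # w)) ?W' = frag_extend (sh xs') (sh ys zs)"
        by (simp only: yz frag_extend_consf)
      also have "frag_extend (sh (x # xs')) ?W' = frag_extend (sh xs) (sh ys' zs)
          + frag_cmul ((- 1) ^ q) (frag_extend (sh xs) (sh ys zs'))"
        by (simp only: frag_extend_sh_tail s q_def)
      finally show ?thesis
        unfolding L by (simp only: frag_cmul_distrib2 frag_cmul_cmul power_add add.assoc)
    qed
  qed
qed

definition dupl :: "'a list \<Rightarrow> bool" where
  "dupl l \<longleftrightarrow> (\<exists>as x bs. l = as @ x # x # bs)"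

lemma dupl_Cons: "dupl (v # l) \<longleftrightarrow> dupl l \<or> (\<exists>l'. l = v # l')"
  unfolding dupl_def by (auto simp: Cons_eq_append_conv)

lemma dupl_Nil: "\<not> dupl []"
  by (simp add: dupl_def)

lemma keys_sh_head: "l \<in> Poly_Mapping.keys (sh (x # xs) (y # ys)) \<Longrightarrow> \<exists>l'. l = (x, y) # l'"
  unfolding sh_Cons by (auto dest: keys_consf)

text \<open>Somewhere the path steps between the two equal neighbours, and at that step the vertex
  of the product grid is repeated. So no path escapes.\<close>

lemma dupl_sh:
  "l \<in> Poly_Mapping.keys (sh xs ys) \<Longrightarrow> dupl xs \<or> dupl ys \<Longrightarrow> dupl l"
proof (induction xs ys arbitrary: l rule: sh.induct)
  case (3 x xs y ys)
  have ne: "\<not> (xs = [] \<and> ys = [])" using 3(4) by (auto simp: dupl_Cons dupl_Nil)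
  let ?k = "frag_cmul ((- 1) ^ length xs) (sh (x # xs) ys)"
  obtain l' where l': "l = (x, y) # l'" "l' \<in> Poly_Mapping.keys (sh xs (y # ys) + ?k)"
    using 3(3) ne by (auto dest: keys_consf)
  then consider "l' \<in> Poly_Mapping.keys (sh xs (y # ys))" | "l' \<in> Poly_Mapping.keys (sh (x # xs) ys)"
    using keys_add[of "sh xs (y # ys)" ?k] keys_cmul[of _ "sh (x # xs) ys"] by blast
  then show ?case
  proof cases
    case 1
    show ?thesis
    proof (cases "dupl xs \<or> dupl (y # ys)")
      case True then show ?thesis using 3(1)[OF ne 1] l'(1) by (simp add: dupl_Cons)
    next
      case False
      then obtain xs' where "xs = x # xs'" using 3(4) by (auto simp: dupl_Cons)
      then show ?thesis using keys_sh_head[of l' x xs' y ys] 1 l'(1) by (auto simp: dupl_Cons)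
    qed
  next
    case 2
    show ?thesis
    proof (cases "dupl (x # xs) \<or> dupl ys")
      case True then show ?thesis using 3(2)[OF ne 2] l'(1) by (simp add: dupl_Cons)
    next
      case False
      then obtain ys' where "ys = y # ys'" using 3(4) by (auto simp: dupl_Cons)
      then show ?thesis using keys_sh_head[of l' x xs y ys'] 2 l'(1) by (auto simp: dupl_Cons)
    qed
  qed
qed auto

text \<open>Deleting one or the other of two equal neighbours gives the same list with opposite
  signs. In every term that survives the pair is still present.\<close>

lemma dupl_dl: "dupl l \<Longrightarrow> l' \<in> Poly_Mapping.keys (dl l) \<Longrightarrow> dupl l'"
proof (induction l arbitrary: l')
  case (Cons v l)
  show ?case
  proof (cases "dupl l")
    case True
    have "l' = l \<or> l' \<in> Poly_Mapping.keys (consf v (dl l))"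
      using Cons(3) keys_diff[of "frag_of l" "consf v (dl l)"] by auto
    then show ?thesis using True Cons.IH[OF True] by (auto dest!: keys_consf simp: dupl_Cons)
  next
    case False
    then obtain k where "l = v # k" using Cons(2) by (auto simp: dupl_Cons)
    then have "dl (v # l) = consf v (consf v (dl k))" by (simp add: consf_lin)
    then show ?thesis using Cons(3) by (auto dest!: keys_consf simp: dupl_Cons)
  qed
qed simp

text \<open>The degeneracy with index \<open>i\<close>, read off on the list of vertices;
  \<open>dups\<close> performs several of them in the order in which \<open>degens\<close>
  does.\<close>

fun dup :: "nat \<Rightarrow> 'a list \<Rightarrow> 'a list" where
  "dup i [] = []"
| "dup 0 (x # xs) = x # x # xs"
| "dup (Suc i) (x # xs) = x # dup i xs"

definition dups :: "'a list \<Rightarrow> nat list \<Rightarrow> 'a list" where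
  "dups = foldl (\<lambda>l i. dup i l)"

lemma dups_Suc: "dups (x # xs) (map Suc is) = x # dups xs is"
  by (induction "is" arbitrary: xs) (simp_all add: dups_def)

lemma dups_0: "dups (x # xs) (0 # map Suc is) = x # dups (x # xs) is"
  using dups_Suc[of x "x # xs" "is"] by (simp add: dups_def)

section \<open>Shuffle permutations as lattice paths\<close>

definition lift_perm :: "(nat \<Rightarrow> nat) \<Rightarrow> nat \<Rightarrow> nat" where
  "lift_perm \<pi> i = (case i of 0 \<Rightarrow> 0 | Suc j \<Rightarrow> Suc (\<pi> j))"

text \<open>The cycle 0, 1, ..., \<open>p\<close>. A path that begins with a step in
  \<open>xs\<close> is a shuffle with value 0 at place 0, for which \<open>lift_perm\<close>
  suffices. If it begins with a step in \<open>ys\<close>, the value 0 sits at place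
  \<open>p\<close>, behind the whole first block; this cycle brings it there, and its sign is the
  factor in the recursion of \<open>sh\<close>.\<close>

primrec cyc :: "nat \<Rightarrow> nat \<Rightarrow> nat" where
  "cyc 0 = id"
| "cyc (Suc p) = cyc p \<circ> Transposition.transpose p (Suc p)"

lemma cyc_apply: "cyc p i = (if i < p then Suc i else if i = p then 0 else i)"
  by (induction p arbitrary: i) (auto simp: Transposition.transpose_def)

lemma cyc_permutes: "p < n \<Longrightarrow> cyc p permutes {..<n}"
proof (induction p)
  case (Suc p)
  show ?case
    unfolding cyc.simps
    by (rule permutes_compose[OF permutes_swap_id Suc.IH]) (use Suc.prems in auto)
qed (simp add: permutes_id)

lemma sign_cyc: "sign (cyc p) = (- 1) ^ p"
proof (induction p)
  case (Suc p)
  have "permutation (cyc p)" using cyc_permutes[of p "Suc p"] permutation_permutes by blast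
  then show ?case
    unfolding cyc.simps sign_compose[OF \<open>permutation (cyc p)\<close> permutation_swap_id] Suc sign_swap_id by simp
qed simp

lemma lift_perm_eq:
  assumes "\<pi> permutes {..<n}" shows "lift_perm \<pi> = map_permutation {..<n} Suc \<pi>"
proof
  fix i show "lift_perm \<pi> i = map_permutation {..<n} Suc \<pi> i"
  proof (cases i)
    case 0 then show ?thesis by (auto simp: lift_perm_def map_permutation_def restrict_id_def)
  next
    case (Suc j)
    show ?thesis
    proof (cases "j < n")
      case True then show ?thesis
        using map_permutation_apply[of Suc "{..<n}" j \<pi>] Suc by (simp add: lift_perm_def)
    next
      case False then show ?thesis
        using assms Suc by (auto simp: lift_perm_def map_permutation_def restrict_id_def permutes_def)
    qed
  qed
qed

lemma lift_perm_permutes: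
  assumes "\<pi> permutes {..<n}" shows "lift_perm \<pi> permutes {..<Suc n}"
proof -
  have "map_permutation {..<n} Suc \<pi> permutes Suc ` {..<n}"
    by (rule map_permutation_permutes[OF _ assms]) (simp add: inj_on_imp_bij_betw)
  then show ?thesis unfolding lift_perm_eq[OF assms] by (rule permutes_subset) auto
qed

lemma sign_lift_perm: "\<pi> permutes {..<n} \<Longrightarrow> sign (lift_perm \<pi>) = sign \<pi>"
  by (simp add: lift_perm_eq sign_map_permutation)

lemma lift_perm_ex:
  assumes "\<pi> permutes {..<Suc n}" "\<pi> 0 = 0"
  shows "\<exists>\<pi>'. \<pi>' permutes {..<n} \<and> \<pi> = lift_perm \<pi>'"
proof -
  define \<pi>' where "\<pi>' i = \<pi> (Suc i) - 1" for i
  have inj: "inj \<pi>" using assms(1) permutes_inj by blast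
  have pos: "\<pi> (Suc i) \<noteq> 0" for i using inj assms(2) by (metis injD nat.distinct(1))
  have lift: "\<pi> = lift_perm \<pi>'"
    using assms(2) pos by (auto simp: fun_eq_iff lift_perm_def \<pi>'_def split: nat.split)
  have out: "\<pi>' i = i" if "i \<notin> {..<n}" for i
    using assms(1) that by (simp add: \<pi>'_def permutes_def)
  have "inj \<pi>'"
    by (rule injI) (metis \<pi>'_def pos inj Suc_pred' bot_nat_0.not_eq_extremum diff_Suc_1 injD nat.inject)
  moreover have "\<pi>' ` {..<n} \<subseteq> {..<n}"
  proof
    fix k assume "k \<in> \<pi>' ` {..<n}"
    then obtain i where i: "i < n" "k = \<pi>' i" by auto
    have "\<pi> (Suc i) \<in> {..<Suc n}" using permutes_in_image[OF assms(1), of "Suc i"] i by simp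
    then show "k \<in> {..<n}" using i pos[of i] by (auto simp: \<pi>'_def)
  qed
  ultimately have "bij_betw \<pi>' {..<n} {..<n}"
    using endo_inj_surj[of "{..<n}" \<pi>'] inj_on_subset[of \<pi>' UNIV "{..<n}"] by (simp add: bij_betw_def)
  then show ?thesis using bij_imp_permutes out lift by blast
qed

lemma pq_shufflesD:
  assumes "\<pi> \<in> pq_shuffles p q"
  shows "\<pi> permutes {..<p + q}" "i < j \<Longrightarrow> j < p \<Longrightarrow> \<pi> i < \<pi> j"
    "p \<le> i \<Longrightarrow> i < j \<Longrightarrow> j < p + q \<Longrightarrow> \<pi> i < \<pi> j"
  using assms by (auto simp: pq_shuffles_def strict_mono_on_def)

lemma pq_shufflesI:
  assumes "\<pi> permutes {..<p + q}" "\<And>i j. i < j \<Longrightarrow> j < p \<Longrightarrow> \<pi> i < \<pi> j"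
    "\<And>i j. p \<le> i \<Longrightarrow> i < j \<Longrightarrow> j < p + q \<Longrightarrow> \<pi> i < \<pi> j"
  shows "\<pi> \<in> pq_shuffles p q"
  using assms by (auto simp: pq_shuffles_def strict_mono_on_def)

lemma finite_pq_shuffles: "finite (pq_shuffles p q)"
  by (rule finite_subset[OF _ finite_permutations[of "{..<p + q}"]]) (auto simp: pq_shuffles_def)

lemma pq_shuffles_first:
  "{\<pi> \<in> pq_shuffles (Suc p) q. \<pi> 0 = 0} = lift_perm ` pq_shuffles p q"
proof (rule equalityI; rule subsetI)
  fix \<pi> assume "\<pi> \<in> {\<pi> \<in> pq_shuffles (Suc p) q. \<pi> 0 = 0}"
  then have \<pi>: "\<pi> \<in> pq_shuffles (Suc p) q" "\<pi> 0 = 0" by auto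
  then obtain \<pi>' where \<pi>': "\<pi>' permutes {..<p + q}" "\<pi> = lift_perm \<pi>'"
    using lift_perm_ex[of \<pi> "p + q"] pq_shufflesD(1)[OF \<pi>(1)] by auto
  have "\<pi>' \<in> pq_shuffles p q"
    by (rule pq_shufflesI[OF \<pi>'(1)])
       (use pq_shufflesD(2,3)[OF \<pi>(1), of "Suc i" "Suc j" for i j] in \<open>auto simp: \<pi>'(2) lift_perm_def\<close>)
  then show "\<pi> \<in> lift_perm ` pq_shuffles p q" using \<pi>'(2) by blast
next
  fix \<pi> assume "\<pi> \<in> lift_perm ` pq_shuffles p q"
  then obtain \<pi>' where \<pi>': "\<pi>' \<in> pq_shuffles p q" "\<pi> = lift_perm \<pi>'" by blast
  have "\<pi> \<in> pq_shuffles (Suc p) q"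
    by (rule pq_shufflesI)
       (use lift_perm_permutes[OF pq_shufflesD(1)[OF \<pi>'(1)]] pq_shufflesD(2,3)[OF \<pi>'(1)]
         in \<open>auto simp: \<pi>'(2) lift_perm_def split: nat.splits\<close>)
  then show "\<pi> \<in> {\<pi> \<in> pq_shuffles (Suc p) q. \<pi> 0 = 0}" using \<pi>'(2) by (simp add: lift_perm_def)
qed

text \<open>Composition with the cycle carries the value 0 from the front to place \<open>p\<close>,
  the first place of the second block, and keeps both blocks increasing.\<close>

lemma pq_shuffles_second:
  "{\<pi> \<in> pq_shuffles p (Suc q). \<pi> p = 0} = (\<lambda>\<pi>. lift_perm \<pi> \<circ> cyc p) ` pq_shuffles p q"
proof (rule equalityI; rule subsetI)
  fix \<pi> assume "\<pi> \<in> {\<pi> \<in> pq_shuffles p (Suc q). \<pi> p = 0}"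
  then have \<pi>: "\<pi> \<in> pq_shuffles p (Suc q)" "\<pi> p = 0" by auto
  \<comment> \<open>Undoing the cycle leaves a permutation that fixes 0, to which
    \<open>lift_perm_ex\<close> applies.\<close>
  define \<rho> where "\<rho> = \<pi> \<circ> inv_into UNIV (cyc p)"
  have c: "cyc p permutes {..<Suc (p + q)}" by (rule cyc_permutes) simp
  have pc: "\<pi> = \<rho> \<circ> cyc p" using permutes_inv_o(2)[OF c] by (simp add: \<rho>_def comp_assoc)
  have "\<rho> permutes {..<Suc (p + q)}"
    unfolding \<rho>_def using permutes_compose[OF permutes_inv[OF c]] pq_shufflesD(1)[OF \<pi>(1)] by simp
  moreover have "\<rho> 0 = 0" using fun_cong[OF pc, of p] \<pi>(2) by (simp add: cyc_apply)
  ultimately obtain \<pi>' where \<pi>': "\<pi>' permutes {..<p + q}" "\<rho> = lift_perm \<pi>'" using lift_perm_ex by blast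
  have val: "\<pi> i = (if i < p then Suc (\<pi>' i) else if i = p then 0 else Suc (\<pi>' (i - 1)))" for i
    by (auto simp: pc \<pi>'(2) cyc_apply lift_perm_def split: nat.split)
  have "\<pi>' \<in> pq_shuffles p q"
  proof (rule pq_shufflesI[OF \<pi>'(1)])
    fix i j assume "i < j" "j < p" then show "\<pi>' i < \<pi>' j"
      using pq_shufflesD(2)[OF \<pi>(1), of i j] by (simp add: val)
  next
    fix i j assume "p \<le> i" "i < j" "j < p + q" then show "\<pi>' i < \<pi>' j"
      using pq_shufflesD(3)[OF \<pi>(1), of "Suc i" "Suc j"] by (simp add: val)
  qed
  then show "\<pi> \<in> (\<lambda>\<pi>. lift_perm \<pi> \<circ> cyc p) ` pq_shuffles p q" using pc \<pi>'(2) by blast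
next
  fix \<pi> assume "\<pi> \<in> (\<lambda>\<pi>. lift_perm \<pi> \<circ> cyc p) ` pq_shuffles p q"
  then obtain \<pi>' where \<pi>': "\<pi>' \<in> pq_shuffles p q" "\<pi> = lift_perm \<pi>' \<circ> cyc p" by blast
  have val: "\<pi> i = (if i < p then Suc (\<pi>' i) else if i = p then 0 else Suc (\<pi>' (i - 1)))" for i
    by (auto simp: \<pi>'(2) cyc_apply lift_perm_def split: nat.split)
  have "\<pi> permutes {..<p + Suc q}"
    unfolding \<pi>'(2) using permutes_compose[OF cyc_permutes[of p "Suc (p + q)"] lift_perm_permutes[OF pq_shufflesD(1)[OF \<pi>'(1)]]]
    by simp
  then have "\<pi> \<in> pq_shuffles p (Suc q)"
  proof (rule pq_shufflesI)
    fix i j assume "i < j" "j < p" then show "\<pi> i < \<pi> j"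
      using pq_shufflesD(2)[OF \<pi>'(1), of i j] by (simp add: val)
  next
    fix i j assume "p \<le> i" "i < j" "j < p + Suc q" then show "\<pi> i < \<pi> j"
      using pq_shufflesD(3)[OF \<pi>'(1), of "i - 1" "j - 1"] by (auto simp: val)
  qed
  then show "\<pi> \<in> {\<pi> \<in> pq_shuffles p (Suc q). \<pi> p = 0}" by (simp add: val)
qed

text \<open>A shuffle is increasing on both blocks, so its smallest value can occur only at the
  beginning of a block. This is the choice of the first step of the path.\<close>

lemma pq_shuffles_zero:
  assumes "\<pi> \<in> pq_shuffles p q" "p + q > 0"
  shows "p > 0 \<and> \<pi> 0 = 0 \<or> q > 0 \<and> \<pi> p = 0"
proof -
  obtain i where i: "\<pi> i = 0" using pq_shufflesD(1)[OF assms(1)] permutes_surj by (metis surjD)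
  have "i < p + q" using permutes_in_image[OF pq_shufflesD(1)[OF assms(1)], of i] i assms(2) by simp
  then show ?thesis
    using pq_shufflesD(2)[OF assms(1), of 0 i] pq_shufflesD(3)[OF assms(1), of p i] i
    by (cases "i = 0"; cases "i = p"; cases "i < p") auto
qed

lemma lift_perm_inj: "inj lift_perm"
proof (rule injI)
  fix \<pi> \<rho> assume "lift_perm \<pi> = lift_perm \<rho>"
  then have "lift_perm \<pi> (Suc i) = lift_perm \<rho> (Suc i)" for i by simp
  then show "\<pi> = \<rho>" by (auto simp: lift_perm_def)
qed

text \<open>The sum in \<open>shuffle_simplex\<close> with vertex lists in place of simplices: each
  list is stretched at the moments when the other one advances.\<close>

definition shuffle_sum :: "nat \<Rightarrow> nat \<Rightarrow> 'a list \<Rightarrow> 'b list \<Rightarrow> (('a \<times> 'b) list \<Rightarrow>\<^sub>0 int)" where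
  "shuffle_sum p q xs ys = (\<Sum>\<pi>\<in>pq_shuffles p q. frag_cmul (sign \<pi>)
     (frag_of (zip (dups xs (map \<pi> [p..<p + q])) (dups ys (map \<pi> [0..<p])))))"

lemma shuffle_sum_first:
  "(\<Sum>\<pi>\<in>lift_perm ` pq_shuffles p q. frag_cmul (sign \<pi>)
     (frag_of (zip (dups (x # xs) (map \<pi> [Suc p..<Suc p + q])) (dups (y # ys) (map \<pi> [0..<Suc p])))))
   = consf (x, y) (shuffle_sum p q xs (y # ys))"
proof -
  have "frag_cmul (sign (lift_perm \<pi>)) (frag_of (zip (dups (x # xs) (map (lift_perm \<pi>) [Suc p..<Suc p + q]))
      (dups (y # ys) (map (lift_perm \<pi>) [0..<Suc p])))) =
    consf (x, y) (frag_cmul (sign \<pi>) (frag_of (zip (dups xs (map \<pi> [p..<p + q])) (dups (y # ys) (map \<pi> [0..<p])))))"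
    if "\<pi> \<in> pq_shuffles p q" for \<pi>
  proof -
    have "[Suc p..<Suc p + q] = map Suc [p..<p + q]" "[0..<Suc p] = 0 # map Suc [0..<p]"
      by (simp_all only: map_Suc_upt upt_conv_Cons zero_less_Suc add_Suc)
    then have "map (lift_perm \<pi>) [Suc p..<Suc p + q] = map Suc (map \<pi> [p..<p + q])"
      "map (lift_perm \<pi>) [0..<Suc p] = 0 # map Suc (map \<pi> [0..<p])"
      by (simp_all add: lift_perm_def)
    then show ?thesis
      by (simp only: dups_Suc dups_0 sign_lift_perm[OF pq_shufflesD(1)[OF that]] consf_lin consf_of zip_Cons_Cons)
  qed
  then show ?thesis
    unfolding shuffle_sum_def zlin_sum[OF zlin_consf]
    by (subst sum.reindex[OF inj_on_subset[OF lift_perm_inj subset_UNIV]]) simp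
qed

lemma shuffle_sum_second:
  "(\<Sum>\<pi>\<in>(\<lambda>\<pi>. lift_perm \<pi> \<circ> cyc p) ` pq_shuffles p q. frag_cmul (sign \<pi>)
     (frag_of (zip (dups (x # xs) (map \<pi> [p..<p + Suc q])) (dups (y # ys) (map \<pi> [0..<p])))))
   = consf (x, y) (frag_cmul ((- 1) ^ p) (shuffle_sum p q (x # xs) ys))"
proof -
  have eq: "frag_cmul (sign (lift_perm \<pi> \<circ> cyc p)) (frag_of (zip (dups (x # xs) (map (lift_perm \<pi> \<circ> cyc p) [p..<p + Suc q]))
      (dups (y # ys) (map (lift_perm \<pi> \<circ> cyc p) [0..<p])))) =
    consf (x, y) (frag_cmul ((- 1) ^ p) (frag_cmul (sign \<pi>) (frag_of (zip (dups (x # xs) (map \<pi> [p..<p + q])) (dups ys (map \<pi> [0..<p]))))))"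
    if \<pi>: "\<pi> \<in> pq_shuffles p q" for \<pi>
  proof -
    have "[p..<p + Suc q] = p # map Suc [p..<p + q]"
      by (simp add: map_Suc_upt upt_conv_Cons)
    then have "map (lift_perm \<pi> \<circ> cyc p) [p..<p + Suc q] = 0 # map Suc (map \<pi> [p..<p + q])"
      by (simp add: lift_perm_def cyc_apply)
    moreover have "map (lift_perm \<pi> \<circ> cyc p) [0..<p] = map Suc (map \<pi> [0..<p])"
      by (simp add: lift_perm_def cyc_apply)
    moreover have "sign (lift_perm \<pi> \<circ> cyc p) = (- 1) ^ p * sign \<pi>"
    proof -
      have "permutation (lift_perm \<pi>)" "permutation (cyc p)"
        using lift_perm_permutes[OF pq_shufflesD(1)[OF \<pi>]] cyc_permutes[of p "Suc p"] permutation_permutes by blast+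
      then show ?thesis
        by (simp add: sign_compose sign_lift_perm[OF pq_shufflesD(1)[OF \<pi>]] sign_cyc)
    qed
    ultimately show ?thesis
      by (simp only: dups_Suc dups_0 consf_lin consf_of zip_Cons_Cons frag_cmul_cmul)
  qed
  have "inj (\<lambda>\<pi>. lift_perm \<pi> \<circ> cyc p)"
  proof (rule injI)
    fix \<pi> \<rho> assume "lift_perm \<pi> \<circ> cyc p = lift_perm \<rho> \<circ> cyc p"
    then have "lift_perm \<pi> = lift_perm \<rho>"
      using permutes_surj[OF cyc_permutes[of p "Suc p"]] by (metis fun.map_cong0 lessI surj_fun_eq)
    then show "\<pi> = \<rho>" using lift_perm_inj by (simp add: inj_eq)
  qed
  from sum.reindex[OF inj_on_subset[OF this subset_UNIV]] show ?thesis
    unfolding shuffle_sum_def frag_cmul_sum' zlin_sum[OF zlin_consf]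
    by (rule trans) (rule sum.cong[OF refl], simp only: o_apply eq)
qed

text \<open>Sorting the shuffles by their first step reproduces the recursion of \<open>sh\<close>.
  The signed sum over permutations can be forgotten from here until it is matched with the given
  Kuenneth morphism.\<close>

lemma shuffle_sum_eq_sh:
  "length xs = Suc p \<Longrightarrow> length ys = Suc q \<Longrightarrow> shuffle_sum p q xs ys = sh xs ys"
proof (induction "p + q" arbitrary: p q xs ys rule: less_induct)
  case less
  let ?f = "\<lambda>\<pi>. frag_cmul (sign \<pi>) (frag_of (zip (dups xs (map \<pi> [p..<p + q])) (dups ys (map \<pi> [0..<p]))))"
  obtain x xs' y ys' where s: "xs = x # xs'" "ys = y # ys'" using less by (metis length_Suc_conv)
  have l: "length xs' = p" "length ys' = q" using less s by auto
  let ?A = "{\<pi> \<in> pq_shuffles p q. p > 0 \<and> \<pi> 0 = 0}" and ?B = "{\<pi> \<in> pq_shuffles p q. q > 0 \<and> \<pi> p = 0}"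
  show ?case
  proof (cases "p + q = 0")
    case True
    then have "pq_shuffles p q = {id}" by (auto simp: pq_shuffles_def permutes_id)
    then show ?thesis using True s l by (simp add: shuffle_sum_def dups_def)
  next
    case False
    then have pos: "p + q > 0" by simp
    have "pq_shuffles p q = ?A \<union> ?B" using pq_shuffles_zero[OF _ pos] by blast
    moreover have "\<pi> \<notin> ?B" if "\<pi> \<in> ?A" for \<pi>
      using permutes_inj[OF pq_shufflesD(1), of \<pi> p q] that by (auto dest: injD[of _ 0 p])
    then have "?A \<inter> ?B = {}" by blast
    ultimately have sum: "shuffle_sum p q xs ys = sum ?f ?A + sum ?f ?B"
      unfolding shuffle_sum_def using sum.union_disjoint[of ?A ?B ?f] finite_pq_shuffles[of p q] by simp
    have A: "sum ?f ?A = consf (x, y) (sh xs' ys)"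
    proof (cases p)
      case 0 then show ?thesis using l by (simp add: consf_lin)
    next
      case (Suc p')
      have "sum ?f ?A = consf (x, y) (shuffle_sum p' q xs' (y # ys'))"
        unfolding shuffle_sum_first[symmetric] pq_shuffles_first[symmetric] by (simp add: Suc s)
      then show ?thesis using less(1)[of p' q xs' ys] l s Suc by simp
    qed
    have B: "sum ?f ?B = consf (x, y) (frag_cmul ((- 1) ^ p) (sh xs ys'))"
    proof (cases q)
      case 0 then show ?thesis using l by (simp add: consf_lin)
    next
      case (Suc q')
      have "sum ?f ?B = consf (x, y) (frag_cmul ((- 1) ^ p) (shuffle_sum p q' (x # xs') ys'))"
        unfolding shuffle_sum_second[symmetric] pq_shuffles_second[symmetric] by (simp add: Suc s)
      then show ?thesis using less(1)[of p q' xs ys'] l s Suc by simp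
    qed
    have "\<not> (xs' = [] \<and> ys' = [])" using False l by auto
    then show ?thesis unfolding sum A B using s l by (auto simp: consf_lin)
  qed
qed

section \<open>Simplicial chains\<close>

text \<open>The affine map of simplices with vertices \<open>e\<^bsub>a\<^esub>\<close>, \<open>a\<close> in the list.\<close>

primrec lin :: "nat list \<Rightarrow> vec \<Rightarrow> vec" where
  "lin [] t = (\<lambda>i. 0)"
| "lin (a # as) t = (\<lambda>i. (if i = a then t 0 else 0) + lin as (t \<circ> Suc) i)"

definition del_nth :: "nat \<Rightarrow> 'a list \<Rightarrow> 'a list" where
  "del_nth k l = take k l @ drop (Suc k) l"

lemma lin_add: "lin l (\<lambda>i. f i + g i) = (\<lambda>i. lin l f i + lin l g i)"
  by (induction l arbitrary: f g) (auto simp: o_def fun_eq_iff)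

lemma lin_zero: "lin l (\<lambda>i. 0) = (\<lambda>i. 0)"
  by (induction l) (auto simp: o_def fun_eq_iff)

lemma lin_single: "a < length l \<Longrightarrow> lin l (\<lambda>i. if i = a then s else 0) = (\<lambda>i. if i = l ! a then s else 0)"
proof (induction l arbitrary: a)
  case (Cons b l)
  show ?case
  proof (cases a)
    case 0 then show ?thesis by (auto simp: o_def fun_eq_iff lin_zero)
  next
    case (Suc a')
    then show ?thesis using Cons by (auto simp: o_def fun_eq_iff)
  qed
qed simp

lemma lin_map: "\<forall>a\<in>set as. a < length l \<Longrightarrow> lin (map ((!) l) as) t = lin l (lin as t)"
proof (induction as arbitrary: t)
  case (Cons a as)
  then show ?case by (auto simp: lin_add lin_single fun_eq_iff)
qed (simp add: lin_zero)

lemma lin_upt: "lin [m..<m + n] t i = (if m \<le> i \<and> i < m + n then t (i - m) else 0)"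
proof (induction n arbitrary: m t)
  case (Suc n)
  have "[m..<m + Suc n] = m # [Suc m..<Suc m + n]" by (simp add: upt_conv_Cons)
  then have "lin [m..<m + Suc n] t i = (if i = m then t 0 else 0) + lin [Suc m..<Suc m + n] (t \<circ> Suc) i"
    by (simp only: lin.simps)
  then show ?case unfolding Suc by (auto simp: Suc_diff_le Suc_diff_Suc)
qed simp

lemma lin_id: "t \<in> standard_simplex p \<Longrightarrow> lin [0..<Suc p] t = t"
  using lin_upt[of 0 "Suc p" t] by (auto simp: fun_eq_iff standard_simplex_def simp del: upt_Suc)

lemma lin_face: "k < length l \<Longrightarrow> lin l (simplical_face k t) = lin (del_nth k l) t"
proof (induction l arbitrary: k t)
  case (Cons a l)
  show ?case
  proof (cases k)
    case 0
    have "simplical_face 0 t \<circ> Suc = t" "simplical_face 0 t 0 = 0" by (auto simp: simplical_face_def)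
    then show ?thesis by (simp add: 0 del_nth_def cong: if_cong)
  next
    case (Suc k')
    have "simplical_face (Suc k') t \<circ> Suc = simplical_face k' (t \<circ> Suc)"
      by (auto simp: simplical_face_def fun_eq_iff)
    moreover have "simplical_face (Suc k') t 0 = t 0" by (simp add: simplical_face_def)
    ultimately show ?thesis using Cons Suc by (simp add: del_nth_def o_def cong: if_cong)
  qed
qed simp

lemma lin_degen: "k < length l \<Longrightarrow> lin l (simplical_degen k t) = lin (dup k l) t"
proof (induction l arbitrary: k t)
  case (Cons a l)
  show ?case
  proof (cases k)
    case 0
    have "simplical_degen 0 t \<circ> Suc = t \<circ> Suc \<circ> Suc" "simplical_degen 0 t 0 = t 0 + t 1"
      by (auto simp: simplical_degen_def)
    then show ?thesis unfolding 0 lin.simps dup.simps by auto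
  next
    case (Suc k')
    have "simplical_degen (Suc k') t \<circ> Suc = simplical_degen k' (t \<circ> Suc)"
      by (auto simp: simplical_degen_def fun_eq_iff)
    moreover have "simplical_degen (Suc k') t 0 = t 0" by (simp add: simplical_degen_def)
    ultimately show ?thesis using Cons Suc by (simp add: o_def cong: if_cong)
  qed
qed simp

lemma lin_eq_sum: "lin l t i = (\<Sum>k<length l. if l ! k = i then t k else 0)"
proof (induction l arbitrary: t)
  case (Cons a l)
  have "(\<Sum>k<length (a # l). if (a # l) ! k = i then t k else 0)
      = (if a = i then t 0 else 0) + (\<Sum>k<length l. if l ! k = i then t (Suc k) else 0)"
    by (simp add: sum.lessThan_Suc_shift del: sum.lessThan_Suc)
  then show ?case by (simp add: Cons del: sum.lessThan_Suc cong: if_cong)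
qed simp

lemma lin_sum:
  assumes "set l \<subseteq> {..p}" shows "(\<Sum>i\<le>p. lin l t i) = (\<Sum>k<length l. t k)"
proof -
  have "(\<Sum>i\<le>p. lin l t i) = (\<Sum>k<length l. \<Sum>i\<le>p. if l ! k = i then t k else 0)"
    unfolding lin_eq_sum by (rule sum.swap)
  also have "\<dots> = (\<Sum>k<length l. t k)"
    by (rule sum.cong) (use assms nth_mem in \<open>fastforce simp: sum.delta'\<close>)+
  finally show ?thesis .
qed

lemma lin_simplex:
  assumes "t \<in> standard_simplex n" "length l = Suc n" "set l \<subseteq> {..p}"
  shows "lin l t \<in> standard_simplex p"
proof -
  have t: "\<And>i. 0 \<le> t i" "(\<Sum>i\<le>n. t i) = 1" using assms(1) by (auto simp: standard_simplex_def)
  have nn: "0 \<le> lin l t i" for i unfolding lin_eq_sum by (rule sum_nonneg) (simp add: t)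
  have s: "(\<Sum>i\<le>p. lin l t i) = 1" using lin_sum[OF assms(3)] t(2) assms(2) by (simp add: lessThan_Suc_atMost)
  have z: "lin l t i = 0" if "i > p" for i
    unfolding lin_eq_sum by (rule sum.neutral) (use assms(3) nth_mem that in fastforce)
  have "lin l t i \<le> 1" for i
  proof (cases "i \<le> p")
    case True
    then show ?thesis using member_le_sum[of i "{..p}" "lin l t"] nn s by simp
  qed (simp add: z)
  then show ?thesis using nn s z by (simp add: standard_simplex_def)
qed

lemma continuous_map_coord: "continuous_map (mtop S) euclideanreal (\<lambda>t. t i)"
  by (rule continuous_map_from_subtopology) (auto intro: continuous_map_product_projection)

lemma lin_continuous:
  assumes "length l = Suc n" "set l \<subseteq> {..p}"
  shows "continuous_map (mtop (standard_simplex n)) (mtop (standard_simplex p)) (lin l)"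
proof -
  have "continuous_map (mtop (standard_simplex n)) euclideanreal (\<lambda>t. lin l t i)" for i
    unfolding lin_eq_sum by (intro continuous_map_sum) (auto simp: continuous_map_coord)
  then show ?thesis
    using lin_simplex[OF _ assms] by (auto simp: continuous_map_in_subtopology continuous_map_componentwise_UNIV)
qed

text \<open>\<open>W\<close> realizes vertex lists as maps on simplices, and renaming positions
  corresponds to an affine map of the domain. Affine simplices and pairs of such realizations have
  this property, so list identities turn into identities of chains in products of any number of
  simplices.\<close>

definition vlin :: "('v list \<Rightarrow> vec \<Rightarrow> 'x) \<Rightarrow> bool" where
  "vlin W \<longleftrightarrow> (\<forall>l as t. (\<forall>a\<in>set as. a < length l) \<longrightarrow> W (map ((!) l) as) t = W l (lin as t))"

definition pairW :: "('v list \<Rightarrow> vec \<Rightarrow> 'x) \<Rightarrow> ('w list \<Rightarrow> vec \<Rightarrow> 'y) \<Rightarrow> ('v \<times> 'w) list \<Rightarrow> vec \<Rightarrow> 'x \<times> 'y" where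
  "pairW W V l t = (W (map fst l) t, V (map snd l) t)"

definition vcells :: "('v list \<Rightarrow> vec \<Rightarrow> 'x) \<Rightarrow> 'v set \<Rightarrow> 'x topology \<Rightarrow> bool" where
  "vcells W A X \<longleftrightarrow> (\<forall>l n. set l \<subseteq> A \<and> length l = Suc n \<longrightarrow> continuous_map (mtop (standard_simplex n)) X (W l))"

definition RW :: "('v list \<Rightarrow> vec \<Rightarrow> 'x) \<Rightarrow> nat \<Rightarrow> ('v list \<Rightarrow>\<^sub>0 int) \<Rightarrow> 'x chain" where
  "RW W n = frag_extend (\<lambda>l. frag_of (restrict (W l) (standard_simplex n)))"

lemma vlinD: "vlin W \<Longrightarrow> (\<And>a. a \<in> set as \<Longrightarrow> a < length l) \<Longrightarrow> W (map ((!) l) as) t = W l (lin as t)"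
  by (simp add: vlin_def)

lemma vlin_lin: "vlin lin"
  by (simp add: vlin_def lin_map)

lemma vcells_lin: "vcells lin {..p} (mtop (standard_simplex p))"
  by (simp add: vcells_def lin_continuous)

lemma vlin_pairW: "vlin W \<Longrightarrow> vlin V \<Longrightarrow> vlin (pairW W V)"
  unfolding vlin_def pairW_def
proof (intro allI impI)
  fix l :: "('a \<times> 'c) list" and as t
  assume W: "\<forall>l as t. (\<forall>a\<in>set as. a < length l) \<longrightarrow> W (map ((!) l) as) t = W l (lin as t)"
    and V: "\<forall>l as t. (\<forall>a\<in>set as. a < length l) \<longrightarrow> V (map ((!) l) as) t = V l (lin as t)"
    and as: "\<forall>a\<in>set as. a < length l"
  have "map fst (map ((!) l) as) = map ((!) (map fst l)) as" "map snd (map ((!) l) as) = map ((!) (map snd l)) as"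
    using as by auto
  moreover have "W (map ((!) (map fst l)) as) t = W (map fst l) (lin as t)"
    "V (map ((!) (map snd l)) as) t = V (map snd l) (lin as t)"
    by (rule W[rule_format] V[rule_format]; use as in simp)+
  ultimately show "(W (map fst (map ((!) l) as)) t, V (map snd (map ((!) l) as)) t) = (W (map fst l) (lin as t), V (map snd l) (lin as t))"
    by (simp only:)
qed

lemma vcells_pairW: "vcells W A X \<Longrightarrow> vcells V B Y \<Longrightarrow> vcells (pairW W V) (A \<times> B) (prod_topology X Y)"
  unfolding vcells_def pairW_def continuous_map_pairwise
proof (intro allI impI conjI)
  fix l :: "('a \<times> 'c) list" and n
  assume W: "\<forall>l n. set l \<subseteq> A \<and> length l = Suc n \<longrightarrow> continuous_map (mtop (standard_simplex n)) X (W l)"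
    and V: "\<forall>l n. set l \<subseteq> B \<and> length l = Suc n \<longrightarrow> continuous_map (mtop (standard_simplex n)) Y (V l)"
    and l: "set l \<subseteq> A \<times> B \<and> length l = Suc n"
  have "set (map fst l) \<subseteq> A" "set (map snd l) \<subseteq> B" using l by auto
  then show "continuous_map (mtop (standard_simplex n)) X (fst \<circ> (\<lambda>t. (W (map fst l) t, V (map snd l) t)))"
    "continuous_map (mtop (standard_simplex n)) Y (snd \<circ> (\<lambda>t. (W (map fst l) t, V (map snd l) t)))"
    using W V l by (auto simp: o_def)
qed

lemma vcells_cell:
  assumes "vcells W A X" "set l \<subseteq> A" "length l = Suc n"
  shows "restrict (W l) (standard_simplex n) \<in> cells (standard_simplex n) X"
proof -
  have "continuous_map (mtop (standard_simplex n)) X (W l)" using assms by (simp add: vcells_def)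
  then have "continuous_map (mtop (standard_simplex n)) X (restrict (W l) (standard_simplex n))"
    by (rule continuous_map_eq) simp
  then show ?thesis by (simp add: cells_def)
qed

lemma zlin_RW: "zlin (RW W n)"
  by (simp add: RW_def zlin_frag_extend)

lemma RW_of: "RW W n (frag_of l) = frag_of (restrict (W l) (standard_simplex n))"
  by (simp add: RW_def)

lemma RW_chain:
  assumes "vcells W A X" "\<And>l. l \<in> Poly_Mapping.keys x \<Longrightarrow> set l \<subseteq> A \<and> length l = Suc n"
  shows "RW W n x \<in> chains (standard_simplex n) X"
  by (rule zlin_mem[OF zlin_RW subgrp_chains order_refl])
     (use assms(2) vcells_cell[OF assms(1)] in \<open>auto simp: RW_of frag_of_chains\<close>)

definition sbd :: "nat \<Rightarrow> vec chain" where
  "sbd p = (if p = 0 then 0 else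
     \<Sum>k\<le>p. frag_cmul ((- 1) ^ k) (frag_of (restrict (simplical_face k) (standard_simplex (p - 1)))))"

lemma sbd_Suc: "sbd (Suc p) =
    (\<Sum>k\<le>Suc p. frag_cmul ((- 1) ^ k) (frag_of (restrict (simplical_face k) (standard_simplex p))))"
  by (simp add: sbd_def)

lemma push_sbd: "push (standard_simplex p) c (sbd (Suc p)) =
    (\<Sum>k\<le>Suc p. frag_cmul ((- 1) ^ k) (frag_of (restrict (c \<circ> simplical_face k) (standard_simplex p))))"
proof -
  have "restrict (c \<circ> restrict (simplical_face k) (standard_simplex p)) (standard_simplex p)
      = restrict (c \<circ> simplical_face k) (standard_simplex p)" for k by auto
  then show ?thesis by (simp only: sbd_Suc zlin_sum[OF zlin_push] zlin_cmul[OF zlin_push] push_of)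
qed

lemma act_sbd: "act (standard_simplex p) (sbd (Suc p)) x = chain_boundary (Suc p) x"
proof (rule zlin_eq[OF zlin_act _ subset_UNIV])
  show "zlin (chain_boundary (Suc p))" by (simp add: zlin_def chain_boundary_diff)
  fix c show "act (standard_simplex p) (sbd (Suc p)) (frag_of c) = chain_boundary (Suc p) (frag_of c)"
    by (simp only: act_of push_sbd chain_boundary_of singular_face_def diff_Suc_Suc minus_nat.diff_0 if_False nat.distinct)
qed

lemma dl_eq_sum: "dl l = (\<Sum>k<length l. frag_cmul ((- 1) ^ k) (frag_of (del_nth k l)))"
proof (induction l)
  case (Cons v l)
  have "consf v (dl l) = (\<Sum>k<length l. frag_cmul ((- 1) ^ k) (frag_of (v # del_nth k l)))"
    by (simp add: Cons zlin_sum[OF zlin_consf] consf_lin)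
  moreover have "(\<Sum>k<length (v # l). frag_cmul ((- 1) ^ k) (frag_of (del_nth k (v # l))))
     = frag_of l + (\<Sum>k<length l. frag_cmul (- ((- 1) ^ k)) (frag_of (v # del_nth k l)))"
    by (simp add: sum.lessThan_Suc_shift del_nth_def del: sum.lessThan_Suc)
  ultimately show ?case by (simp add: sum_negf flip: minus_frag_cmul)
qed simp

lemma del_nth_map: "del_nth k (map f l) = map f (del_nth k l)"
  by (simp add: del_nth_def take_map drop_map)

lemma dup_map: "dup k (map f l) = map f (dup k l)"
  by (induction k l rule: dup.induct) auto

lemma set_del_nth: "set (del_nth k l) \<subseteq> set l"
  using set_take_subset[of k l] set_drop_subset[of "Suc k" l] by (auto simp: del_nth_def)

lemma set_dup: "set (dup k l) = set l"
  by (induction k l rule: dup.induct) auto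

lemma length_dup: "k < length l \<Longrightarrow> length (dup k l) = Suc (length l)"
  by (induction k l rule: dup.induct) auto

lemma face_simplex: "t \<in> standard_simplex p \<Longrightarrow> k \<le> Suc p \<Longrightarrow> simplical_face k t \<in> standard_simplex (Suc p)"
  using simplical_face_in_standard_simplex[of "Suc p" k t] by simp

text \<open>Every list is the image of its list of positions, so by \<open>vlin\<close> only the
  affine simplex on the positions has to be computed.\<close>

lemma vlin_face:
  assumes "vlin W" "length l = Suc (Suc p)" "k \<le> Suc p" "t \<in> standard_simplex p"
  shows "W l (simplical_face k t) = W (del_nth k l) t"
proof -
  have "W (del_nth k l) t = W (map ((!) l) (del_nth k [0..<length l])) t"
    by (simp add: map_nth flip: del_nth_map)
  also have "\<dots> = W l (lin (del_nth k [0..<length l]) t)"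
    by (rule vlinD[OF assms(1)]) (use set_del_nth[of k "[0..<length l]"] in auto)
  also have "lin (del_nth k [0..<length l]) t = lin [0..<length l] (simplical_face k t)"
    using assms by (simp add: lin_face del: upt_Suc)
  also have "\<dots> = simplical_face k t"
    unfolding assms(2) by (rule lin_id[OF face_simplex[OF assms(4,3)]])
  finally show ?thesis by simp
qed

lemma degen_simplex:
  assumes "t \<in> standard_simplex (Suc p)" "k \<le> p" shows "simplical_degen k t \<in> standard_simplex p"
proof -
  have "lin (dup k [0..<Suc p]) t = lin [0..<Suc p] (simplical_degen k t)"
    using assms by (simp add: lin_degen del: upt_Suc)
  moreover have "lin [0..<Suc p] (simplical_degen k t) = simplical_degen k t"
    using lin_upt[of 0 "Suc p" "simplical_degen k t"] assms
    by (auto simp: fun_eq_iff simplical_degen_def standard_simplex_def simp del: upt_Suc)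
  moreover have "lin (dup k [0..<Suc p]) t \<in> standard_simplex p"
    by (rule lin_simplex[OF assms(1)]) (use assms(2) in \<open>auto simp: length_dup set_dup simp del: upt_Suc\<close>)
  ultimately show ?thesis by simp
qed

lemma lin_dup_id:
  assumes "t \<in> standard_simplex (Suc p)" "k \<le> p"
  shows "lin (dup k [0..<Suc p]) t = simplical_degen k t"
proof -
  have "lin (dup k [0..<Suc p]) t = lin [0..<Suc p] (simplical_degen k t)"
    using assms by (simp add: lin_degen del: upt_Suc)
  then show ?thesis using lin_id[OF degen_simplex[OF assms]] by simp
qed

lemma vlin_degen:
  assumes "vlin W" "length l = Suc p" "k \<le> p" "t \<in> standard_simplex (Suc p)"
  shows "W l (simplical_degen k t) = W (dup k l) t"
proof -
  have "W (dup k l) t = W (map ((!) l) (dup k [0..<length l])) t"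
    by (simp add: map_nth flip: dup_map)
  also have "\<dots> = W l (lin (dup k [0..<length l]) t)"
    by (rule vlinD[OF assms(1)]) (auto simp: set_dup)
  finally show ?thesis using lin_dup_id[OF assms(4,3)] by (simp add: assms(2) del: upt_Suc)
qed

text \<open>On realized lists the boundary is deletion of entries. All boundary computations for
  simplices and their products are thereby moved to lists.\<close>

lemma sbd_RW:
  assumes "vlin W" "\<And>l. l \<in> Poly_Mapping.keys x \<Longrightarrow> length l = Suc (Suc p)"
  shows "act (standard_simplex p) (sbd (Suc p)) (RW W (Suc p) x) = RW W p (Dl x)"
proof (rule zlin_eq[OF zlin_comp[OF zlin_act zlin_RW] zlin_comp[OF zlin_RW zlin_frag_extend] order_refl])
  fix l assume "l \<in> Poly_Mapping.keys x"
  then have l: "length l = Suc (Suc p)" by (rule assms(2))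
  have "restrict (restrict (W l) (standard_simplex (Suc p)) \<circ> simplical_face k) (standard_simplex p)
    = restrict (W (del_nth k l)) (standard_simplex p)" if "k \<le> Suc p" for k
    using that by (auto simp: fun_eq_iff restrict_def face_simplex vlin_face[OF assms(1) l])
  then show "act (standard_simplex p) (sbd (Suc p)) (RW W (Suc p) (frag_of l)) = RW W p (Dl (frag_of l))"
    by (simp add: RW_of act_of push_sbd dl_eq_sum l zlin_sum[OF zlin_RW] zlin_cmul[OF zlin_RW]
        lessThan_Suc_atMost del: sum.atMost_Suc sum.lessThan_Suc)
qed

section \<open>The cell theories of simplices\<close>

definition vertex0 :: vec where
  "vertex0 = (\<lambda>i. if i = 0 then 1 else 0)"

text \<open>The apex is vertex 0 with weight \<open>t 0\<close>, and the other coordinates are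
  rescaled to the opposite face. At \<open>t 0 = 1\<close> the rescaling would divide by zero, so
  the value there is prescribed.\<close>

definition scone :: "vec \<Rightarrow> nat \<Rightarrow> (vec \<Rightarrow> vec) \<Rightarrow> vec \<Rightarrow> vec" where
  "scone v p c = (\<lambda>t\<in>standard_simplex (Suc p). if t 0 = 1 then v
     else (\<lambda>i. t 0 * v i + (1 - t 0) * c (\<lambda>k. t (Suc k) / (1 - t 0)) i))"

definition smlt :: "nat \<Rightarrow> nat \<Rightarrow> (vec \<times> vec) chain" where
  "smlt p q = RW (pairW lin lin) (p + q) (sh [0..<Suc p] [0..<Suc q])"

definition simp_data :: "(nat \<Rightarrow> (nat \<times> vec chain) set) \<Rightarrow> cell_data" where
  "simp_data R = \<lparr>mdl = standard_simplex, bdy = sbd, rels = R, base = (\<lambda>_. vertex0), cone = scone, mlt = smlt\<rparr>"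

definition degen_rels :: "nat \<Rightarrow> (nat \<times> vec chain) set" where
  "degen_rels p = {(p - 1, frag_of (restrict (simplical_degen j) (standard_simplex p))) | j. j < p}"

lemma simp_data_sel [simp]: "mdl (simp_data R) = standard_simplex" "bdy (simp_data R) = sbd"
  "rels (simp_data R) = R" "base (simp_data R) = (\<lambda>_. vertex0)" "cone (simp_data R) = scone" "mlt (simp_data R) = smlt"
  by (simp_all add: simp_data_def)

lemma keys_dl_set: "l \<in> Poly_Mapping.keys (dl k) \<Longrightarrow> set l \<subseteq> set k"
proof (induction k arbitrary: l)
  case (Cons v k)
  then have "l = k \<or> l \<in> Poly_Mapping.keys (consf v (dl k))"
    using keys_diff[of "frag_of k" "consf v (dl k)"] by auto
  then show ?case using Cons.IH by (fastforce dest!: keys_consf)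
qed simp

lemma keys_sh_set: "l \<in> Poly_Mapping.keys (sh xs ys) \<Longrightarrow> set l \<subseteq> set xs \<times> set ys"
proof (induction xs ys arbitrary: l rule: sh.induct)
  case (3 x xs y ys)
  show ?case
  proof (cases "xs = [] \<and> ys = []")
    case True then show ?thesis using 3 by simp
  next
    case False
    let ?k = "frag_cmul ((- 1) ^ length xs) (sh (x # xs) ys)"
    obtain l' where l': "l = (x, y) # l'" "l' \<in> Poly_Mapping.keys (sh xs (y # ys) + ?k)"
      using 3(3) False by (auto dest: keys_consf)
    then have "l' \<in> Poly_Mapping.keys (sh xs (y # ys)) \<or> l' \<in> Poly_Mapping.keys (sh (x # xs) ys)"
      using keys_add[of "sh xs (y # ys)" ?k] keys_cmul[of _ "sh (x # xs) ys"] by blast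
    then have "set l' \<subseteq> set xs \<times> set (y # ys) \<or> set l' \<subseteq> set (x # xs) \<times> set ys"
      using 3(1,2)[OF False] by blast
    then show ?thesis using l'(1) by auto
  qed
qed auto

lemma restrict_id_lin: "restrict (\<lambda>t. t) (standard_simplex p) = restrict (lin [0..<Suc p]) (standard_simplex p)"
  by (auto simp: fun_eq_iff restrict_def lin_id simp del: upt_Suc)

lemma idc_RW: "idc (standard_simplex p) = RW lin p (frag_of [0..<Suc p])"
  by (simp only: idc_def RW_of restrict_id_lin)

lemma sbd_eq_RW: "sbd (Suc p) = RW lin p (dl [0..<Suc (Suc p)])"
proof -
  have "sbd (Suc p) = act (standard_simplex p) (sbd (Suc p)) (idc (standard_simplex (Suc p)))"
  proof -
    have "restrict (restrict (\<lambda>t. t) (standard_simplex (Suc p)) \<circ> simplical_face k) (standard_simplex p)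
        = restrict (simplical_face k) (standard_simplex p)" if "k \<le> Suc p" for k
      using that by (auto simp: fun_eq_iff restrict_def face_simplex)
    then show ?thesis unfolding idc_def act_of push_sbd by (subst sbd_Suc) (rule sum.cong, auto)
  qed
  then show ?thesis
    unfolding idc_RW by (subst (asm) sbd_RW) (simp_all add: vlin_lin del: upt_Suc dl.simps)
qed

lemma sbd_chain: "sbd (Suc p) \<in> chains (standard_simplex p) (mtop (standard_simplex (Suc p)))"
  unfolding sbd_eq_RW
proof (rule RW_chain[OF vcells_lin])
  fix l assume l: "l \<in> Poly_Mapping.keys (dl [0..<Suc (Suc p)])"
  show "set l \<subseteq> {..Suc p} \<and> length l = Suc p" using keys_dl[OF l] keys_dl_set[OF l] by auto
qed

lemma sbd_sbd: "act (standard_simplex p) (sbd (Suc p)) (sbd (Suc (Suc p))) = 0"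
proof -
  have "act (standard_simplex p) (sbd (Suc p)) (sbd (Suc (Suc p))) = RW lin p (Dl (dl [0..<Suc (Suc (Suc p))]))"
    unfolding sbd_eq_RW[of "Suc p"] by (rule sbd_RW[OF vlin_lin]) (auto dest!: keys_dl)
  also have "Dl (dl l) = 0" for l :: "nat list"
    by (induction l) (simp_all add: frag_extend_diff Dl_consf consf_lin)
  finally show ?thesis by (simp add: zlin_0[OF zlin_RW])
qed

lemma simp_cell_theory:
  assumes "\<And>m r p. (m, r) \<in> R p \<Longrightarrow> r \<in> chains (standard_simplex p) (mtop (standard_simplex m))"
    "R 0 = {}"
    "\<And>m r p. (m, r) \<in> R (Suc p) \<Longrightarrow>
      act (standard_simplex p) (sbd (Suc p)) r \<in> relspan standard_simplex R p (mtop (standard_simplex m))"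
  shows "cell_theory (simp_data R)"
  by standard (use assms sbd_chain sbd_sbd in \<open>auto simp: sbd_def[of 0]\<close>)

lemma dup_ex: "dupl l \<Longrightarrow> length l = Suc n \<Longrightarrow> \<exists>k l0. k < n \<and> length l0 = n \<and> l = dup k l0 \<and> set l0 = set l"
proof -
  assume "dupl l" "length l = Suc n"
  then obtain as x bs where l: "l = as @ x # x # bs" by (auto simp: dupl_def)
  have "dup (length as) (as @ x # bs) = l" unfolding l by (induction as) auto
  then show ?thesis using \<open>length l = Suc n\<close> l
    by (intro exI[of _ "length as"] exI[of _ "as @ x # bs"]) auto
qed

text \<open>A list with two equal neighbours is \<open>dup k\<close> of a shorter list, so its
  realization factors through a degeneracy.\<close>

lemma dupl_degen:
  assumes W: "vlin W" "vcells W A X" and l: "dupl l" "length l = Suc n" "set l \<subseteq> A"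
  shows "frag_of (restrict (W l) (standard_simplex n)) \<in> relspan standard_simplex degen_rels n X"
proof -
  obtain k l0 where k: "k < n" "length l0 = n" "l = dup k l0" "set l0 = set l" using dup_ex[OF l(1,2)] by blast
  obtain m where n: "n = Suc m" using k(1) by (cases n) auto
  let ?c = "restrict (W l0) (standard_simplex m)"
  have c: "?c \<in> cells (standard_simplex m) X"
    by (rule vcells_cell[OF W(2)]) (use k l n in auto)
  have "restrict (W l) (standard_simplex n) = restrict (?c \<circ> restrict (simplical_degen k) (standard_simplex n)) (standard_simplex n)"
    using k n by (auto simp: fun_eq_iff restrict_def degen_simplex vlin_degen[OF W(1)])
  then have "frag_of (restrict (W l) (standard_simplex n)) =
      push (standard_simplex n) ?c (frag_of (restrict (simplical_degen k) (standard_simplex n)))"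
    by (simp add: push_of)
  moreover have "(m, frag_of (restrict (simplical_degen k) (standard_simplex n))) \<in> degen_rels n"
    using k n by (auto simp: degen_rels_def)
  ultimately show ?thesis using relspan_gen[where K=standard_simplex and rel=degen_rels and p=n and m=m, OF _ c] by simp
qed

lemma RW_degen:
  assumes W: "vlin W" "vcells W A X" and x: "\<And>l. l \<in> Poly_Mapping.keys x \<Longrightarrow> dupl l \<and> length l = Suc n \<and> set l \<subseteq> A"
  shows "RW W n x \<in> relspan standard_simplex degen_rels n X"
  by (rule zlin_mem[OF zlin_RW subgrp_relspan order_refl]) (use x dupl_degen[OF W] in \<open>auto simp: RW_of\<close>)

lemma dupl_dup: "k < length l \<Longrightarrow> dupl (dup k l)"
  by (induction k l rule: dup.induct) (auto simp: dupl_Cons)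

lemma degen_rel_eq:
  assumes "(m, r) \<in> degen_rels p"
  obtains j where "p = Suc m" "j \<le> m" "r = RW lin p (frag_of (dup j [0..<Suc m]))"
    "r = frag_of (restrict (simplical_degen j) (standard_simplex p))"
proof -
  obtain j where j: "j < p" "m = p - 1" "r = frag_of (restrict (simplical_degen j) (standard_simplex p))"
    using assms by (auto simp: degen_rels_def)
  then have p: "p = Suc m" and jm: "j \<le> m" by simp_all
  have "restrict (simplical_degen j) (standard_simplex p) = restrict (lin (dup j [0..<Suc m])) (standard_simplex p)"
    unfolding p by (rule restrict_ext) (rule lin_dup_id[OF _ jm, symmetric])
  then have "r = RW lin p (frag_of (dup j [0..<Suc m]))" by (simp only: j(3) RW_of)
  then show thesis using that[OF p jm _ j(3)] by blast
qed

lemma degen_rel_chain: "(m, r) \<in> degen_rels p \<Longrightarrow> r \<in> chains (standard_simplex p) (mtop (standard_simplex m))"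
proof -
  assume "(m, r) \<in> degen_rels p"
  then obtain j where j: "p = Suc m" "j \<le> m" "r = RW lin p (frag_of (dup j [0..<Suc m]))" by (rule degen_rel_eq)
  show ?thesis
    unfolding j(3) by (rule RW_chain[OF vcells_lin]) (use j in \<open>auto simp: length_dup set_dup simp del: upt_Suc\<close>)
qed

text \<open>The degeneracy is itself the realization of a list with a repeated vertex; by
  \<open>dupl_dl\<close> its boundary consists of such lists only.\<close>

lemma degen_rel_bd:
  assumes "(m, r) \<in> degen_rels (Suc p)"
  shows "act (standard_simplex p) (sbd (Suc p)) r \<in> relspan standard_simplex degen_rels p (mtop (standard_simplex m))"
proof -
  obtain j where j: "Suc p = Suc m" "j \<le> m" "r = RW lin (Suc p) (frag_of (dup j [0..<Suc m]))"
    using assms by (rule degen_rel_eq)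
  have "act (standard_simplex p) (sbd (Suc p)) r = RW lin p (dl (dup j [0..<Suc m]))"
    unfolding j(3) by (subst sbd_RW[OF vlin_lin]) (use j in \<open>auto simp: length_dup simp del: upt_Suc\<close>)
  also have "\<dots> \<in> relspan standard_simplex degen_rels p (mtop (standard_simplex m))"
  proof (rule RW_degen[OF vlin_lin vcells_lin])
    fix l assume l: "l \<in> Poly_Mapping.keys (dl (dup j [0..<Suc m]))"
    have "dupl l" by (rule dupl_dl[OF dupl_dup l]) (use j in simp)
    then show "dupl l \<and> length l = Suc p \<and> set l \<subseteq> {..m}"
      using keys_dl[OF l] keys_dl_set[OF l] j by (auto simp: length_dup set_dup simp del: upt_Suc)
  qed
  finally show ?thesis .
qed

lemma cell_theory_S: "cell_theory (simp_data (\<lambda>_. {}))"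
  by (rule simp_cell_theory) auto

lemma cell_theory_N: "cell_theory (simp_data degen_rels)"
  by (rule simp_cell_theory[OF degen_rel_chain _ degen_rel_bd]) (auto simp: degen_rels_def)

section \<open>Cones of simplices\<close>

definition shrink :: "vec \<Rightarrow> vec" where
  "shrink t = (\<lambda>k. t (Suc k) / (1 - t 0))"

lemma shrink_simplex:
  assumes t: "t \<in> standard_simplex (Suc p)" "t 0 \<noteq> 1" shows "shrink t \<in> standard_simplex p"
proof -
  have s: "\<And>i. 0 \<le> t i" "(\<Sum>i\<le>Suc p. t i) = 1" "\<And>i. i > Suc p \<Longrightarrow> t i = 0" "t 0 < 1"
    using t by (auto simp: standard_simplex_def less_le)
  have 1: "(\<Sum>i\<le>p. t (Suc i)) = 1 - t 0"
    using s(2) by (simp add: sum.atMost_Suc_shift del: sum.atMost_Suc)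
  have sum: "(\<Sum>i\<le>p. shrink t i) = 1"
    unfolding shrink_def sum_divide_distrib[symmetric] 1 using s(4) by simp
  have nn: "0 \<le> shrink t i" for i using s by (simp add: shrink_def)
  have z: "shrink t i = 0" if "i > p" for i using s(3)[of "Suc i"] that by (simp add: shrink_def)
  have "shrink t i \<le> 1" for i
  proof (cases "i \<le> p")
    case True then show ?thesis using member_le_sum[of i "{..p}" "shrink t"] nn sum by simp
  qed (simp add: z)
  then show ?thesis using nn z sum by (simp add: standard_simplex_def)
qed

lemma scone_eq: "t \<in> standard_simplex (Suc p) \<Longrightarrow> scone v p c t =
    (if t 0 = 1 then v else (\<lambda>i. t 0 * v i + (1 - t 0) * c (shrink t) i))"
  by (simp add: scone_def shrink_def)

lemma simplex_coord: "t \<in> standard_simplex p \<Longrightarrow> 0 \<le> t i \<and> t i \<le> 1"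
  by (simp add: standard_simplex_def)

lemma star_atD: "star_at v V \<Longrightarrow> x \<in> V \<Longrightarrow> 0 \<le> s \<Longrightarrow> s \<le> 1 \<Longrightarrow> (\<lambda>i. (1 - s) * v i + s * x i) \<in> V"
  by (simp add: star_at_def)

lemma bpaffD: "bpaff v V v' f \<Longrightarrow> x \<in> V \<Longrightarrow> 0 \<le> s \<Longrightarrow> s \<le> 1 \<Longrightarrow>
    f (\<lambda>i. (1 - s) * v i + s * x i) = (\<lambda>i. (1 - s) * v' i + s * f x i)"
  by (simp add: bpaff_def)

lemma scone_in:
  assumes "star_at v V" "c \<in> cells (standard_simplex p) (mtop V)" "t \<in> standard_simplex (Suc p)"
  shows "scone v p c t \<in> V"
proof (cases "t 0 = 1")
  case True then show ?thesis using assms by (simp add: scone_eq star_at_def)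
next
  case False
  have "c (shrink t) \<in> V" using cells_value[OF assms(2) shrink_simplex[OF assms(3) False]] by simp
  from star_atD[OF assms(1) this, of "1 - t 0"] show ?thesis
    using False assms(3) simplex_coord[OF assms(3), of 0] by (simp add: scone_eq)
qed

text \<open>Off the apex the cone is composed of continuous maps. At the apex, continuity comes from
  an estimate: the image of the rescaled point stays bounded while its weight \<open>1 - t 0\<close>
  tends to 0.\<close>

lemma scone_continuous:
  assumes V: "star_at v V" and c: "c \<in> cells (standard_simplex p) (mtop V)"
  shows "continuous_on (standard_simplex (Suc p)) (\<lambda>t. scone v p c t i)"
proof -
  let ?S = "standard_simplex (Suc p)"
  let ?g = "\<lambda>t::vec. t 0 * v i + (1 - t 0) * c (shrink t) i"
  have "continuous_map (mtop (standard_simplex p)) (powertop_real UNIV) c"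
    using cells_continuous[OF c] by (simp add: continuous_map_in_subtopology)
  then have cc: "continuous_on (standard_simplex p) c"
    by (simp add: euclidean_product_topology)
  obtain B where B: "\<And>x i. x \<in> V \<Longrightarrow> \<bar>x i\<bar> \<le> B" using V unfolding star_at_def by blast
  have coord: "continuous_on S (\<lambda>t::vec. t k)" for k S
    by (rule continuous_on_subset[OF continuous_on_product_coordinates]) auto
  have "((\<lambda>t. scone v p c t i) \<longlongrightarrow> scone v p c x i) (at x within ?S)" if x: "x \<in> ?S" for x
  proof (cases "x 0 = 1")
    case False
    let ?U = "?S \<inter> {t. t 0 \<noteq> 1}"
    have op: "open {t :: vec. t 0 \<noteq> 1}"
      by (rule open_Collect_neq) (auto intro: coord)
    have sh: "continuous_on ?U shrink"
      unfolding shrink_def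
      by (rule continuous_on_coordinatewise_then_product) (auto intro!: continuous_intros coord)
    have "continuous_on ?U (\<lambda>t. c (shrink t))"
      by (rule continuous_on_compose2[OF cc sh]) (auto intro: shrink_simplex)
    then have "continuous_on ?U (\<lambda>t. c (shrink t) i)"
      by (rule continuous_on_product_then_coordinatewise)
    then have "continuous_on ?U ?g" by (intro continuous_intros coord)
    then have "continuous_on ?U (\<lambda>t. scone v p c t i)"
      by (rule continuous_on_eq) (auto simp: scone_eq)
    then have "((\<lambda>t. scone v p c t i) \<longlongrightarrow> scone v p c x i) (at x within ?U)"
      using x False by (auto simp: continuous_on_def)
    moreover have "at x within ?S = at x within ?U"
      by (rule at_within_nhd[of x "{t. t 0 \<noteq> 1}"]) (use False op in auto)
    ultimately show ?thesis by simp
  next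
    case True
    have lim: "((\<lambda>t::vec. (1 - t 0) * (\<bar>v i\<bar> + B)) \<longlongrightarrow> (1 - x 0) * (\<bar>v i\<bar> + B)) (at x within ?S)"
      using coord[of ?S 0] x by (intro tendsto_intros) (auto simp: continuous_on_def)
    have "((\<lambda>t. scone v p c t i - v i) \<longlongrightarrow> 0) (at x within ?S)"
    proof (rule Lim_null_comparison)
      show "\<forall>\<^sub>F t in at x within ?S. norm (scone v p c t i - v i) \<le> (1 - t 0) * (\<bar>v i\<bar> + B)"
        unfolding eventually_at_topological
      proof (intro exI[of _ UNIV] conjI ballI impI)
        fix t :: vec assume t: "t \<in> ?S"
        show "norm (scone v p c t i - v i) \<le> (1 - t 0) * (\<bar>v i\<bar> + B)"
        proof (cases "t 0 = 1")
          case True then show ?thesis using t by (simp add: scone_eq)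
        next
          case False
          have "c (shrink t) \<in> V" using cells_value[OF c shrink_simplex[OF t False]] by simp
          then have "\<bar>c (shrink t) i - v i\<bar> \<le> \<bar>v i\<bar> + B" using B[of "c (shrink t)" i] by linarith
          moreover have "scone v p c t i - v i = (1 - t 0) * (c (shrink t) i - v i)"
            using t False by (simp add: scone_eq algebra_simps)
          ultimately show ?thesis
            using simplex_coord[OF t, of 0] by (simp add: abs_mult mult_left_mono)
        qed
      qed auto
      show "((\<lambda>t::vec. (1 - t 0) * (\<bar>v i\<bar> + B)) \<longlongrightarrow> 0) (at x within ?S)" using lim True by simp
    qed
    then have "((\<lambda>t. scone v p c t i) \<longlongrightarrow> v i) (at x within ?S)" by (simp add: LIM_zero_iff)
    then show ?thesis using True x by (simp add: scone_eq)
  qed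
  then show ?thesis by (simp add: continuous_on_def)
qed

lemma scone_cell:
  assumes V: "star_at v V" and c: "c \<in> cells (standard_simplex p) (mtop V)"
  shows "scone v p c \<in> cells (standard_simplex (Suc p)) (mtop V)"
proof -
  have "continuous_map (mtop (standard_simplex (Suc p))) euclideanreal (\<lambda>t. scone v p c t i)" for i
    using scone_continuous[OF assms, of i] by (simp add: euclidean_product_topology)
  then have "continuous_map (mtop (standard_simplex (Suc p))) (mtop V) (scone v p c)"
    using scone_in[OF assms] by (auto simp: continuous_map_in_subtopology continuous_map_componentwise_UNIV)
  then show ?thesis by (simp add: cells_def scone_def)
qed

lemma bpaff_base: "bpaff v V v' f \<Longrightarrow> v \<in> V \<Longrightarrow> f v = v'"
  using bpaffD[of v V v' f v 0] by simp

lemma scone_nat: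
  assumes V: "star_at v V" and f: "bpaff v V v' f" and c: "c \<in> cells (standard_simplex p) (mtop V)"
  shows "scone v' p (restrict (f \<circ> c) (standard_simplex p)) = restrict (f \<circ> scone v p c) (standard_simplex (Suc p))"
proof
  fix t show "scone v' p (restrict (f \<circ> c) (standard_simplex p)) t = restrict (f \<circ> scone v p c) (standard_simplex (Suc p)) t"
  proof (cases "t \<in> standard_simplex (Suc p)")
    case t: True
    show ?thesis
    proof (cases "t 0 = 1")
      case True
      have "f v = v'" by (rule bpaff_base[OF f]) (use V in \<open>simp add: star_at_def\<close>)
      then show ?thesis using t True by (simp add: scone_eq)
    next
      case False
      have "c (shrink t) \<in> V" using cells_value[OF c shrink_simplex[OF t False]] by simp
      from bpaffD[OF f this, of "1 - t 0"] show ?thesis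
        using t False shrink_simplex[OF t False] simplex_coord[OF t, of 0] by (simp add: scone_eq)
    qed
  qed (simp add: scone_def)
qed

lemma scone_face_0:
  assumes "t \<in> standard_simplex p" shows "scone v p c (simplical_face 0 t) = c t"
proof -
  have "simplical_face 0 t \<in> standard_simplex (Suc p)" by (rule face_simplex[OF assms]) simp
  moreover have "shrink (simplical_face 0 t) = t" "simplical_face 0 t 0 = 0"
    by (auto simp: shrink_def simplical_face_def)
  ultimately show ?thesis by (simp add: scone_eq)
qed

lemma scone_face_Suc:
  assumes "t \<in> standard_simplex (Suc p)" "k \<le> Suc p"
  shows "scone v (Suc p) c (simplical_face (Suc k) t) = scone v p (restrict (c \<circ> simplical_face k) (standard_simplex p)) t"
proof -
  have f: "simplical_face (Suc k) t \<in> standard_simplex (Suc (Suc p))" by (rule face_simplex[OF assms(1)]) (use assms in simp)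
  have s: "shrink (simplical_face (Suc k) t) = simplical_face k (shrink t)"
    by (auto simp: shrink_def simplical_face_def fun_eq_iff)
  have "simplical_face (Suc k) t 0 = t 0" by (simp add: simplical_face_def)
  then show ?thesis using assms f s shrink_simplex[OF assms(1)] by (simp add: scone_eq)
qed

text \<open>The cone over a degenerate simplex is degenerate, with the index shifted by the new
  vertex. Hence the contraction passes to normalized chains.\<close>

lemma scone_degen:
  assumes "t \<in> standard_simplex (Suc (Suc p))" "k \<le> p"
  shows "scone v p c (simplical_degen (Suc k) t) = scone v (Suc p) (restrict (c \<circ> simplical_degen k) (standard_simplex (Suc p))) t"
proof -
  have f: "simplical_degen (Suc k) t \<in> standard_simplex (Suc p)" by (rule degen_simplex[OF assms(1)]) (use assms in simp)
  have s: "shrink (simplical_degen (Suc k) t) = simplical_degen k (shrink t)"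
    by (auto simp: shrink_def simplical_degen_def fun_eq_iff add_divide_distrib)
  have "simplical_degen (Suc k) t 0 = t 0" by (simp add: simplical_degen_def)
  then show ?thesis using assms f s shrink_simplex[OF assms(1)] by (simp add: scone_eq)
qed

definition sconec :: "vec \<Rightarrow> nat \<Rightarrow> vec chain \<Rightarrow> vec chain" where
  "sconec v p = frag_extend (\<lambda>c. frag_of (scone v p c))"

lemma conec_simp: "conec (simp_data R) v p = sconec v p"
  by (simp add: conec_def sconec_def)

text \<open>Face 0 forgets the apex and gives back \<open>c\<close>; face \<open>k + 1\<close> is
  the cone over face \<open>k\<close>, and the shift of the index is the minus sign. For simplices
  the contraction identity is therefore exact.\<close>

lemma scone_bd:
  assumes c: "c \<in> cells (standard_simplex (Suc p)) (mtop V)"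
  shows "push (standard_simplex (Suc p)) (scone v (Suc p) c) (sbd (Suc (Suc p))) =
    frag_of c - sconec v p (push (standard_simplex p) c (sbd (Suc p)))"
proof -
  let ?D = standard_simplex
  have 0: "restrict (scone v (Suc p) c \<circ> simplical_face 0) (?D (Suc p)) = c"
    using cells_ext[OF c] by (auto simp: fun_eq_iff restrict_def scone_face_0)
  have S: "restrict (scone v (Suc p) c \<circ> simplical_face (Suc k)) (?D (Suc p)) =
      scone v p (restrict (c \<circ> simplical_face k) (?D p))" if "k \<le> Suc p" for k
    using that by (auto simp: fun_eq_iff restrict_def scone_face_Suc) (simp_all add: scone_def)
  have "push (?D (Suc p)) (scone v (Suc p) c) (sbd (Suc (Suc p))) = frag_of c
      + (\<Sum>k\<le>Suc p. frag_cmul (- ((- 1) ^ k)) (frag_of (scone v p (restrict (c \<circ> simplical_face k) (?D p)))))"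
    unfolding push_sbd sum.atMost_Suc_shift[of _ "Suc p"] 0 by (simp add: S 0 del: sum.atMost_Suc)
  also have "\<dots> = frag_of c - sconec v p (push (?D p) c (sbd (Suc p)))"
    unfolding push_sbd zlin_sum[OF zlin_frag_extend] sconec_def zlin_cmul[OF zlin_frag_extend] frag_extend_of
    by (simp add: sum_negf del: sum.atMost_Suc flip: minus_frag_cmul)
  finally show ?thesis .
qed

lemma scone_bd0:
  assumes c: "c \<in> cells (standard_simplex 0) (mtop V)"
  shows "push (standard_simplex 0) (scone v 0 c) (sbd (Suc 0)) =
    frag_of c - frag_of (restrict (\<lambda>_. v) (standard_simplex 0))"
proof -
  have 0: "restrict (scone v 0 c \<circ> simplical_face 0) (standard_simplex 0) = c"
    using cells_ext[OF c] by (auto simp: fun_eq_iff restrict_def scone_face_0)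
  have "scone v 0 c (simplical_face (Suc 0) t) = v" if t: "t \<in> standard_simplex 0" for t
  proof -
    have "simplical_face (Suc 0) t \<in> standard_simplex (Suc 0)" by (rule face_simplex[OF t]) simp
    moreover have "simplical_face (Suc 0) t 0 = 1" using t by (auto simp: standard_simplex_0 simplical_face_def)
    ultimately show ?thesis by (simp add: scone_eq)
  qed
  then have "restrict (scone v 0 c \<circ> simplical_face (Suc 0)) (standard_simplex 0) = restrict (\<lambda>_. v) (standard_simplex 0)"
    by (auto simp: fun_eq_iff restrict_def)
  then show ?thesis unfolding push_sbd by (simp add: 0)
qed

lemma star_simplex: "star_at vertex0 (standard_simplex p)"
proof -
  have v: "vertex0 \<in> standard_simplex p"
    unfolding vertex0_def using basis_in_standard_simplex[of 0 p] by simp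
  show ?thesis
    unfolding star_at_def
  proof (intro conjI ballI exI[of _ 1] allI)
    fix x t assume "x \<in> standard_simplex p" "t \<in> {0..1::real}"
    then show "(\<lambda>i. (1 - t) * vertex0 i + t * x i) \<in> standard_simplex p"
      using convex_standard_simplex[OF v] by simp
  next
    fix x i assume "x \<in> standard_simplex p" then show "\<bar>x i\<bar> \<le> 1" using simplex_coord[of x p i] by auto
  qed (rule v)
qed

lemma simp_acyclic:
  assumes "cell_theory (simp_data R)"
    "\<And>m r p c. (m, r) \<in> R p \<Longrightarrow> c \<in> Poly_Mapping.keys r \<Longrightarrow> bpaff vertex0 (standard_simplex p) vertex0 c"
    "\<And>v V m r p c. star_at v V \<Longrightarrow> (m, r) \<in> R p \<Longrightarrow> c \<in> cells (standard_simplex m) (mtop V) \<Longrightarrow>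
      sconec v p (push (standard_simplex p) c r) \<in> relspan standard_simplex R (Suc p) (mtop V)"
  shows "acyclic_theory (simp_data R)"
proof -
  interpret cell_theory "simp_data R" by fact
  show ?thesis
  proof (unfold_locales; simp only: simp_data_sel conec_simp)
    show "standard_simplex 0 = {vertex0}" by (simp add: standard_simplex_0 vertex0_def)
    show "push (standard_simplex 0) (\<lambda>_. vertex0) (sbd (Suc 0)) = 0"
      unfolding push_sbd by (simp add: o_def)
  qed (simp_all add: star_simplex assms(2,3) scone_cell scone_nat scone_bd scone_bd0 subgrp_0[OF subgrp_relspan])
qed

lemma acyclic_S: "acyclic_theory (simp_data (\<lambda>_. {}))"
  by (rule simp_acyclic[OF cell_theory_S]) auto

lemma acyclic_N: "acyclic_theory (simp_data degen_rels)"
proof (rule simp_acyclic[OF cell_theory_N])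
  fix m r p c assume "(m, r) \<in> degen_rels p" "c \<in> Poly_Mapping.keys r"
  then obtain j where j: "p = Suc m" "j \<le> m" "c = restrict (simplical_degen j) (standard_simplex p)"
    by (metis degen_rel_eq keys_frag_of singletonD)
  \<comment> \<open>A degeneracy map adds two neighbouring coordinates, so it is linear, and it
    fixes vertex 0.\<close>
  show "bpaff vertex0 (standard_simplex p) vertex0 c"
    unfolding bpaff_def
  proof (intro ballI)
    fix x t assume x: "x \<in> standard_simplex p" "t \<in> {0..1::real}"
    have "(\<lambda>i. (1 - t) * vertex0 i + t * x i) \<in> standard_simplex p"
      using star_simplex x unfolding star_at_def by blast
    then show "c (\<lambda>i. (1 - t) * vertex0 i + t * x i) = (\<lambda>i. (1 - t) * vertex0 i + t * c x i)"
      using x by (auto simp: j(3) simplical_degen_def vertex0_def fun_eq_iff algebra_simps)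
  qed
next
  fix v V m r p c
  assume V: "star_at v V" and r: "(m, r) \<in> degen_rels p" and c: "c \<in> cells (standard_simplex m) (mtop V)"
  let ?D = standard_simplex
  obtain j where j: "p = Suc m" "j \<le> m" "r = frag_of (restrict (simplical_degen j) (?D p))"
    using r by (rule degen_rel_eq)
  have "restrict (c \<circ> restrict (simplical_degen j) (?D p)) (?D p) = restrict (c \<circ> simplical_degen j) (?D p)" by auto
  moreover have "scone v p (restrict (c \<circ> simplical_degen j) (?D p)) =
      restrict (scone v m c \<circ> restrict (simplical_degen (Suc j)) (?D (Suc p))) (?D (Suc p))"
    using j by (auto simp: fun_eq_iff restrict_def scone_degen) (simp_all add: scone_def)
  ultimately have "sconec v p (push (?D p) c r) =
      push (?D (Suc p)) (scone v m c) (frag_of (restrict (simplical_degen (Suc j)) (?D (Suc p))))"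
    by (simp add: j(3) push_of sconec_def)
  moreover have "(p, frag_of (restrict (simplical_degen (Suc j)) (?D (Suc p)))) \<in> degen_rels (Suc p)"
    using j by (auto simp: degen_rels_def)
  ultimately show "sconec v p (push (?D p) c r) \<in> relspan ?D degen_rels (Suc p) (mtop V)"
    using relspan_gen[where K="?D" and rel=degen_rels and p="Suc p" and m=p] scone_cell[OF V c] j(1) by simp
qed

section \<open>The shuffle product\<close>

lemma RW_mapf: "RW W n (mapf h z) = RW (\<lambda>l. W (map h l)) n z"
  by (rule zlin_eq[OF zlin_comp[OF zlin_RW zlin_mapf] zlin_RW subset_UNIV]) (simp add: RW_of)

lemma keys_sh_upt:
  assumes "w \<in> Poly_Mapping.keys (sh [0..<Suc m] [0..<Suc q])"
  shows "length w = Suc (m + q)" "set w \<subseteq> {..m} \<times> {..q}"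
    "set (map fst w) \<subseteq> {..m}" "set (map snd w) \<subseteq> {..q}"
  using keys_sh[OF assms] keys_sh_set[OF assms] by (auto simp del: upt_Suc)

text \<open>The universal product is the shuffle of two lists of positions. Substituting vertices
  for positions gives the shuffle of arbitrary lists, by \<open>sh_map\<close>.\<close>

lemma push_smlt:
  assumes W: "vlin W" and V: "vlin V" and l: "length l = Suc m" "length l' = Suc q"
  shows "push (standard_simplex (m + q)) (map_prod (restrict (W l) (standard_simplex m)) (restrict (V l') (standard_simplex q))) (smlt m q)
    = RW (pairW W V) (m + q) (sh l l')"
proof -
  let ?h = "map_prod ((!) l) ((!) l')"
  have "push (standard_simplex (m + q)) (map_prod (restrict (W l) (standard_simplex m)) (restrict (V l') (standard_simplex q))) (smlt m q)
    = RW (pairW W V) (m + q) (mapf ?h (sh [0..<Suc m] [0..<Suc q]))"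
    unfolding smlt_def RW_mapf
  proof (rule zlin_eq[OF zlin_comp[OF zlin_push zlin_RW] zlin_RW order_refl])
    fix w assume w: "w \<in> Poly_Mapping.keys (sh [0..<Suc m] [0..<Suc q])"
    note k = keys_sh_upt[OF w]
    have "map_prod (restrict (W l) (standard_simplex m)) (restrict (V l') (standard_simplex q)) (pairW lin lin w t)
        = pairW W V (map ?h w) t" if t: "t \<in> standard_simplex (m + q)" for t
    proof -
      have "lin (map fst w) t \<in> standard_simplex m" "lin (map snd w) t \<in> standard_simplex q"
        using lin_simplex[OF t _ k(3)] lin_simplex[OF t _ k(4)] k(1) by auto
      moreover have "W l (lin (map fst w) t) = W (map ((!) l) (map fst w)) t"
        by (rule vlinD[OF W, symmetric]) (use k(3) l in auto)
      moreover have "V l' (lin (map snd w) t) = V (map ((!) l') (map snd w)) t"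
        by (rule vlinD[OF V, symmetric]) (use k(4) l in auto)
      ultimately show ?thesis by (simp add: pairW_def o_def)
    qed
    then show "push (standard_simplex (m + q)) (map_prod (restrict (W l) (standard_simplex m)) (restrict (V l') (standard_simplex q)))
        (RW (pairW lin lin) (m + q) (frag_of w)) = RW (\<lambda>l. pairW W V (map ?h l)) (m + q) (frag_of w)"
      by (auto simp: RW_of push_of frag_of_eq fun_eq_iff restrict_def)
  qed
  also have "mapf ?h (sh [0..<Suc m] [0..<Suc q]) = sh l l'"
    using map_nth[of l] map_nth[of l'] l by (simp add: sh_map[symmetric] del: upt_Suc)
  finally show ?thesis .
qed

lemma mul_RW:
  assumes W: "vlin W" and V: "vlin V"
    and "\<And>l. l \<in> Poly_Mapping.keys x \<Longrightarrow> length l = Suc m" "\<And>l. l \<in> Poly_Mapping.keys y \<Longrightarrow> length l = Suc q"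
  shows "mul (standard_simplex (m + q)) (smlt m q) (RW W m x) (RW V q y) = RW (pairW W V) (m + q) (shx x y)"
proof (rule zlin_eq[OF zlin_comp[OF zlin_mul1 zlin_RW] zlin_comp[OF zlin_RW zlin_shx1] order_refl])
  fix l assume l: "l \<in> Poly_Mapping.keys x"
  show "mul (standard_simplex (m + q)) (smlt m q) (RW W m (frag_of l)) (RW V q y) = RW (pairW W V) (m + q) (shx (frag_of l) y)"
  proof (rule zlin_eq[OF zlin_comp[OF zlin_mul2 zlin_RW] zlin_comp[OF zlin_RW zlin_shx2] order_refl])
    fix l' assume "l' \<in> Poly_Mapping.keys y"
    then show "mul (standard_simplex (m + q)) (smlt m q) (RW W m (frag_of l)) (RW V q (frag_of l'))
        = RW (pairW W V) (m + q) (shx (frag_of l) (frag_of l'))"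
      using push_smlt[OF W V assms(3)[OF l] assms(4)] by (simp add: RW_of mul_of shx_of)
  qed
qed

lemma smlt_chain: "smlt p q \<in> chains (standard_simplex (p + q)) (prod_topology (mtop (standard_simplex p)) (mtop (standard_simplex q)))"
  unfolding smlt_def
  by (rule RW_chain[OF vcells_pairW[OF vcells_lin vcells_lin]]) (use keys_sh_upt(1,2) in blast)

lemma shx_of1: "shx (frag_of xs) y = frag_extend (sh xs) y"
  by (simp add: shx_def)

lemma shx_of2: "shx x (frag_of ys) = frag_extend (\<lambda>l. sh l ys) x"
  by (simp add: shx_def)

lemma smlt_bd: "act (standard_simplex (p + q - 1)) (sbd (p + q)) (smlt p q) =
      mul (standard_simplex (p + q - 1)) (smlt (p - 1) q) (sbd p) (idc (standard_simplex q)) +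
      frag_cmul ((- 1) ^ p) (mul (standard_simplex (p + q - 1)) (smlt p (q - 1)) (idc (standard_simplex p)) (sbd q))"
proof (cases "p + q")
  case 0
  then show ?thesis by (simp add: sbd_def act_0 zlin_0[OF zlin_mul1] zlin_0[OF zlin_mul2])
next
  case (Suc n)
  let ?P = "[0..<Suc p]" and ?Q = "[0..<Suc q]"
  have "act (standard_simplex n) (sbd (Suc n)) (smlt p q) = RW (pairW lin lin) n (Dl (sh ?P ?Q))"
    unfolding smlt_def Suc
    by (rule sbd_RW[OF vlin_pairW[OF vlin_lin vlin_lin]]) (use keys_sh_upt(1)[of _ p q] Suc in simp)
  also have "Dl (sh ?P ?Q) = frag_extend (\<lambda>l. sh l ?Q) (dl ?P) + frag_cmul ((- 1) ^ p) (frag_extend (sh ?P) (dl ?Q))"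
    using Dl_sh[of ?P ?Q] Suc by (simp add: diff_conv_add_uminus del: add_uminus_conv_diff upt_Suc dl.simps)
  also have "RW (pairW lin lin) n \<dots> = mul (standard_simplex n) (smlt (p - 1) q) (sbd p) (idc (standard_simplex q)) +
      frag_cmul ((- 1) ^ p) (mul (standard_simplex n) (smlt p (q - 1)) (idc (standard_simplex p)) (sbd q))"
  proof -
    have "mul (standard_simplex n) (smlt (p - 1) q) (sbd p) (idc (standard_simplex q))
        = RW (pairW lin lin) n (frag_extend (\<lambda>l. sh l ?Q) (dl ?P))"
    proof (cases p)
      case 0
      then show ?thesis unfolding 0 by (simp add: sbd_def[of 0] zlin_0[OF zlin_mul1] zlin_0[OF zlin_RW] consf_lin)
    next
      case (Suc p')
      then have n: "n = p' + q" using \<open>p + q = Suc n\<close> by simp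
      show ?thesis
        unfolding Suc n diff_Suc_1 sbd_eq_RW idc_RW shx_of2[symmetric]
        by (rule mul_RW[OF vlin_lin vlin_lin]) (auto dest!: keys_dl simp del: upt_Suc)
    qed
    moreover have "mul (standard_simplex n) (smlt p (q - 1)) (idc (standard_simplex p)) (sbd q)
        = RW (pairW lin lin) n (frag_extend (sh ?P) (dl ?Q))"
    proof (cases q)
      case 0
      then show ?thesis unfolding 0 by (simp add: sbd_def[of 0] zlin_0[OF zlin_mul2] zlin_0[OF zlin_RW] consf_lin)
    next
      case (Suc q')
      then have n: "n = p + q'" using \<open>p + q = Suc n\<close> by simp
      show ?thesis
        unfolding Suc n diff_Suc_1 sbd_eq_RW idc_RW shx_of1[symmetric]
        by (rule mul_RW[OF vlin_lin vlin_lin]) (auto dest!: keys_dl simp del: upt_Suc)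
    qed
    ultimately show ?thesis by (simp only: zlin_add[OF zlin_RW] zlin_cmul[OF zlin_RW])
  qed
  finally show ?thesis by (simp only: Suc diff_Suc_1)
qed

lemma smlt_assoc: "push (standard_simplex (p + q + r)) (\<lambda>((x, y), z). (x, (y, z)))
        (mul (standard_simplex (p + q + r)) (smlt (p + q) r) (smlt p q) (idc (standard_simplex r))) =
      mul (standard_simplex (p + q + r)) (smlt p (q + r)) (idc (standard_simplex p)) (smlt q r)"
proof -
  let ?P = "[0..<Suc p]" and ?Q = "[0..<Suc q]" and ?R = "[0..<Suc r]"
  have 1: "mul (standard_simplex (p + q + r)) (smlt (p + q) r) (smlt p q) (idc (standard_simplex r))
      = RW (pairW (pairW lin lin) lin) (p + q + r) (frag_extend (\<lambda>u. sh u ?R) (sh ?P ?Q))"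
    unfolding smlt_def[of p q] idc_RW shx_of2[symmetric]
    by (rule mul_RW[OF vlin_pairW[OF vlin_lin vlin_lin] vlin_lin]) (use keys_sh_upt(1)[of _ p q] in \<open>auto simp del: upt_Suc\<close>)
  have 2: "mul (standard_simplex (p + (q + r))) (smlt p (q + r)) (idc (standard_simplex p)) (smlt q r)
      = RW (pairW lin (pairW lin lin)) (p + (q + r)) (frag_extend (sh ?P) (sh ?Q ?R))"
    unfolding smlt_def[of q r] idc_RW shx_of1[symmetric]
    by (rule mul_RW[OF vlin_lin vlin_pairW[OF vlin_lin vlin_lin]]) (use keys_sh_upt(1)[of _ q r] in \<open>auto simp del: upt_Suc\<close>)
  have 3: "push (standard_simplex n) assoc3 (RW (pairW (pairW lin lin) lin) n z) = RW (pairW lin (pairW lin lin)) n (mapf assoc3 z)" for n z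
    unfolding RW_mapf
  proof (rule zlin_eq[OF zlin_comp[OF zlin_push zlin_RW] zlin_RW subset_UNIV])
    fix l :: "((nat \<times> nat) \<times> nat) list"
    have "assoc3 (pairW (pairW lin lin) lin l t) = pairW lin (pairW lin lin) (map assoc3 l) t" for t
      by (simp add: pairW_def assoc3_def o_def split_def)
    then show "push (standard_simplex n) assoc3 (RW (pairW (pairW lin lin) lin) n (frag_of l))
        = RW (\<lambda>l. pairW lin (pairW lin lin) (map assoc3 l)) n (frag_of l)"
      by (auto simp: RW_of push_of frag_of_eq fun_eq_iff restrict_def)
  qed
  show ?thesis
    using 3[of "p + q + r" "frag_extend (\<lambda>u. sh u ?R) (sh ?P ?Q)"] unfolding 1 sh_assoc 2[unfolded add.assoc[symmetric]]
    by (simp only: assoc3_def)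
qed

text \<open>This holds on the nose and not just modulo degenerate simplices; so unnormalized
  singular chains, which have no relations, are graded commutative as well.\<close>

lemma smlt_swap: "push (standard_simplex (p + q)) prod.swap (smlt p q) = frag_cmul ((- 1) ^ (p * q)) (smlt q p)"
proof -
  let ?P = "[0..<Suc p]" and ?Q = "[0..<Suc q]"
  have "push (standard_simplex n) prod.swap (RW (pairW lin lin) n z) = RW (pairW lin lin) n (mapf prod.swap z)" for n z
    unfolding RW_mapf
  proof (rule zlin_eq[OF zlin_comp[OF zlin_push zlin_RW] zlin_RW subset_UNIV])
    fix l :: "(nat \<times> nat) list"
    have "prod.swap (pairW lin lin l t) = pairW lin lin (map prod.swap l) t" for t
      by (simp add: pairW_def o_def)
    then show "push (standard_simplex n) prod.swap (RW (pairW lin lin) n (frag_of l)) = RW (\<lambda>l. pairW lin lin (map prod.swap l)) n (frag_of l)"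
      by (auto simp: RW_of push_of frag_of_eq fun_eq_iff restrict_def)
  qed
  then show ?thesis
    by (simp add: smlt_def sh_swap zlin_cmul[OF zlin_RW] add.commute del: upt_Suc)
qed

lemma monoidal_simp:
  assumes "cell_theory (simp_data R)"
    "\<And>m u p q. (m, u) \<in> R p \<Longrightarrow> mul (standard_simplex (p + q)) (smlt p q) u (idc (standard_simplex q))
      \<in> relspan standard_simplex R (p + q) (prod_topology (mtop (standard_simplex m)) (mtop (standard_simplex q)))"
    "\<And>m u p q. (m, u) \<in> R q \<Longrightarrow> mul (standard_simplex (p + q)) (smlt p q) (idc (standard_simplex p)) u
      \<in> relspan standard_simplex R (p + q) (prod_topology (mtop (standard_simplex p)) (mtop (standard_simplex m)))"
  shows "monoidal_theory (simp_data R)"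
proof -
  interpret cell_theory "simp_data R" by fact
  show ?thesis
    by (unfold_locales; simp only: simp_data_sel smlt_chain smlt_bd smlt_assoc smlt_swap diff_self
        subgrp_0[OF subgrp_relspan] assms(2,3))
qed

lemma monoidal_S: "monoidal_theory (simp_data (\<lambda>_. {}))"
  by (rule monoidal_simp[OF cell_theory_S]) auto

lemma monoidal_N: "monoidal_theory (simp_data degen_rels)"
proof (rule monoidal_simp[OF cell_theory_N])
  fix m u p q assume "(m, u) \<in> degen_rels p"
  then obtain j where j: "p = Suc m" "j \<le> m" "u = RW lin p (frag_of (dup j [0..<Suc m]))" by (rule degen_rel_eq)
  have "mul (standard_simplex (p + q)) (smlt p q) u (idc (standard_simplex q)) =
      RW (pairW lin lin) (p + q) (sh (dup j [0..<Suc m]) [0..<Suc q])"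
    unfolding j(3) idc_RW shx_of[symmetric]
    by (rule mul_RW[OF vlin_lin vlin_lin]) (use j in \<open>auto simp: length_dup simp del: upt_Suc\<close>)
  also have "\<dots> \<in> relspan standard_simplex degen_rels (p + q) (prod_topology (mtop (standard_simplex m)) (mtop (standard_simplex q)))"
  proof (rule RW_degen[OF vlin_pairW[OF vlin_lin vlin_lin] vcells_pairW[OF vcells_lin vcells_lin]])
    fix l assume l: "l \<in> Poly_Mapping.keys (sh (dup j [0..<Suc m]) [0..<Suc q])"
    have "dupl l" by (rule dupl_sh[OF l]) (use j in \<open>simp add: dupl_dup del: upt_Suc\<close>)
    then show "dupl l \<and> length l = Suc (p + q) \<and> set l \<subseteq> {..m} \<times> {..q}"
      using keys_sh[OF l] keys_sh_set[OF l] j by (auto simp: length_dup set_dup simp del: upt_Suc)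
  qed
  finally show "mul (standard_simplex (p + q)) (smlt p q) u (idc (standard_simplex q))
      \<in> relspan standard_simplex degen_rels (p + q) (prod_topology (mtop (standard_simplex m)) (mtop (standard_simplex q)))" .
next
  fix m u p q assume "(m, u) \<in> degen_rels q"
  then obtain j where j: "q = Suc m" "j \<le> m" "u = RW lin q (frag_of (dup j [0..<Suc m]))" by (rule degen_rel_eq)
  have "mul (standard_simplex (p + q)) (smlt p q) (idc (standard_simplex p)) u =
      RW (pairW lin lin) (p + q) (sh [0..<Suc p] (dup j [0..<Suc m]))"
    unfolding j(3) idc_RW shx_of[symmetric]
    by (rule mul_RW[OF vlin_lin vlin_lin]) (use j in \<open>auto simp: length_dup simp del: upt_Suc\<close>)
  also have "\<dots> \<in> relspan standard_simplex degen_rels (p + q) (prod_topology (mtop (standard_simplex p)) (mtop (standard_simplex m)))"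
  proof (rule RW_degen[OF vlin_pairW[OF vlin_lin vlin_lin] vcells_pairW[OF vcells_lin vcells_lin]])
    fix l assume l: "l \<in> Poly_Mapping.keys (sh [0..<Suc p] (dup j [0..<Suc m]))"
    have "dupl l" by (rule dupl_sh[OF l]) (use j in \<open>simp add: dupl_dup del: upt_Suc\<close>)
    then show "dupl l \<and> length l = Suc (p + q) \<and> set l \<subseteq> {..p} \<times> {..m}"
      using keys_sh[OF l] keys_sh_set[OF l] j by (auto simp: length_dup set_dup simp del: upt_Suc)
  qed
  finally show "mul (standard_simplex (p + q)) (smlt p q) (idc (standard_simplex p)) u
      \<in> relspan standard_simplex degen_rels (p + q) (prod_topology (mtop (standard_simplex p)) (mtop (standard_simplex m)))" .
qed

text \<open>A strictly increasing sequence must leave room for its later values. For a block of a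
  shuffle this says that each degeneracy index is in range at the moment when it is applied.\<close>

lemma strict_mono_bound:
  assumes "\<And>i j. a \<le> i \<Longrightarrow> i < j \<Longrightarrow> j < a + n \<Longrightarrow> f i < (f j :: nat)"
    "\<And>i. a \<le> i \<Longrightarrow> i < a + n \<Longrightarrow> f i < N + n" "j < n"
  shows "f (a + j) \<le> N + j"
  using assms(3)
proof (induction "n - j" arbitrary: j)
  case (Suc d)
  show ?case
  proof (cases "Suc j = n")
    case True then show ?thesis using assms(2)[of "a + j"] by simp
  next
    case False
    then have "f (a + Suc j) \<le> N + Suc j" using Suc by (intro Suc(1)) auto
    moreover have "f (a + j) < f (a + Suc j)" using False Suc(3) by (intro assms(1)) auto
    ultimately show ?thesis by simp
  qed
qed simp

lemma length_dups: "(\<And>k. k < length is \<Longrightarrow> is ! k < length l + k) \<Longrightarrow> length (dups l is) = length l + length is"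
proof (induction "is" arbitrary: l)
  case (Cons i "is")
  have "i < length l" using Cons(2)[of 0] by simp
  moreover have "is ! k < length (dup i l) + k" if "k < length is" for k
    using Cons(2)[of "Suc k"] that calculation by (simp add: length_dup)
  ultimately show ?case using Cons(1)[of "dup i l"] by (simp add: dups_def length_dup)
qed (simp add: dups_def)

lemma set_dups: "set (dups l is) = set l"
  by (induction "is" arbitrary: l) (auto simp: dups_def set_dup)

lemma dups_map: "dups (map f l) is = map f (dups l is)"
  by (induction "is" arbitrary: l) (auto simp: dups_def dup_map)

text \<open>Iterated degeneracies amount to one affine map, whose vertex list is obtained by the
  corresponding duplications.\<close>

lemma degens_lin:
  assumes "t \<in> standard_simplex (p + length is)" "\<And>k. k < length is \<Longrightarrow> is ! k \<le> p + k"
  shows "degens p is \<sigma> t = \<sigma> (lin (dups [0..<Suc p] is) t)"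
  using assms
proof (induction "is" arbitrary: p \<sigma>)
  case Nil
  then show ?case using lin_id[of t p] by (simp add: dups_def del: upt_Suc)
next
  case (Cons i "is")
  have i: "i \<le> p" using Cons(3)[of 0] by simp
  have b: "is ! k \<le> Suc p + k" if "k < length is" for k using Cons(3)[of "Suc k"] that by simp
  let ?s = "lin (dups [0..<Suc (Suc p)] is) t"
  have t: "t \<in> standard_simplex (Suc p + length is)" using Cons(2) by simp
  have s: "?s \<in> standard_simplex (Suc p)"
    by (rule lin_simplex[OF t])
       (subst length_dups, use b in \<open>auto simp: set_dups less_Suc_eq_le simp del: upt_Suc\<close>)
  have l: "length (dup i [0..<Suc p]) = Suc (Suc p)" using i by (simp add: length_dup del: upt_Suc)
  \<comment> \<open>The later duplications are carried out on the list of positions, and the result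
    of the first one is substituted afterwards. This splits off the first degeneracy as the outer
    map.\<close>
  have "lin (dups (dup i [0..<Suc p]) is) t = lin (map ((!) (dup i [0..<Suc p])) (dups [0..<Suc (Suc p)] is)) t"
    using map_nth[of "dup i [0..<Suc p]"] by (simp add: dups_map[symmetric] l del: upt_Suc)
  also have "\<dots> = lin (dup i [0..<Suc p]) ?s"
    by (rule vlinD[OF vlin_lin]) (use set_dups[of "[0..<Suc (Suc p)]" "is"] l in \<open>auto simp del: upt_Suc\<close>)
  also have "\<dots> = simplical_degen i ?s" by (rule lin_dup_id[OF s i])
  finally have "lin (dups [0..<Suc p] (i # is)) t = simplical_degen i ?s" by (simp add: dups_def)
  moreover have "degens p (i # is) \<sigma> t = singular_degen p i \<sigma> ?s"
    using Cons(1)[OF t b] by simp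
  moreover have "singular_degen p i \<sigma> ?s = \<sigma> (simplical_degen i ?s)"
    using s by (simp add: singular_degen_def del: upt_Suc)
  ultimately show ?case by (simp only:)
qed

text \<open>The bridge between the shuffle formula that defines the Kuenneth morphism of singular
  chains and the product by lattice paths.\<close>

lemma shuffle_simplex_eq:
  "shuffle_simplex p q \<sigma> \<tau> = push (standard_simplex (p + q)) (map_prod \<sigma> \<tau>) (smlt p q)"
proof -
  have "push (standard_simplex (p + q)) (map_prod \<sigma> \<tau>) (smlt p q) =
    (\<Sum>\<pi>\<in>pq_shuffles p q. frag_cmul (sign \<pi>) (frag_of (restrict (map_prod \<sigma> \<tau> \<circ> restrict (pairW lin lin
       (zip (dups [0..<Suc p] (map \<pi> [p..<p + q])) (dups [0..<Suc q] (map \<pi> [0..<p])))) (standard_simplex (p + q)))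
       (standard_simplex (p + q)))))"
    unfolding smlt_def
    by (subst shuffle_sum_eq_sh[of _ p _ q, symmetric])
       (simp_all add: shuffle_sum_def zlin_sum[OF zlin_RW] zlin_cmul[OF zlin_RW] RW_of zlin_sum[OF zlin_push] zlin_cmul[OF zlin_push]
         push_of del: upt_Suc)
  also have "\<dots> = shuffle_simplex p q \<sigma> \<tau>"
    unfolding shuffle_simplex_def
  proof (rule sum.cong[OF refl])
    fix \<pi> assume \<pi>: "\<pi> \<in> pq_shuffles p q"
    note D = pq_shufflesD[OF \<pi>]
    have lt: "\<pi> i < p + q" if "i < p + q" for i using permutes_in_image[OF D(1), of i] that by simp
    let ?A = "map \<pi> [p..<p + q]" and ?B = "map \<pi> [0..<p]"
    have A: "?A ! k \<le> p + k" if "k < length ?A" for k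
      using strict_mono_bound[of p q \<pi> p k, OF D(3)] lt that by simp
    have B: "?B ! k \<le> q + k" if "k < length ?B" for k
      using strict_mono_bound[of 0 p \<pi> q k] D(2) lt that by (simp add: add.commute)
    have len: "length (dups [0..<Suc p] ?A) = Suc (p + q)" "length (dups [0..<Suc q] ?B) = Suc (p + q)"
      using length_dups[of ?A "[0..<Suc p]"] length_dups[of ?B "[0..<Suc q]"] A B
      by (simp_all add: less_Suc_eq_le del: upt_Suc)
    have "map_prod \<sigma> \<tau> (pairW lin lin (zip (dups [0..<Suc p] ?A) (dups [0..<Suc q] ?B)) t) =
        (degens p ?A \<sigma> t, degens q ?B \<tau> t)" if t: "t \<in> standard_simplex (p + q)" for t
      using degens_lin[of t p ?A \<sigma>, OF _ A] degens_lin[of t q ?B \<tau>, OF _ B] t len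
      by (simp add: pairW_def add.commute del: upt_Suc)
    then show "frag_cmul (sign \<pi>) (frag_of (restrict (map_prod \<sigma> \<tau> \<circ> restrict (pairW lin lin
       (zip (dups [0..<Suc p] ?A) (dups [0..<Suc q] ?B))) (standard_simplex (p + q))) (standard_simplex (p + q)))) =
      frag_cmul (sign \<pi>) (frag_of (\<lambda>t\<in>standard_simplex (p + q). (degens p ?A \<sigma> t, degens q ?B \<tau> t)))"
      by (intro arg_cong[of _ _ "\<lambda>c. frag_cmul (sign \<pi>) (frag_of c)"]) (auto simp: fun_eq_iff restrict_def simp del: upt_Suc)
  qed
  finally show ?thesis ..
qed

lemma shuffle_prod_eq: "shuffle_prod p q x y = mul (standard_simplex (p + q)) (smlt p q) x y"
  by (simp add: shuffle_prod_def mul_def shuffle_simplex_eq)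

section \<open>The functors of singular and of normalized singular chains\<close>

abbreviation "TS \<equiv> simp_data (\<lambda>_. {})"
abbreviation "TN \<equiv> simp_data degen_rels"

lemma gch_eq:
  assumes "mdl T = K"
    and "G = (\<lambda>n. if n < 0 then singleton_group 0 else free_Abelian_group (cells (K (nat n)) X))"
  shows "carrier (G n) = gch T X n" "\<one>\<^bsub>G n\<^esub> = 0"
    "x \<in> gch T X n \<Longrightarrow> y \<in> gch T X n \<Longrightarrow> x \<otimes>\<^bsub>G n\<^esub> y = x + y"
    "N \<subseteq> gch T X n \<Longrightarrow> x \<in> gch T X n \<Longrightarrow> N #>\<^bsub>G n\<^esub> x = (\<lambda>h. h + x) ` N"
  using assms by (auto simp: gch_def chains_def r_coset_def singleton_group_def)

lemma sing_cx_grp: "grp (sing_cx X) = (\<lambda>n. if n < 0 then singleton_group 0 else free_Abelian_group (cells (standard_simplex (nat n)) X))"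
  unfolding sing_cx_def cells_def singular_simplex_def chain_group_def by simp

lemmas sing_gch = gch_eq[OF simp_data_sel(1) sing_cx_grp]

lemma sing_carrier: "carrier (grp (sing_cx X) n) = gch TS X n"
  by (rule sing_gch)

lemma gbd_simp: "x \<in> gch (simp_data R) X n \<Longrightarrow> gbd (simp_data R) n x = chain_boundary (nat n) x"
proof (cases n rule: int_cases_neg)
  case (Suc k)
  then have "nat n = Suc k" by simp
  then show ?thesis by (simp add: gbd_def act_sbd)
qed (simp_all add: gbd_def sbd_def act_0 chain_boundary_def)

lemma grl_S: "grl TS X n = {0}"
  by (simp add: grl_def relspan_def zspan_empty)

lemma sing_presents0: "cell_theory (simp_data R) \<Longrightarrow>
    presents (gch (simp_data R) X) (\<lambda>_. {0}) (gbd (simp_data R)) (sing_cx X) (\<lambda>n x. x)"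
  by (rule presents_free; (rule sing_gch | rule subgrp_gch zlin_gbd cell_theory.gbd_gch)?)
     (auto simp: gbd_simp sing_cx_def)

lemma sing_presents: "presents (gch TS X) (grl TS X) (gbd TS) (sing_cx X) (\<lambda>n x. x)"
  using sing_presents0[OF cell_theory_S, of X] by (simp add: grl_S[abs_def])

lemma push_chain_map: "push (standard_simplex p) f = chain_map p f"
  by (simp add: push_def chain_map_def simplex_map_def fun_eq_iff o_def[abs_def])

interpretation S: lax_functor TS sing_cx "\<lambda>X n x. x" sing_mor sing_cx "\<lambda>X n x. x" sing_mor sing_kunneth "\<lambda>x. x"
proof (intro lax_functor.intro lax_functor_axioms.intro monoidal_S)
  show "sing_mor X Y f n x = gpush TS n f x" if "x \<in> gch TS X n" for X :: "'a topology" and Y :: "'a topology" and f n x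
    using that by (simp add: sing_mor_def sing_carrier gpush_def push_chain_map)
  show "sing_mor X Y f n x = gpush TS n f x" if "x \<in> gch TS X n" for X :: "('a \<times> 'a) topology" and Y :: "'a topology" and f n x
    using that by (simp add: sing_mor_def sing_carrier gpush_def push_chain_map)
  show "sing_kunneth X Y = (\<lambda>n. \<lambda>c\<in>carrier (grp (tensor (sing_cx X) (sing_cx Y)) n).
      the_elem ((\<lambda>z. frag_extend (\<lambda>(i, u, j, v). gmul TS i j u v) z) ` c))" for X Y :: "'a topology"
    by (simp add: sing_kunneth_def gmul_def shuffle_prod_eq)
qed (simp_all add: sing_presents sing_mor_def sing_carrier)

text \<open>The classes are sets of singular chains, so the elements have the type
  \<open>'x chain set\<close>, in which the interior of the zigzag is to live.\<close>

definition norm_cx :: "'x topology \<Rightarrow> 'x chain set chain_cx" where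
  "norm_cx X = quot_cx (sing_cx X) (grl TN X)"

definition norm_cls :: "'x topology \<Rightarrow> int \<Rightarrow> 'x chain \<Rightarrow> 'x chain set" where
  "norm_cls X n x = grl TN X n #>\<^bsub>grp (sing_cx X) n\<^esub> x"

definition norm_rep :: "'x chain set \<Rightarrow> 'x chain" where
  "norm_rep u = (SOME x. x \<in> u)"

definition norm_mor :: "'x topology \<Rightarrow> 'y topology \<Rightarrow> ('x \<Rightarrow> 'y) \<Rightarrow> int \<Rightarrow> 'x chain set \<Rightarrow> 'y chain set" where
  "norm_mor X Y f = (\<lambda>n. \<lambda>u\<in>carrier (grp (norm_cx X) n). norm_cls Y n (gpush TN n f (norm_rep u)))"

definition norm_kunneth ::
  "'x topology \<Rightarrow> 'y topology \<Rightarrow> int \<Rightarrow> ('x chain set, 'y chain set) tens \<Rightarrow> ('x \<times> 'y) chain set" where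
  "norm_kunneth X Y = (\<lambda>n. \<lambda>c\<in>carrier (grp (tensor (norm_cx X) (norm_cx Y)) n).
     the_elem ((\<lambda>z. norm_cls (prod_topology X Y) n
       (frag_extend (\<lambda>(i, u, j, v). gmul TN i j (norm_rep u) (norm_rep v)) z)) ` c))"

lemma norm_presents: "presents (gch TN X) (grl TN X) (gbd TN) (norm_cx X) (norm_cls X)"
proof -
  interpret cell_theory TN by (rule cell_theory_N)
  show ?thesis
    unfolding norm_cx_def norm_cls_def[abs_def]
    by (rule presents_quot[OF sing_presents0[OF cell_theory_N]])
       (simp_all add: grl_gch subgrp_grl gbd_grl subgrp_0[OF subgrp_grl])
qed

lemma norm_rep:
  assumes "u \<in> carrier (grp (norm_cx X) n)"
  shows "norm_rep u \<in> gch TN X n \<and> norm_cls X n (norm_rep u) = u"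
proof -
  interpret cell_theory TN by (rule cell_theory_N)
  interpret P: presented "gch TN X" "grl TN X" "gbd TN" "norm_cx X" "norm_cls X"
    by standard (rule norm_presents)
  obtain x where x: "x \<in> gch TN X n" "u = norm_cls X n x" using assms by (rule P.cls_obtain)
  then have u: "u = (\<lambda>h. h + x) ` grl TN X n"
    unfolding norm_cls_def using sing_gch(4)[OF grl_gch x(1)] by simp
  have "x \<in> u" using subgrp_0[OF subgrp_grl[of TN X n]] unfolding u by force
  then have "norm_rep u \<in> u" unfolding norm_rep_def by (rule someI)
  then obtain h where h: "h \<in> grl TN X n" "norm_rep u = h + x" unfolding u by blast
  have r: "norm_rep u \<in> gch TN X n"
    unfolding h(2) by (rule subgrp_add[OF subgrp_gch subsetD[OF grl_gch h(1)] x(1)])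
  moreover have "norm_cls X n (norm_rep u) = norm_cls X n x"
    using P.cls_eq[OF r x(1)] h by simp
  ultimately show ?thesis using x(2) by simp
qed

lemma norm_mor_cls:
  assumes "f \<in> top_hom X Y" "x \<in> gch TN X n"
  shows "norm_mor X Y f n (norm_cls X n x) = norm_cls Y n (gpush TN n f x)"
proof -
  interpret cell_theory TN by (rule cell_theory_N)
  interpret P: presented "gch TN X" "grl TN X" "gbd TN" "norm_cx X" "norm_cls X"
    by standard (rule norm_presents)
  interpret Q: presented "gch TN Y" "grl TN Y" "gbd TN" "norm_cx Y" "norm_cls Y"
    by standard (rule norm_presents)
  have c: "norm_cls X n x \<in> carrier (grp (norm_cx X) n)" by (rule P.cls_carrier[OF assms(2)])
  note r = norm_rep[OF c]
  have f: "continuous_map X Y f" using assms(1) by (simp add: top_hom_def)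
  have "norm_rep (norm_cls X n x) - x \<in> grl TN X n" using P.cls_eq[of "norm_rep (norm_cls X n x)" n x] r assms(2) by simp
  then have "gpush TN n f (norm_rep (norm_cls X n x)) - gpush TN n f x \<in> grl TN Y n"
    using gpush_grl[OF _ f] by (simp flip: zlin_diff[OF zlin_gpush])
  then show ?thesis
    using c r by (simp add: norm_mor_def Q.cls_eq gpush_gch[OF _ f] assms(2))
qed

interpretation N: lax_functor TN norm_cx norm_cls norm_mor norm_cx norm_cls norm_mor norm_kunneth norm_rep
proof (intro lax_functor.intro lax_functor_axioms.intro monoidal_N)
qed (simp_all add: norm_presents norm_mor_cls norm_rep norm_kunneth_def, simp_all add: norm_mor_def)

text \<open>The universal chains of the identity of \<open>TN\<close>, reused with a source that has
  no relations to preserve.\<close>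

lemma datum_SN: "chain_datum TS TN (\<lambda>n. idc (standard_simplex n))"
  using datum_id[OF acyclic_N]
  by (simp add: chain_datum_def act_0 zlin_0[OF zlin_act] subgrp_0[OF subgrp_relspan])

interpretation SN: lax_map TS sing_cx "\<lambda>X n x. x" sing_mor sing_cx "\<lambda>X n x. x" sing_mor sing_kunneth "\<lambda>x. x"
    TN norm_cx norm_cls norm_mor norm_cx norm_cls norm_mor norm_kunneth norm_rep "\<lambda>n. idc (standard_simplex n)"
proof (intro lax_map.intro lax_map_axioms.intro theory_map.intro theory_map_axioms.intro
    S.lax_functor_axioms N.lax_functor_axioms acyclic_S acyclic_N cell_theory_S cell_theory_N datum_SN)
  fix p q show "act (mdl TN (p + q)) (idc (standard_simplex (p + q))) (mlt TS p q) =
      mul (mdl TN (p + q)) (mlt TN p q) (idc (standard_simplex p)) (idc (standard_simplex q))"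
    by (simp add: act_idc[OF smlt_chain] mul_idc[OF smlt_chain])
qed

section \<open>Ordered cubical chains\<close>

text \<open>Places are counted from 0 here, so \<open>ins k\<close> is
  \<open>cube_insert (Suc k)\<close>.\<close>

definition ins :: "nat \<Rightarrow> real \<Rightarrow> vec \<Rightarrow> vec" where
  "ins k e t = (\<lambda>j. if j < k then t j else if j = k then e else t (j - 1))"

definition del_coord :: "nat \<Rightarrow> vec \<Rightarrow> vec" where
  "del_coord k t = (\<lambda>j. if j < k then t j else t (Suc j))"

definition swp :: "nat \<Rightarrow> nat \<Rightarrow> nat" where
  "swp k = Transposition.transpose k (Suc k)"

definition perm_coords :: "(nat \<Rightarrow> nat) \<Rightarrow> vec \<Rightarrow> vec" where
  "perm_coords \<pi> t = t \<circ> \<pi>"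

abbreviation ev :: "nat \<Rightarrow> (vec \<Rightarrow> 'x) \<Rightarrow> (vec \<Rightarrow> 'x) \<Rightarrow>\<^sub>0 int" where
  "ev p f \<equiv> frag_of (restrict f (unit_cube p))"

text \<open>With \<open>i = k + 1\<close> the sign (-1)^(i + e) of the definitions is (-1)^k on the
  face at 1 and its negative on the face at 0.\<close>

definition cbd :: "nat \<Rightarrow> vec chain" where
  "cbd p = (\<Sum>k<p. frag_cmul ((- 1) ^ k) (ev (p - 1) (ins k 1) - ev (p - 1) (ins k 0)))"

definition split_coords :: "nat \<Rightarrow> vec \<Rightarrow> vec \<times> vec" where
  "split_coords p t = ((\<lambda>i. if i < p then t i else 0), (\<lambda>i. t (p + i)))"

definition cmlt :: "nat \<Rightarrow> nat \<Rightarrow> (vec \<times> vec) chain" where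
  "cmlt p q = ev (p + q) (split_coords p)"

text \<open>The cone parameter is a new coordinate 0. The face at 1 is \<open>c\<close>, the face at
  0 is constant at the apex; the cube is not collapsed there, which is why continuity is
  unproblematic.\<close>

definition ccone :: "vec \<Rightarrow> nat \<Rightarrow> (vec \<Rightarrow> vec) \<Rightarrow> vec \<Rightarrow> vec" where
  "ccone v p c = (\<lambda>t\<in>unit_cube (Suc p). (\<lambda>i. (1 - t 0) * v i + t 0 * c (del_coord 0 t) i))"

definition del_rels :: "nat \<Rightarrow> (nat \<times> vec chain) set" where
  "del_rels p = {(p - 1, ev p (del_coord k)) | k. k < p}"

text \<open>Only adjacent transpositions, with their sign -1. They generate the symmetric group, and
  \<open>perm_gen\<close> recovers the relation for an arbitrary permutation.\<close>

definition swp_rels :: "nat \<Rightarrow> (nat \<times> vec chain) set" where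
  "swp_rels p = {(p, ev p (\<lambda>t. t) + ev p (perm_coords (swp k))) | k. Suc k < p}"

definition cube_data :: "(nat \<Rightarrow> (nat \<times> vec chain) set) \<Rightarrow> cell_data" where
  "cube_data R = \<lparr>mdl = unit_cube, bdy = cbd, rels = R, base = (\<lambda>_ _. 0), cone = ccone, mlt = cmlt\<rparr>"

lemma cube_data_sel [simp]: "mdl (cube_data R) = unit_cube" "bdy (cube_data R) = cbd"
  "rels (cube_data R) = R" "base (cube_data R) = (\<lambda>_ _. 0)" "cone (cube_data R) = ccone" "mlt (cube_data R) = cmlt"
  by (simp_all add: cube_data_def)

text \<open>C^ord is defined in two steps; \<open>TD\<close> has the relations of the first one,
  degenerate cubes, and \<open>TC\<close> those of both.\<close>

abbreviation "TD \<equiv> cube_data del_rels"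
abbreviation "TC \<equiv> cube_data (\<lambda>p. del_rels p \<union> swp_rels p)"

lemma cube_coord: "t \<in> unit_cube p \<Longrightarrow> 0 \<le> t i \<and> t i \<le> 1"
  by (cases "i < p") (auto simp: unit_cube_def)

lemma cube_zero: "t \<in> unit_cube p \<Longrightarrow> i \<ge> p \<Longrightarrow> t i = 0"
  by (simp add: unit_cube_def)

lemma cubeI: "(\<And>i. 0 \<le> t i \<and> t i \<le> 1) \<Longrightarrow> (\<And>i. i \<ge> p \<Longrightarrow> t i = 0) \<Longrightarrow> t \<in> unit_cube p"
  by (simp add: unit_cube_def)

lemma ins_cube: "t \<in> unit_cube p \<Longrightarrow> k \<le> p \<Longrightarrow> 0 \<le> e \<Longrightarrow> e \<le> 1 \<Longrightarrow> ins k e t \<in> unit_cube (Suc p)"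
  using cube_coord[of t p] cube_zero[of t p] by (intro cubeI) (auto simp: ins_def)

lemma del_coord_cube: "t \<in> unit_cube (Suc p) \<Longrightarrow> k \<le> p \<Longrightarrow> del_coord k t \<in> unit_cube p"
  using cube_coord[of t "Suc p"] cube_zero[of t "Suc p"] by (intro cubeI) (auto simp: del_coord_def)

lemma perm_coords_cube: "t \<in> unit_cube p \<Longrightarrow> \<pi> permutes {..<p} \<Longrightarrow> perm_coords \<pi> t \<in> unit_cube p"
  using cube_coord[of t p] cube_zero[of t p] by (intro cubeI) (auto simp: perm_coords_def permutes_def)

lemma swp_permutes: "Suc k < p \<Longrightarrow> swp k permutes {..<p}"
  unfolding swp_def by (rule permutes_swap_id) auto

lemma split_coords_cube:
  "t \<in> unit_cube (p + q) \<Longrightarrow> fst (split_coords p t) \<in> unit_cube p \<and> snd (split_coords p t) \<in> unit_cube q"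
  using cube_coord[of t "p + q"] cube_zero[of t "p + q"] by (auto intro!: cubeI simp: split_coords_def)

lemma continuous_map_mtopI:
  assumes "\<And>i. continuous_map (mtop S) euclideanreal (\<lambda>t. f t i)" "\<And>t. t \<in> S \<Longrightarrow> f t \<in> S'"
  shows "continuous_map (mtop S) (mtop S') f"
  using assms by (auto simp: continuous_map_in_subtopology continuous_map_componentwise_UNIV)

lemma cells_restrict: "continuous_map (mtop S) X f \<Longrightarrow> restrict f S \<in> cells S X"
  using continuous_map_eq[of "mtop S" X f "restrict f S"] by (simp add: cells_def)

lemma ins_continuous: "k \<le> p \<Longrightarrow> 0 \<le> e \<Longrightarrow> e \<le> 1 \<Longrightarrow> continuous_map (mtop (unit_cube p)) (mtop (unit_cube (Suc p))) (ins k e)"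
  by (rule continuous_map_mtopI) (auto simp: ins_cube, simp add: ins_def continuous_map_coord)

lemma del_coord_continuous: "k \<le> p \<Longrightarrow> continuous_map (mtop (unit_cube (Suc p))) (mtop (unit_cube p)) (del_coord k)"
  by (rule continuous_map_mtopI) (auto simp: del_coord_cube, simp add: del_coord_def continuous_map_coord)

lemma perm_coords_continuous: "\<pi> permutes {..<p} \<Longrightarrow> continuous_map (mtop (unit_cube p)) (mtop (unit_cube p)) (perm_coords \<pi>)"
  by (rule continuous_map_mtopI) (auto simp: perm_coords_cube, simp add: perm_coords_def continuous_map_coord)

lemma split_coords_continuous:
  "continuous_map (mtop (unit_cube (p + q))) (prod_topology (mtop (unit_cube p)) (mtop (unit_cube q))) (split_coords p)"
  unfolding continuous_map_pairwise
proof
  show "continuous_map (mtop (unit_cube (p + q))) (mtop (unit_cube p)) (fst \<circ> split_coords p)"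
    by (rule continuous_map_mtopI) (auto simp: split_coords_cube, simp add: split_coords_def continuous_map_coord)
  show "continuous_map (mtop (unit_cube (p + q))) (mtop (unit_cube q)) (snd \<circ> split_coords p)"
    by (rule continuous_map_mtopI) (auto simp: split_coords_cube, simp add: split_coords_def continuous_map_coord)
qed

lemma ev_chain: "continuous_map (mtop (unit_cube p)) X f \<Longrightarrow> ev p f \<in> chains (unit_cube p) X"
  by (simp add: frag_of_chains cells_restrict)

lemma push_ev: "push (unit_cube p) c (ev p f) = ev p (c \<circ> f)"
proof -
  have "restrict (c \<circ> restrict f (unit_cube p)) (unit_cube p) = restrict (c \<circ> f) (unit_cube p)" by auto
  then show ?thesis by (simp add: push_of)
qed

lemma ev_cong: "(\<And>t. t \<in> unit_cube p \<Longrightarrow> f t = g t) \<Longrightarrow> ev p f = ev p g"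
  by (simp add: frag_of_eq fun_eq_iff restrict_def)

lemma ev_restrict: "(\<And>t. t \<in> unit_cube p \<Longrightarrow> g t \<in> unit_cube m) \<Longrightarrow> ev p (restrict f (unit_cube m) \<circ> g) = ev p (f \<circ> g)"
  by (rule ev_cong) simp

lemma push_cbd: "push (unit_cube p) c (cbd (Suc p)) =
    (\<Sum>k\<le>p. frag_cmul ((- 1) ^ k) (ev p (c \<circ> ins k 1) - ev p (c \<circ> ins k 0)))"
  by (simp only: cbd_def diff_Suc_1 zlin_sum[OF zlin_push] zlin_cmul[OF zlin_push] zlin_diff[OF zlin_push] push_ev
      lessThan_Suc_atMost)

lemma cbd_chain: "cbd (Suc p) \<in> chains (unit_cube p) (mtop (unit_cube (Suc p)))"
  unfolding cbd_def
  by (intro subgrp_sum[OF subgrp_chains] subgrp_cmul[OF subgrp_chains] subgrp_diff[OF subgrp_chains])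
     (auto intro!: cells_restrict ins_continuous simp: frag_of_chains)

text \<open>The term at \<open>(k, j)\<close> with \<open>j < k\<close> cancels against the term at
  \<open>(j, k - 1)\<close>, whose exponent is smaller by one.\<close>

lemma alternating_sum_zero:
  fixes a :: "nat \<Rightarrow> nat \<Rightarrow> ('a \<Rightarrow>\<^sub>0 int)"
  assumes "\<And>k j. j < k \<Longrightarrow> k \<le> Suc p \<Longrightarrow> a k j = a j (k - 1)"
  shows "(\<Sum>k\<le>Suc p. \<Sum>j\<le>p. frag_cmul ((- 1) ^ (k + j)) (a k j)) = 0"
proof -
  let ?f = "\<lambda>(k, j). frag_cmul ((- 1) ^ (k + j)) (a k j)"
  let ?L = "{(k, j). j < k \<and> k \<le> Suc p}" and ?U = "{(k, j). k \<le> j \<and> j \<le> p}"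
  have fin: "finite ?L" "finite ?U"
    by (rule finite_subset[of _ "{..Suc p} \<times> {..Suc p}"]; auto)+
  have "(\<Sum>k\<le>Suc p. \<Sum>j\<le>p. frag_cmul ((- 1) ^ (k + j)) (a k j)) = sum ?f ({..Suc p} \<times> {..p})"
    by (simp add: sum.cartesian_product del: sum.atMost_Suc)
  also have "{..Suc p} \<times> {..p} = ?L \<union> ?U" by auto
  also have "sum ?f (?L \<union> ?U) = sum ?f ?L + sum ?f ?U"
    by (rule sum.union_disjoint[OF fin]) auto
  also have "sum ?f ?L = sum (\<lambda>x. - ?f x) ?U"
    by (rule sum.reindex_bij_witness[of _ "\<lambda>(k, j). (Suc j, k)" "\<lambda>(k, j). (j, k - 1)"])
       (auto simp: assms neg_one_power)
  finally show ?thesis by (simp add: sum_negf)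
qed

lemma ins_ins: "j < k \<Longrightarrow> ins k e (ins j e' t) = ins j e' (ins (k - 1) e t)"
  by (auto simp: ins_def fun_eq_iff)

lemma cbd_cbd: "act (unit_cube p) (cbd (Suc p)) (cbd (Suc (Suc p))) = 0"
proof -
  let ?a = "\<lambda>k j. (ev p (ins k 1 \<circ> ins j 1) - ev p (ins k 1 \<circ> ins j 0)) - (ev p (ins k 0 \<circ> ins j 1) - ev p (ins k 0 \<circ> ins j 0))"
  have r: "ev p (restrict (ins k e) (unit_cube (Suc p)) \<circ> ins j e') = ev p (ins k e \<circ> ins j e')"
    if "j \<le> p" "0 \<le> e'" "e' \<le> 1" for k e j e'
    using that by (intro ev_restrict) (simp add: ins_cube)
  have "act (unit_cube p) (cbd (Suc p)) (cbd (Suc (Suc p))) =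
    (\<Sum>k\<le>Suc p. \<Sum>j\<le>p. frag_cmul ((- 1) ^ (k + j)) (?a k j))"
    unfolding cbd_def[of "Suc (Suc p)"] lessThan_Suc_atMost
    by (simp add: zlin_sum[OF zlin_act] zlin_cmul[OF zlin_act] zlin_diff[OF zlin_act] act_of push_cbd r
        frag_cmul_sum' frag_cmul_diff2 sum_subtractf power_add del: sum.atMost_Suc)
  also have "\<dots> = 0"
  proof (rule alternating_sum_zero)
    fix k j assume jk: "j < k" "k \<le> Suc p"
    have "ins k e \<circ> ins j e' = ins j e' \<circ> ins (k - 1) e" for e e' using jk by (simp add: fun_eq_iff ins_ins)
    then show "?a k j = ?a j (k - 1)" by simp
  qed
  finally show ?thesis .
qed

lemma relspan_mono: "(\<And>p. R p \<subseteq> R' p) \<Longrightarrow> relspan K R p X \<subseteq> relspan K R' p X"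
  unfolding relspan_def by (rule zspan_least[OF subgrp_zspan]) (blast intro: zspan_gen)

lemma del_gen: "k \<le> p \<Longrightarrow> continuous_map (mtop (unit_cube p)) X f \<Longrightarrow> ev (Suc p) (f \<circ> del_coord k) \<in> relspan unit_cube del_rels (Suc p) X"
proof -
  assume k: "k \<le> p" and f: "continuous_map (mtop (unit_cube p)) X f"
  have "push (unit_cube (Suc p)) (restrict f (unit_cube p)) (ev (Suc p) (del_coord k)) \<in> relspan unit_cube del_rels (Suc p) X"
    by (rule relspan_gen[where K=unit_cube and rel=del_rels, OF _ cells_restrict[OF f]])
       (use k in \<open>force simp: del_rels_def\<close>)
  then show ?thesis using ev_restrict[of "Suc p" "del_coord k" p f] k by (simp add: push_ev del_coord_cube)
qed

lemma swp_gen: "Suc k < p \<Longrightarrow> continuous_map (mtop (unit_cube p)) X f \<Longrightarrow>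
    ev p f + ev p (f \<circ> perm_coords (swp k)) \<in> relspan unit_cube swp_rels p X"
proof -
  assume k: "Suc k < p" and f: "continuous_map (mtop (unit_cube p)) X f"
  have "push (unit_cube p) (restrict f (unit_cube p)) (ev p (\<lambda>t. t) + ev p (perm_coords (swp k))) \<in> relspan unit_cube swp_rels p X"
    by (rule relspan_gen[where K=unit_cube and rel=swp_rels, OF _ cells_restrict[OF f]])
       (use k in \<open>auto simp: swp_rels_def\<close>)
  moreover have "ev p (restrict f (unit_cube p) \<circ> (\<lambda>t. t)) = ev p f" by (rule ev_cong) simp
  moreover have "ev p (restrict f (unit_cube p) \<circ> perm_coords (swp k)) = ev p (f \<circ> perm_coords (swp k))"
    by (rule ev_restrict) (simp add: perm_coords_cube swp_permutes k)
  ultimately show ?thesis by (simp add: push_ev zlin_add[OF zlin_push])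
qed

lemma del_rel_chain: "(m, r) \<in> del_rels p \<Longrightarrow> r \<in> chains (unit_cube p) (mtop (unit_cube m))"
proof -
  assume "(m, r) \<in> del_rels p"
  then obtain k where k: "k < p" "m = p - 1" "r = ev p (del_coord k)" by (auto simp: del_rels_def)
  obtain m' where p: "p = Suc m'" using k(1) by (cases p) auto
  show ?thesis using ev_chain[OF del_coord_continuous[of k m']] k by (simp add: p)
qed

lemma swp_rel_chain: "(m, r) \<in> swp_rels p \<Longrightarrow> r \<in> chains (unit_cube p) (mtop (unit_cube m))"
  by (auto simp: swp_rels_def intro!: subgrp_add[OF subgrp_chains] ev_chain perm_coords_continuous swp_permutes
      continuous_map_id[unfolded id_def])

lemma del_ins: "del_coord k (ins k e t) = t"
  "j < k \<Longrightarrow> del_coord k (ins j e t) = ins j e (del_coord (k - 1) t)"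
  "k < j \<Longrightarrow> del_coord k (ins j e t) = ins (j - 1) e (del_coord k t)"
  by (auto simp: ins_def del_coord_def fun_eq_iff)

text \<open>In the forgotten direction both faces become the identity cube and cancel. In every
  other direction the face still factors through forgetting a coordinate.\<close>

lemma del_rel_bd:
  assumes "(m, r) \<in> del_rels (Suc p)"
  shows "act (unit_cube p) (cbd (Suc p)) r \<in> relspan unit_cube del_rels p (mtop (unit_cube m))"
proof -
  obtain k where k: "k \<le> p" "m = p" "r = ev (Suc p) (del_coord k)"
    using assms unfolding del_rels_def less_Suc_eq_le diff_Suc_1 by blast
  have "ev p (del_coord k \<circ> ins j 1) - ev p (del_coord k \<circ> ins j 0) \<in> relspan unit_cube del_rels p (mtop (unit_cube p))"
    if j: "j \<le> p" for j
  proof (cases "j = k")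
    case True
    have "del_coord k \<circ> ins k e = (\<lambda>t. t)" for e by (simp add: fun_eq_iff del_ins)
    then show ?thesis using True by (simp add: subgrp_0[OF subgrp_relspan])
  next
    case False
    then obtain p' where p: "p = Suc p'" using j k(1) by (cases p) auto
    have "ev p (del_coord k \<circ> ins j e) \<in> relspan unit_cube del_rels p (mtop (unit_cube p))" if "0 \<le> e" "e \<le> 1" for e
    proof (cases "j < k")
      case True
      then have "del_coord k \<circ> ins j e = ins j e \<circ> del_coord (k - 1)" by (simp add: fun_eq_iff del_ins)
      then show ?thesis using del_gen[OF _ ins_continuous[of j p' e], of "k - 1"] True k(1) that by (simp add: p)
    next
      case False
      then have "del_coord k \<circ> ins j e = ins (j - 1) e \<circ> del_coord k" using \<open>j \<noteq> k\<close> by (simp add: fun_eq_iff del_ins)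
      then show ?thesis using del_gen[OF _ ins_continuous[of "j - 1" p' e], of k] False \<open>j \<noteq> k\<close> j that by (simp add: p)
    qed
    then show ?thesis by (intro subgrp_diff[OF subgrp_relspan]) auto
  qed
  moreover have "ev p (restrict (del_coord k) (unit_cube (Suc p)) \<circ> ins j e) = ev p (del_coord k \<circ> ins j e)"
    if "j \<le> p" "0 \<le> e" "e \<le> 1" for j e
    using that by (intro ev_restrict) (simp add: ins_cube)
  ultimately show ?thesis
    unfolding k act_of push_cbd
    by (intro subgrp_sum[OF subgrp_relspan] subgrp_cmul[OF subgrp_relspan]) simp
qed

lemma swp_ins: "perm_coords (swp k) (ins k e t) = ins (Suc k) e t"
  "perm_coords (swp k) (ins (Suc k) e t) = ins k e t"
  "j < k \<Longrightarrow> perm_coords (swp k) (ins j e t) = ins j e (perm_coords (swp (k - 1)) t)"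
  "Suc k < j \<Longrightarrow> perm_coords (swp k) (ins j e t) = ins j e (perm_coords (swp k) t)"
  by (auto simp: ins_def perm_coords_def swp_def fun_eq_iff Transposition.transpose_def)

text \<open>The swap exchanges the faces in the directions \<open>k\<close> and
  \<open>k + 1\<close>, which appear with opposite signs and so cancel in the symmetrized cube. Each
  other face inherits a swap of two neighbouring coordinates.\<close>

lemma swp_rel_bd:
  assumes "(m, r) \<in> swp_rels (Suc p)"
  shows "act (unit_cube p) (cbd (Suc p)) r \<in> relspan unit_cube swp_rels p (mtop (unit_cube m))"
proof -
  obtain k where k: "k < p" "m = Suc p" "r = ev (Suc p) (\<lambda>t. t) + ev (Suc p) (perm_coords (swp k))"
    using assms unfolding swp_rels_def Suc_less_eq by blast
  define s where "s j e = ev p (ins j e) + ev p (perm_coords (swp k) \<circ> ins j e)" for j e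
  have r1: "ev p (restrict f (unit_cube (Suc p)) \<circ> ins j e) = ev p (f \<circ> ins j e)"
    if "j \<le> p" "0 \<le> e" "e \<le> 1" for j e and f :: "vec \<Rightarrow> vec"
    using that by (intro ev_restrict) (simp add: ins_cube)
  have "act (unit_cube p) (cbd (Suc p)) r = (\<Sum>j\<le>p. frag_cmul ((- 1) ^ j) (s j 1 - s j 0))"
    unfolding k zlin_add[OF zlin_act] act_of push_cbd sum.distrib[symmetric]
    by (rule sum.cong) (simp_all add: r1 s_def frag_cmul_diff2 frag_cmul_distrib2 o_def[of "\<lambda>t. t"])
  also have "\<dots> = (\<Sum>j\<in>{..p} - {k, Suc k}. frag_cmul ((- 1) ^ j) (s j 1 - s j 0))
      + (\<Sum>j\<in>{k, Suc k}. frag_cmul ((- 1) ^ j) (s j 1 - s j 0))"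
    by (rule sum.subset_diff) (use k in auto)
  also have "(\<Sum>j\<in>{k, Suc k}. frag_cmul ((- 1) ^ j) (s j 1 - s j 0)) = 0"
  proof -
    have "s k e = s (Suc k) e" for e
      by (simp add: s_def o_def swp_ins add.commute)
    then show ?thesis by (simp flip: minus_frag_cmul)
  qed
  also have "(\<Sum>j\<in>{..p} - {k, Suc k}. frag_cmul ((- 1) ^ j) (s j 1 - s j 0)) + 0 \<in> relspan unit_cube swp_rels p (mtop (unit_cube (Suc p)))"
  proof -
    have "s j e \<in> relspan unit_cube swp_rels p (mtop (unit_cube (Suc p)))"
      if j: "j \<in> {..p} - {k, Suc k}" and e: "0 \<le> e" "e \<le> 1" for j e
    proof (cases "j < k")
      case True
      have "perm_coords (swp k) \<circ> ins j e = ins j e \<circ> perm_coords (swp (k - 1))" using True by (simp add: fun_eq_iff swp_ins)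
      then show ?thesis using swp_gen[OF _ ins_continuous[of j p e], of "k - 1"] True k(1) e by (simp add: s_def)
    next
      case False
      then have "Suc k < j" using j by auto
      then have "perm_coords (swp k) \<circ> ins j e = ins j e \<circ> perm_coords (swp k)" by (simp add: fun_eq_iff swp_ins)
      then show ?thesis using swp_gen[OF _ ins_continuous[of j p e], of k] \<open>Suc k < j\<close> j e by (simp add: s_def)
    qed
    then show ?thesis
      by (simp, intro subgrp_sum[OF subgrp_relspan] subgrp_cmul[OF subgrp_relspan] subgrp_diff[OF subgrp_relspan]) auto
  qed
  finally show ?thesis unfolding k(2) .
qed

lemma cell_theory_D: "cell_theory TD"
proof (rule cell_theory.intro; unfold cube_data_sel)
  show "del_rels 0 = {}" by (simp add: del_rels_def)
qed (simp_all only: cbd_chain cbd_cbd del_rel_bd del_rel_chain, simp add: cbd_def)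

lemma rels_C_chain: "(m, r) \<in> del_rels p \<union> swp_rels p \<Longrightarrow> r \<in> chains (unit_cube p) (mtop (unit_cube m))"
  using del_rel_chain swp_rel_chain by blast

lemma rels_C_bd:
  assumes "(m, r) \<in> del_rels (Suc p) \<union> swp_rels (Suc p)"
  shows "act (unit_cube p) (cbd (Suc p)) r \<in> relspan unit_cube (\<lambda>p. del_rels p \<union> swp_rels p) p (mtop (unit_cube m))"
  using assms
proof
  assume "(m, r) \<in> del_rels (Suc p)"
  then show ?thesis
    by (intro subsetD[OF relspan_mono[of del_rels] del_rel_bd]) auto
next
  assume "(m, r) \<in> swp_rels (Suc p)"
  then show ?thesis
    by (intro subsetD[OF relspan_mono[of swp_rels] swp_rel_bd]) auto
qed

lemma cell_theory_C: "cell_theory TC"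
  by (rule cell_theory.intro; unfold cube_data_sel)
     (rule cbd_chain, simp add: cbd_def, rule cbd_cbd, erule rels_C_chain, simp add: del_rels_def swp_rels_def, erule rels_C_bd)

text \<open>The permutations that act by their sign modulo swap relations. Quantifying over all
  \<open>f\<close> makes the set closed under composition, because the second permutation is applied
  to a cube that is already permuted.\<close>

definition alt_perms :: "nat \<Rightarrow> 'x topology \<Rightarrow> (nat \<Rightarrow> nat) set" where
  "alt_perms n X = {\<pi>. \<pi> permutes {..<n} \<and> (\<forall>f. continuous_map (mtop (unit_cube n)) X f \<longrightarrow>
     ev n f - frag_cmul (sign \<pi>) (ev n (f \<circ> perm_coords \<pi>)) \<in> relspan unit_cube swp_rels n X)}"

lemma permutes_permutation: "\<pi> permutes {..<n::nat} \<Longrightarrow> permutation \<pi>"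
  using permutation_permutes by blast

lemma alt_perms_comp:
  assumes "\<sigma> \<in> alt_perms n X" "\<pi> \<in> alt_perms n X" shows "\<sigma> \<circ> \<pi> \<in> alt_perms n X"
proof -
  have p: "\<sigma> permutes {..<n}" "\<pi> permutes {..<n}" using assms by (auto simp: alt_perms_def)
  have "ev n f - frag_cmul (sign (\<sigma> \<circ> \<pi>)) (ev n (f \<circ> perm_coords (\<sigma> \<circ> \<pi>))) \<in> relspan unit_cube swp_rels n X"
    if f: "continuous_map (mtop (unit_cube n)) X f" for f
  proof -
    let ?g = "f \<circ> perm_coords \<pi>"
    have 1: "ev n f - frag_cmul (sign \<pi>) (ev n ?g) \<in> relspan unit_cube swp_rels n X"
      using assms(2) f by (simp add: alt_perms_def)
    have 2: "ev n ?g - frag_cmul (sign \<sigma>) (ev n (?g \<circ> perm_coords \<sigma>)) \<in> relspan unit_cube swp_rels n X"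
      using assms(1) continuous_map_compose[OF perm_coords_continuous[OF p(2)] f] by (simp add: alt_perms_def)
    have "sign (\<sigma> \<circ> \<pi>) = sign \<pi> * sign \<sigma>"
      by (simp add: sign_compose permutes_permutation[OF p(1)] permutes_permutation[OF p(2)])
    moreover have "?g \<circ> perm_coords \<sigma> = f \<circ> perm_coords (\<sigma> \<circ> \<pi>)"
      by (simp add: fun_eq_iff perm_coords_def o_assoc)
    ultimately show ?thesis
      using subgrp_add[OF subgrp_relspan 1 subgrp_cmul[OF subgrp_relspan 2, of "sign \<pi>"]]
      by (simp add: frag_cmul_diff2 del: minus_frag_cmul)
  qed
  then show ?thesis using permutes_compose[OF p(2,1)] by (simp add: alt_perms_def)
qed

lemma alt_perms_swp: "Suc k < n \<Longrightarrow> swp k \<in> alt_perms n X"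
proof -
  assume k: "Suc k < n"
  have "sign (swp k) = - 1" by (simp add: swp_def sign_swap_id)
  then show ?thesis using swp_gen[OF k, of X] swp_permutes[OF k] by (simp add: alt_perms_def)
qed

text \<open>A transposition of distant places is conjugated by adjacent swaps until the places are
  neighbours.\<close>

lemma alt_perms_transpose: "b < n \<Longrightarrow> a < b \<Longrightarrow> Transposition.transpose a b \<in> alt_perms n X"
proof (induction b)
  case (Suc b)
  show ?case
  proof (cases "a = b")
    case True then show ?thesis using alt_perms_swp[of b n X] Suc by (simp add: swp_def)
  next
    case False
    then have "Transposition.transpose a (Suc b) = swp b \<circ> (Transposition.transpose a b \<circ> swp b)"
      using Suc(3) by (auto simp: fun_eq_iff swp_def Transposition.transpose_def)
    moreover have "Transposition.transpose a b \<in> alt_perms n X" using Suc False by simp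
    ultimately show ?thesis using Suc(2) by (simp only: alt_perms_comp alt_perms_swp)
  qed
qed simp

lemma alt_perms_all:
  assumes "\<pi> permutes {..<n}" shows "\<pi> \<in> alt_perms n X"
  using assms finite_lessThan[of n]
proof (induction rule: permutes_induct)
  case id
  have "perm_coords id = id" by (simp add: fun_eq_iff perm_coords_def)
  then show ?case
    by (simp only: alt_perms_def mem_Collect_eq permutes_id sign_id) (simp add: subgrp_0[OF subgrp_relspan])
next
  case (swap a b p)
  have "Transposition.transpose a b \<in> alt_perms n X"
    using alt_perms_transpose[of b n a X] alt_perms_transpose[of a n b X] swap(1-3)
    by (cases "a < b") (auto simp: transpose_commute)
  then show ?case using swap by (intro alt_perms_comp) auto
qed

lemma perm_gen: "\<pi> permutes {..<n} \<Longrightarrow> continuous_map (mtop (unit_cube n)) X f \<Longrightarrow>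
    ev n f - frag_cmul (sign \<pi>) (ev n (f \<circ> perm_coords \<pi>)) \<in> relspan unit_cube swp_rels n X"
  using alt_perms_all[of \<pi> n X] by (simp add: alt_perms_def)

text \<open>Addition of \<open>p\<close> modulo \<open>p + q\<close>: composing a point of the cube
  with it puts the last \<open>q\<close> coordinates in front of the first \<open>p\<close>.\<close>

definition rot :: "nat \<Rightarrow> nat \<Rightarrow> nat \<Rightarrow> nat" where
  "rot p q = (cyc (p + q - 1) ^^ p)"

text \<open>The cycle has length \<open>p + q\<close>, so the sign has exponent
  \<open>(p + q - 1) * p\<close>, which has the parity of \<open>p * q\<close> because
  \<open>p * (p - 1)\<close> is even.\<close>

lemma rot_permutes_sign:
  assumes "0 < p + q" shows "rot p q permutes {..<p + q}" "sign (rot p q) = (- 1) ^ (p * q)"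
proof -
  obtain n where n: "p + q = Suc n" using assms by (cases "p + q") auto
  have *: "(cyc n ^^ k) permutes {..<Suc n} \<and> sign (cyc n ^^ k) = (- 1) ^ (n * k)" for k
  proof (induction k)
    case (Suc k)
    have c: "cyc n permutes {..<Suc n}" by (rule cyc_permutes) simp
    show ?case
      using Suc permutes_compose[OF _ c] permutes_permutation[OF c] permutes_permutation[of "cyc n ^^ k" "Suc n"]
      by (simp only: funpow.simps sign_compose sign_cyc power_add mult_Suc_right)
  qed (simp add: permutes_id[unfolded id_def])
  have "even (n * p) \<longleftrightarrow> even (p * q)" using arg_cong[OF n, of even] by auto
  then have "(- 1 :: int) ^ (n * p) = (- 1) ^ (p * q)" by (simp add: neg_one_power)
  then show "rot p q permutes {..<p + q}" "sign (rot p q) = (- 1) ^ (p * q)"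
    using *[of p] by (simp_all add: rot_def n)
qed

lemma rot_apply: "i < q \<Longrightarrow> rot p q i = p + i" "i < p \<Longrightarrow> rot p q (q + i) = i"
proof -
  have 1: "(cyc n ^^ k) i = k + i" if "k + i \<le> n" for n k i
    using that by (induction k) (auto simp: cyc_apply)
  have "rot p q i = p + i" if "i < q" for i using 1[of p i "p + q - 1"] that by (simp add: rot_def)
  then show "i < q \<Longrightarrow> rot p q i = p + i" .
  show "rot p q (q + i) = i" if "i < p"
  proof -
    have "rot p q (q + i) = (cyc (p + q - 1) ^^ (i + Suc (p - 1 - i))) (q + i)" using that by (simp add: rot_def)
    also have "\<dots> = (cyc (p + q - 1) ^^ i) (cyc (p + q - 1) ((cyc (p + q - 1) ^^ (p - 1 - i)) (q + i)))"
      by (simp only: funpow_add o_apply funpow.simps)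
    also have "(cyc (p + q - 1) ^^ (p - 1 - i)) (q + i) = p + q - 1"
      using 1[of "p - 1 - i" "q + i" "p + q - 1"] that by simp
    also have "cyc (p + q - 1) (p + q - 1) = 0" by (simp add: cyc_apply)
    also have "(cyc (p + q - 1) ^^ i) 0 = i" using 1[of i 0 "p + q - 1"] that by simp
    finally show ?thesis .
  qed
qed

lemma split_rot: "t \<in> unit_cube (p + q) \<Longrightarrow> split_coords q (perm_coords (rot p q) t) = prod.swap (split_coords p t)"
proof -
  assume t: "t \<in> unit_cube (p + q)"
  have "(if i < q then t (rot p q i) else 0) = t (p + i)" for i
    using cube_zero[OF t, of "p + i"] by (simp add: rot_apply)
  moreover have "t (rot p q (q + i)) = (if i < p then t i else 0)" for i
  proof (cases "i < p")
    case False
    have "rot p q (q + i) = q + i"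
      using permutes_not_in[OF rot_permutes_sign(1), of p q "q + i"] False
      by (cases "p + q = 0") (auto simp: rot_def)
    then show ?thesis using cube_zero[OF t, of "q + i"] False by simp
  qed (simp add: rot_apply)
  ultimately show ?thesis unfolding split_coords_def perm_coords_def o_apply by simp
qed

lemma mul_cmlt: "mul (unit_cube (p + q)) (cmlt p q) (ev p f) (ev q g) = ev (p + q) (map_prod f g \<circ> split_coords p)"
  unfolding mul_of cmlt_def push_ev
  by (rule ev_cong) (use split_coords_cube[of _ p q] in \<open>auto simp: map_prod_def split_def\<close>)

lemma mul_cmlt_add: "n = p + q \<Longrightarrow> mul (unit_cube n) (cmlt p q) (ev p f) (ev q g) = ev n (map_prod f g \<circ> split_coords p)"
  by (simp only: mul_cmlt)

lemma idc_cube: "idc (unit_cube p) = ev p (\<lambda>t. t)"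
  by (simp add: idc_def)

lemma cmlt_chain: "cmlt p q \<in> chains (unit_cube (p + q)) (prod_topology (mtop (unit_cube p)) (mtop (unit_cube q)))"
  unfolding cmlt_def by (rule ev_chain[OF split_coords_continuous])

lemma split_ins: "k < p \<Longrightarrow> split_coords p (ins k e t) = map_prod (ins k e) (\<lambda>t. t) (split_coords (p - 1) t)"
  "split_coords p (ins (p + k) e t) = map_prod (\<lambda>t. t) (ins k e) (split_coords p t)"
  by (auto simp: split_coords_def ins_def fun_eq_iff)

lemma sum_lessThan_add: "(\<Sum>k<p + q. f k) = (\<Sum>k<(p::nat). f k) + (\<Sum>k<q. f (p + k) :: 'a::comm_monoid_add)"
  by (induction q) (simp_all add: add.assoc)

text \<open>A face of the product cube is a face of one of the factors. The directions of the second
  factor are numbered after the \<open>p\<close> directions of the first, which gives the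
  sign.\<close>

lemma cmlt_bd: "act (unit_cube (p + q - 1)) (cbd (p + q)) (cmlt p q) =
      mul (unit_cube (p + q - 1)) (cmlt (p - 1) q) (cbd p) (idc (unit_cube q)) +
      frag_cmul ((- 1) ^ p) (mul (unit_cube (p + q - 1)) (cmlt p (q - 1)) (idc (unit_cube p)) (cbd q))"
proof -
  define a where "a k = ev (p + q - 1) (split_coords p \<circ> ins k 1) - ev (p + q - 1) (split_coords p \<circ> ins k 0)" for k
  have r: "ev (p + q - 1) (restrict (split_coords p) (unit_cube (p + q)) \<circ> ins k e) = ev (p + q - 1) (split_coords p \<circ> ins k e)"
    if "k < p + q" "0 \<le> e" "e \<le> 1" for k e
  proof (rule ev_restrict)
    have "Suc (p + q - 1) = p + q" "k \<le> p + q - 1" using that by auto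
    then show "ins k e t \<in> unit_cube (p + q)" if "t \<in> unit_cube (p + q - 1)" for t
      using ins_cube[OF that _ \<open>0 \<le> e\<close> \<open>e \<le> 1\<close>] by metis
  qed
  have "act (unit_cube (p + q - 1)) (cbd (p + q)) (cmlt p q) = (\<Sum>k<p + q. frag_cmul ((- 1) ^ k) (a k))"
    unfolding cmlt_def act_of cbd_def zlin_sum[OF zlin_push] zlin_cmul[OF zlin_push] zlin_diff[OF zlin_push] push_ev a_def
    by (rule sum.cong) (simp_all only: lessThan_iff r zero_le_one order_refl)
  also have "\<dots> = (\<Sum>k<p. frag_cmul ((- 1) ^ k) (a k)) + frag_cmul ((- 1) ^ p) (\<Sum>k<q. frag_cmul ((- 1) ^ k) (a (p + k)))"
    by (simp add: sum_lessThan_add frag_cmul_sum' power_add)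
  also have "(\<Sum>k<p. frag_cmul ((- 1) ^ k) (a k)) = mul (unit_cube (p + q - 1)) (cmlt (p - 1) q) (cbd p) (idc (unit_cube q))"
    unfolding cbd_def idc_cube zlin_sum[OF zlin_mul1] zlin_cmul[OF zlin_mul1] zlin_diff[OF zlin_mul1] a_def
  proof (rule sum.cong[OF refl])
    fix k assume k: "k \<in> {..<p}"
    have "split_coords p \<circ> ins k e = map_prod (ins k e) (\<lambda>t. t) \<circ> split_coords (p - 1)" for e
      using k by (simp add: fun_eq_iff split_ins)
    then show "frag_cmul ((- 1) ^ k) (ev (p + q - 1) (split_coords p \<circ> ins k 1) - ev (p + q - 1) (split_coords p \<circ> ins k 0)) =
      frag_cmul ((- 1) ^ k) (mul (unit_cube (p + q - 1)) (cmlt (p - 1) q) (ev (p - 1) (ins k 1)) (ev q (\<lambda>t. t)) -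
         mul (unit_cube (p + q - 1)) (cmlt (p - 1) q) (ev (p - 1) (ins k 0)) (ev q (\<lambda>t. t)))"
      using k by (simp add: mul_cmlt_add)
  qed
  also have "(\<Sum>k<q. frag_cmul ((- 1) ^ k) (a (p + k))) = mul (unit_cube (p + q - 1)) (cmlt p (q - 1)) (idc (unit_cube p)) (cbd q)"
    unfolding cbd_def idc_cube zlin_sum[OF zlin_mul2] zlin_cmul[OF zlin_mul2] zlin_diff[OF zlin_mul2] a_def
  proof (rule sum.cong[OF refl])
    fix k assume k: "k \<in> {..<q}"
    have "split_coords p \<circ> ins (p + k) e = map_prod (\<lambda>t. t) (ins k e) \<circ> split_coords p" for e
      by (simp add: fun_eq_iff split_ins)
    then show "frag_cmul ((- 1) ^ k) (ev (p + q - 1) (split_coords p \<circ> ins (p + k) 1) - ev (p + q - 1) (split_coords p \<circ> ins (p + k) 0)) =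
      frag_cmul ((- 1) ^ k) (mul (unit_cube (p + q - 1)) (cmlt p (q - 1)) (ev p (\<lambda>t. t)) (ev (q - 1) (ins k 1)) -
         mul (unit_cube (p + q - 1)) (cmlt p (q - 1)) (ev p (\<lambda>t. t)) (ev (q - 1) (ins k 0)))"
      using k by (simp add: mul_cmlt_add)
  qed
  finally show ?thesis .
qed

lemma cmlt_assoc: "push (unit_cube (p + q + r)) (\<lambda>((x, y), z). (x, (y, z)))
      (mul (unit_cube (p + q + r)) (cmlt (p + q) r) (cmlt p q) (idc (unit_cube r))) =
    mul (unit_cube (p + q + r)) (cmlt p (q + r)) (idc (unit_cube p)) (cmlt q r)"
proof -
  have "mul (unit_cube (p + q + r)) (cmlt p (q + r)) (idc (unit_cube p)) (cmlt q r) =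
      ev (p + q + r) (map_prod (\<lambda>t. t) (split_coords q) \<circ> split_coords p)"
    unfolding idc_cube cmlt_def[of q r] by (rule mul_cmlt_add) simp
  moreover have "mul (unit_cube (p + q + r)) (cmlt (p + q) r) (cmlt p q) (idc (unit_cube r)) =
      ev (p + q + r) (map_prod (split_coords p) (\<lambda>t. t) \<circ> split_coords (p + q))"
    unfolding idc_cube cmlt_def[of p q] by (rule mul_cmlt)
  moreover have "(\<lambda>((x, y), z). (x, (y, z))) \<circ> (map_prod (split_coords p) (\<lambda>t. t) \<circ> split_coords (p + q)) =
      map_prod (\<lambda>t. t) (split_coords q) \<circ> split_coords p"
    by (auto simp: split_coords_def fun_eq_iff add.assoc)
  ultimately show ?thesis by (simp only: push_ev)
qed

text \<open>The place where alternation is indispensable: exchanging the factors moves one block of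
  coordinates past the other, and only the relations for permuted cubes turn this into a
  sign.\<close>

lemma cmlt_sym:
  "push (unit_cube (p + q)) prod.swap (cmlt p q) - frag_cmul ((- 1) ^ (p * q)) (cmlt q p)
    \<in> relspan unit_cube swp_rels (p + q) (prod_topology (mtop (unit_cube q)) (mtop (unit_cube p)))"
proof (cases "p + q = 0")
  case True
  then have "ev 0 (prod.swap \<circ> split_coords 0) = ev 0 (split_coords 0)"
    by (intro ev_cong) (auto simp: split_coords_def fun_eq_iff cube_zero)
  then show ?thesis using True by (simp add: cmlt_def push_ev subgrp_0[OF subgrp_relspan])
next
  case False
  then have pq: "0 < p + q" by simp
  have "ev (p + q) (split_coords q) - frag_cmul ((- 1) ^ (p * q)) (ev (p + q) (split_coords q \<circ> perm_coords (rot p q)))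
      \<in> relspan unit_cube swp_rels (p + q) (prod_topology (mtop (unit_cube q)) (mtop (unit_cube p)))"
    using perm_gen[OF rot_permutes_sign(1)[OF pq] split_coords_continuous[of q p, unfolded add.commute[of q p]]]
    by (simp only: rot_permutes_sign(2)[OF pq])
  also have "ev (p + q) (split_coords q \<circ> perm_coords (rot p q)) = push (unit_cube (p + q)) prod.swap (cmlt p q)"
    unfolding cmlt_def push_ev by (rule ev_cong) (simp add: split_rot)
  finally have "frag_cmul (- ((- 1) ^ (p * q))) (ev (p + q) (split_coords q) -
      frag_cmul ((- 1) ^ (p * q)) (push (unit_cube (p + q)) prod.swap (cmlt p q)))
      \<in> relspan unit_cube swp_rels (p + q) (prod_topology (mtop (unit_cube q)) (mtop (unit_cube p)))"
    by (rule subgrp_cmul[OF subgrp_relspan])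
  then show ?thesis by (simp add: frag_cmul_diff2 cmlt_def[of q p] add.commute minus_frag_cmul[symmetric] del: minus_frag_cmul)
qed

lemma split_del: "k < p \<Longrightarrow> map_prod (del_coord k) (\<lambda>t. t) (split_coords p t) = split_coords (p - 1) (del_coord k t)"
  "map_prod (\<lambda>t. t) (del_coord k) (split_coords p t) = split_coords p (del_coord (p + k) t)"
  by (auto simp: split_coords_def del_coord_def fun_eq_iff)

lemma split_swp: "Suc k < p \<Longrightarrow> map_prod (perm_coords (swp k)) (\<lambda>t. t) (split_coords p t) = split_coords p (perm_coords (swp k) t)"
  "map_prod (\<lambda>t. t) (perm_coords (swp k)) (split_coords p t) = split_coords p (perm_coords (swp (p + k)) t)"
  by (auto simp: split_coords_def perm_coords_def swp_def Transposition.transpose_def fun_eq_iff)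

lemma cmlt_rel1:
  assumes "(m, u) \<in> del_rels p \<union> swp_rels p"
  shows "mul (unit_cube (p + q)) (cmlt p q) u (idc (unit_cube q)) \<in> rspan TC (p + q) (prod_topology (mtop (unit_cube m)) (mtop (unit_cube q)))"
  using assms
proof
  assume "(m, u) \<in> del_rels p"
  then obtain k where k: "k < p" "m = p - 1" "u = ev p (del_coord k)" unfolding del_rels_def by blast
  then obtain p' where p: "p = Suc p'" by (cases p) auto
  have "map_prod (del_coord k) (\<lambda>t. t) \<circ> split_coords p = split_coords p' \<circ> del_coord k"
    using k by (simp add: fun_eq_iff split_del p)
  then show ?thesis
    using subsetD[OF relspan_mono del_gen[OF _ split_coords_continuous[of p' q], of k]] k
    by (simp add: p idc_cube mul_cmlt[of "Suc p'" q, simplified])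
next
  assume "(m, u) \<in> swp_rels p"
  then obtain k where k: "Suc k < p" "m = p" "u = ev p (\<lambda>t. t) + ev p (perm_coords (swp k))" unfolding swp_rels_def by blast
  have "map_prod (perm_coords (swp k)) (\<lambda>t. t) \<circ> split_coords p = split_coords p \<circ> perm_coords (swp k)"
    using k by (simp add: fun_eq_iff split_swp)
  moreover have "map_prod (\<lambda>t. t) (\<lambda>t. t) = (\<lambda>t. t :: vec \<times> vec)" by (simp add: fun_eq_iff)
  ultimately show ?thesis
    using subsetD[OF relspan_mono swp_gen[OF _ split_coords_continuous[of p q], of k]] k
    by (simp add: idc_cube mul_cmlt zlin_add[OF zlin_mul1] o_def[of "\<lambda>t. t"])
qed

lemma cmlt_rel2:
  assumes "(m, u) \<in> del_rels q \<union> swp_rels q"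
  shows "mul (unit_cube (p + q)) (cmlt p q) (idc (unit_cube p)) u \<in> rspan TC (p + q) (prod_topology (mtop (unit_cube p)) (mtop (unit_cube m)))"
  using assms
proof
  assume "(m, u) \<in> del_rels q"
  then obtain k where k: "k < q" "m = q - 1" "u = ev q (del_coord k)" unfolding del_rels_def by blast
  then obtain q' where q: "q = Suc q'" by (cases q) auto
  have "map_prod (\<lambda>t. t) (del_coord k) \<circ> split_coords p = split_coords p \<circ> del_coord (p + k)"
    by (simp add: fun_eq_iff split_del)
  then show ?thesis
    using subsetD[OF relspan_mono del_gen[OF _ split_coords_continuous[of p q'], of "p + k"]] k
    by (simp add: q idc_cube mul_cmlt[of p "Suc q'", simplified])
next
  assume "(m, u) \<in> swp_rels q"
  then obtain k where k: "Suc k < q" "m = q" "u = ev q (\<lambda>t. t) + ev q (perm_coords (swp k))" unfolding swp_rels_def by blast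
  have "map_prod (\<lambda>t. t) (perm_coords (swp k)) \<circ> split_coords p = split_coords p \<circ> perm_coords (swp (p + k))"
    by (simp add: fun_eq_iff split_swp)
  moreover have "map_prod (\<lambda>t. t) (\<lambda>t. t) = (\<lambda>t. t :: vec \<times> vec)" by (simp add: fun_eq_iff)
  ultimately show ?thesis
    using subsetD[OF relspan_mono swp_gen[OF _ split_coords_continuous[of p q], of "p + k"]] k
    by (simp add: idc_cube mul_cmlt zlin_add[OF zlin_mul2] o_def[of "\<lambda>t. t"])
qed

lemma monoidal_C: "monoidal_theory TC"
proof (rule monoidal_theory.intro[OF cell_theory_C])
  show "monoidal_theory_axioms TC"
    by (rule monoidal_theory_axioms.intro)
       (unfold cube_data_sel, rule cmlt_chain, rule cmlt_bd, rule cmlt_assoc, rule subsetD[OF relspan_mono cmlt_sym], blast,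
         erule cmlt_rel1[unfolded cube_data_sel], erule cmlt_rel2[unfolded cube_data_sel])
qed

section \<open>Cones of cubes\<close>

lemma ccone_ev: "ccone v p (restrict f (unit_cube p)) = restrict (\<lambda>t i. (1 - t 0) * v i + t 0 * f (del_coord 0 t) i) (unit_cube (Suc p))"
  by (auto simp: ccone_def fun_eq_iff restrict_def del_coord_cube)

lemma zlin_conec_C: "zlin (conec (cube_data R) v p)"
  by (simp add: conec_def zlin_frag_extend)

lemma conec_ev: "conec (cube_data R) v p (ev p f) = ev (Suc p) (\<lambda>t i. (1 - t 0) * v i + t 0 * f (del_coord 0 t) i)"
  by (simp add: conec_def ccone_ev)

lemma del_del: "del_coord 0 (del_coord (Suc k) t) = del_coord k (del_coord 0 t)"
  by (auto simp: del_coord_def fun_eq_iff)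

lemma del_swp: "del_coord 0 (perm_coords (swp (Suc k)) t) = perm_coords (swp k) (del_coord 0 t)"
  by (auto simp: del_coord_def perm_coords_def swp_def Transposition.transpose_def fun_eq_iff)

lemma ccone_in:
  assumes "star_at v V" "c \<in> cells (unit_cube p) (mtop V)" "t \<in> unit_cube (Suc p)"
  shows "ccone v p c t \<in> V"
proof -
  have "c (del_coord 0 t) \<in> V" using cells_value[OF assms(2) del_coord_cube[OF assms(3)]] by simp
  then show ?thesis using star_atD[OF assms(1)] cube_coord[OF assms(3), of 0] assms(3) by (simp add: ccone_def)
qed

lemma ccone_cell:
  assumes "star_at v V" "c \<in> cells (unit_cube p) (mtop V)"
  shows "ccone v p c \<in> cells (unit_cube (Suc p)) (mtop V)"
proof -
  let ?f = "\<lambda>t i. (1 - t 0) * v i + t 0 * c (del_coord 0 t) i"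
  have "continuous_map (mtop (unit_cube (Suc p))) (mtop V) (c \<circ> del_coord 0)"
    by (rule continuous_map_compose[OF del_coord_continuous cells_continuous[OF assms(2)]]) simp
  then have "continuous_map (mtop (unit_cube (Suc p))) euclideanreal (\<lambda>t. c (del_coord 0 t) i)" for i
    by (simp add: continuous_map_in_subtopology continuous_map_componentwise_UNIV)
  then have "continuous_map (mtop (unit_cube (Suc p))) (mtop V) ?f"
    using ccone_in[OF assms]
    by (intro continuous_map_mtopI continuous_intros continuous_map_coord) (auto simp: ccone_def)
  from cells_restrict[OF this] show ?thesis by (simp add: ccone_def)
qed

lemma ccone_nat:
  assumes "star_at v V" "bpaff v V v' f" "c \<in> cells (unit_cube p) (mtop V)"
  shows "ccone v' p (restrict (f \<circ> c) (unit_cube p)) = restrict (f \<circ> ccone v p c) (unit_cube (Suc p))"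
proof
  fix t
  show "ccone v' p (restrict (f \<circ> c) (unit_cube p)) t = restrict (f \<circ> ccone v p c) (unit_cube (Suc p)) t"
  proof (cases "t \<in> unit_cube (Suc p)")
    case True
    have "c (del_coord 0 t) \<in> V" using cells_value[OF assms(3) del_coord_cube[OF True]] by simp
    from bpaffD[OF assms(2) this, of "t 0"] show ?thesis
      using True cube_coord[OF True, of 0] by (simp add: ccone_def del_coord_cube)
  qed (simp add: ccone_def)
qed

text \<open>The cone coordinate is added in front, so a relation in direction \<open>k\<close>
  becomes the relation of the same kind in direction \<open>k + 1\<close>.\<close>

lemma ccone_rel:
  assumes "star_at v V" "(m, r) \<in> del_rels p \<union> swp_rels p" "c \<in> cells (unit_cube m) (mtop V)"
  shows "conec TC v p (push (unit_cube p) c r) \<in> rspan TC (Suc p) (mtop V)"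
proof -
  let ?C = "\<lambda>t i. (1 - t 0) * v i + t 0 * c (del_coord 0 t) i"
  have C: "continuous_map (mtop (unit_cube (Suc m))) (mtop V) ?C"
    using continuous_map_eq[OF cells_continuous[OF ccone_cell[OF assms(1,3)]], of ?C] by (simp add: ccone_def)
  from assms(2) show ?thesis
  proof
    assume "(m, r) \<in> del_rels p"
    then obtain k where k: "k < p" "m = p - 1" "r = ev p (del_coord k)" unfolding del_rels_def by blast
    then obtain p' where p: "p = Suc p'" by (cases p) auto
    have "(\<lambda>t i. (1 - t 0) * v i + t 0 * (c \<circ> del_coord k) (del_coord 0 t) i) = ?C \<circ> del_coord (Suc k)"
      by (simp add: fun_eq_iff del_del) (simp add: del_coord_def)
    then have "conec TC v p (push (unit_cube p) c r) = ev (Suc p) (?C \<circ> del_coord (Suc k))"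
      unfolding k(3) push_ev conec_ev by (rule arg_cong)
    then show ?thesis
      using subsetD[OF relspan_mono del_gen[OF _ C, of "Suc k"]] k by (simp add: p)
  next
    assume "(m, r) \<in> swp_rels p"
    then obtain k where k: "Suc k < p" "m = p" "r = ev p (\<lambda>t. t) + ev p (perm_coords (swp k))" unfolding swp_rels_def by blast
    have "(\<lambda>t i. (1 - t 0) * v i + t 0 * (c \<circ> perm_coords (swp k)) (del_coord 0 t) i) = ?C \<circ> perm_coords (swp (Suc k))"
      by (simp add: fun_eq_iff del_swp) (simp add: perm_coords_def swp_def Transposition.transpose_def)
    then have "conec TC v p (push (unit_cube p) c r) = ev (Suc p) ?C + ev (Suc p) (?C \<circ> perm_coords (swp (Suc k)))"
      unfolding k(3) zlin_add[OF zlin_push] zlin_add[OF zlin_conec_C] push_ev conec_ev by (simp add: o_def)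
    then show ?thesis
      using subsetD[OF relspan_mono swp_gen[OF _ C, of "Suc k"]] k by simp
  qed
qed

text \<open>Direction 0 contributes \<open>c\<close> and the constant cube at the apex. Direction
  \<open>k + 1\<close> contributes the cones over the faces in direction \<open>k\<close>, with the
  sign reversed.\<close>

lemma ccone_faces:
  assumes "star_at v V" "c \<in> cells (unit_cube p) (mtop V)"
  shows "push (unit_cube p) (ccone v p c) (cbd (Suc p)) = frag_of c - ev p (\<lambda>_. v) -
    (\<Sum>k<p. frag_cmul ((- 1) ^ k) (conec TC v (p - 1) (ev (p - 1) (c \<circ> ins k 1)) - conec TC v (p - 1) (ev (p - 1) (c \<circ> ins k 0))))"
proof -
  have z: "ccone v p c (ins k e t) = (\<lambda>i. (1 - ins k e t 0) * v i + ins k e t 0 * c (del_coord 0 (ins k e t)) i)"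
    if "t \<in> unit_cube p" "k \<le> p" "0 \<le> e" "e \<le> 1" for k e t
    using that by (simp add: ccone_def ins_cube)
  have "ev p (ccone v p c \<circ> ins 0 1) = ev p c"
    by (rule ev_cong) (simp add: z del_ins, simp add: ins_def)
  also have "ev p c = frag_of c" using assms(2) by (simp add: cells_def extensional_restrict)
  finally have 1: "ev p (ccone v p c \<circ> ins 0 1) = frag_of c" .
  have 2: "ev p (ccone v p c \<circ> ins 0 0) = ev p (\<lambda>_. v)"
    by (rule ev_cong) (simp add: z, simp add: ins_def)
  have 3: "ev p (ccone v p c \<circ> ins (Suc k) e) = conec TC v (p - 1) (ev (p - 1) (c \<circ> ins k e))"
    if "k < p" "0 \<le> e" "e \<le> 1" for k e
  proof -
    have p: "Suc (p - 1) = p" using that by simp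
    show ?thesis unfolding conec_ev p
      by (rule ev_cong) (use that in \<open>simp add: z del_ins\<close>, simp add: ins_def)
  qed
  have "push (unit_cube p) (ccone v p c) (cbd (Suc p)) = ev p (ccone v p c \<circ> ins 0 1) - ev p (ccone v p c \<circ> ins 0 0) +
      (\<Sum>k<p. frag_cmul ((- 1) ^ Suc k) (ev p (ccone v p c \<circ> ins (Suc k) 1) - ev p (ccone v p c \<circ> ins (Suc k) 0)))"
    unfolding push_cbd sum.atMost_shift by (simp add: atLeast0LessThan)
  also have "\<dots> = frag_of c - ev p (\<lambda>_. v) +
    (\<Sum>k<p. frag_cmul ((- 1) ^ Suc k) (conec TC v (p - 1) (ev (p - 1) (c \<circ> ins k 1)) - conec TC v (p - 1) (ev (p - 1) (c \<circ> ins k 0))))"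
    unfolding 1 2 by (intro arg_cong2[of _ _ _ _ "(+)"] refl sum.cong) (simp add: 3)
  finally show ?thesis by (simp add: sum_negf flip: minus_frag_cmul)
qed

text \<open>The surplus constant cube factors through forgetting a coordinate, hence is a relation
  in positive dimension.\<close>

lemma ccone_bd:
  assumes "star_at v V" "c \<in> cells (unit_cube (Suc p)) (mtop V)"
  shows "push (unit_cube (Suc p)) (ccone v (Suc p) c) (cbd (Suc (Suc p)))
      - (frag_of c - conec TC v p (push (unit_cube p) c (cbd (Suc p)))) \<in> rspan TC (Suc p) (mtop V)"
proof -
  have "ev (Suc p) ((\<lambda>_. v) \<circ> del_coord 0) \<in> relspan unit_cube del_rels (Suc p) (mtop V)"
    by (rule del_gen) (use assms(1) in \<open>auto simp: star_at_def\<close>)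
  then have "ev (Suc p) (\<lambda>_. v) \<in> rspan TC (Suc p) (mtop V)"
    using relspan_mono[of del_rels "\<lambda>p. del_rels p \<union> swp_rels p"] by (auto simp: o_def)
  then have "- ev (Suc p) (\<lambda>_. v) \<in> rspan TC (Suc p) (mtop V)" by (rule subgrp_minus[OF subgrp_relspan])
  moreover have "conec TC v p (push (unit_cube p) c (cbd (Suc p))) =
      (\<Sum>k<Suc p. frag_cmul ((- 1) ^ k) (conec TC v p (ev p (c \<circ> ins k 1)) - conec TC v p (ev p (c \<circ> ins k 0))))"
    unfolding push_cbd by (simp only: zlin_sum[OF zlin_conec_C] zlin_cmul[OF zlin_conec_C] zlin_diff[OF zlin_conec_C] lessThan_Suc_atMost)
  ultimately show ?thesis by (simp only: ccone_faces[OF assms] diff_Suc_1) simp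
qed

lemma ccone_bd0:
  assumes "star_at v V" "c \<in> cells (unit_cube 0) (mtop V)"
  shows "push (unit_cube 0) (ccone v 0 c) (cbd (Suc 0)) = frag_of c - ev 0 (\<lambda>_. v)"
  by (simp add: ccone_faces[OF assms])

lemma star_cube: "star_at (\<lambda>_. 0) (unit_cube m)"
proof -
  have "(\<lambda>i. t * x i) \<in> unit_cube m" if "x \<in> unit_cube m" "0 \<le> t" "t \<le> 1" for x t
    using cube_coord[OF that(1)] cube_zero[OF that(1)] that(2,3) by (intro cubeI) (auto simp: mult_le_one)
  moreover have "\<bar>x i\<bar> \<le> 1" if "x \<in> unit_cube m" for x i using cube_coord[OF that, of i] by simp
  ultimately show ?thesis by (auto simp: star_at_def unit_cube_def[of m] intro!: exI[of _ 1])
qed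

text \<open>The maps in question precompose a point, seen as a function of its index, with a map of
  indices; so they are linear and fix the origin.\<close>

lemma aff_rels:
  assumes "(m, r) \<in> del_rels p \<union> swp_rels p" "c \<in> Poly_Mapping.keys r"
  shows "bpaff (\<lambda>_. 0) (unit_cube p) (\<lambda>_. 0) c"
proof -
  have s: "(\<lambda>i. t * x i) \<in> unit_cube p" if "x \<in> unit_cube p" "0 \<le> t" "t \<le> 1" for x t
    using star_atD[OF star_cube that] by simp
  have "\<exists>\<phi>. c = restrict (\<lambda>t. t \<circ> \<phi>) (unit_cube p)"
    using assms(1)
  proof
    assume "(m, r) \<in> del_rels p"
    then obtain k where "r = ev p (del_coord k)" unfolding del_rels_def by blast
    moreover have "del_coord k = (\<lambda>t. t \<circ> (\<lambda>j. if j < k then j else Suc j))" by (auto simp: del_coord_def fun_eq_iff)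
    ultimately show ?thesis using assms(2) by auto
  next
    assume "(m, r) \<in> swp_rels p"
    then obtain k where "r = ev p (\<lambda>t. t) + ev p (perm_coords (swp k))" unfolding swp_rels_def by blast
    then have "c = restrict (\<lambda>t. t \<circ> id) (unit_cube p) \<or> c = restrict (\<lambda>t. t \<circ> swp k) (unit_cube p)"
      using assms(2) subsetD[OF keys_add, of c "ev p (\<lambda>t. t)" "ev p (perm_coords (swp k))"] by (auto simp: perm_coords_def[abs_def])
    then show ?thesis by blast
  qed
  then show ?thesis by (auto simp: bpaff_def s fun_eq_iff)
qed

lemma acyclic_C: "acyclic_theory TC"
proof (rule acyclic_theory.intro[OF cell_theory_C])
  have 0: "unit_cube 0 = {\<lambda>_. 0}" by (auto simp: unit_cube_def)
  have a: "push (unit_cube 0) (\<lambda>_. \<lambda>_. 0) (cbd (Suc 0)) = 0"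
    by (simp add: push_cbd o_def)
  show "acyclic_theory_axioms TC"
    by (rule acyclic_theory_axioms.intro)
       (unfold cube_data_sel, rule star_cube, erule (1) aff_rels, rule 0, rule a, erule (1) ccone_cell, erule (2) ccone_nat,
        erule (2) ccone_rel[unfolded cube_data_sel], erule (1) ccone_bd[unfolded cube_data_sel], erule (1) ccone_bd0)
qed

section \<open>Identification with the complexes in the definition of ordered cubical chains\<close>

lemma cube_bd_eq: "cube_bd p x = act (unit_cube (p - 1)) (cbd p) x"
proof -
  have "cube_insert (Suc k) e = ins k e" for k e by (simp add: cube_insert_def ins_def fun_eq_iff)
  then have "(\<Sum>i\<in>{1..p}. \<Sum>e\<in>{0, 1}. frag_cmul ((- 1) ^ (i + e)) (ev (p - 1) (c \<circ> cube_insert i (real e)))) =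
      push (unit_cube (p - 1)) c (cbd p)" for c :: "vec \<Rightarrow> 'a"
    unfolding One_nat_def sum.atLeast1_atMost_eq cbd_def zlin_sum[OF zlin_push] zlin_cmul[OF zlin_push] zlin_diff[OF zlin_push] push_ev
    by (intro sum.cong) (simp_all add: frag_cmul_diff2 minus_frag_cmul[symmetric] del: minus_frag_cmul)
  then show ?thesis by (simp add: cube_bd_def act_def)
qed

lemma cubeQ_grp: "grp (cubeQ X) = (\<lambda>n. if n < 0 then singleton_group 0 else free_Abelian_group (cells (unit_cube (nat n)) X))"
  unfolding cubeQ_def cells_def singular_cube_def by simp

lemmas cubeQ_gch = gch_eq[where T=TC and K=unit_cube, OF cube_data_sel(1) cubeQ_grp]

lemma gch_D: "gch TD = gch TC" "gbd TD = gbd TC" "gpush TD = gpush TC"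
  by (simp_all add: gch_def[abs_def] gbd_def[abs_def] gpush_def[abs_def] cong: if_cong)

lemma grl_D: "grl TD X n \<subseteq> grl TC X n"
  using relspan_mono[of del_rels "\<lambda>p. del_rels p \<union> swp_rels p"] by (auto simp: grl_def)

lemma cubeQ_presents: "presents (gch TC X) (\<lambda>_. {0}) (gbd TC) (cubeQ X) (\<lambda>n x. x)"
  by (rule presents_free; (rule cubeQ_gch | rule subgrp_gch zlin_gbd cell_theory.gbd_gch[OF cell_theory_C])?)
     (simp_all add: gbd_def cubeQ_def cube_bd_eq)

text \<open>If a coordinate does not matter it may be set to 0, so the cube is recovered from its
  face there by forgetting that coordinate first.\<close>

lemma degenerate_cube_iff:
  assumes "c \<in> cells (unit_cube p) X"
  shows "degenerate_cube p c \<longleftrightarrow> (\<exists>k<p. \<exists>c'\<in>cells (unit_cube (p - 1)) X. c = restrict (c' \<circ> del_coord k) (unit_cube p))"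
proof
  assume "degenerate_cube p c"
  then obtain k where k: "k < p" and d: "\<And>s t. s \<in> unit_cube p \<Longrightarrow> t \<in> unit_cube p \<Longrightarrow> (\<And>j. j \<noteq> k \<Longrightarrow> s j = t j) \<Longrightarrow> c s = c t"
    unfolding degenerate_cube_def by blast
  obtain p' where p: "p = Suc p'" using k by (cases p) auto
  define c' where "c' = restrict (c \<circ> ins k 0) (unit_cube p')"
  have "c' \<in> cells (unit_cube p') X"
    unfolding c'_def
    by (intro cells_restrict continuous_map_compose[OF ins_continuous cells_continuous[OF assms[unfolded p]]]) (use k p in auto)
  moreover have "c t = c' (del_coord k t)" if t: "t \<in> unit_cube p" for t
  proof -
    have del: "del_coord k t \<in> unit_cube p'" using t k by (simp add: p del_coord_cube)
    then have "ins k 0 (del_coord k t) \<in> unit_cube p" using k by (simp add: p ins_cube)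
    then have "c t = c (ins k 0 (del_coord k t))" by (rule d[OF t]) (auto simp: ins_def del_coord_def)
    then show ?thesis using del by (simp add: c'_def)
  qed
  then have "c = restrict (c' \<circ> del_coord k) (unit_cube p)"
    using cells_ext[OF assms] by (auto simp: fun_eq_iff restrict_def)
  ultimately show "\<exists>k<p. \<exists>c'\<in>cells (unit_cube (p - 1)) X. c = restrict (c' \<circ> del_coord k) (unit_cube p)"
    using k p by auto
next
  assume "\<exists>k<p. \<exists>c'\<in>cells (unit_cube (p - 1)) X. c = restrict (c' \<circ> del_coord k) (unit_cube p)"
  then obtain k c' where k: "k < p" "c = restrict (c' \<circ> del_coord k) (unit_cube p)" by blast
  have "del_coord k s = del_coord k t" if "\<forall>j. j \<noteq> k \<longrightarrow> s j = t j" for s t using that by (auto simp: del_coord_def)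
  then show "degenerate_cube p c" unfolding degenerate_cube_def k(2) using k(1) by (intro exI[of _ k]) (simp, metis)
qed

lemma cube_degen_eq: "cube_degen X n = grl TD X n"
proof (cases "n < 0")
  case True
  have "generate (singleton_group 0) {} = {0 :: ('a chain)}"
    using group.generate_empty[OF singleton_group, of "0 :: 'a chain"] by (simp add: singleton_group_def)
  then show ?thesis using True by (simp add: cube_degen_def grl_def cubeQ_grp)
next
  case False
  let ?p = "nat n"
  let ?G = "{frag_of c | c. c \<in> cells (unit_cube ?p) X \<and> degenerate_cube ?p c}"
  have "cube_degen X n = zspan ?G"
  proof -
    have "?G \<subseteq> carrier (free_Abelian_group (cells (unit_cube ?p) X))" by auto
    from generate_free[OF this] show ?thesis
      using False by (simp add: cube_degen_def cubeQ_grp singular_cube_def cells_def)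
  qed
  also have "?G = {push (unit_cube ?p) c r | m r c. (m, r) \<in> del_rels ?p \<and> c \<in> cells (unit_cube m) X}" (is "_ = ?H")
  proof (rule equalityI; rule subsetI)
    fix x assume "x \<in> ?G"
    then obtain c where c: "c \<in> cells (unit_cube ?p) X" "degenerate_cube ?p c" "x = frag_of c" by blast
    then obtain k c' where k: "k < ?p" "c' \<in> cells (unit_cube (?p - 1)) X" "c = restrict (c' \<circ> del_coord k) (unit_cube ?p)"
      using degenerate_cube_iff by blast
    have "(?p - 1, ev ?p (del_coord k)) \<in> del_rels ?p" unfolding del_rels_def using k(1) by blast
    moreover have "x = push (unit_cube ?p) c' (ev ?p (del_coord k))" unfolding push_ev c(3) k(3) ..
    ultimately show "x \<in> ?H" using k(2) by blast
  next
    fix x assume "x \<in> ?H"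
    then obtain k c' where k: "k < ?p" "c' \<in> cells (unit_cube (?p - 1)) X" "x = ev ?p (c' \<circ> del_coord k)"
      unfolding del_rels_def push_ev by (auto simp: push_ev)
    obtain p' where p: "?p = Suc p'" using k(1) by (cases "?p") auto
    have cell: "restrict (c' \<circ> del_coord k) (unit_cube ?p) \<in> cells (unit_cube ?p) X"
      using k unfolding p
      by (intro cells_restrict continuous_map_compose[OF del_coord_continuous[of k p'] cells_continuous]) auto
    then show "x \<in> ?G" using degenerate_cube_iff[OF cell] k by blast
  qed
  finally show ?thesis using False by (simp add: grl_def relspan_def)
qed

definition cubeC_cls :: "'x topology \<Rightarrow> int \<Rightarrow> 'x chain \<Rightarrow> 'x chain set" where
  "cubeC_cls X n x = cube_degen X n #>\<^bsub>grp (cubeQ X) n\<^esub> x"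

lemma cubeC_presents: "presents (gch TC X) (grl TD X) (gbd TC) (cubeC X) (cubeC_cls X)"
proof -
  interpret D: cell_theory TD by (rule cell_theory_D)
  show ?thesis
    unfolding cubeC_def cubeC_cls_def[abs_def]
    by (rule presents_quot[OF cubeQ_presents])
       (use D.grl_gch D.gbd_grl in \<open>simp_all add: cube_degen_eq subgrp_grl subgrp_0[OF subgrp_grl] gch_D\<close>)
qed

interpretation cubeQ: presented "gch TC X" "\<lambda>_. {0}" "gbd TC" "cubeQ X" "\<lambda>n x. x" for X
  by standard (rule cubeQ_presents)

interpretation cubeC: presented "gch TC X" "grl TD X" "gbd TC" "cubeC X" "cubeC_cls X" for X
  by standard (rule cubeC_presents)

lemma grl_C_gch: "grl TC X n \<subseteq> gch TC X n"
  by (rule cell_theory.grl_gch[OF cell_theory_C])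

lemma cube_perm_ev: "cube_perm p \<pi> c = frag_cmul (sign \<pi>) (ev p (c \<circ> perm_coords \<pi>))"
  by (simp add: cube_perm_def perm_coords_def o_def)

definition perm_diffs :: "'x topology \<Rightarrow> int \<Rightarrow> 'x chain set" where
  "perm_diffs X n = {frag_of c - cube_perm (nat n) \<pi> c | c \<pi>. 0 \<le> n \<and> c \<in> cells (unit_cube (nat n)) X \<and> \<pi> permutes {..<nat n}}"

lemma cube_sym_gen: "cube_sym X n = generate (grp (cubeC X) n) (cubeC_cls X n ` perm_diffs X n)"
proof -
  have "{cube_degen X n #>\<^bsub>grp (cubeQ X) n\<^esub> (frag_of c - cube_perm (nat n) \<pi> c)
       | c \<pi>. 0 \<le> n \<and> singular_cube (nat n) X c \<and> \<pi> permutes {..<nat n}} = cubeC_cls X n ` perm_diffs X n"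
    by (auto simp: perm_diffs_def cubeC_cls_def singular_cube_def cells_def)
  then show ?thesis by (simp only: cube_sym_def)
qed

lemma perm_diffs_grl: "perm_diffs X n \<subseteq> grl TC X n"
proof
  fix x assume "x \<in> perm_diffs X n"
  then obtain c \<pi> where c: "0 \<le> n" "c \<in> cells (unit_cube (nat n)) X" "\<pi> permutes {..<nat n}" "x = frag_of c - cube_perm (nat n) \<pi> c"
    unfolding perm_diffs_def by blast
  have "ev (nat n) c = frag_of c" using c(2) by (simp add: cells_def extensional_restrict)
  then have "x \<in> relspan unit_cube swp_rels (nat n) X"
    using perm_gen[OF c(3) cells_continuous[OF c(2)]] by (simp add: c(4) cube_perm_ev)
  then show "x \<in> grl TC X n"
    using relspan_mono[of swp_rels "\<lambda>p. del_rels p \<union> swp_rels p" unit_cube "nat n" X] c(1) by (auto simp: grl_def)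
qed

lemma cube_sym_subgroup: "subgroup (cube_sym X n) (grp (cubeC X) n)"
  unfolding cube_sym_gen
  by (rule group.generate_is_subgroup[OF comm_group.axioms(2)[OF cubeC.comm_group]])
     (use perm_diffs_grl grl_C_gch cubeC.cls_carrier in blast)

text \<open>The subgroup of the second quotient, pulled back to cubes. Its generators are relations
  by \<open>perm_gen\<close>; conversely a degenerate cube has trivial class in
  \<open>cubeC X\<close>, and a swap relation is the generator of an adjacent transposition.\<close>

lemma cube_sym_eq: "cube_sym X n = cubeC_cls X n ` grl TC X n"
proof (rule equalityI; rule subsetI)
  fix u assume "u \<in> cube_sym X n"
  then show "u \<in> cubeC_cls X n ` grl TC X n"
    unfolding cube_sym_gen
  proof (induction rule: generate.induct)
    case one show ?case unfolding cubeC.one_eq using subgrp_0[OF subgrp_grl] by blast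
  next
    case (incl h) then show ?case using perm_diffs_grl by blast
  next
    case (inv h)
    then obtain x where x: "x \<in> grl TC X n" "h = cubeC_cls X n x" using perm_diffs_grl by blast
    have "cubeC_cls X n (- x) = inv\<^bsub>grp (cubeC X) n\<^esub> h"
      unfolding x(2) by (rule cubeC.cls_minus[OF subsetD[OF grl_C_gch x(1)]])
    from image_eqI[where f="cubeC_cls X n", OF this[symmetric] subgrp_minus[OF subgrp_grl x(1)]] show ?case .
  next
    case (eng g h)
    then obtain x y where x: "x \<in> grl TC X n" "g = cubeC_cls X n x" and y: "y \<in> grl TC X n" "h = cubeC_cls X n y" by blast
    have "cubeC_cls X n (x + y) = g \<otimes>\<^bsub>grp (cubeC X) n\<^esub> h"
      unfolding x(2) y(2) by (rule cubeC.cls_add[OF subsetD[OF grl_C_gch x(1)] subsetD[OF grl_C_gch y(1)]])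
    from image_eqI[where f="cubeC_cls X n", OF this[symmetric] subgrp_add[OF subgrp_grl x(1) y(1)]] show ?case .
  qed
next
  note sg = cube_sym_subgroup[of X n]
  let ?A = "{x \<in> gch TC X n. cubeC_cls X n x \<in> cube_sym X n}"
  have A: "subgrp ?A"
    unfolding subgrp_def
  proof (intro conjI ballI)
    show "0 \<in> ?A" using subgroup.one_closed[OF sg] subgrp_0[OF subgrp_gch] by (simp add: cubeC.one_eq)
    fix x y assume "x \<in> ?A" "y \<in> ?A"
    then show "x - y \<in> ?A"
      using subgroup.m_closed[OF sg, of "cubeC_cls X n x" "inv\<^bsub>grp (cubeC X) n\<^esub> cubeC_cls X n y"] subgroup.m_inv_closed[OF sg]
      by (simp add: cubeC.cls_diff subgrp_diff[OF subgrp_gch])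
  qed
  have "grl TC X n \<subseteq> ?A"
  proof (cases "n < 0")
    case True then show ?thesis using subgrp_0[OF A] by (simp add: grl_def)
  next
    case False
    have "push (unit_cube (nat n)) c r \<in> ?A" if mr: "(m, r) \<in> rels TC (nat n)" and c: "c \<in> cells (unit_cube m) X" for m r c
    proof -
      have g: "push (unit_cube (nat n)) c r \<in> grl TC X n"
        using relspan_gen[where K=unit_cube and rel="rels TC", OF mr c] False by (simp add: grl_def)
      then have ch: "push (unit_cube (nat n)) c r \<in> gch TC X n" using grl_C_gch by blast
      have "(m, r) \<in> del_rels (nat n) \<or> (m, r) \<in> swp_rels (nat n)" using mr by simp
      then show ?thesis
      proof
        assume "(m, r) \<in> del_rels (nat n)"
        then have "push (unit_cube (nat n)) c r \<in> grl TD X n"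
          using relspan_gen[where K=unit_cube and rel=del_rels, OF _ c] False by (simp add: grl_def)
        then show ?thesis using ch subgroup.one_closed[OF sg] by (simp add: iffD2[OF cubeC.cls_one])
      next
        assume "(m, r) \<in> swp_rels (nat n)"
        then obtain k where k: "Suc k < nat n" "m = nat n" "r = ev (nat n) (\<lambda>t. t) + ev (nat n) (perm_coords (swp k))"
          unfolding swp_rels_def by blast
        have c': "ev (nat n) c = frag_of c" using c by (simp add: k(2) cells_def extensional_restrict)
        have "push (unit_cube (nat n)) c r = frag_of c - cube_perm (nat n) (swp k) c"
          by (simp add: k(3) zlin_add[OF zlin_push] push_ev cube_perm_ev swp_def sign_swap_id c' o_def[of c "\<lambda>t. t"])
        also have "\<dots> \<in> perm_diffs X n"
          unfolding perm_diffs_def using c swp_permutes[OF k(1)] False by (auto simp: k(2))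
        finally show ?thesis using ch unfolding cube_sym_gen by (auto intro: generate.incl)
      qed
    qed
    then have "relspan unit_cube (rels TC) (nat n) X \<subseteq> ?A"
      unfolding relspan_def by (intro zspan_least[OF A]) blast
    then show ?thesis using False by (simp add: grl_def)
  qed
  then show "u \<in> cube_sym X n" if "u \<in> cubeC_cls X n ` grl TC X n" for u using that by blast
qed

text \<open>Merges the two successive quotients into one, of all cubical chains by all relations of
  \<open>TC\<close>, which is the form that the method of acyclic models takes as input.\<close>

lemma cord_presents: "presents (gch TC X) (grl TC X) (gbd TC) (cord_cx X) (cord_class X)"
proof -
  interpret T: cell_theory TC by (rule cell_theory_C)
  have "cord_class X = (\<lambda>n x. cube_sym X n #>\<^bsub>grp (cubeC X) n\<^esub> cubeC_cls X n x)"
    by (simp add: fun_eq_iff cord_class_def cubeC_cls_def)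
  then show ?thesis
    unfolding cord_cx_def
    by (simp only:) (rule presents_quot[OF cubeC_presents cube_sym_eq subgrp_grl grl_D T.grl_gch T.gbd_grl])
qed

interpretation cord: presented "gch TC X" "grl TC X" "gbd TC" "cord_cx X" "cord_class X" for X
  by standard (rule cord_presents)

text \<open>A member of the double quotient is a set of cosets of degenerate chains. The union of
  this set is exactly one coset of the joint relations, so whichever chain is chosen from it is a
  representative.\<close>

lemma cord_rep:
  assumes "u \<in> carrier (grp (cord_cx X) n)"
  shows "cord_rep u \<in> gch TC X n \<and> cord_class X n (cord_rep u) = u"
proof -
  obtain x where x: "x \<in> gch TC X n" "u = cord_class X n x" using assms by (rule cord.cls_obtain)
  have mem: "y \<in> \<Union> u \<longleftrightarrow> y \<in> gch TC X n \<and> y - x \<in> grl TC X n" for y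
  proof -
    have "u = (\<lambda>s. s \<otimes>\<^bsub>grp (cubeC X) n\<^esub> cubeC_cls X n x) ` cubeC_cls X n ` grl TC X n"
      unfolding x(2) cord_class_def cubeC_cls_def[symmetric] cube_sym_eq r_coset_def[of "grp (cubeC X) n"] by blast
    also have "\<dots> = (\<lambda>r. cubeC_cls X n (r + x)) ` grl TC X n"
      unfolding image_image by (rule image_cong) (simp_all add: cubeC.cls_add[OF subsetD[OF grl_C_gch] x(1)])
    finally have u: "u = (\<lambda>r. cubeC_cls X n (r + x)) ` grl TC X n" .
    have coset: "cubeC_cls X n z = (\<lambda>h. h + z) ` grl TD X n" if "z \<in> gch TC X n" for z
      unfolding cubeC_cls_def cube_degen_eq by (rule cubeQ_gch(4)[OF _ that]) (use grl_D grl_C_gch in blast)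
    have rx: "r + x \<in> gch TC X n" if "r \<in> grl TC X n" for r
      using subgrp_add[OF subgrp_gch subsetD[OF grl_C_gch that] x(1)] .
    show ?thesis
    proof
      assume "y \<in> \<Union> u"
      then obtain r h where r: "r \<in> grl TC X n" "h \<in> grl TD X n" "y = h + (r + x)"
        unfolding u using coset[OF rx] by blast
      then have "h + r \<in> grl TC X n" using subgrp_add[OF subgrp_grl] grl_D by blast
      then show "y \<in> gch TC X n \<and> y - x \<in> grl TC X n" using rx[of "h + r"] r(3) by (simp add: add.assoc)
    next
      assume y: "y \<in> gch TC X n \<and> y - x \<in> grl TC X n"
      then have "y \<in> cubeC_cls X n (y - x + x)" using coset[of y] subgrp_0[OF subgrp_grl, of TD X n] by force
      then show "y \<in> \<Union> u" unfolding u using y by blast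
    qed
  qed
  have "x \<in> \<Union> u" unfolding mem using x(1) subgrp_0[OF subgrp_grl] by simp
  then have "cord_rep u \<in> \<Union> u" unfolding cord_rep_def by (rule someI)
  then have "cord_rep u \<in> gch TC X n" "cord_rep u - x \<in> grl TC X n" unfolding mem by simp_all
  then show ?thesis using x cord.cls_eq by blast
qed

lemma quot_mor_cls:
  assumes "comm_group (grp A n)" "comm_group (grp B n)" "subgroup (N n) (grp A n)" "subgroup (M n) (grp B n)"
    "f n \<in> hom (grp A n) (grp B n)" "f n ` N n \<subseteq> M n" "a \<in> carrier (grp A n)"
  shows "quot_mor A N B M f n (N n #>\<^bsub>grp A n\<^esub> a) = M n #>\<^bsub>grp B n\<^esub> f n a"
proof -
  have "N n #>\<^bsub>grp A n\<^esub> a \<in> carrier (grp (quot_cx A N) n)"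
    using assms(7) by (auto simp: quot_cx_def FactGroup_def RCOSETS_def)
  then show ?thesis using coset_map_coset[OF assms] by (simp add: quot_mor_def)
qed

lemma cube_degen_subgroup: "subgroup (cube_degen X n) (grp (cubeQ X) n)"
  unfolding cube_degen_def
  by (rule group.generate_is_subgroup[OF comm_group.axioms(2)[OF cubeQ.comm_group]])
     (auto simp: cubeQ_grp cells_def singular_cube_def)

text \<open>The two levels of \<open>quot_mor\<close> are evaluated from the inside out; at each of
  them the push-forward preserves the subgroup that is divided out.\<close>

lemma cord_mor_cls:
  assumes f: "continuous_map X Y f" and x: "x \<in> gch TC X n"
  shows "cord_mor X Y f n (cord_class X n x) = cord_class Y n (gpush TC n f x)"
proof -
  interpret T: cell_theory TC by (rule cell_theory_C)
  interpret D: cell_theory TD by (rule cell_theory_D)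
  let ?f0 = "cubeQ_mor X Y f"
  let ?f1 = "quot_mor (cubeQ X) (cube_degen X) (cubeQ Y) (cube_degen Y) ?f0"
  have f0: "?f0 n x = gpush TC n f x" if "x \<in> gch TC X n" for n x
    using that by (simp add: cubeQ_mor_def cubeQ_gch(1) gpush_def push_def)
  interpret m0: presented_map "gch TC X" "\<lambda>_. {0}" "gbd TC" "cubeQ X" "\<lambda>n x. x" "gch TC Y" "\<lambda>_. {0}" "gbd TC" "cubeQ Y" "\<lambda>n x. x"
    "\<lambda>n. gpush TC n f" ?f0
    by standard (use f0 in \<open>simp_all add: zlin_gpush gpush_gch f T.gbd_gpush cubeQ_mor_def\<close>)
  have h0: "?f0 n \<in> hom (grp (cubeQ X) n) (grp (cubeQ Y) n)" for n using m0.cx_hom by (simp add: cx_hom_def)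
  have f1: "?f1 n (cubeC_cls X n x) = cubeC_cls Y n (gpush TC n f x)" if x: "x \<in> gch TC X n" for n x
  proof -
    have "?f0 n ` cube_degen X n \<subseteq> cube_degen Y n"
      unfolding cube_degen_eq
      using f0[OF subsetD[OF D.grl_gch, unfolded gch_D]] D.gpush_grl[OF _ f] by (simp add: gch_D image_subset_iff)
    then show ?thesis
      using quot_mor_cls[of "cubeQ X" n "cubeQ Y" "cube_degen X" "cube_degen Y" ?f0,
          OF cubeQ.comm_group cubeQ.comm_group cube_degen_subgroup cube_degen_subgroup h0]
        cubeQ.cls_carrier[OF x] f0[OF x]
      by (simp add: cubeC_cls_def)
  qed
  interpret m1: presented_map "gch TC X" "grl TD X" "gbd TC" "cubeC X" "cubeC_cls X" "gch TC Y" "grl TD Y" "gbd TC" "cubeC Y" "cubeC_cls Y"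
    "\<lambda>n. gpush TC n f" ?f1
    by standard (use f1 in \<open>simp_all add: zlin_gpush gpush_gch f T.gbd_gpush subgrp_0[OF subgrp_grl]\<close>, simp add: quot_mor_def cubeC_def)
  have "?f1 n ` cube_sym X n \<subseteq> cube_sym Y n"
    unfolding cube_sym_eq
    using f1[OF subsetD[OF T.grl_gch]] T.gpush_grl[OF _ f] by (simp add: image_subset_iff)
  moreover have "?f1 n \<in> hom (grp (cubeC X) n) (grp (cubeC Y) n)" using m1.cx_hom by (simp add: cx_hom_def)
  ultimately show ?thesis
    using quot_mor_cls[of "cubeC X" n "cubeC Y" "cube_sym X" "cube_sym Y" ?f1,
        OF cubeC.comm_group cubeC.comm_group cube_sym_subgroup cube_sym_subgroup]
      cubeC.cls_carrier[OF x] f1[OF x]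
    by (simp add: cord_mor_def cord_class_def flip: cubeC_cls_def)
qed

lemma cross_prod_eq: "cross_prod p q x y = mul (unit_cube (p + q)) (cmlt p q) x y"
proof -
  have "frag_of (cube_cross p q c c') = push (unit_cube (p + q)) (map_prod c c') (cmlt p q)" for c :: "vec \<Rightarrow> 'a" and c' :: "vec \<Rightarrow> 'b"
    unfolding cmlt_def push_ev cube_cross_def by (simp add: split_coords_def o_def)
  then show ?thesis by (simp add: cross_prod_def mul_def)
qed

interpretation C: lax_functor TC cord_cx cord_class cord_mor cord_cx cord_class cord_mor cord_kunneth cord_rep
proof (intro lax_functor.intro lax_functor_axioms.intro monoidal_C)
  show "cord_kunneth X Y = (\<lambda>n. \<lambda>c\<in>carrier (grp (tensor (cord_cx X) (cord_cx Y)) n).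
      the_elem ((\<lambda>z. cord_class (prod_topology X Y) n (frag_extend (\<lambda>(i, u, j, v). gmul TC i j (cord_rep u) (cord_rep v)) z)) ` c))"
    for X Y :: "'a topology"
    by (simp add: cord_kunneth_def gmul_def cross_prod_eq)
qed (simp_all add: cord_presents cord_rep cord_mor_cls top_hom_def, simp_all add: cord_mor_def quot_mor_def cord_cx_def)

lemma C_functor: "C.G = cord_functor"
  by (simp add: C.G_def cord_functor_def)

section \<open>Triangulating the cube\<close>

text \<open>On cubes this is inverse to \<open>split_coords\<close>.\<close>

definition jn :: "nat \<Rightarrow> vec \<times> vec \<Rightarrow> vec" where
  "jn p = (\<lambda>(s, t) i. if i < p then s i else t (i - p))"

definition evs :: "nat \<Rightarrow> (vec \<Rightarrow> 'x) \<Rightarrow> 'x chain" where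
  "evs p f = frag_of (restrict f (standard_simplex p))"

text \<open>The unit interval as a 1-simplex running from 0 to 1: the barycentric coordinate
  \<open>t 1\<close> is the weight of the end point.\<close>

definition seg :: "vec chain" where
  "seg = evs 1 (\<lambda>t i. if i = 0 then t 1 else 0)"

definition unit_vec :: "real \<Rightarrow> vec" where
  "unit_vec e = (\<lambda>i. if i = 0 then e else 0)"

abbreviation smul :: "nat \<Rightarrow> nat \<Rightarrow> 'x chain \<Rightarrow> 'y chain \<Rightarrow> ('x \<times> 'y) chain" where
  "smul p q \<equiv> mul (standard_simplex (p + q)) (smlt p q)"

primrec tri :: "nat \<Rightarrow> vec chain" where
  "tri 0 = evs 0 (\<lambda>_ _. 0)"
| "tri (Suc n) = push (standard_simplex (Suc n)) (jn n) (mul (standard_simplex (Suc n)) (smlt n 1) (tri n) seg)"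

abbreviation cub :: "nat \<Rightarrow> vec topology" where
  "cub p \<equiv> mtop (unit_cube p)"

lemma jn_cube: "s \<in> unit_cube p \<Longrightarrow> t \<in> unit_cube q \<Longrightarrow> jn p (s, t) \<in> unit_cube (p + q)"
  using cube_coord[of s p] cube_coord[of t q] cube_zero[of t q] by (intro cubeI) (auto simp: jn_def)

lemma jn_continuous: "continuous_map (prod_topology (cub p) (cub q)) (cub (p + q)) (jn p)"
proof -
  have "continuous_map (prod_topology (cub p) (cub q)) euclideanreal (\<lambda>x. fst x i)"
    "continuous_map (prod_topology (cub p) (cub q)) euclideanreal (\<lambda>x. snd x i)" for i
    using continuous_map_compose[OF continuous_map_fst continuous_map_coord[of "unit_cube p" i]]
      continuous_map_compose[OF continuous_map_snd continuous_map_coord[of "unit_cube q" i]]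
    by (simp_all add: o_def)
  then have "continuous_map (prod_topology (cub p) (cub q)) euclideanreal (\<lambda>x. jn p x i)" for i
    by (simp add: jn_def split_def)
  then show ?thesis
    using jn_cube[of _ p _ q] by (auto simp: continuous_map_in_subtopology continuous_map_componentwise_UNIV)
qed

lemma push_evs: "push (standard_simplex p) f (evs p g) = evs p (f \<circ> g)"
  unfolding evs_def push_of by (intro arg_cong[of _ _ frag_of]) auto

lemma evs_cong: "(\<And>t. t \<in> standard_simplex p \<Longrightarrow> f t = g t) \<Longrightarrow> evs p f = evs p g"
  by (auto simp: evs_def frag_of_eq fun_eq_iff restrict_def)

lemma evs_chain: "continuous_map (mtop (standard_simplex p)) X f \<Longrightarrow> evs p f \<in> chains (standard_simplex p) X"
  by (simp add: evs_def frag_of_chains cells_restrict)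

lemma seg_chain: "seg \<in> chains (standard_simplex 1) (cub 1)"
  unfolding seg_def
proof (rule evs_chain, rule continuous_map_mtopI)
  show "continuous_map (mtop (standard_simplex 1)) euclideanreal (\<lambda>t. if i = 0 then t 1 else 0)" for i :: nat
    by (simp add: continuous_map_coord)
  show "(\<lambda>i. if i = 0 then t 1 else 0) \<in> unit_cube 1" if "t \<in> standard_simplex 1" for t
    using that by (intro cubeI) (auto simp: standard_simplex_def)
qed

lemma zero_cube: "(\<lambda>_. 0) \<in> unit_cube p"
  by (simp add: unit_cube_def)

lemma tri_chain: "tri n \<in> chains (standard_simplex n) (cub n)"
proof (induction n)
  case 0
  show ?case by (simp, rule evs_chain) (simp add: zero_cube)
next
  case (Suc n)
  show ?case
    using push_chain[OF mul_chain[OF smlt_chain Suc seg_chain] jn_continuous] by simp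
qed

lemma sh_single: "xs \<noteq> [] \<Longrightarrow> sh xs [y] = frag_of (map (\<lambda>x. (x, y)) xs)"
proof (induction xs)
  case (Cons x xs)
  then show ?case by (cases xs) (simp_all add: consf_of)
qed simp

text \<open>Through a grid with a single column there is just one path, so multiplying by a point is
  plain pairing with that point.\<close>

lemma smul_point: "mul (standard_simplex p) (smlt p 0) x (evs 0 (\<lambda>_. v)) = push (standard_simplex p) (\<lambda>a. (a, v)) x"
proof (rule zlin_eq[OF zlin_mul1 zlin_push subset_UNIV])
  fix c
  have "smlt p 0 = evs p (\<lambda>t. (lin [0..<Suc p] t, lin (map (\<lambda>_. 0) [0..<Suc p]) t))"
  proof -
    have "[0..<Suc p] \<noteq> []" "[0..<Suc 0] = [0]" by simp_all
    then show ?thesis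
      by (simp only: smlt_def sh_single RW_of evs_def pairW_def[abs_def] add_0_right not_False_eq_True) (simp add: o_def del: upt_Suc)
  qed
  moreover have "lin (map (\<lambda>_. 0) [0..<Suc p]) t \<in> standard_simplex 0" if "t \<in> standard_simplex p" for t
    by (rule lin_simplex[OF that]) auto
  ultimately show "mul (standard_simplex p) (smlt p 0) (frag_of c) (evs 0 (\<lambda>_. v)) = push (standard_simplex p) (\<lambda>a. (a, v)) (frag_of c)"
    unfolding evs_def[of 0] mul_of push_of
    by (simp only: push_evs evs_def[symmetric], intro evs_cong) (simp add: lin_id[of _ p] del: upt_Suc)
qed

lemma tri_point: "mul (standard_simplex n) (smlt n 0) x (tri 0) = push (standard_simplex n) (\<lambda>a. (a, (\<lambda>_. 0))) x"
  by (simp add: smul_point)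

text \<open>The powers are bracketed to the left, so associativity of the shuffle product is needed
  to collect the last \<open>q\<close> edges into one factor. This holds for chains themselves,
  without passing to normalized ones.\<close>

lemma tri_add: "push (standard_simplex (p + q)) (jn p) (smul p q (tri p) (tri q)) = tri (p + q)"
proof (induction q)
  case 0
  have "push (standard_simplex p) (jn p \<circ> (\<lambda>a. (a, (\<lambda>_. 0)))) (tri p) = tri p"
    by (rule push_id[OF tri_chain]) (auto simp: jn_def fun_eq_iff cube_zero)
  then show ?case by (simp only: add_0_right tri_point push_push)
next
  case (Suc q)
  let ?S = "standard_simplex (p + q + 1)"
  let ?a = "\<lambda>((x, y), z). (x, (y, z))"
  have "smul p (q + 1) (push (standard_simplex p) (\<lambda>x. x) (tri p)) (push (standard_simplex (q + 1)) (jn q) (smul q 1 (tri q) seg))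
      = push (standard_simplex (p + (q + 1))) (map_prod (\<lambda>x. x) (jn q)) (smul p (q + 1) (tri p) (smul q 1 (tri q) seg))"
    by (rule mul_push[OF smlt_chain])
  moreover have "push (standard_simplex p) (\<lambda>x. x) (tri p) = tri p" by (rule push_id[OF tri_chain]) simp
  ultimately have "push ?S (jn p) (smul p (q + 1) (tri p) (tri (q + 1))) =
      push ?S (jn p \<circ> map_prod (\<lambda>x. x) (jn q)) (mul ?S (smlt p (q + 1)) (tri p) (smul q 1 (tri q) seg))"
    by (simp add: push_push)
  also have "mul ?S (smlt p (q + 1)) (tri p) (smul q 1 (tri q) seg) = push ?S ?a (smul (p + q) 1 (smul p q (tri p) (tri q)) seg)"
    by (rule N.mm_assoc[unfolded simp_data_sel, OF tri_chain tri_chain seg_chain, symmetric])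
  also have "push ?S (jn p \<circ> map_prod (\<lambda>x. x) (jn q)) (push ?S ?a (smul (p + q) 1 (smul p q (tri p) (tri q)) seg)) =
      push ?S (jn (p + q) \<circ> map_prod (jn p) (\<lambda>x. x)) (smul (p + q) 1 (smul p q (tri p) (tri q)) seg)"
  proof -
    have "jn p \<circ> map_prod (\<lambda>x. x) (jn q) \<circ> ?a = jn (p + q) \<circ> map_prod (jn p) (\<lambda>x. x)"
      by (auto simp: jn_def fun_eq_iff)
    then show ?thesis by (simp only: push_push)
  qed
  also have "\<dots> = push ?S (jn (p + q)) (smul (p + q) 1 (push (standard_simplex (p + q)) (jn p) (smul p q (tri p) (tri q)))
      (push (standard_simplex 1) (\<lambda>x. x) seg))"
    by (simp only: mul_push[OF smlt_chain] push_push)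
  also have "push (standard_simplex 1) (\<lambda>x. x) seg = seg" by (rule push_id[OF seg_chain]) simp
  finally show ?case unfolding Suc by simp
qed

lemma tri_mlt: "act (standard_simplex (p + q)) (tri (p + q)) (cmlt p q) = smul p q (tri p) (tri q)"
proof -
  have "act (standard_simplex (p + q)) (tri (p + q)) (cmlt p q) = push (standard_simplex (p + q)) (split_coords p) (tri (p + q))"
    unfolding cmlt_def act_of by (rule push_cong[OF tri_chain]) simp
  also have "\<dots> = push (standard_simplex (p + q)) (split_coords p \<circ> jn p) (smul p q (tri p) (tri q))"
    unfolding tri_add[symmetric] push_push ..
  also have "\<dots> = smul p q (tri p) (tri q)"
    by (rule push_id[OF mul_chain[OF smlt_chain tri_chain tri_chain]])
       (auto simp: split_coords_def jn_def fun_eq_iff cube_zero)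
  finally show ?thesis .
qed

text \<open>A map of the cube that treats the first \<open>n\<close> coordinates and the last one
  separately can be applied factor by factor. All inductions on \<open>tri\<close> rest on
  this.\<close>

lemma push_tri_Suc:
  assumes "\<And>a b. a \<in> unit_cube n \<Longrightarrow> b \<in> unit_cube 1 \<Longrightarrow> f (jn n (a, b)) = h (g a, g' b)"
  shows "push (standard_simplex (Suc n)) f (tri (Suc n)) =
    push (standard_simplex (Suc n)) h (mul (standard_simplex (Suc n)) (smlt n 1) (push (standard_simplex n) g (tri n)) (push (standard_simplex 1) g' seg))"
proof -
  have "push (standard_simplex (n + 1)) h (smul n 1 (push (standard_simplex n) g (tri n)) (push (standard_simplex 1) g' seg))
      = push (standard_simplex (n + 1)) (h \<circ> map_prod g g') (smul n 1 (tri n) seg)"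
    by (simp only: mul_push[OF smlt_chain] push_push)
  also have "\<dots> = push (standard_simplex (n + 1)) (f \<circ> jn n) (smul n 1 (tri n) seg)"
    by (rule push_cong[OF mul_chain[OF smlt_chain tri_chain seg_chain]]) (auto simp: assms)
  finally show ?thesis by (simp add: push_push)
qed

lemma push_seg_id: "push (standard_simplex 1) (\<lambda>x. x) seg = seg"
  by (rule push_id[OF seg_chain]) simp

lemma act_tri_ev: "act (standard_simplex p) (tri p) (ev p f) = push (standard_simplex p) f (tri p)"
  unfolding act_of by (rule push_cong[OF tri_chain]) simp

lemma seg_bd: "act (standard_simplex 0) (sbd (Suc 0)) seg = evs 0 (\<lambda>_. unit_vec 1) - evs 0 (\<lambda>_. unit_vec 0)"
proof -
  let ?F = "\<lambda>t i. if i = (0::nat) then t (1::nat) else (0::real)"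
  have 0: "t = vertex0" if "t \<in> standard_simplex 0" for t
    using that by (auto simp: standard_simplex_def vertex0_def fun_eq_iff)
  have "evs 0 (restrict ?F (standard_simplex 1) \<circ> simplical_face k) = evs 0 (\<lambda>_. unit_vec (if k = 0 then 1 else 0))"
    if "k \<le> 1" for k :: nat
  proof (rule evs_cong)
    fix t assume t: "t \<in> standard_simplex 0"
    have "simplical_face k t \<in> standard_simplex 1" using face_simplex[OF t, of k] that by simp
    then show "(restrict ?F (standard_simplex 1) \<circ> simplical_face k) t = unit_vec (if k = 0 then 1 else 0)"
      using that by (auto simp: 0[OF t] unit_vec_def simplical_face_def vertex0_def fun_eq_iff)
  qed
  note F = this[of 0, OF zero_le_one] this[of 1, OF order_refl]
  have "act (standard_simplex 0) (sbd (Suc 0)) seg = evs 0 (restrict ?F (standard_simplex 1) \<circ> simplical_face 0)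
      - evs 0 (restrict ?F (standard_simplex 1) \<circ> simplical_face 1)"
    unfolding seg_def evs_def act_of push_sbd by simp
  then show ?thesis unfolding F by simp
qed

text \<open>By the Leibniz rule the boundary of the last edge yields the two faces in the last
  direction, with sign (-1)^n, and the induction hypothesis yields the others. Again no relations
  are needed.\<close>

lemma tri_bd: "act (standard_simplex n) (sbd (Suc n)) (tri (Suc n)) = act (standard_simplex n) (tri n) (cbd (Suc n))"
proof -
  let ?S = "standard_simplex"
  have R: "act (?S n) (tri n) (cbd (Suc n)) =
      (\<Sum>k\<le>n. frag_cmul ((- 1) ^ k) (push (?S n) (ins k 1) (tri n) - push (?S n) (ins k 0) (tri n)))" for n
    by (simp only: cbd_def zlin_sum[OF zlin_act] zlin_cmul[OF zlin_act] zlin_diff[OF zlin_act] act_tri_ev diff_Suc_1 lessThan_Suc_atMost)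
  have ends: "push (?S n) (jn n) (push (?S n) (\<lambda>a. (a, unit_vec e)) (tri n)) = push (?S n) (ins n e) (tri n)" for n e
    unfolding push_push
    by (rule push_cong[OF tri_chain]) (auto simp: jn_def ins_def unit_vec_def fun_eq_iff cube_zero)
  have leib: "act (?S n) (sbd (Suc n)) (tri (Suc n)) =
      push (?S n) (jn n) (mul (?S n) (smlt (n - 1) 1) (act (?S (n - 1)) (sbd n) (tri n)) seg) +
      frag_cmul ((- 1) ^ n) (push (?S n) (ins n 1) (tri n) - push (?S n) (ins n 0) (tri n))" for n
  proof -
    have "act (?S n) (sbd (Suc n)) (tri (Suc n)) = push (?S n) (jn n) (act (?S n) (sbd (Suc n)) (smul n 1 (tri n) seg))"
      using cell_theory.bd1_push[OF cell_theory_N, of n "jn n" "smul n 1 (tri n) seg"] by simp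
    also have "act (?S n) (sbd (Suc n)) (smul n 1 (tri n) seg) =
        mul (?S n) (smlt (n - 1) 1) (act (?S (n - 1)) (sbd n) (tri n)) seg +
        frag_cmul ((- 1) ^ n) (mul (?S n) (smlt n 0) (tri n) (act (?S 0) (sbd (Suc 0)) seg))"
      using N.mm_bd[unfolded simp_data_sel, OF tri_chain[of n] seg_chain] by simp
    finally show ?thesis
      by (simp only: seg_bd zlin_diff[OF zlin_mul2] smul_point zlin_add[OF zlin_push] zlin_cmul[OF zlin_push] zlin_diff[OF zlin_push] ends)
  qed
  have "act (?S n) (sbd (Suc n)) (tri (Suc n)) =
      (\<Sum>k\<le>n. frag_cmul ((- 1) ^ k) (push (?S n) (ins k 1) (tri n) - push (?S n) (ins k 0) (tri n)))" for n
  proof (induction n)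
    case 0
    show ?case unfolding leib by (simp add: sbd_def act_0 zlin_0[OF zlin_mul1] zlin_0[OF zlin_push])
  next
    case (Suc n)
    have side: "push (?S (Suc n)) (jn (Suc n)) (mul (?S (Suc n)) (smlt n 1) (push (?S n) (ins k e) (tri n)) seg)
        = push (?S (Suc n)) (ins k e) (tri (Suc n))" if "k \<le> n" for k e
    proof -
      have "ins k e (jn n (a, b)) = jn (Suc n) (ins k e a, b)" for a b
        using that by (auto simp: jn_def ins_def fun_eq_iff Suc_diff_le)
      then show ?thesis
        using push_tri_Suc[of n "ins k e" "jn (Suc n)" "ins k e" "\<lambda>x. x"] by (simp only: push_seg_id)
    qed
    show ?case
      unfolding leib[of "Suc n"] diff_Suc_1 Suc sum.atMost_Suc
      by (simp only: zlin_sum[OF zlin_mul1] zlin_cmul[OF zlin_mul1] zlin_diff[OF zlin_mul1]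
          zlin_sum[OF zlin_push] zlin_cmul[OF zlin_push] zlin_diff[OF zlin_push])
         (rule arg_cong2[of _ _ _ _ "(+)"], rule sum.cong, simp_all only: atMost_iff side)
  qed
  then show ?thesis by (simp only: R)
qed

lemma tri_del: "k \<le> n \<Longrightarrow> push (standard_simplex (Suc n)) (del_coord k) (tri (Suc n)) \<in> rspan TN (Suc n) (cub n)"
proof (induction n arbitrary: k)
  \<comment> \<open>Forgetting the last coordinate collapses the last edge to a point, that is, to a
    degenerate 1-simplex; a product with a degenerate factor is a relation in
    \<open>TN\<close>.\<close>
  have last: "push (standard_simplex (Suc n)) (del_coord n) (tri (Suc n)) \<in> rspan TN (Suc n) (cub n)" for n
  proof -
    have "del_coord n (jn n (a, b)) = jn n (a, del_coord 0 b)" for a b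
      by (auto simp: jn_def del_coord_def fun_eq_iff Suc_diff_le)
    then have eq: "push (standard_simplex (Suc n)) (del_coord n) (tri (Suc n)) =
        push (standard_simplex (Suc n)) (jn n) (mul (standard_simplex (Suc n)) (smlt n 1)
          (push (standard_simplex n) (\<lambda>x. x) (tri n)) (push (standard_simplex 1) (del_coord 0) seg))"
      by (intro push_tri_Suc)
    have "del_coord 0 \<circ> (\<lambda>t i. if i = 0 then t 1 else 0) = (\<lambda>(t :: vec) i. 0 :: real)"
      by (simp add: fun_eq_iff del_coord_def)
    then have "push (standard_simplex 1) (del_coord 0) seg = evs 1 (\<lambda>t i. 0)"
      by (simp only: seg_def push_evs)
    also have "\<dots> = push (standard_simplex 1) (restrict (\<lambda>_ _. 0) (standard_simplex 0)) (evs 1 (simplical_degen 0))"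
      unfolding push_evs by (rule evs_cong) (simp add: degen_simplex)
    also have "\<dots> \<in> relspan standard_simplex degen_rels 1 (cub 0)"
      by (rule relspan_gen[where K=standard_simplex and rel=degen_rels and m=0])
         (auto simp: degen_rels_def evs_def zero_cube intro!: cells_restrict)
    finally have d: "push (standard_simplex 1) (del_coord 0) seg \<in> rspan TN 1 (cub 0)" by simp
    have "push (standard_simplex n) (\<lambda>x. x) (tri n) = tri n" by (rule push_id[OF tri_chain]) simp
    then show ?thesis
      unfolding eq
      using N.rspan_push[OF N.mm_rel2[OF _ d, of "tri n" n "cub n"] jn_continuous] tri_chain[of n] by simp
  qed
  {
    case 0
    then show ?case using last[of 0] by simp
  next
    case (Suc n)
    show ?case
    proof (cases "k = Suc n")
      case True show ?thesis unfolding True by (rule last)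
    next
      case False
      then have k: "k \<le> n" using Suc(2) by simp
      have "del_coord k (jn (Suc n) (a, b)) = jn n (del_coord k a, b)" for a b
        using k by (auto simp: jn_def del_coord_def fun_eq_iff)
      then have eq: "push (standard_simplex (Suc (Suc n))) (del_coord k) (tri (Suc (Suc n))) =
          push (standard_simplex (Suc (Suc n))) (jn n) (mul (standard_simplex (Suc (Suc n))) (smlt (Suc n) 1)
            (push (standard_simplex (Suc n)) (del_coord k) (tri (Suc n))) seg)"
        using push_tri_Suc[of "Suc n" "del_coord k" "jn n" "del_coord k" "\<lambda>x. x"] by (simp only: push_seg_id)
      show ?thesis
        unfolding eq
        using N.rspan_push[OF N.mm_rel1[OF Suc(1)[OF k], of seg 1 "cub 1"] jn_continuous] seg_chain by simp
    qed
  }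
qed

lemma sh_single1: "ys \<noteq> [] \<Longrightarrow> sh [x] ys = frag_of (map (\<lambda>y. (x, y)) ys)"
proof (induction ys)
  case (Cons y ys)
  then show ?case by (cases ys) (simp_all add: consf_of)
qed simp

lemma tri_1: "tri 1 = seg"
proof -
  have l: "smlt 0 1 = evs 1 (\<lambda>t. (lin [0, 0] t, lin [0, 1] t))"
  proof -
    have "[0..<Suc 0] = [0]" "[0..<Suc 1] = [0, 1]" by (simp_all add: upt_rec)
    then show ?thesis
      by (simp only: smlt_def sh_single1 RW_of evs_def pairW_def[abs_def] list.simps not_False_eq_True add_0) (simp add: o_def)
  qed
  have "(jn 0 \<circ> (map_prod (restrict (\<lambda>_ _. 0) (standard_simplex 0)) (restrict (\<lambda>t i. if i = 0 then t 1 else 0) (standard_simplex 1))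
      \<circ> (\<lambda>t. (lin [0, 0] t, lin [0, 1] t)))) t = (\<lambda>i. if i = 0 then t 1 else 0)" if t: "t \<in> standard_simplex 1" for t
  proof -
    have "lin [0, 0] t \<in> standard_simplex 0" by (rule lin_simplex[OF t]) auto
    moreover have "lin [0, 1] t = t" using lin_id[OF t] by (simp add: upt_rec)
    ultimately show ?thesis using t by (simp add: jn_def fun_eq_iff)
  qed
  then show ?thesis
    unfolding One_nat_def tri.simps unfolding One_nat_def[symmetric] l seg_def
    by (simp only: evs_def[of 0] evs_def[of 1 "\<lambda>t i. if i = 0 then t 1 else 0"] mul_of)
       (simp only: push_evs, simp only: evs_def[symmetric], rule evs_cong, simp only:)
qed

text \<open>Commutativity of the shuffle product in degrees 1 and 1: exchanging the two edges of the
  square costs the sign -1.\<close>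

lemma tri_2_swp: "push (standard_simplex 2) (perm_coords (swp 0)) (tri 2) = - tri 2"
proof -
  let ?F = "restrict (\<lambda>t i. if i = (0::nat) then t (1::nat) else (0::real)) (standard_simplex 1)"
  let ?S = "standard_simplex 2"
  have 2: "tri 2 = push ?S (jn 1 \<circ> map_prod ?F ?F) (smlt 1 1)"
  proof -
    have "tri 2 = push ?S (jn 1) (mul ?S (smlt 1 1) (tri 1) seg)" by (simp add: numeral_2_eq_2)
    also have "\<dots> = push ?S (jn 1 \<circ> map_prod ?F ?F) (smlt 1 1)"
      unfolding tri_1 seg_def evs_def mul_of push_push ..
    finally show ?thesis .
  qed
  have "push ?S (perm_coords (swp 0)) (tri 2) = push ?S (jn 1 \<circ> map_prod ?F ?F \<circ> prod.swap) (smlt 1 1)"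
    unfolding 2 push_push
    by (rule push_cong[OF smlt_chain[of 1 1, unfolded one_add_one]])
       (auto simp: perm_coords_def swp_def jn_def fun_eq_iff Transposition.transpose_def)
  also have "\<dots> = push ?S (jn 1 \<circ> map_prod ?F ?F) (push ?S prod.swap (smlt 1 1))"
    by (simp only: push_push)
  also have "push ?S prod.swap (smlt 1 1) = - smlt 1 1"
    using smlt_swap[of 1 1] by (simp add: numeral_2_eq_2)
  finally show ?thesis by (simp only: zlin_minus[OF zlin_push] 2)
qed

lemma tri_swp: "Suc k < p \<Longrightarrow> push (standard_simplex p) (perm_coords (swp k)) (tri p) = - tri p"
proof (induction p)
  case (Suc n)
  show ?case
  proof (cases "Suc k < n")
    case True
    have "perm_coords (swp k) (jn n (a, b)) = jn n (perm_coords (swp k) a, b)" for a b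
      using True by (auto simp: jn_def perm_coords_def swp_def Transposition.transpose_def fun_eq_iff)
    then have "push (standard_simplex (Suc n)) (perm_coords (swp k)) (tri (Suc n)) =
        push (standard_simplex (Suc n)) (jn n) (mul (standard_simplex (Suc n)) (smlt n 1)
          (push (standard_simplex n) (perm_coords (swp k)) (tri n)) seg)"
      using push_tri_Suc[of n "perm_coords (swp k)" "jn n" "perm_coords (swp k)" "\<lambda>x. x"] by (simp only: push_seg_id)
    also have "\<dots> = - tri (Suc n)"
      by (simp only: Suc(1)[OF True] zlin_minus[OF zlin_mul1] zlin_minus[OF zlin_push] tri.simps)
    finally show ?thesis .
  next
    case False
    \<comment> \<open>The swap concerns the last two coordinates, which the recursion separates.
      \<open>tri_add\<close> regroups the power as a product with the triangulated square, and
      \<open>tri_2_swp\<close> applies there.\<close>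
    then have n: "Suc n = k + 2" using Suc(2) by simp
    have "perm_coords (swp k) \<circ> jn k = jn k \<circ> map_prod (\<lambda>x. x) (perm_coords (swp 0))"
      by (auto simp: jn_def perm_coords_def swp_def Transposition.transpose_def fun_eq_iff)
    then have "push (standard_simplex (k + 2)) (perm_coords (swp k)) (tri (k + 2)) =
        push (standard_simplex (k + 2)) (jn k) (smul k 2 (push (standard_simplex k) (\<lambda>x. x) (tri k)) (push (standard_simplex 2) (perm_coords (swp 0)) (tri 2)))"
      by (simp only: tri_add[symmetric] mul_push[OF smlt_chain] push_push)
    also have "push (standard_simplex k) (\<lambda>x. x) (tri k) = tri k" by (rule push_id[OF tri_chain]) simp
    also have "push (standard_simplex (k + 2)) (jn k) (smul k 2 (tri k) (push (standard_simplex 2) (perm_coords (swp 0)) (tri 2))) = - tri (k + 2)"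
      by (simp only: tri_2_swp zlin_minus[OF zlin_mul2] zlin_minus[OF zlin_push] tri_add)
    finally show ?thesis unfolding n .
  qed
qed simp

lemma datum_CN: "chain_datum TC TN tri"
  unfolding chain_datum_def cube_data_sel simp_data_sel
proof (intro conjI allI impI)
  fix n m r assume "(m, r) \<in> del_rels n \<union> swp_rels n"
  then show "act (standard_simplex n) (tri n) r \<in> relspan standard_simplex degen_rels n (mtop (unit_cube m))"
  proof
    assume "(m, r) \<in> del_rels n"
    then obtain k where k: "k < n" "m = n - 1" "r = ev n (del_coord k)" unfolding del_rels_def by blast
    obtain n' where n: "n = Suc n'" using k(1) by (cases n) auto
    show ?thesis using tri_del[of k n'] k by (simp only: act_tri_ev simp_data_sel) (simp add: n)
  next
    assume "(m, r) \<in> swp_rels n"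
    then obtain k where k: "Suc k < n" "r = ev n (\<lambda>t. t) + ev n (perm_coords (swp k))" unfolding swp_rels_def by blast
    have "push (standard_simplex n) (\<lambda>t. t) (tri n) = tri n" by (rule push_id[OF tri_chain]) simp
    then show ?thesis
      by (simp add: k(2) zlin_add[OF zlin_act] act_tri_ev tri_swp[OF k(1)] subgrp_0[OF subgrp_relspan])
  qed
qed (simp_all only: tri_chain tri_bd diff_self subgrp_0[OF subgrp_relspan] tri.simps(1) evs_def)

interpretation CN: lax_map TC cord_cx cord_class cord_mor cord_cx cord_class cord_mor cord_kunneth cord_rep
    TN norm_cx norm_cls norm_mor norm_cx norm_cls norm_mor norm_kunneth norm_rep tri
proof (intro lax_map.intro lax_map_axioms.intro theory_map.intro theory_map_axioms.intro
    C.lax_functor_axioms N.lax_functor_axioms acyclic_C acyclic_N cell_theory_C cell_theory_N datum_CN)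
qed (simp only: simp_data_sel cube_data_sel tri_mlt)

lemma nat_weak_equiv_ex:
  fixes P :: "('l, 'x) top_modop"
  shows "nat_weak_equiv F H \<Longrightarrow> is_top_modop P \<Longrightarrow> dg_weak_equiv_ex (fun_ob F P) (fun_ob H P)"
proof -
  assume "nat_weak_equiv F H" "is_top_modop P"
  then obtain \<eta> where "is_modop_functor F" "is_modop_functor H" "dg_weak_equiv (fun_ob F P) (fun_ob H P) (\<eta> P)"
    unfolding nat_weak_equiv_def by blast
  moreover from this(1,2) have "is_dg_modop (fun_ob F P)" "is_dg_modop (fun_ob H P)"
    using \<open>is_top_modop P\<close> by (simp_all add: is_modop_functor_def)
  ultimately show ?thesis unfolding dg_weak_equiv_ex_def by blast
qed

theorem theorem7p4p1:
  shows "weakly_equiv_functors TYPE('x chain set)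
           (sing_functor :: ('l::infinite, 'x, 'x chain) modop_functor)
           (cord_functor :: ('l, 'x, 'x chain set set) modop_functor) \<and>
         (\<forall>P :: ('l, 'x) top_modop. is_top_modop P \<longrightarrow>
            weakly_equiv_dg TYPE('x chain set) (fun_ob sing_functor P) (fun_ob cord_functor P))"
proof -
  let ?N = "N.G :: ('l, 'x, 'x chain set) modop_functor"
  have S: "nat_weak_equiv (sing_functor :: ('l, 'x, 'x chain) modop_functor) ?N"
    unfolding sing_functor_def S.G_def[symmetric] by (rule SN.nat_weak_equiv)
  have C: "nat_weak_equiv (cord_functor :: ('l, 'x, 'x chain set set) modop_functor) ?N"
    unfolding C_functor[symmetric] by (rule CN.nat_weak_equiv)
  \<comment> \<open>Both comparison maps end in \<open>?N\<close>, so the zigzag has two steps and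
    its interior is the single functor \<open>?N\<close>.\<close>
  have "weakly_equiv_functors TYPE('x chain set) (sing_functor :: ('l, 'x, 'x chain) modop_functor)
      (cord_functor :: ('l, 'x, 'x chain set set) modop_functor)"
    unfolding weakly_equiv_functors_def
    by (rule exI[of _ ?N], rule exI[of _ ?N], intro conjI) (rule disjI1[OF S], rule equivclp_refl, rule disjI2[OF C])
  moreover have "weakly_equiv_dg TYPE('x chain set) (fun_ob sing_functor P) (fun_ob cord_functor P)"
    if "is_top_modop P" for P :: "('l, 'x) top_modop"
    unfolding weakly_equiv_dg_def
    by (rule exI[of _ "fun_ob ?N P"], rule exI[of _ "fun_ob ?N P"], intro conjI)
       (rule disjI1[OF nat_weak_equiv_ex[OF S that]], rule equivclp_refl, rule disjI2[OF nat_weak_equiv_ex[OF C that]])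
  ultimately show ?thesis by blast
qed

end
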